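(* Let $p>1$. Let $(X_0^n)_{n\in\mathbb N}$ be i.i.d. random variables in $L^p(\Omega;\mathbb R^d)$, let $(W^n)_{n\in\mathbb N}$ be independent $d$-dimensional Brownian motions, let $(Y_0^1,\dots,Y_0^m)\in(\mathbb R^d)^m$, and let $u:\mathcal W_1(\mathbb R^d)\to\mathbb R^d$ be Lipschitz. For each $N\in\mathbb N$ let $X^n$ ($n=1,\dots,N$), $Y^i$ ($i=1,\dots,m$) be the solution of $$\begin{cases} dX^n(t)=\Big(\frac1N\sum_{l=1}^NH_1(X^n(t)-X^l(t))+\frac1m\sum_{j=1}^mK_1(Y^j(t)-X^n(t))\Big)dt+\sqrt{2\sigma}\,dW^n(t)\\ \frac{d}{dt}Y^i(t)=\frac1N\sum_{l=1}^NK_2(Y^i(t)-X^l(t))+\frac1m\sum_{j=1}^mH_2(Y^j(t)-Y^i(t))+u\Big(\frac1N\sum_{l=1}^N\delta_{X^l(t)}\Big)\\ X^n(0)=X_0^n,\ Y^i(0)=Y^i_0;\quad i=1,\dots,m,\ n=1,\dots,N.\end{cases}$$ Let $\overline X^n,\overline Y^i$ be the solution of the limit system (S) of the context with initial data $(X_0^n,Y_0^1,\dots,Y_0^m)$ and Brownian motion $W^n$ (the functions $\overline Y^i$ do not depend on $n$). Then there exist constants $C_{d,p}(N)>0$ with $\lim_{N\to\infty}C_{d,p}(N)=0$ such that, for every $N$, $$\mathbb E\Big(\max_{1\le n\le N}\max_{0\le t\le T}|X^n(t)-\overline X^n(t)|+\max_{1\le i\le m}\max_{0\le t\le T}|Y^i(t)-\overline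 Y^i(t)|\Big)\le C_{d,p}(N).$$
   Context: Fix $d,m\in\mathbb N$, $T>0$, $\sigma>0$ and a filtered probability space $(\Omega,\mathcal F,(\mathcal F_t),\mathbb P)$; Brownian motions are with respect to $(\mathcal F_t)$ and the random initial data are $\mathcal F_0$-measurable. $\mathcal W_1(\mathbb R^d)$ is the space of Borel probability measures on $\mathbb R^d$ with finite first moment, with the 1-Wasserstein distance. $\mathrm{Law}(X)=X_\sharp\mathbb P$ and $\mathrm{ev}_t(f)=f(t)$. For a Lipschitz $H$ and $\mu\in\mathcal W_1(\mathbb R^d)$, $H\ast\mu(x)=\int_{\mathbb R^d}H(x-y)\,d\mu(y)$. $H_1,H_2,K_1,K_2:\mathbb R^d\to\mathbb R^d$ are globally Lipschitz. Limit system (S), driven by a Brownian motion $W$: $$\begin{cases} d\overline X(t)=\Big(H_1\ast\overline\mu_t(\overline X(t))+\frac1m\sum_{j=1}^mK_1(\overline Y^j(t)-\overline X(t))\Big)dt+\sqrt{2\sigma}\,dW(t)\\ \frac{d}{dt}\overline Y^i(t)=K_2\ast\overline\mu_t(\overline Y^i(t))+\frac1m\sum_{j=1}^mH_2(\overline Y^j(t)-\overline Y^i(t))+u(\overline\mu_t),\quad i=1,\dots,m\\ \overline X(0)=\overline X_0,\ \overline Y^i(0)=\overline Y^i_0,\quad i=1,\dots,m\\ \overline\mu=\mathrm{Law}(\overline X),\ \overline\mu_t=(\mathrm{ev}_t)_\sharp\overline\mu.\end{cases}$$ A solution consists of a $C^0([0,T];\mathbb R^d)$-valued random variable $\overline X$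 satisfying the first equation in integral form almost surely for all $t$, and deterministic $\overline Y^i\in C^0([0,T];\mathbb R^d)$ solving the ODEs. It exists and is pathwise unique. The constants $C_{d,p}(N)$ may depend also on the fixed data of the problem ($T$, $m$, $\sigma$, $H_i$, $K_i$, $u$, $\mathrm{Law}(X^1_0)$, $Y_0^i$). *)

theory Defs
  imports "HOL-Probability.Probability"
begin

section \<open>The Wasserstein space of order one\<close>

definition W1_space :: "(real^'d) measure set" where
  "W1_space = {\<mu>. prob_space \<mu> \<and> sets \<mu> = sets borel \<and> integrable \<mu> norm}"

definition couplings :: "(real^'d) measure \<Rightarrow> (real^'d) measure \<Rightarrow> ((real^'d) \<times> (real^'d)) measure set" where
  "couplings \<mu> \<nu> =
     {\<pi>. sets \<pi> = sets (borel \<Otimes>\<^sub>M borel) \<and> distr \<pi> borel fst = \<mu> \<and> distr \<pi> borel snd = \<nu>}"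

text \<open>The infimum is finite whenever both measures belong to \<^const>\<open>W1_space\<close>, the only case in which
  the distance is used.\<close>
definition wasserstein1 :: "(real^'d) measure \<Rightarrow> (real^'d) measure \<Rightarrow> real" where
  "wasserstein1 \<mu> \<nu> =
     enn2real (INF \<pi>\<in>couplings \<mu> \<nu>. \<integral>\<^sup>+ z. ennreal (dist (fst z) (snd z)) \<partial>\<pi>)"

definition lipschitz_on_W1 :: "((real^'d) measure \<Rightarrow> real^'d) \<Rightarrow> bool" where
  "lipschitz_on_W1 u \<longleftrightarrow>
     (\<exists>L. \<forall>\<mu>\<in>W1_space. \<forall>\<nu>\<in>W1_space. dist (u \<mu>) (u \<nu>) \<le> L * wasserstein1 \<mu> \<nu>)"

definition conv :: "(real^'d \<Rightarrow> real^'d) \<Rightarrow> (real^'d) measure \<Rightarrow> real^'d \<Rightarrow> real^'d" where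
  "conv H \<mu> x = (\<integral>y. H (x - y) \<partial>\<mu>)"

definition empirical_measure :: "nat \<Rightarrow> (nat \<Rightarrow> real^'d) \<Rightarrow> (real^'d) measure" where
  "empirical_measure N x = distr (uniform_count_measure {1..N}) borel x"

text \<open>It is the average of the Dirac measures at \<open>x 1, \<dots>, x N\<close>.\<close>
lemma emeasure_empirical_measure:
  assumes "N \<ge> 1" and "A \<in> sets borel"
  shows "emeasure (empirical_measure N x) A =
    ennreal (1 / real N) * (\<Sum>l=1..N. emeasure (return borel (x l)) A)"
proof -
  let ?B = "x -` A \<inter> {1..N}"
  have "emeasure (empirical_measure N x) A = emeasure (uniform_count_measure {1..N}) ?B"
    unfolding empirical_measure_def using assms
    by (subst emeasure_distr)
       (auto simp: space_uniform_count_measure measurable_def sets_uniform_count_measure)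
  also have "\<dots> = ennreal (card ?B / N)"
    by (simp add: emeasure_uniform_count_measure)
  also have "\<dots> = ennreal (1 / real N) * of_nat (card ?B)"
    by (simp add: ennreal_mult[symmetric] ennreal_of_nat_eq_real_of_nat)
  also have "of_nat (card ?B) = (\<Sum>l=1..N. emeasure (return borel (x l)) A)"
    using assms by (simp add: indicator_def sum.If_cases vimage_def Int_def conj_commute)
  finally show ?thesis .
qed


section \<open>Random continuous paths\<close>

text \<open>\<open>C\<^sup>0([0,T]; \<real>\<^sup>d)\<close> with the Borel \<open>\<sigma>\<close>-algebra of the uniform distance. The elements of
  \<^const>\<open>cfunspace\<close> are extensional, i.e. take the value \<^const>\<open>undefined\<close> outside \<open>[0,T]\<close>.\<close>
definition path_space :: "real \<Rightarrow> (real \<Rightarrow> real^'d) measure" where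
  "path_space T =
     (let C = cfunspace (top_of_set {0..T}) euclidean_metric
      in sigma (mspace C) {U. openin (mtopology_of C) U})"

lemma space_path_space:
  "space (path_space T :: (real \<Rightarrow> real^'d) measure) =
     {f \<in> extensional {0..T}. continuous_on {0..T} f}"
proof -
  have "bounded (f ` {0..T})" if "continuous_on {0..T} f" for f :: "real \<Rightarrow> real^'d"
    using that by (intro compact_imp_bounded compact_continuous_image) auto
  then show ?thesis
    by (auto simp: path_space_def Let_def space_measure_of_conv)
qed

text \<open>The flow of time marginals \<open>(ev\<^sub>t)\<^sub>\<sharp> Law(X)\<close>.\<close>
definition marginal :: "'a measure \<Rightarrow> real \<Rightarrow> ('a \<Rightarrow> real \<Rightarrow> real^'d) \<Rightarrow> real \<Rightarrow> (real^'d) measure" where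
  "marginal M T X t = distr (distr M (path_space T) X) borel (\<lambda>f. f t)"


section \<open>Filtrations and Brownian motions on a finite horizon\<close>

definition filtration_upto :: "'a measure \<Rightarrow> real \<Rightarrow> (real \<Rightarrow> 'a measure) \<Rightarrow> bool" where
  "filtration_upto M T F \<longleftrightarrow>
     (\<forall>t\<in>{0..T}. subalgebra M (F t)) \<and>
     (\<forall>s t. 0 \<le> s \<longrightarrow> s \<le> t \<longrightarrow> t \<le> T \<longrightarrow> subalgebra (F t) (F s))"

text \<open>The increment over \<open>[s,t]\<close> has law \<open>N(0, (t - s) Id)\<close>; \<^const>\<open>normal_density\<close> takes the standard
  deviation as its second argument.\<close>
definition brownian_motion ::
    "'a measure \<Rightarrow> (real \<Rightarrow> 'a measure) \<Rightarrow> real \<Rightarrow> ('a \<Rightarrow> real \<Rightarrow> real^'d) \<Rightarrow> bool" where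
  "brownian_motion M F T W \<longleftrightarrow>
     (\<forall>t\<in>{0..T}. (\<lambda>\<omega>. W \<omega> t) \<in> borel_measurable (F t)) \<and>
     (AE \<omega> in M. W \<omega> 0 = 0) \<and>
     (AE \<omega> in M. continuous_on {0..T} (W \<omega>)) \<and>
     (\<forall>s t. 0 \<le> s \<longrightarrow> s < t \<longrightarrow> t \<le> T \<longrightarrow>
        distributed M lborel (\<lambda>\<omega>. W \<omega> t - W \<omega> s)
          (\<lambda>x. ennreal (\<Prod>k\<in>UNIV. normal_density 0 (sqrt (t - s)) (x $ k))) \<and>
        prob_space.indep_set M (sets (F s))
          {(\<lambda>\<omega>. W \<omega> t - W \<omega> s) -` B \<inter> space M | B. B \<in> sets borel})"

text \<open>Independence of the processes \<open>W n\<close>, \<open>n \<ge> 1\<close>, each seen as a random element of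
  \<open>(\<real>\<^sup>d)\<^bsup>[0,T]\<^esup>\<close> with the product \<open>\<sigma>\<close>-algebra.\<close>
definition indep_processes ::
    "'a measure \<Rightarrow> real \<Rightarrow> (nat \<Rightarrow> 'a \<Rightarrow> real \<Rightarrow> real^'d) \<Rightarrow> bool" where
  "indep_processes M T W \<longleftrightarrow>
     prob_space.indep_vars M (\<lambda>_. \<Pi>\<^sub>M t\<in>{0..T}. borel) (\<lambda>n \<omega>. restrict (W n \<omega>) {0..T}) {1..}"


section \<open>The particle system and the limit system\<close>

text \<open>\<open>x(t) = x\<^sub>0 + \<integral>\<^sub>0\<^sup>t b(s) ds + w(t)\<close> on \<open>[0,T]\<close>, with an integrable drift.\<close>
definition solves_integral_eq ::
    "real \<Rightarrow> real^'d \<Rightarrow> (real \<Rightarrow> real^'d) \<Rightarrow> (real \<Rightarrow> real^'d) \<Rightarrow> (real \<Rightarrow> real^'d) \<Rightarrow> bool" where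
  "solves_integral_eq T x0 b w x \<longleftrightarrow>
     set_integrable lborel {0..T} b \<and>
     (\<forall>t\<in>{0..T}. x t = x0 + set_lebesgue_integral lborel {0..t} b + w t)"

definition particle_solution where
  "particle_solution (M :: 'a measure) T \<sigma> m H1 H2 K1 K2 u N
      (X0 :: nat \<Rightarrow> 'a \<Rightarrow> real^'d) (Y0 :: nat \<Rightarrow> real^'d) (W :: nat \<Rightarrow> 'a \<Rightarrow> real \<Rightarrow> real^'d)
      (X :: nat \<Rightarrow> 'a \<Rightarrow> real \<Rightarrow> real^'d) (Y :: nat \<Rightarrow> 'a \<Rightarrow> real \<Rightarrow> real^'d) \<longleftrightarrow>
     (\<forall>n\<in>{1..N}. X n \<in> M \<rightarrow>\<^sub>M path_space T) \<and>
     (\<forall>i\<in>{1..m}. Y i \<in> M \<rightarrow>\<^sub>M path_space T) \<and>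
     (\<forall>n\<in>{1..N}. AE \<omega> in M. solves_integral_eq T (X0 n \<omega>)
        (\<lambda>t. (1 / real N) *\<^sub>R (\<Sum>l=1..N. H1 (X n \<omega> t - X l \<omega> t))
           + (1 / real m) *\<^sub>R (\<Sum>j=1..m. K1 (Y j \<omega> t - X n \<omega> t)))
        (\<lambda>t. sqrt (2 * \<sigma>) *\<^sub>R W n \<omega> t) (X n \<omega>)) \<and>
     (\<forall>i\<in>{1..m}. AE \<omega> in M. Y i \<omega> 0 = Y0 i \<and>
        (\<forall>t\<in>{0..T}. (Y i \<omega> has_vector_derivative
            (1 / real N) *\<^sub>R (\<Sum>l=1..N. K2 (Y i \<omega> t - X l \<omega> t))
          + (1 / real m) *\<^sub>R (\<Sum>j=1..m. H2 (Y j \<omega> t - Y i \<omega> t))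
          + u (empirical_measure N (\<lambda>l. X l \<omega> t))) (at t within {0..T})))"

definition limit_solution where
  "limit_solution (M :: 'a measure) T \<sigma> m H1 H2 K1 K2 u
      (X0 :: 'a \<Rightarrow> real^'d) (Y0 :: nat \<Rightarrow> real^'d) (W :: 'a \<Rightarrow> real \<Rightarrow> real^'d)
      (X :: 'a \<Rightarrow> real \<Rightarrow> real^'d) (Y :: nat \<Rightarrow> real \<Rightarrow> real^'d) \<longleftrightarrow>
     X \<in> M \<rightarrow>\<^sub>M path_space T \<and>
     (\<forall>i\<in>{1..m}. Y i \<in> space (path_space T)) \<and>
     (\<forall>t\<in>{0..T}. marginal M T X t \<in> W1_space) \<and>
     (AE \<omega> in M. solves_integral_eq T (X0 \<omega>)
        (\<lambda>t. conv H1 (marginal M T X t) (X \<omega> t)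
           + (1 / real m) *\<^sub>R (\<Sum>j=1..m. K1 (Y j t - X \<omega> t)))
        (\<lambda>t. sqrt (2 * \<sigma>) *\<^sub>R W \<omega> t) (X \<omega>)) \<and>
     (\<forall>i\<in>{1..m}. Y i 0 = Y0 i \<and>
        (\<forall>t\<in>{0..T}. (Y i has_vector_derivative
            conv K2 (marginal M T X t) (Y i t)
          + (1 / real m) *\<^sub>R (\<Sum>j=1..m. H2 (Y j t - Y i t))
          + u (marginal M T X t)) (at t within {0..T})))"

text \<open>\<open>max\<^sub>n max\<^sub>t |X\<^sup>n(t) - X'\<^sup>n(t)| + max\<^sub>i max\<^sub>t |Y\<^sup>i(t) - Y'\<^sup>i(t)|\<close>; for continuous paths the
  suprema over \<open>[0,T]\<close> are maxima.\<close>
definition max_error where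
  "max_error T m N (X :: nat \<Rightarrow> 'a \<Rightarrow> real \<Rightarrow> real^'d) (X' :: nat \<Rightarrow> 'a \<Rightarrow> real \<Rightarrow> real^'d)
      (Y :: nat \<Rightarrow> 'a \<Rightarrow> real \<Rightarrow> real^'d) (Y' :: nat \<Rightarrow> real \<Rightarrow> real^'d) (\<omega> :: 'a) =
     (MAX n\<in>{1..N}. SUP t\<in>{0..T}. norm (X n \<omega> t - X' n \<omega> t)) +
     (MAX i\<in>{1..m}. SUP t\<in>{0..T}. norm (Y i \<omega> t - Y' i t))"

end

theory Submission
  imports Defs
begin

text \<open>The particle system is compared with the limit processes along each path: Gronwall's inequality
  bounds the maximal error by the time integral of the Wasserstein distance between the empirical
  measure of the limit processes and their common law. That distance is estimated by a coupling which
  matches the masses of the cells of a finite partition of unity, so that its expectation is small by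
  a law of large numbers, provided that the limit processes are pairwise uncorrelated and have uniformly
  small tails. Identical laws and pairwise independence are first shown for an Euler scheme and then
  transferred to the limit processes. The independence of the pair of Brownian increments from the past,
  which the scheme requires, follows from a martingale argument in place of Levy's characterisation.\<close>


section \<open>Gronwall inequalities\<close>

text \<open>The bounding sequence has to be fixed before the probability space, the filtration and
  the solutions are known. Every constant is therefore computed from \<open>T\<close>,
  \<open>\<sigma>\<close>, \<open>m\<close>, the coefficients, \<open>Y0\<close> and the initial law
  \<nu> alone. For cells of diameter 1 / k filling a ball of radius about k, the number of cells
  enters the error, so N has to grow while k is fixed; the final sequence is the infimum over k of
  such bounds. Cells are smoothed to Lipschitz functions, since the Euler scheme converges in L1,
  which transfers expectations of Lipschitz functions but not of indicators. Only pairs of particles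
  are ever compared, because a second-moment law of large numbers asks for vanishing covariances.
  The limit system provides, for each copy, a solution with its own law and a finite first moment at
  each time; neither equality of these laws nor a moment bound uniform in time is given, and both
  are derived before any comparison starts.\<close>

lemma set_integrable_bounded_Icc:
  fixes a :: "real \<Rightarrow> real"
  assumes "a \<in> borel_measurable borel" "\<And>s. s \<in> {x..y} \<Longrightarrow> \<bar>a s\<bar> \<le> B"
  shows "set_integrable lborel {x..y} a"
  unfolding set_integrable_def
proof (rule Bochner_Integration.integrable_bound[where f="\<lambda>s. indicator {x..y} s *\<^sub>R B"])
  show "integrable lborel (\<lambda>s. indicator {x..y} s *\<^sub>R B)"
    by (intro integrable_scaleR_left integrable_real_indicator)
       (auto simp: emeasure_lborel_Icc_eq)
  show "(\<lambda>s. indicator {x..y} s *\<^sub>R a s) \<in> borel_measurable lborel"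
    using assms(1) by simp
  show "AE s in lborel. norm (indicator {x..y} s *\<^sub>R a s) \<le> norm (indicator {x..y} s *\<^sub>R B)"
    using assms(2) by (intro AE_I2) (fastforce split: split_indicator intro: order_trans)
qed

lemma set_integrable_Icc_subset:
  fixes f :: "real \<Rightarrow> 'b::{banach, second_countable_topology}"
  assumes "set_integrable lborel {a..b} f" "a \<le> c" "d \<le> b"
  shows "set_integrable lborel {c..d} f"
  using assms by (intro set_integrable_subset[OF assms(1)]) auto

lemma set_lint_mono_Icc_norm:
  fixes b :: "real \<Rightarrow> 'b::{banach, second_countable_topology}"
  assumes "set_integrable lborel {x..y} b" "set_integrable lborel {x..y} g"
    and "\<And>s. s \<in> {x..y} \<Longrightarrow> norm (b s) \<le> g s"
  shows "norm (set_lebesgue_integral lborel {x..y} b) \<le> (LINT s:{x..y}|lborel. g s)"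
proof -
  have "norm (set_lebesgue_integral lborel {x..y} b) \<le> (LINT s:{x..y}|lborel. norm (b s))"
    by (rule set_integral_norm_bound[OF assms(1)])
  also have "\<dots> \<le> (LINT s:{x..y}|lborel. g s)"
    using assms by (intro set_integral_mono set_integrable_norm) auto
  finally show ?thesis .
qed

lemma set_lint_const_Icc: "x \<le> y \<Longrightarrow> (LINT s:{x..y}|lborel. c :: real) = c * (y - x)"
  by (simp add: set_lebesgue_integral_def mult.commute)

lemma set_lint_exp:
  fixes l x :: real
  assumes "l > 0" "0 \<le> x"
  shows "set_integrable lborel {0..x} (\<lambda>s. exp (l * s))"
    and "(LINT s:{0..x}|lborel. exp (l * s)) = (exp (l * x) - 1) / l"
proof -
  show 1: "set_integrable lborel {0..x} (\<lambda>s. exp (l * s))"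
    by (intro borel_integrable_atLeastAtMost'  continuous_intros)
  have "((\<lambda>s. exp (l * s)) has_integral (exp (l * x) / l - exp (l * 0) / l)) {0..x}"
    using assms
    by (intro fundamental_theorem_of_calculus)
       (auto simp: has_real_derivative_iff_has_vector_derivative[symmetric] intro!: derivative_eq_intros)
  then show "(LINT s:{0..x}|lborel. exp (l * s)) = (exp (l * x) - 1) / l"
    using set_borel_integral_eq_integral(2)[OF 1] by (simp add: integral_unique diff_divide_distrib)
qed

text \<open>With the weight exp (-2 L t), the map sending \<open>a\<close> to \<open>L\<close> times
  its primitive has norm at most 1/2 in the supremum norm, so half of the weighted supremum can be
  absorbed. \<open>B\<close> makes that supremum finite and does not enter the estimate.\<close>

lemma gronwall:
  fixes a :: "real \<Rightarrow> real"
  assumes L: "L > 0" and c: "c \<ge> 0"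
    and meas: "a \<in> borel_measurable borel"
    and bnd: "\<And>s. s \<in> {0..T} \<Longrightarrow> 0 \<le> a s \<and> a s \<le> B"
    and ineq: "\<And>t. t \<in> {0..T} \<Longrightarrow> a t \<le> c + L * (LINT s:{0..t}|lborel. a s)"
    and t: "t \<in> {0..T}"
  shows "a t \<le> 2 * c * exp (2 * L * T)"
proof -
  define S where "S = (SUP s\<in>{0..T}. a s * exp (- (2 * L * s)))"
  have bd: "bdd_above ((\<lambda>s. a s * exp (- (2 * L * s))) ` {0..T})"
  proof (rule bdd_aboveI2)
    fix s assume s: "s \<in> {0..T}"
    have "a s * exp (- (2 * L * s)) \<le> B * 1"
      using bnd[OF s] L s by (intro mult_mono) auto
    then show "a s * exp (- (2 * L * s)) \<le> B" by simp
  qed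
  have le_S: "a s \<le> S * exp (2 * L * s)" if "s \<in> {0..T}" for s
  proof -
    have "a s * exp (- (2 * L * s)) \<le> S"
      unfolding S_def using that bd by (rule cSUP_upper)
    then show ?thesis by (simp add: exp_minus field_simps)
  qed
  have S0: "0 \<le> S"
  proof -
    have "0 \<le> S * exp (2 * L * t)" using le_S[OF t] bnd[OF t] by linarith
    then show ?thesis by (simp add: zero_le_mult_iff)
  qed
  have step: "a r * exp (- (2 * L * r)) \<le> c + S / 2" if r: "r \<in> {0..T}" for r
  proof -
    have "(LINT s:{0..r}|lborel. a s) \<le> (LINT s:{0..r}|lborel. S * exp (2 * L * s))"
    proof (rule set_integral_mono)
      show "set_integrable lborel {0..r} a"
        using r bnd by (intro set_integrable_bounded_Icc[OF meas, of _ _ B]) fastforce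
      show "set_integrable lborel {0..r} (\<lambda>s. S * exp (2 * L * s))"
        using r L by (intro set_integrable_mult_right set_lint_exp) auto
      show "a s \<le> S * exp (2 * L * s)" if "s \<in> {0..r}" for s
        using that r by (intro le_S) auto
    qed
    also have "\<dots> = S * ((exp (2 * L * r) - 1) / (2 * L))"
      using set_lint_exp(2)[of "2 * L" r] r L by simp
    also have "\<dots> \<le> S * (exp (2 * L * r) / (2 * L))"
      using S0 L by (intro mult_left_mono divide_right_mono) auto
    finally have "L * (LINT s:{0..r}|lborel. a s) \<le> L * (S * (exp (2 * L * r) / (2 * L)))"
      using L by (intro mult_left_mono) auto
    also have "\<dots> = S / 2 * exp (2 * L * r)" using L by simp
    finally have "a r \<le> c + S / 2 * exp (2 * L * r)" using ineq[OF r] by linarith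
    then have "a r * exp (- (2 * L * r)) \<le> (c + S / 2 * exp (2 * L * r)) * exp (- (2 * L * r))"
      by (intro mult_right_mono) auto
    also have "\<dots> = c * exp (- (2 * L * r)) + S / 2"
      by (simp add: exp_minus field_simps)
    also have "\<dots> \<le> c * 1 + S / 2"
      using c L r by (intro add_right_mono mult_left_mono) auto
    finally show ?thesis by simp
  qed
  have "S \<le> c + S / 2"
    unfolding S_def using t step[unfolded S_def] by (intro cSUP_least) auto
  then have "S \<le> 2 * c" by simp
  have "a t \<le> S * exp (2 * L * t)" by (rule le_S[OF t])
  also have "\<dots> \<le> 2 * c * exp (2 * L * T)"
    using \<open>S \<le> 2 * c\<close> c S0 L t by (intro mult_mono) auto
  finally show ?thesis .
qed

text \<open>The inhomogeneity \<open>g\<close> will contain a Brownian path, so it varies in time.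
  Integrating the inequality once gives one for the primitive of \<open>a\<close> whose constant is
  the integral of \<open>g\<close>; \<open>gronwall\<close> applies to it, and the resulting bound
  is inserted back.\<close>

lemma gronwall_variable:
  fixes a g :: "real \<Rightarrow> real"
  assumes L: "L > 0"
    and cont: "continuous_on {0..T} a" and a0: "\<And>s. s \<in> {0..T} \<Longrightarrow> 0 \<le> a s"
    and g: "set_integrable lborel {0..T} g" and g0: "\<And>s. s \<in> {0..T} \<Longrightarrow> 0 \<le> g s"
    and ineq: "\<And>t. t \<in> {0..T} \<Longrightarrow> a t \<le> g t + L * (LINT s:{0..t}|lborel. a s)"
    and t: "t \<in> {0..T}"
  shows "a t \<le> g t + 2 * L * exp (2 * L * T) * (LINT s:{0..T}|lborel. g s)"
proof -
  have int_a: "set_integrable lborel {0..T} a"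
    by (rule borel_integrable_atLeastAtMost'[OF cont])
  define A where "A r = (LINT s:{0..r}|lborel. a s)" for r
  \<comment> \<open>\<open>gronwall\<close> asks for measurability on the whole line. The clamped
    primitive is monotone, hence Borel, and agrees with the primitive on [0,T].\<close>
  define clamp :: "real \<Rightarrow> real" where "clamp r = max 0 (min T r)" for r
  have T0: "0 \<le> T" using t by simp
  have clamp: "clamp r \<in> {0..T}" for r using T0 by (auto simp: clamp_def)
  have clamp_id: "clamp r = r" if "r \<in> {0..T}" for r using that by (auto simp: clamp_def)
  have A_nonneg: "0 \<le> A r" if "r \<in> {0..T}" for r
    unfolding A_def set_lebesgue_integral_def using that a0
    by (intro Bochner_Integration.integral_nonneg) (auto split: split_indicator)
  have A_mono: "A r \<le> A q" if "r \<le> q" "q \<in> {0..T}" for r q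
    unfolding A_def set_lebesgue_integral_def
  proof (rule integral_mono)
    show "integrable lborel (\<lambda>s. indicat_real {0..q} s *\<^sub>R a s)"
      using set_integrable_Icc_subset[OF int_a, of 0 q] that by (simp add: set_integrable_def)
    show "integrable lborel (\<lambda>s. indicat_real {0..r} s *\<^sub>R a s)"
      using set_integrable_Icc_subset[OF int_a, of 0 r] that by (simp add: set_integrable_def)
  qed (use that a0 in \<open>auto split: split_indicator\<close>)
  have "mono (\<lambda>r. A (clamp r))"
    by (intro monoI A_mono clamp) (auto simp: clamp_def)
  then have meas: "(\<lambda>r. A (clamp r)) \<in> borel_measurable borel"
    by (rule borel_measurable_mono)
  have G0: "0 \<le> (LINT s:{0..T}|lborel. g s)"
    unfolding set_lebesgue_integral_def using g0
    by (intro Bochner_Integration.integral_nonneg) (auto split: split_indicator)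
  have "A (clamp r) \<le> (LINT s:{0..T}|lborel. g s) + L * (LINT s:{0..r}|lborel. A (clamp s))"
    if r: "r \<in> {0..T}" for r
  proof -
    have i1: "set_integrable lborel {0..r} g" using set_integrable_Icc_subset[OF g] r by simp
    have i2: "set_integrable lborel {0..r} (\<lambda>s. A (clamp s))"
      using A_nonneg[OF clamp] A_mono[of "clamp _" T] clamp T0
      by (intro set_integrable_bounded_Icc[OF meas, of _ _ "A T"]) (auto simp: abs_le_iff intro!: A_mono)
    have "A (clamp r) = (LINT s:{0..r}|lborel. a s)" by (simp add: A_def clamp_id[OF r])
    also have "\<dots> \<le> (LINT s:{0..r}|lborel. g s + L * A (clamp s))"
    proof (intro set_integral_mono)
      show "set_integrable lborel {0..r} a" using set_integrable_Icc_subset[OF int_a] r by simp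
      show "set_integrable lborel {0..r} (\<lambda>s. g s + L * A (clamp s))"
        using i1 i2 by (intro set_integral_add set_integrable_mult_right) auto
      show "a s \<le> g s + L * A (clamp s)" if "s \<in> {0..r}" for s
        using ineq[of s] that r clamp_id[of s] by (simp add: A_def)
    qed
    also have "\<dots> = (LINT s:{0..r}|lborel. g s) + L * (LINT s:{0..r}|lborel. A (clamp s))"
      using i1 i2 by (subst set_integral_add) (auto intro: set_integrable_mult_right)
    also have "(LINT s:{0..r}|lborel. g s) \<le> (LINT s:{0..T}|lborel. g s)"
      unfolding set_lebesgue_integral_def using i1 g r g0
      by (intro integral_mono) (auto simp: set_integrable_def split: split_indicator)
    finally show ?thesis by simp
  qed
  then have "A (clamp t) \<le> 2 * (LINT s:{0..T}|lborel. g s) * exp (2 * L * T)"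
    using A_nonneg[OF clamp] A_mono[of "clamp _" T] clamp T0 t
    by (intro gronwall[OF L G0 meas, where B="A T"]) auto
  then have "L * A t \<le> L * (2 * (LINT s:{0..T}|lborel. g s) * exp (2 * L * T))"
    using L clamp_id[OF t] by (intro mult_left_mono) auto
  then show ?thesis using ineq[OF t] by (simp add: A_def mult_ac)
qed

text \<open>By 1 + c \<le> exp c, each of the \<open>j\<close> defects \<open>e\<close> is amplified
  by at most exp (c j).\<close>

lemma gronwall_discrete:
  fixes x :: "nat \<Rightarrow> real"
  assumes "x 0 = 0" "c \<ge> 0" "e \<ge> 0"
    and "\<And>j. j < J \<Longrightarrow> x (Suc j) \<le> (1 + c) * x j + e"
    and "j \<le> J"
  shows "x j \<le> real j * e * exp (c * real j)"
  using \<open>j \<le> J\<close>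
proof (induction j)
  case (Suc j)
  have "x (Suc j) \<le> (1 + c) * x j + e" using Suc.prems assms(4) by simp
  also have "\<dots> \<le> (1 + c) * (real j * e * exp (c * real j)) + e"
    using Suc assms by (intro add_mono mult_left_mono) auto
  also have "\<dots> \<le> exp c * (real j * e * exp (c * real j)) + e * exp (c * real (Suc j))"
    using assms by (intro add_mono mult_right_mono) (auto simp: mult_le_cancel_left1)
  also have "\<dots> = real (Suc j) * e * exp (c * real (Suc j))"
    by (simp add: exp_add[symmetric] algebra_simps)
  finally show ?case .
qed (use assms in simp)

section \<open>Random continuous paths\<close>

text \<open>Evaluation at a time is 1-Lipschitz for the uniform distance, so preimages of open sets
  are open and hence generators of the \<sigma>-algebra of \<open>path_space\<close>.\<close>

lemma measurable_eval_path_space: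
  assumes "t \<in> {0..T}"
  shows "(\<lambda>f :: real \<Rightarrow> real^'d. f t) \<in> path_space T \<rightarrow>\<^sub>M borel"
proof (rule borel_measurableI)
  fix S :: "(real^'d) set" assume "open S"
  define C :: "(real \<Rightarrow> real^'d) metric" where "C = cfunspace (top_of_set {0..T}) euclidean_metric"
  interpret C: Metric_space "mspace C" "mdist C" by simp
  let ?U = "(\<lambda>f. f t) -` S \<inter> mspace C"
  have "openin (mtopology_of C) ?U"
    unfolding mtopology_of_def C.openin_mtopology
  proof (intro conjI allI impI)
    fix f assume f: "f \<in> ?U"
    then obtain r where r: "r > 0" "ball (f t) r \<subseteq> S"
      using \<open>open S\<close> by (auto simp: open_contains_ball)
    have "g \<in> ?U" if g: "g \<in> C.mball f r" for g
    proof -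
      have fg: "f \<in> mspace C" "g \<in> mspace C" "mdist C f g < r"
        using g by (auto simp only: C.in_mball)
      then have "\<forall>x\<in>{0..T}. dist (f x) (g x) \<le> mdist C f g"
        using cfunspace_mdist_le[of f "top_of_set {0..T}" euclidean_metric g "mdist C f g"] assms
        unfolding C_def by auto
      then have "dist (f t) (g t) < r" using fg(3) assms by fastforce
      with fg r show ?thesis by auto
    qed
    then show "\<exists>r>0. C.mball f r \<subseteq> ?U" using r(1) by blast
  qed simp
  moreover have "{U. openin (mtopology_of C) U} \<subseteq> Pow (mspace C)"
    using openin_subset[of "mtopology_of C"] by auto
  ultimately show "(\<lambda>f. f t) -` S \<inter> space (path_space T) \<in> sets (path_space T)"
    unfolding path_space_def Let_def C_def[symmetric]
    by (simp add: sets_measure_of space_measure_of_conv sigma_sets.Basic del: mspace_cfunspace)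
qed

lemma measurable_path_eval:
  assumes "X \<in> M \<rightarrow>\<^sub>M path_space T" "t \<in> {0..T}"
  shows "(\<lambda>\<omega>. X \<omega> t) \<in> borel_measurable M"
  using measurable_compose[OF assms(1) measurable_eval_path_space[OF assms(2)]] .

lemma continuous_on_path:
  assumes "X \<in> M \<rightarrow>\<^sub>M path_space T" "\<omega> \<in> space M"
  shows "continuous_on {0..T} (X \<omega>)"
  using measurable_space[OF assms] by (simp add: space_path_space)

lemma marginal_eq_distr:
  assumes "X \<in> M \<rightarrow>\<^sub>M path_space T" "t \<in> {0..T}"
  shows "marginal M T X t = distr M borel (\<lambda>\<omega>. X \<omega> t)"
  unfolding marginal_def
  by (subst distr_distr[OF measurable_eval_path_space[OF assms(2)] assms(1)]) (simp add: comp_def)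

text \<open>A Caratheodory argument: with the time rounded down to a multiple of 1 / (k + 1) the
  function has countably many pieces, each measurable in the second variable, and continuity in time
  yields the pointwise limit.\<close>

lemma borel_measurable_pair_continuous:
  fixes f :: "real \<Rightarrow> 'a \<Rightarrow> 'b::metric_space"
  assumes meas: "\<And>s. f s \<in> borel_measurable M"
    and cont: "\<And>\<omega>. \<omega> \<in> space M \<Longrightarrow> continuous_on UNIV (\<lambda>s. f s \<omega>)"
  shows "(\<lambda>(s, \<omega>). f s \<omega>) \<in> borel_measurable (borel \<Otimes>\<^sub>M M)"
proof (rule borel_measurable_LIMSEQ_metric)
  let ?q = "\<lambda>(k::nat) s. real_of_int \<lfloor>s * real (Suc k)\<rfloor> / real (Suc k)"
  fix k :: nat
  have "(\<lambda>z. f (real_of_int \<lfloor>fst z * real (Suc k)\<rfloor> / real (Suc k)) (snd z)) \<in> borel_measurable (borel \<Otimes>\<^sub>M M)"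
    by (rule measurable_compose_countable[where g="\<lambda>z. \<lfloor>fst z * real (Suc k)\<rfloor>"
          and f="\<lambda>i z. f (real_of_int i / real (Suc k)) (snd z)"])
       (auto intro!: measurable_compose[OF measurable_snd meas])
  then show "(\<lambda>(s, \<omega>). f (?q k s) \<omega>) \<in> borel_measurable (borel \<Otimes>\<^sub>M M)"
    by (simp add: case_prod_beta)
next
  let ?q = "\<lambda>(k::nat) s. real_of_int \<lfloor>s * real (Suc k)\<rfloor> / real (Suc k)"
  fix z :: "real \<times> 'a" assume z: "z \<in> space (borel \<Otimes>\<^sub>M M)"
  obtain s \<omega> where [simp]: "z = (s, \<omega>)" by force
  have "(\<lambda>k. ?q k s) \<longlonglongrightarrow> s"
  proof (rule tendsto_sandwich)
    show "\<forall>\<^sub>F k in sequentially. s - 1 / real (Suc k) \<le> ?q k s"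
    proof (intro always_eventually allI)
      fix k
      have "s * real (Suc k) - 1 \<le> real_of_int \<lfloor>s * real (Suc k)\<rfloor>" by linarith
      then have "(s * real (Suc k) - 1) / real (Suc k) \<le> ?q k s" by (intro divide_right_mono) auto
      then show "s - 1 / real (Suc k) \<le> ?q k s" by (simp add: diff_divide_distrib)
    qed
    show "\<forall>\<^sub>F k in sequentially. ?q k s \<le> s"
      by (intro always_eventually allI) (simp add: field_simps)
    show "(\<lambda>k. s - 1 / real (Suc k)) \<longlonglongrightarrow> s"
      using tendsto_diff[OF tendsto_const LIMSEQ_inverse_real_of_nat, of s] by (simp add: divide_inverse)
  qed simp
  moreover have "isCont (\<lambda>s. f s \<omega>) s"
    using cont[of \<omega>] z by (auto simp: continuous_on_eq_continuous_at space_pair_measure)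
  ultimately show "(\<lambda>k. (case z of (s, \<omega>) \<Rightarrow> f (?q k s) \<omega>)) \<longlonglongrightarrow> (case z of (s, \<omega>) \<Rightarrow> f s \<omega>)"
    using isCont_tendsto_compose[of s "\<lambda>s. f s \<omega>" "\<lambda>k. ?q k s" sequentially] by simp
qed

text \<open>Elements of \<open>path_space\<close> are \<open>undefined\<close> outside [0,T].
  Clamping the time extends them continuously to the whole line, where measurability with respect to
  \<open>borel\<close> and Fubini's theorem are formulated.\<close>

definition clamp0 :: "real \<Rightarrow> real \<Rightarrow> real" where "clamp0 T s = max 0 (min T s)"

lemma clamp0_in [simp]: "0 \<le> T \<Longrightarrow> clamp0 T s \<in> {0..T}"
  and clamp0_bounds [simp]: "0 \<le> clamp0 T s" "0 \<le> T \<Longrightarrow> clamp0 T s \<le> T"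
  and clamp0_id [simp]: "s \<in> {0..T} \<Longrightarrow> clamp0 T s = s"
  by (auto simp: clamp0_def)

lemma continuous_on_clamp0:
  assumes "continuous_on {0..T} f" "0 \<le> T"
  shows "continuous_on UNIV (\<lambda>s. f (clamp0 T s))"
  by (rule continuous_on_compose2[OF assms(1)])
     (use assms(2) in \<open>auto simp: clamp0_def intro!: continuous_intros\<close>)

lemma measurable_path_pair:
  assumes "X \<in> M \<rightarrow>\<^sub>M path_space T" "0 \<le> T"
  shows "(\<lambda>(s, \<omega>). X \<omega> (clamp0 T s)) \<in> borel_measurable (borel \<Otimes>\<^sub>M M)"
  using assms by (intro borel_measurable_pair_continuous measurable_path_eval continuous_on_clamp0)
    (auto intro: continuous_on_path)

text \<open>By continuity the supremum equals the one over a countable dense subset of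
  [0,T].\<close>

lemma borel_measurable_SUP_Icc:
  fixes g :: "'a \<Rightarrow> real \<Rightarrow> real"
  assumes meas: "\<And>t. t \<in> {0..T} \<Longrightarrow> (\<lambda>\<omega>. g \<omega> t) \<in> borel_measurable M"
    and cont: "\<And>\<omega>. \<omega> \<in> space M \<Longrightarrow> continuous_on {0..T} (g \<omega>)" and "0 \<le> T"
  shows "(\<lambda>\<omega>. SUP t\<in>{0..T}. g \<omega> t) \<in> borel_measurable M"
proof -
  obtain D where D: "countable D" "D \<subseteq> {0..T}" "{0..T} \<subseteq> closure D"
    by (rule separable)
  have clD: "closure D = {0..T}"
    using D closure_minimal[of D "{0..T}"] by auto
  have ne: "D \<noteq> {}" using clD \<open>0 \<le> T\<close> by auto
  have bd: "bdd_above (g \<omega> ` {0..T})" if "\<omega> \<in> space M" for \<omega>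
    using cont[OF that] by (intro bounded_imp_bdd_above compact_imp_bounded compact_continuous_image) auto
  have bdD: "bdd_above (g \<omega> ` D)" if "\<omega> \<in> space M" for \<omega>
    using bdd_above_mono[OF bd[OF that]] D(2) by (meson image_mono)
  have "(SUP t\<in>{0..T}. g \<omega> t) = (SUP t\<in>D. g \<omega> t)" if w: "\<omega> \<in> space M" for \<omega>
  proof (rule antisym)
    show "(SUP t\<in>{0..T}. g \<omega> t) \<le> (SUP t\<in>D. g \<omega> t)"
    proof (rule cSUP_least)
      fix t assume "t \<in> {0..T}"
      then have t: "t \<in> closure D" using clD by simp
      show "g \<omega> t \<le> (SUP t\<in>D. g \<omega> t)"
        by (rule continuous_le_on_closure[OF _ t]) (use cont[OF w] clD cSUP_upper[OF _ bdD[OF w]] in auto)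
    qed (use \<open>0 \<le> T\<close> in auto)
    show "(SUP t\<in>D. g \<omega> t) \<le> (SUP t\<in>{0..T}. g \<omega> t)"
      using ne D(2) by (intro cSUP_subset_mono bd[OF w]) auto
  qed
  moreover have "(\<lambda>\<omega>. SUP t\<in>D. g \<omega> t) \<in> borel_measurable M"
    using D meas bdD by (intro borel_measurable_cSUP) auto
  ultimately show ?thesis by (simp cong: measurable_cong)
qed

section \<open>Couplings and the Wasserstein distance\<close>

lemma wasserstein1_le:
  assumes "\<pi> \<in> couplings \<mu> \<nu>" "(\<integral>\<^sup>+ z. ennreal (dist (fst z) (snd z)) \<partial>\<pi>) \<le> ennreal c" "0 \<le> c"
  shows "wasserstein1 \<mu> \<nu> \<le> c"
  unfolding wasserstein1_def
  by (rule enn2real_leI[OF assms(3)]) (rule INF_lower2[OF assms(1)], rule assms(2))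

lemma wasserstein1_nonneg: "0 \<le> wasserstein1 \<mu> \<nu>"
  by (simp add: wasserstein1_def)

lemma borel_measurable_lipschitz:
  fixes h :: "'b::real_normed_vector \<Rightarrow> 'c::real_normed_vector"
  assumes "\<And>x y. norm (h x - h y) \<le> L * norm (x - y)"
  shows "continuous_on A h" "h \<in> borel_measurable borel"
proof -
  have "norm (h x - h y) \<le> \<bar>L\<bar> * norm (x - y)" for x y
    by (rule order_trans[OF assms]) (simp add: mult_right_mono)
  then have "\<bar>L\<bar>-lipschitz_on UNIV h"
    by (intro lipschitz_onI) (auto simp: dist_norm)
  then have "continuous_on UNIV h" by (rule lipschitz_on_continuous_on)
  then show "continuous_on A h" "h \<in> borel_measurable borel"
    by (auto intro: continuous_on_subset borel_measurable_continuous_onI)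
qed

lemma norm_lipschitz_growth:
  fixes h :: "'b::real_normed_vector \<Rightarrow> 'c::real_normed_vector"
  assumes "\<And>x y. norm (h x - h y) \<le> L * norm (x - y)"
  shows "norm (h x) \<le> norm (h 0) + L * norm x"
  using assms[of x 0] norm_triangle_ineq2[of "h x" "h 0"] by simp

lemma integrable_lipschitz:
  fixes h :: "'b::euclidean_space \<Rightarrow> 'c::euclidean_space"
  assumes "finite_measure M" and X: "X \<in> borel_measurable M" "integrable M (\<lambda>\<omega>. norm (X \<omega>))"
    and lip: "\<And>x y. norm (h x - h y) \<le> L * norm (x - y)" "0 \<le> L"
  shows "integrable M (\<lambda>\<omega>. h (X \<omega>))"
proof (rule Bochner_Integration.integrable_bound)
  interpret finite_measure M by fact
  show "integrable M (\<lambda>\<omega>. norm (h 0) + L * norm (X \<omega>))" using X by simp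
  show "(\<lambda>\<omega>. h (X \<omega>)) \<in> borel_measurable M"
    using measurable_compose[OF X(1) borel_measurable_lipschitz(2)[OF lip(1)]] .
  show "AE \<omega> in M. norm (h (X \<omega>)) \<le> norm (norm (h 0) + L * norm (X \<omega>))"
    using norm_lipschitz_growth[OF lip(1)] lip(2) by (intro AE_I2) (auto intro: order_trans)
qed

text \<open>The easy half of Kantorovich duality, for one given coupling and a vector-valued
  \<open>h\<close>. Working with a coupling avoids the question whether the infimum in
  \<open>wasserstein1\<close> is attained, and one coupling then bounds both the convolutions and,
  through \<open>wasserstein1_le\<close>, the term with \<open>u\<close>.\<close>

lemma lipschitz_integral_diff_le:
  fixes h :: "real^'d \<Rightarrow> 'c::euclidean_space"
  assumes \<pi>: "\<pi> \<in> couplings \<mu> \<nu>" and W: "\<mu> \<in> W1_space" "\<nu> \<in> W1_space"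
    and c: "(\<integral>\<^sup>+ z. ennreal (dist (fst z) (snd z)) \<partial>\<pi>) \<le> ennreal c" "0 \<le> c"
    and lip: "\<And>x y. norm (h x - h y) \<le> L * norm (x - y)" "0 \<le> L"
  shows "norm (integral\<^sup>L \<mu> h - integral\<^sup>L \<nu> h) \<le> L * c"
proof -
  have sets: "sets \<pi> = sets (borel \<Otimes>\<^sub>M borel)" using \<pi> by (simp add: couplings_def)
  have [measurable]: "fst \<in> \<pi> \<rightarrow>\<^sub>M borel" "snd \<in> \<pi> \<rightarrow>\<^sub>M borel"
    by (simp_all cong: measurable_cong_sets add: sets)
  have \<mu>: "\<mu> = distr \<pi> borel fst" and \<nu>: "\<nu> = distr \<pi> borel snd"
    using \<pi> by (simp_all add: couplings_def)
  have [measurable]: "h \<in> borel_measurable borel" by (rule borel_measurable_lipschitz[OF lip(1)])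
  have "integrable \<mu> h" "integrable \<nu> h"
    using W lip by (auto intro!: integrable_lipschitz[where X="\<lambda>x. x"] prob_space.finite_measure
        simp: W1_space_def cong: measurable_cong_sets)
  then have i: "integrable \<pi> (\<lambda>z. h (fst z))" "integrable \<pi> (\<lambda>z. h (snd z))"
    unfolding \<mu> \<nu> by (simp_all add: integrable_distr_eq)
  have fin: "(\<integral>\<^sup>+ z. ennreal (dist (fst z) (snd z)) \<partial>\<pi>) < \<infinity>"
    using c(1) by (rule le_less_trans) simp
  have idist: "integrable \<pi> (\<lambda>z. dist (fst z) (snd z))"
    using fin by (intro integrableI_bounded) auto
  have "ennreal (integral\<^sup>L \<pi> (\<lambda>z. dist (fst z) (snd z))) \<le> ennreal c"
    using c(1) by (subst nn_integral_eq_integral[symmetric, OF idist]) auto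
  then have le_c: "integral\<^sup>L \<pi> (\<lambda>z. dist (fst z) (snd z)) \<le> c" using c(2) by simp
  have "integral\<^sup>L \<mu> h - integral\<^sup>L \<nu> h = (\<integral>z. h (fst z) - h (snd z) \<partial>\<pi>)"
    using i unfolding \<mu> \<nu> by (simp add: integral_distr)
  also have "norm \<dots> \<le> (\<integral>z. L * dist (fst z) (snd z) \<partial>\<pi>)"
    using i idist lip by (intro Bochner_Integration.integral_norm_bound_integral) (auto simp: dist_norm)
  also have "\<dots> \<le> L * c" using le_c lip by (simp add: mult_left_mono)
  finally show ?thesis .
qed

section \<open>Empirical and Dirac measures in the Wasserstein space\<close>

lemma empirical_measure_integral:
  fixes f :: "real^'d \<Rightarrow> 'b::{banach, second_countable_topology}"
  assumes "N \<ge> 1" "f \<in> borel_measurable borel"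
  shows "integral\<^sup>L (empirical_measure N x) f = (1 / real N) *\<^sub>R (\<Sum>l=1..N. f (x l))"
proof -
  have "integral\<^sup>L (empirical_measure N x) f = integral\<^sup>L (uniform_count_measure {1..N}) (\<lambda>l. f (x l))"
    unfolding empirical_measure_def using assms
    by (subst integral_distr) (auto simp: measurable_def sets_uniform_count_measure space_uniform_count_measure)
  also have "\<dots> = (\<Sum>l=1..N. (1 / real N) *\<^sub>R f (x l))"
    unfolding uniform_count_measure_def using assms by (subst lebesgue_integral_point_measure_finite) auto
  finally show ?thesis by (simp add: scaleR_right.sum)
qed

lemma empirical_measure_in_W1:
  assumes "N \<ge> 1"
  shows "(empirical_measure N x :: (real^'d) measure) \<in> W1_space"
proof -
  let ?U = "uniform_count_measure {1..N}"
  have m: "x \<in> ?U \<rightarrow>\<^sub>M borel"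
    by (auto simp: measurable_def sets_uniform_count_measure space_uniform_count_measure)
  interpret U: prob_space ?U using assms by (intro prob_space_uniform_count_measure) auto
  have "integrable ?U (\<lambda>l. norm (x l))"
    unfolding uniform_count_measure_def by (rule integrable_point_measure_finite) auto
  then show ?thesis
    unfolding W1_space_def empirical_measure_def using m U.prob_space_distr[OF m]
    by (auto simp: integrable_distr_eq)
qed

text \<open>The coupling pairs equal indices: it is the image of the uniform measure under l -> (x
  l, y l).\<close>

lemma wasserstein1_empirical_le:
  fixes x y :: "nat \<Rightarrow> real^'d"
  assumes "N \<ge> 1"
  shows "wasserstein1 (empirical_measure N x) (empirical_measure N y) \<le> (1 / real N) * (\<Sum>l=1..N. norm (x l - y l))"
proof (rule wasserstein1_le)
  let ?U = "uniform_count_measure {1..N}"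
  let ?\<pi> = "distr ?U (borel \<Otimes>\<^sub>M borel) (\<lambda>l. (x l, y l))"
  have m: "f \<in> ?U \<rightarrow>\<^sub>M A" if "\<And>l. f l \<in> space A" for f and A :: "'c measure"
    using that by (auto simp: measurable_def sets_uniform_count_measure space_uniform_count_measure)
  have mp: "(\<lambda>l. (x l, y l)) \<in> ?U \<rightarrow>\<^sub>M borel \<Otimes>\<^sub>M borel"
    by (rule m) (simp add: space_pair_measure)
  show "?\<pi> \<in> couplings (empirical_measure N x) (empirical_measure N y)"
    unfolding couplings_def empirical_measure_def using mp by (auto simp: distr_distr comp_def)
  have "(\<integral>\<^sup>+ z. ennreal (dist (fst z) (snd z)) \<partial>?\<pi>) = (\<integral>\<^sup>+ l. ennreal (norm (x l - y l)) \<partial>?U)"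
    using mp by (subst nn_integral_distr) (auto simp: dist_norm)
  also have "\<dots> = ennreal (\<integral>l. norm (x l - y l) \<partial>?U)"
    by (intro nn_integral_eq_integral)
       (auto simp: uniform_count_measure_def intro!: integrable_point_measure_finite)
  also have "(\<integral>l. norm (x l - y l) \<partial>?U) = (1 / real N) * (\<Sum>l=1..N. norm (x l - y l))"
    by (subst integral_uniform_count_measure) auto
  finally show "(\<integral>\<^sup>+ z. ennreal (dist (fst z) (snd z)) \<partial>?\<pi>) \<le> ennreal ((1 / real N) * (\<Sum>l=1..N. norm (x l - y l)))"
    by simp
qed (simp add: sum_nonneg)

lemma return_in_W1: "(return borel x :: (real^'d) measure) \<in> W1_space"
  by (auto simp: W1_space_def prob_space_return integrable_iff_bounded nn_integral_return)

text \<open>The Dirac measure at 0 is the reference point from which the linear growth of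
  \<open>u\<close> in the first moment is read off. The coupling is the image of \<mu> under x ->
  (x, 0).\<close>

lemma wasserstein1_return_le:
  assumes "\<mu> \<in> W1_space"
  shows "wasserstein1 \<mu> (return borel 0 :: (real^'d) measure) \<le> integral\<^sup>L \<mu> norm"
proof (rule wasserstein1_le)
  interpret prob_space \<mu> using assms by (simp add: W1_space_def)
  have s[measurable_cong]: "sets \<mu> = sets borel" and i: "integrable \<mu> norm" using assms by (auto simp: W1_space_def)
  let ?\<pi> = "distr \<mu> (borel \<Otimes>\<^sub>M borel) (\<lambda>x. (x, 0::real^'d))"
  have "distr \<mu> borel (\<lambda>x. 0::real^'d) = return borel 0"
    by (rule measure_eqI) (auto simp: emeasure_distr emeasure_space_1 split: split_indicator)
  then show "?\<pi> \<in> couplings \<mu> (return borel 0)"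
    unfolding couplings_def using distr_id2[of borel \<mu>] s by (auto simp: distr_distr comp_def)
  show "(\<integral>\<^sup>+ z. ennreal (dist (fst z) (snd z)) \<partial>?\<pi>) \<le> ennreal (integral\<^sup>L \<mu> norm)"
    by (subst nn_integral_distr) (auto simp: nn_integral_eq_integral[OF i])
qed simp

section \<open>A coupling that matches the masses of cells\<close>

lemma has_bochner_integral_pair_times:
  fixes f :: "'a \<Rightarrow> real" and g :: "'b \<Rightarrow> real"
  assumes "prob_space \<mu>" "prob_space \<nu>" and f: "integrable \<mu> f" and g: "integrable \<nu> g"
  shows "has_bochner_integral (\<mu> \<Otimes>\<^sub>M \<nu>) (\<lambda>z. f (fst z) * g (snd z)) (integral\<^sup>L \<mu> f * integral\<^sup>L \<nu> g)"
proof -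
  interpret m: prob_space \<mu> by fact
  interpret n: prob_space \<nu> by fact
  interpret pair_sigma_finite \<mu> \<nu> ..
  have [measurable]: "f \<in> borel_measurable \<mu>" "g \<in> borel_measurable \<nu>" using f g by auto
  have i: "integrable (\<mu> \<Otimes>\<^sub>M \<nu>) (\<lambda>z. f (fst z) * g (snd z))"
  proof (rule Fubini_integrable)
    show "integrable \<mu> (\<lambda>x. \<integral>y. norm (f (fst (x, y)) * g (snd (x, y))) \<partial>\<nu>)"
      using f by (simp add: abs_mult)
    show "AE x in \<mu>. integrable \<nu> (\<lambda>y. f (fst (x, y)) * g (snd (x, y)))" using g by simp
  qed simp
  moreover have "integral\<^sup>L (\<mu> \<Otimes>\<^sub>M \<nu>) (\<lambda>z. f (fst z) * g (snd z)) = integral\<^sup>L \<mu> f * integral\<^sup>L \<nu> g"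
    using integral_fst'[OF i] by simp
  ultimately show ?thesis by (simp add: has_bochner_integral_iff)
qed

text \<open>In each cell the smaller of the two masses is transported within the cell; what remains
  of the two measures has the same total mass and is coupled by a product. Mass kept in a small cell
  moves by at most \<epsilon>. The leftovers of both measures in the small cells add up to the sum
  of the mass differences and lie within \<rho> of the origin. Everything in the far cell
  \<open>c0\<close> is paid for by first moments.\<close>

lemma coupling_of_partition:
  fixes \<phi> :: "'i \<Rightarrow> real^'d \<Rightarrow> real"
  assumes W: "\<mu> \<in> W1_space" "\<nu> \<in> W1_space"
    and I: "finite I" "c0 \<in> I"
    and meas: "\<And>c. c \<in> I \<Longrightarrow> \<phi> c \<in> borel_measurable borel"
    and nonneg: "\<And>c x. c \<in> I \<Longrightarrow> 0 \<le> \<phi> c x"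
    and sum1: "\<And>x. (\<Sum>c\<in>I. \<phi> c x) = 1"
    and \<epsilon>: "0 \<le> \<epsilon>" "\<And>c x y. c \<in> I - {c0} \<Longrightarrow> \<phi> c x > 0 \<Longrightarrow> \<phi> c y > 0 \<Longrightarrow> dist x y \<le> \<epsilon>"
    and \<rho>: "0 \<le> \<rho>" "\<And>c x. c \<in> I - {c0} \<Longrightarrow> \<phi> c x > 0 \<Longrightarrow> norm x \<le> \<rho>"
  shows "\<exists>\<pi>\<in>couplings \<mu> \<nu>. (\<integral>\<^sup>+ z. ennreal (dist (fst z) (snd z)) \<partial>\<pi>) \<le>
    ennreal (\<epsilon> + \<rho> * (\<Sum>c\<in>I - {c0}. \<bar>integral\<^sup>L \<mu> (\<phi> c) - integral\<^sup>L \<nu> (\<phi> c)\<bar>)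
      + (\<integral>x. norm x * \<phi> c0 x \<partial>\<mu>) + (\<integral>x. norm x * \<phi> c0 x \<partial>\<nu>))"
proof -
  interpret m: prob_space \<mu> using W by (simp add: W1_space_def)
  interpret n: prob_space \<nu> using W by (simp add: W1_space_def)
  have \<kappa>: "prob_space \<kappa>" "sets \<kappa> = sets borel" "integrable \<kappa> norm" if "\<kappa> \<in> {\<mu>, \<nu>}" for \<kappa>
    using W that by (auto simp: W1_space_def)
  have s[measurable_cong]: "sets \<mu> = sets borel" "sets \<nu> = sets borel" by (simp_all add: \<kappa>)
  have le1: "\<phi> c x \<le> 1" if "c \<in> I" for c x
    using member_le_sum[of c I "\<lambda>c. \<phi> c x"] I nonneg that by (simp add: sum1)
  have int_\<phi>: "integrable \<kappa> (\<lambda>x. p x * \<phi> c x)" if "\<kappa> \<in> {\<mu>, \<nu>}" "c \<in> I" "integrable \<kappa> p" for p c \<kappa>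
  proof (rule Bochner_Integration.integrable_bound[OF that(3)])
    show "AE x in \<kappa>. norm (p x * \<phi> c x) \<le> norm (p x)"
      using le1[OF that(2)] nonneg[OF that(2)] by (intro AE_I2) (simp add: abs_mult mult_left_le)
    have "\<phi> c \<in> borel_measurable \<kappa>" using meas[OF that(2)] \<kappa>(2)[OF that(1)] by (simp cong: measurable_cong_sets)
    then show "(\<lambda>x. p x * \<phi> c x) \<in> borel_measurable \<kappa>" using that(3) by measurable
  qed
  have int1: "integrable \<kappa> (\<lambda>x. 1 :: real)" "(\<integral>x. 1 \<partial>\<kappa>) = (1 :: real)" if "\<kappa> \<in> {\<mu>, \<nu>}" for \<kappa>
    using that m.prob_space n.prob_space by auto
  define A where "A \<kappa> c = integral\<^sup>L \<kappa> (\<phi> c)" for \<kappa> c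
  \<comment> \<open>\<open>w c\<close> is the mass kept in cell \<open>c\<close>, and
    \<open>k c\<close> normalises the product of \<phi> c (x) and \<phi> c (y) to carry exactly that
    mass. \<open>\<alpha> \<kappa>\<close> is the density, with respect to \<kappa>, of the mass
    left over; its total is \<open>r\<close> for both measures.\<close>
  define w where "w c = min (A \<mu> c) (A \<nu> c)" for c
  define k where "k c = w c / (A \<mu> c * A \<nu> c)" for c
  define \<alpha> where "\<alpha> \<kappa> x = (\<Sum>c\<in>I. (1 - w c / A \<kappa> c) * \<phi> c x)" for \<kappa> x
  define r where "r = 1 - (\<Sum>c\<in>I. w c)"
  define N where "N \<kappa> c = (\<integral>x. norm x * \<phi> c x \<partial>\<kappa>)" for \<kappa> c
  have A0: "0 \<le> A \<kappa> c" if "c \<in> I" for c \<kappa>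
    unfolding A_def using nonneg[OF that] by simp
  have w0: "0 \<le> w c" "w c \<le> A \<mu> c" "w c \<le> A \<nu> c" if "c \<in> I" for c
    using A0[OF that] by (auto simp: w_def)
  \<comment> \<open>A cell without mass needs no separate treatment: then \<open>w c\<close> is 0,
    and so is the quotient by zero.\<close>
  have wA: "w c \<le> A \<kappa> c" "0 \<le> 1 - w c / A \<kappa> c" "w c / A \<kappa> c * A \<kappa> c = w c" if "\<kappa> \<in> {\<mu>, \<nu>}" "c \<in> I" for c \<kappa>
    using w0[OF that(2)] A0[OF that(2), of \<kappa>] that(1) by (auto simp: divide_le_eq_1)
  have kk: "k c * A \<nu> c = w c / A \<mu> c" "k c * A \<mu> c = w c / A \<nu> c" "0 \<le> k c" if "c \<in> I" for c
    using w0[OF that] A0[OF that, of \<mu>] A0[OF that, of \<nu>] by (auto simp: k_def)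
  have sumA: "(\<Sum>c\<in>I. A \<kappa> c) = 1" if "\<kappa> \<in> {\<mu>, \<nu>}" for \<kappa>
    unfolding A_def using int_\<phi>[OF that _ int1(1)[OF that]] int1(2)[OF that]
    by (simp add: sum1 flip: Bochner_Integration.integral_sum)
  have \<alpha>0: "0 \<le> \<alpha> \<kappa> x" if "\<kappa> \<in> {\<mu>, \<nu>}" for x \<kappa>
    unfolding \<alpha>_def using wA[OF that] nonneg by (auto intro!: sum_nonneg)
  have int_\<alpha>: "has_bochner_integral \<kappa> (\<lambda>x. p x * \<alpha> \<kappa> x) (\<Sum>c\<in>I. (1 - w c / A \<kappa> c) * (\<integral>x. p x * \<phi> c x \<partial>\<kappa>))"
    if "\<kappa> \<in> {\<mu>, \<nu>}" "integrable \<kappa> p" for p \<kappa>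
  proof -
    have "has_bochner_integral \<kappa> (\<lambda>x. \<Sum>c\<in>I. (1 - w c / A \<kappa> c) * (p x * \<phi> c x)) (\<Sum>c\<in>I. (1 - w c / A \<kappa> c) * (\<integral>x. p x * \<phi> c x \<partial>\<kappa>))"
      using int_\<phi>[OF that(1) _ that(2)]
      by (intro has_bochner_integral_sum has_bochner_integral_mult_right) (auto simp: has_bochner_integral_iff)
    then show ?thesis by (simp add: \<alpha>_def sum_distrib_left mult_ac)
  qed
  note int_\<alpha>_eq = has_bochner_integral_integral_eq[OF int_\<alpha>]
  have \<alpha>r: "(\<integral>x. \<alpha> \<kappa> x \<partial>\<kappa>) = r" if "\<kappa> \<in> {\<mu>, \<nu>}" for \<kappa>
  proof -
    have "(\<integral>x. \<alpha> \<kappa> x \<partial>\<kappa>) = (\<Sum>c\<in>I. (1 - w c / A \<kappa> c) * A \<kappa> c)"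
      using int_\<alpha>_eq[OF that int1(1)[OF that]] by (simp add: A_def)
    also have "\<dots> = (\<Sum>c\<in>I. A \<kappa> c - w c)" using wA(3)[OF that] by (intro sum.cong refl) (simp add: left_diff_distrib)
    finally show ?thesis by (simp add: r_def sum_subtractf sumA[OF that])
  qed
  have r0: "0 \<le> r"
    using sum_mono[of I w "A \<mu>"] w0 sumA[of \<mu>] by (simp add: r_def)
  \<comment> \<open>If r = 0, the leftover density vanishes almost everywhere, so both sides are 0
    and the division by zero in the density below does no harm.\<close>
  have r_zero: "(\<integral>x. p x * \<alpha> \<kappa> x \<partial>\<kappa>) * r / r = (\<integral>x. p x * \<alpha> \<kappa> x \<partial>\<kappa>)" if k: "\<kappa> \<in> {\<mu>, \<nu>}" for p \<kappa>
  proof (cases "r = 0")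
    case True
    then have "AE x in \<kappa>. \<alpha> \<kappa> x = 0"
      using \<alpha>r[OF k] \<alpha>0[OF k] int_\<alpha>[OF k int1(1)[OF k]]
      by (subst integral_nonneg_eq_0_iff_AE[symmetric]) (auto simp: has_bochner_integral_iff)
    then have "AE x in \<kappa>. p x * \<alpha> \<kappa> x = 0" by eventually_elim simp
    then have "(\<integral>x. p x * \<alpha> \<kappa> x \<partial>\<kappa>) = 0" by (rule integral_eq_zero_AE)
    then show ?thesis by simp
  qed simp
  have split: "(\<Sum>c\<in>I. w c / A \<kappa> c * (\<integral>x. p x * \<phi> c x \<partial>\<kappa>)) + (\<integral>x. p x * \<alpha> \<kappa> x \<partial>\<kappa>) = integral\<^sup>L \<kappa> p"
    if "\<kappa> \<in> {\<mu>, \<nu>}" "integrable \<kappa> p" for p \<kappa>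
  proof -
    have "(\<Sum>c\<in>I. w c / A \<kappa> c * (\<integral>x. p x * \<phi> c x \<partial>\<kappa>)) + (\<integral>x. p x * \<alpha> \<kappa> x \<partial>\<kappa>) = (\<Sum>c\<in>I. \<integral>x. p x * \<phi> c x \<partial>\<kappa>)"
      unfolding int_\<alpha>_eq[OF that] by (simp add: sum.distrib[symmetric] left_diff_distrib)
    also have "\<dots> = integral\<^sup>L \<kappa> p"
      using int_\<phi>[OF that(1) _ that(2)] by (subst Bochner_Integration.integral_sum[symmetric]) (auto simp: sum_distrib_left[symmetric] sum1)
    finally show ?thesis .
  qed
  let ?P = "\<mu> \<Otimes>\<^sub>M \<nu>"
  \<comment> \<open>The density of the coupling with respect to the product measure. Every summand
    is a function of the first variable times one of the second, so all integrals against it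
    factorise.\<close>
  define g where "g z = (\<Sum>c\<in>I. k c * (\<phi> c (fst z) * \<phi> c (snd z))) + \<alpha> \<mu> (fst z) * \<alpha> \<nu> (snd z) / r" for z
  have g0: "0 \<le> g z" for z
    unfolding g_def using kk nonneg \<alpha>0 r0 by (intro add_nonneg_nonneg sum_nonneg divide_nonneg_nonneg mult_nonneg_nonneg) auto
  have [measurable]: "\<alpha> \<kappa> \<in> borel_measurable borel" for \<kappa>
    unfolding \<alpha>_def using meas by measurable
  have sp: "sets ?P = sets (borel \<Otimes>\<^sub>M borel)" by (rule sets_pair_measure_cong) (simp_all add: s)
  have "g \<in> borel_measurable (borel \<Otimes>\<^sub>M borel)"
    unfolding g_def using meas by measurable
  then have [measurable]: "g \<in> borel_measurable ?P"
    by (simp cong: measurable_cong_sets add: sp)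
  note pt = has_bochner_integral_pair_times[OF m.prob_space_axioms n.prob_space_axioms]
  \<comment> \<open>Testing against products p(x) q(y) covers both marginals: they are the cases
    where one of the two functions is 1.\<close>
  have gen: "has_bochner_integral ?P (\<lambda>z. p (fst z) * q (snd z) * g z)
      ((\<Sum>c\<in>I. k c * ((\<integral>x. p x * \<phi> c x \<partial>\<mu>) * (\<integral>x. q x * \<phi> c x \<partial>\<nu>))) + (\<integral>x. p x * \<alpha> \<mu> x \<partial>\<mu>) * (\<integral>x. q x * \<alpha> \<nu> x \<partial>\<nu>) / r)"
    if p: "integrable \<mu> p" and q: "integrable \<nu> q" for p q
  proof -
    have "has_bochner_integral ?P (\<lambda>z. (\<Sum>c\<in>I. k c * ((p (fst z) * \<phi> c (fst z)) * (q (snd z) * \<phi> c (snd z)))) + ((p (fst z) * \<alpha> \<mu> (fst z)) * (q (snd z) * \<alpha> \<nu> (snd z))) / r)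
      ((\<Sum>c\<in>I. k c * ((\<integral>x. p x * \<phi> c x \<partial>\<mu>) * (\<integral>x. q x * \<phi> c x \<partial>\<nu>))) + (\<integral>x. p x * \<alpha> \<mu> x \<partial>\<mu>) * (\<integral>x. q x * \<alpha> \<nu> x \<partial>\<nu>) / r)"
      using int_\<phi>[OF _ _ p] int_\<phi>[OF _ _ q] int_\<alpha>[OF _ p] int_\<alpha>[OF _ q]
      by (intro has_bochner_integral_add has_bochner_integral_sum has_bochner_integral_mult_right
          has_bochner_integral_divide pt) (auto simp: has_bochner_integral_iff)
    moreover have "(\<lambda>z. (\<Sum>c\<in>I. k c * ((p (fst z) * \<phi> c (fst z)) * (q (snd z) * \<phi> c (snd z)))) + ((p (fst z) * \<alpha> \<mu> (fst z)) * (q (snd z) * \<alpha> \<nu> (snd z))) / r)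
       = (\<lambda>z. p (fst z) * q (snd z) * g z)"
      by (simp add: g_def fun_eq_iff distrib_left sum_distrib_left mult_ac)
    ultimately show ?thesis by simp
  qed
  have marg1: "has_bochner_integral ?P (\<lambda>z. p (fst z) * g z) (integral\<^sup>L \<mu> p)" if p: "integrable \<mu> p" for p
  proof -
    have "k c * (x * A \<nu> c) = w c / A \<mu> c * x" if "c \<in> I" for c x
      using kk(1)[OF that] by (metis mult.assoc mult.commute)
    then have "(\<Sum>c\<in>I. k c * ((\<integral>x. p x * \<phi> c x \<partial>\<mu>) * A \<nu> c)) + (\<integral>x. p x * \<alpha> \<mu> x \<partial>\<mu>) = integral\<^sup>L \<mu> p"
      using split[OF _ p] by simp
    then show ?thesis using gen[OF p, of "\<lambda>_. 1"] r_zero[of \<mu> p] by (simp add: \<alpha>r A_def)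
  qed
  have marg2: "has_bochner_integral ?P (\<lambda>z. q (snd z) * g z) (integral\<^sup>L \<nu> q)" if q: "integrable \<nu> q" for q
  proof -
    have "k c * (A \<mu> c * x) = w c / A \<nu> c * x" if "c \<in> I" for c x
      using kk(2)[OF that] by (metis mult.assoc)
    then have "(\<Sum>c\<in>I. k c * (A \<mu> c * (\<integral>x. q x * \<phi> c x \<partial>\<nu>))) + (\<integral>x. q x * \<alpha> \<nu> x \<partial>\<nu>) = integral\<^sup>L \<nu> q"
      using split[OF _ q] by simp
    then show ?thesis using gen[OF _ q, of "\<lambda>_. 1"] r_zero[of \<nu> q] by (simp add: \<alpha>r A_def mult.commute)
  qed
  define \<pi> where "\<pi> = density ?P (\<lambda>z. ennreal (g z))"
  have marg: "distr \<pi> borel f = \<kappa>"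
    if k: "\<kappa> \<in> {\<mu>, \<nu>}" and f: "f \<in> borel \<Otimes>\<^sub>M borel \<rightarrow>\<^sub>M borel"
      and m: "\<And>p. integrable \<kappa> p \<Longrightarrow> has_bochner_integral ?P (\<lambda>z. p (f z) * g z) (integral\<^sup>L \<kappa> p)" for f \<kappa>
  proof (rule measure_eqI)
    interpret prob_space \<kappa> by (rule \<kappa>(1)[OF k])
    have fP[measurable]: "f \<in> ?P \<rightarrow>\<^sub>M borel" using f by (simp cong: measurable_cong_sets add: sp)
    fix S assume "S \<in> sets (distr \<pi> borel f)"
    then have S: "S \<in> sets borel" by simp
    have "integrable \<kappa> (indicat_real S)"
      using S by (simp add: \<kappa>(2)[OF k] integrable_indicator_iff emeasure_finite less_top[symmetric])
    from m[OF this] have i: "integrable ?P (\<lambda>z. indicat_real S (f z) * g z)" "(\<integral>z. indicat_real S (f z) * g z \<partial>?P) = prob S"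
      using S sets_eq_imp_space_eq[OF \<kappa>(2)[OF k]] by (auto simp: has_bochner_integral_iff)
    have "emeasure (distr \<pi> borel f) S = emeasure \<pi> (f -` S \<inter> space ?P)"
      using S by (subst emeasure_distr) (auto simp: \<pi>_def)
    also have "\<dots> = (\<integral>\<^sup>+z. ennreal (indicator S (f z) * g z) \<partial>?P)"
      unfolding \<pi>_def using measurable_sets[OF fP S]
      by (subst emeasure_density) (auto intro!: nn_integral_cong split: split_indicator)
    also have "\<dots> = ennreal (prob S)"
      using g0 by (subst nn_integral_eq_integral[OF i(1)]) (auto simp: i(2))
    finally show "emeasure (distr \<pi> borel f) S = emeasure \<kappa> S" by (simp add: emeasure_eq_measure)
  qed (use \<kappa>(2)[OF k] in simp)
  have "\<pi> \<in> couplings \<mu> \<nu>"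
    using marg[of \<mu> fst] marg[of \<nu> snd] marg1 marg2 by (simp add: couplings_def \<pi>_def sp)
  moreover have "(\<integral>\<^sup>+ z. ennreal (dist (fst z) (snd z)) \<partial>\<pi>) \<le>
    ennreal (\<epsilon> + \<rho> * (\<Sum>c\<in>I - {c0}. \<bar>A \<mu> c - A \<nu> c\<bar>) + N \<mu> c0 + N \<nu> c0)"
  proof -
    \<comment> \<open>An integrable majorant of density times distance that is again built from
      product terms: the distance is replaced by \<epsilon> in the small cells and by the sum of the
      norms in the far cell and in the leftover part.\<close>
    define G where "G z = (\<Sum>c\<in>I - {c0}. \<epsilon> * k c * (\<phi> c (fst z) * \<phi> c (snd z)))
        + k c0 * ((norm (fst z) * \<phi> c0 (fst z)) * \<phi> c0 (snd z) + \<phi> c0 (fst z) * (norm (snd z) * \<phi> c0 (snd z)))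
        + ((norm (fst z) * \<alpha> \<mu> (fst z)) * \<alpha> \<nu> (snd z) / r + \<alpha> \<mu> (fst z) * (norm (snd z) * \<alpha> \<nu> (snd z)) / r)" for z
    have dG: "g z * dist (fst z) (snd z) \<le> G z" for z
    proof -
      let ?d = "dist (fst z) (snd z)"
      have dn: "?d \<le> norm (fst z) + norm (snd z)" by (simp add: dist_norm norm_triangle_ineq4)
      have "(\<Sum>c\<in>I. k c * (\<phi> c (fst z) * \<phi> c (snd z))) * ?d
        = (\<Sum>c\<in>I - {c0}. k c * (\<phi> c (fst z) * \<phi> c (snd z)) * ?d) + k c0 * (\<phi> c0 (fst z) * \<phi> c0 (snd z)) * ?d"
        using I by (simp add: sum.remove[of I c0] distrib_right sum_distrib_right)
      also have "\<dots> \<le> (\<Sum>c\<in>I - {c0}. \<epsilon> * k c * (\<phi> c (fst z) * \<phi> c (snd z)))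
        + k c0 * (\<phi> c0 (fst z) * \<phi> c0 (snd z)) * (norm (fst z) + norm (snd z))"
      proof (intro add_mono sum_mono mult_left_mono dn)
        fix c assume c: "c \<in> I - {c0}"
        have c': "c \<in> I" using c by simp
        show "k c * (\<phi> c (fst z) * \<phi> c (snd z)) * ?d \<le> \<epsilon> * k c * (\<phi> c (fst z) * \<phi> c (snd z))"
        proof (cases "\<phi> c (fst z) > 0 \<and> \<phi> c (snd z) > 0")
          case True
          have "k c * (\<phi> c (fst z) * \<phi> c (snd z)) * ?d \<le> k c * (\<phi> c (fst z) * \<phi> c (snd z)) * \<epsilon>"
            using True kk(3)[OF c'] nonneg[OF c'] by (intro mult_left_mono \<epsilon>(2)[OF c]) auto
          then show ?thesis by (simp add: mult_ac)
        next
          case False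
          then have eq0: "\<phi> c (fst z) * \<phi> c (snd z) = 0" using nonneg[OF c'] by (metis less_eq_real_def mult_eq_0_iff)
          show ?thesis unfolding eq0 by simp
        qed
      qed (use kk nonneg I in auto)
      finally have 1: "(\<Sum>c\<in>I. k c * (\<phi> c (fst z) * \<phi> c (snd z))) * ?d \<le> \<dots>" .
      have 2: "\<alpha> \<mu> (fst z) * \<alpha> \<nu> (snd z) / r * ?d \<le> \<alpha> \<mu> (fst z) * \<alpha> \<nu> (snd z) / r * (norm (fst z) + norm (snd z))"
        using \<alpha>0 r0 by (intro mult_left_mono dn) auto
      have "g z * ?d = (\<Sum>c\<in>I. k c * (\<phi> c (fst z) * \<phi> c (snd z))) * ?d + \<alpha> \<mu> (fst z) * \<alpha> \<nu> (snd z) / r * ?d"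
        by (simp add: g_def distrib_right)
      also have "\<dots> \<le> ((\<Sum>c\<in>I - {c0}. \<epsilon> * k c * (\<phi> c (fst z) * \<phi> c (snd z)))
        + k c0 * (\<phi> c0 (fst z) * \<phi> c0 (snd z)) * (norm (fst z) + norm (snd z))) + \<alpha> \<mu> (fst z) * \<alpha> \<nu> (snd z) / r * (norm (fst z) + norm (snd z))"
        by (rule add_mono[OF 1 2])
      also have "\<dots> = G z"
        by (simp add: G_def distrib_left mult_ac add_divide_distrib[symmetric])
      finally show ?thesis .
    qed
    have hG: "has_bochner_integral ?P G ((\<Sum>c\<in>I - {c0}. \<epsilon> * k c * (A \<mu> c * A \<nu> c)) + k c0 * (N \<mu> c0 * A \<nu> c0 + A \<mu> c0 * N \<nu> c0)
      + ((\<integral>x. norm x * \<alpha> \<mu> x \<partial>\<mu>) * (\<integral>x. \<alpha> \<nu> x \<partial>\<nu>) / r + (\<integral>x. \<alpha> \<mu> x \<partial>\<mu>) * (\<integral>x. norm x * \<alpha> \<nu> x \<partial>\<nu>) / r))"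
      unfolding G_def A_def N_def
      using int_\<phi>[of \<mu> _ "\<lambda>_. 1"] int_\<phi>[of \<nu> _ "\<lambda>_. 1"] int_\<phi>[of \<mu> _ norm] int_\<phi>[of \<nu> _ norm]
        int_\<alpha>[of \<mu> "\<lambda>_. 1"] int_\<alpha>[of \<nu> "\<lambda>_. 1"] int_\<alpha>[of \<mu> norm] int_\<alpha>[of \<nu> norm] \<kappa>(3) I
      by (intro has_bochner_integral_add has_bochner_integral_sum has_bochner_integral_mult_right
          has_bochner_integral_divide pt) (auto simp: has_bochner_integral_iff)
    \<comment> \<open>In the small cells the norm is at most \<rho>. The far cell keeps the share 1
      - w / A of its first moment; the transported part has the share w / A, so together they give
      \<open>N \<kappa> c0\<close>.\<close>
    have far: "(\<integral>x. norm x * \<alpha> \<kappa> x \<partial>\<kappa>) \<le> (1 - w c0 / A \<kappa> c0) * N \<kappa> c0 + \<rho> * (\<Sum>c\<in>I - {c0}. A \<kappa> c - w c)"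
      if k: "\<kappa> \<in> {\<mu>, \<nu>}" for \<kappa>
    proof -
      have "(1 - w c / A \<kappa> c) * N \<kappa> c \<le> \<rho> * (A \<kappa> c - w c)" if c: "c \<in> I - {c0}" for c
      proof -
        have c': "c \<in> I" using c by simp
        have "norm x * \<phi> c x \<le> \<rho> * \<phi> c x" for x
          using \<rho>(2)[OF c, of x] nonneg[OF c', of x] by (cases "\<phi> c x = 0") (auto intro: mult_right_mono)
        then have "N \<kappa> c \<le> (\<integral>x. \<rho> * \<phi> c x \<partial>\<kappa>)"
          unfolding N_def using int_\<phi>[OF k c' \<kappa>(3)[OF k]] int_\<phi>[OF k c' int1(1)[OF k]] by (intro integral_mono) auto
        then have "(1 - w c / A \<kappa> c) * N \<kappa> c \<le> (1 - w c / A \<kappa> c) * (\<rho> * A \<kappa> c)"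
          using wA(2)[OF k c'] by (intro mult_left_mono) (simp_all add: A_def)
        also have "\<dots> = \<rho> * (A \<kappa> c - w c)"
          using wA(3)[OF k c'] by (simp add: left_diff_distrib right_diff_distrib mult.left_commute)
        finally show ?thesis .
      qed
      then have "(\<Sum>c\<in>I - {c0}. (1 - w c / A \<kappa> c) * N \<kappa> c) \<le> (\<Sum>c\<in>I - {c0}. \<rho> * (A \<kappa> c - w c))" by (rule sum_mono)
      then show ?thesis
        unfolding int_\<alpha>_eq[OF k \<kappa>(3)[OF k]] N_def[symmetric] using I by (simp add: sum.remove[of I c0] sum_distrib_left)
    qed
    have "(\<Sum>c\<in>I - {c0}. \<epsilon> * k c * (A \<mu> c * A \<nu> c)) \<le> \<epsilon>"
    proof -
      have "\<epsilon> * k c * (A \<mu> c * A \<nu> c) \<le> \<epsilon> * A \<mu> c" if "c \<in> I" for c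
      proof -
        have "k c * (A \<mu> c * A \<nu> c) = w c" using kk(1)[OF that] wA(3)[of \<mu>, OF _ that] by (metis insertI1 mult.assoc mult.commute)
        then show ?thesis using w0(2)[OF that] \<epsilon>(1) by (simp add: mult.assoc mult_left_mono)
      qed
      then have "(\<Sum>c\<in>I - {c0}. \<epsilon> * k c * (A \<mu> c * A \<nu> c)) \<le> (\<Sum>c\<in>I - {c0}. \<epsilon> * A \<mu> c)"
        by (intro sum_mono) auto
      also have "\<dots> \<le> (\<Sum>c\<in>I. \<epsilon> * A \<mu> c)" using I A0 \<epsilon>(1) by (intro sum_mono2) auto
      also have "\<dots> = \<epsilon>" using sumA[of \<mu>] by (simp flip: sum_distrib_left)
      finally show ?thesis .
    qed
    moreover have "k c0 * (N \<mu> c0 * A \<nu> c0 + A \<mu> c0 * N \<nu> c0) = w c0 / A \<mu> c0 * N \<mu> c0 + w c0 / A \<nu> c0 * N \<nu> c0"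
    proof -
      have "k c0 * (N \<mu> c0 * A \<nu> c0 + A \<mu> c0 * N \<nu> c0) = (k c0 * A \<nu> c0) * N \<mu> c0 + (k c0 * A \<mu> c0) * N \<nu> c0"
        by (simp add: algebra_simps)
      then show ?thesis by (simp only: kk(1,2)[OF I(2)])
    qed
    moreover have "(\<integral>x. norm x * \<alpha> \<mu> x \<partial>\<mu>) * (\<integral>x. \<alpha> \<nu> x \<partial>\<nu>) / r = (\<integral>x. norm x * \<alpha> \<mu> x \<partial>\<mu>)"
      "(\<integral>x. \<alpha> \<mu> x \<partial>\<mu>) * (\<integral>x. norm x * \<alpha> \<nu> x \<partial>\<nu>) / r = (\<integral>x. norm x * \<alpha> \<nu> x \<partial>\<nu>)"
      using r_zero[of \<mu> norm] r_zero[of \<nu> norm] by (simp_all add: \<alpha>r mult.commute)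
    \<comment> \<open>Since \<open>w c\<close> is the minimum, one of the two deficits in a cell is
      0 and the other is the absolute difference of the masses.\<close>
    moreover have "(\<Sum>c\<in>I - {c0}. A \<mu> c - w c) + (\<Sum>c\<in>I - {c0}. A \<nu> c - w c) = (\<Sum>c\<in>I - {c0}. \<bar>A \<mu> c - A \<nu> c\<bar>)"
      unfolding sum.distrib[symmetric] by (intro sum.cong refl) (auto simp: w_def min_def)
    then have "\<rho> * (\<Sum>c\<in>I - {c0}. A \<mu> c - w c) + \<rho> * (\<Sum>c\<in>I - {c0}. A \<nu> c - w c) = \<rho> * (\<Sum>c\<in>I - {c0}. \<bar>A \<mu> c - A \<nu> c\<bar>)"
      by (metis distrib_left)
    ultimately have V: "integral\<^sup>L ?P G \<le> \<epsilon> + \<rho> * (\<Sum>c\<in>I - {c0}. \<bar>A \<mu> c - A \<nu> c\<bar>) + N \<mu> c0 + N \<nu> c0"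
      unfolding has_bochner_integral_integral_eq[OF hG] using far[of \<mu>] far[of \<nu>] by (simp add: left_diff_distrib)
    have "(\<integral>\<^sup>+ z. ennreal (dist (fst z) (snd z)) \<partial>\<pi>) = (\<integral>\<^sup>+ z. ennreal (g z) * ennreal (dist (fst z) (snd z)) \<partial>?P)"
      unfolding \<pi>_def by (subst nn_integral_density) auto
    also have "\<dots> \<le> (\<integral>\<^sup>+ z. ennreal (G z) \<partial>?P)"
      using dG g0 by (intro nn_integral_mono) (simp add: ennreal_mult[symmetric] ennreal_leI)
    also have "\<dots> = ennreal (integral\<^sup>L ?P G)"
    proof (rule nn_integral_eq_integral)
      show "integrable ?P G" using hG by (simp add: has_bochner_integral_iff)
      show "AE z in ?P. 0 \<le> G z" using dG g0 by (intro AE_I2) (meson mult_nonneg_nonneg order_trans zero_le_dist)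
    qed
    also have "\<dots> \<le> ennreal (\<epsilon> + \<rho> * (\<Sum>c\<in>I - {c0}. \<bar>A \<mu> c - A \<nu> c\<bar>) + N \<mu> c0 + N \<nu> c0)"
      by (rule ennreal_leI[OF V])
    finally show ?thesis .
  qed
  ultimately show ?thesis unfolding A_def N_def by blast
qed

section \<open>Lipschitz partitions of unity into small cells\<close>

primrec partial_max :: "(nat \<Rightarrow> 'b \<Rightarrow> real) \<Rightarrow> nat \<Rightarrow> 'b \<Rightarrow> real" where
  "partial_max \<theta> 0 x = 0"
| "partial_max \<theta> (Suc i) x = max (partial_max \<theta> i x) (\<theta> i x)"

lemma partial_max_lipschitz:
  assumes "\<And>i x y. \<bar>\<theta> i x - \<theta> i y\<bar> \<le> B * dist x y" "0 \<le> B"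
  shows "\<bar>partial_max \<theta> i x - partial_max \<theta> i y\<bar> \<le> B * dist x y"
proof (induction i)
  case (Suc i)
  then show ?case using assms(1)[of i x y] by (auto simp: max_def)
qed (use assms in simp)

lemma partial_max_ge: "i < K \<Longrightarrow> \<theta> i x \<le> partial_max \<theta> K x"
  by (induction K) (auto simp: less_Suc_eq max_def)

lemma partial_max_bounds:
  assumes "\<And>i. \<theta> i x \<le> 1"
  shows "0 \<le> partial_max \<theta> K x" "partial_max \<theta> K x \<le> 1"
  using assms by (induction K) (auto simp: le_max_iff_disj)

text \<open>Cell 0 lives outside the ball of radius \<open>R\<close>, the cells 1 to
  \<open>K\<close> are small. They are Lipschitz functions instead of indicators because identities
  between expectations pass from the Euler scheme to the limit processes for Lipschitz functions
  only.\<close>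

locale partition_of_unity =
  fixes R \<epsilon> :: real and K :: nat and \<phi> :: "nat \<Rightarrow> 'b::euclidean_space \<Rightarrow> real" and B :: real
  assumes R: "R > 0" and \<epsilon>: "\<epsilon> > 0" and B: "0 \<le> B"
    and \<phi>_lip: "\<And>c x y. \<bar>\<phi> c x - \<phi> c y\<bar> \<le> B * norm (x - y)"
    and \<phi>_nonneg: "\<And>c x. 0 \<le> \<phi> c x"
    and \<phi>_sum: "\<And>x. (\<Sum>c\<in>{..K}. \<phi> c x) = 1"
    and \<phi>_diam: "\<And>c x y. c \<in> {..K} - {0} \<Longrightarrow> \<phi> c x > 0 \<Longrightarrow> \<phi> c y > 0 \<Longrightarrow> dist x y \<le> \<epsilon>"
    and \<phi>_supp: "\<And>c x. c \<in> {..K} - {0} \<Longrightarrow> \<phi> c x > 0 \<Longrightarrow> norm x \<le> R + \<epsilon>"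
    and \<phi>_far: "\<And>x. \<phi> 0 x > 0 \<Longrightarrow> norm x > R"
begin

lemma \<phi>_meas [measurable]: "\<phi> c \<in> borel_measurable borel"
  by (rule borel_measurable_lipschitz(2)[of _ B]) (simp add: \<phi>_lip)

lemma \<phi>_le_1: "c \<in> {..K} \<Longrightarrow> \<phi> c x \<le> 1"
  using member_le_sum[of c "{..K}" "\<lambda>c. \<phi> c x"] \<phi>_nonneg by (simp add: \<phi>_sum)

end

text \<open>Bumps around finitely many centres covering the ball become a partition of unity by
  taking the increments of their running maximum. These telescope, and each is Lipschitz with twice
  the constant of the bumps; no division by a sum occurs.\<close>

lemma exists_partition_of_unity:
  fixes \<epsilon> R :: real
  assumes "\<epsilon> > 0" "R > 0"
  shows "\<exists>K (\<phi> :: nat \<Rightarrow> 'b::euclidean_space \<Rightarrow> real) B. partition_of_unity R \<epsilon> K \<phi> B"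
proof -
  \<comment> \<open>A bump is supported within 2 \<delta> of its centre, so a cell has diameter at
    most 4 \<delta>.\<close>
  define \<delta> where "\<delta> = \<epsilon> / 4"
  have \<delta>: "\<delta> > 0" using assms by (simp add: \<delta>_def)
  define bump :: "'b \<Rightarrow> 'b \<Rightarrow> real" where "bump z x = max 0 (min 1 (2 - dist x z / \<delta>))" for z x
  obtain C' where C': "C' \<subseteq> cball (0::'b) R" "finite C'" "cball 0 R \<subseteq> (\<Union>z\<in>C'. ball z \<delta>)"
    by (rule compactE_image[OF compact_cball, of "cball (0::'b) R" "\<lambda>z. ball z \<delta>" 0 R]) (use \<delta> in auto)
  obtain zs where zs: "set zs = C'" using finite_list[OF C'(2)] by blast
  define K where "K = length zs"
  \<comment> \<open>Past \<open>K\<close> the running maximum stays constant, so the functions with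
    index above \<open>K\<close> vanish and the axioms quantified over all indices hold for them
    too.\<close>
  define \<theta> where "\<theta> i x = (if i < K then bump (zs ! i) x else 0)" for i x
  define \<psi> where "\<psi> = partial_max \<theta>"
  define \<phi> where "\<phi> c x = (case c of 0 \<Rightarrow> 1 - \<psi> K x | Suc i \<Rightarrow> \<psi> (Suc i) x - \<psi> i x)" for c x
  have bump_lip: "\<bar>bump z x - bump z y\<bar> \<le> (1 / \<delta>) * dist x y" for z x y
  proof -
    have "\<bar>dist x z / \<delta> - dist y z / \<delta>\<bar> \<le> dist x y / \<delta>"
      using \<delta> dist_triangle[of x z y] dist_triangle[of y z x]
      by (simp add: diff_divide_distrib[symmetric] abs_divide divide_right_mono dist_commute abs_le_iff)
    then show ?thesis unfolding bump_def by (simp add: max_def min_def abs_le_iff)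
  qed
  have bump_supp: "dist x z \<le> 2 * \<delta>" if "bump z x > 0" for z x
    using that \<delta> by (auto simp: bump_def max_def min_def field_simps split: if_splits)
  have bump_one: "bump z x = 1" if "dist x z \<le> \<delta>" for z x
    using that \<delta> by (auto simp: bump_def max_def min_def field_simps split: if_splits)
  have \<theta>_lip: "\<bar>\<theta> i x - \<theta> i y\<bar> \<le> (1 / \<delta>) * dist x y" for i x y
    using bump_lip \<delta> by (simp add: \<theta>_def)
  have \<theta>_1: "\<theta> i x \<le> 1" for i x by (simp add: \<theta>_def bump_def)
  have \<psi>_lip: "\<bar>\<psi> i x - \<psi> i y\<bar> \<le> (1 / \<delta>) * dist x y" for i x y
    unfolding \<psi>_def using \<theta>_lip \<delta> by (intro partial_max_lipschitz) auto
  \<comment> \<open>The running maximum is nonnegative and grows only where the next bump exceeds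
    it, so a positive increment forces that bump to be positive.\<close>
  have supp: "dist x (zs ! (c - 1)) \<le> 2 * \<delta> \<and> c - 1 < K" if "c \<noteq> 0" "\<phi> c x > 0" for c x
  proof -
    obtain i where i: "c = Suc i" using \<open>c \<noteq> 0\<close> by (cases c) auto
    have "0 \<le> \<psi> i x" using partial_max_bounds(1)[of \<theta>] \<theta>_1 by (simp add: \<psi>_def)
    then have "\<theta> i x > 0" using that(2) by (auto simp: \<phi>_def i \<psi>_def max_def split: if_splits)
    then show ?thesis using bump_supp i by (auto simp: \<theta>_def split: if_splits)
  qed
  have tel: "(\<Sum>c\<in>{..n}. \<phi> c x) = 1 - \<psi> K x + \<psi> n x" for n x
    by (induction n) (auto simp: \<phi>_def \<psi>_def)
  have "partition_of_unity R \<epsilon> K \<phi> (2 * (1 / \<delta>))"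
  proof
    show "R > 0" "\<epsilon> > 0" by fact+
    show "0 \<le> 2 * (1 / \<delta>)" using \<delta> by simp
    show "\<bar>\<phi> c x - \<phi> c y\<bar> \<le> 2 * (1 / \<delta>) * norm (x - y)" for c x y
      using \<psi>_lip[of K x y] \<psi>_lip[of c x y] \<psi>_lip[of "c - 1" x y]
      by (cases c) (auto simp: \<phi>_def dist_norm abs_le_iff)
    show "0 \<le> \<phi> c x" for c x
      using partial_max_bounds(2)[of \<theta> x K] \<theta>_1 by (cases c) (auto simp: \<phi>_def \<psi>_def)
    show "(\<Sum>c\<in>{..K}. \<phi> c x) = 1" for x by (simp add: tel)
    show "dist x y \<le> \<epsilon>" if "c \<in> {..K} - {0}" "\<phi> c x > 0" "\<phi> c y > 0" for c x y
      using supp[of c x] supp[of c y] that dist_triangle2[of x y "zs ! (c - 1)"] by (simp add: \<delta>_def)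
    show "norm x \<le> R + \<epsilon>" if "c \<in> {..K} - {0}" "\<phi> c x > 0" for c x
    proof -
      have d: "dist x (zs ! (c - 1)) \<le> 2 * \<delta>" "c - 1 < K" using supp that by auto
      then have "zs ! (c - 1) \<in> cball 0 R" using C'(1) zs nth_mem[of "c - 1" zs] by (auto simp only: K_def)
      then show ?thesis using d(1) \<delta> norm_triangle_sub[of x "zs ! (c - 1)"]
        by (simp add: dist_norm \<delta>_def)
    qed
    \<comment> \<open>A point of the ball lies within \<delta> of some centre, where the bump equals
      1. The full maximum is then 1 and nothing is left for cell 0.\<close>
    show "norm x > R" if "\<phi> 0 x > 0" for x
    proof (rule ccontr)
      assume "\<not> norm x > R"
      then have "x \<in> cball 0 R" by simp
      then have "x \<in> (\<Union>z\<in>C'. ball z \<delta>)" using C'(3) by blast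
      then obtain i where i: "i < K" "dist x (zs ! i) \<le> \<delta>"
        by (auto simp: zs[symmetric] in_set_conv_nth K_def dist_commute intro: less_imp_le)
      then have "1 \<le> \<psi> K x" using bump_one partial_max_ge[of i K \<theta> x] by (simp add: \<psi>_def \<theta>_def)
      then show False using that by (simp add: \<phi>_def)
    qed
  qed
  then show ?thesis by blast
qed

section \<open>Brownian increments\<close>

lemma normal_density_second_moment:
  assumes "\<sigma> > 0"
  shows "(\<integral>\<^sup>+ y. ennreal (normal_density 0 \<sigma> y) * ennreal (y\<^sup>2) \<partial>lborel) = ennreal (\<sigma>\<^sup>2)"
proof -
  have "(\<integral>\<^sup>+ y. ennreal (normal_density 0 \<sigma> y) * ennreal (y\<^sup>2) \<partial>lborel)
    = (\<integral>\<^sup>+ y. ennreal (normal_density 0 \<sigma> y * (y - 0) ^ (2 * 1)) \<partial>lborel)"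
    by (simp add: ennreal_mult)
  also have "\<dots> = ennreal (fact (2 * 1) / ((2 / \<sigma>\<^sup>2) ^ 1 * fact 1))"
    using normal_moment_even[OF assms, of 0 1]
    by (subst nn_integral_eq_integral) (auto simp: has_bochner_integral_iff)
  finally show ?thesis by simp
qed

lemma gaussian_second_moment:
  assumes "\<sigma> > 0"
  shows "(\<integral>\<^sup>+ x. ennreal (\<Prod>k\<in>UNIV. normal_density 0 \<sigma> (x $ k)) * ennreal ((norm x)\<^sup>2) \<partial>(lborel :: (real^'d) measure))
     = ennreal (real CARD('d) * \<sigma>\<^sup>2)"
proof -
  have B: "(Basis :: (real^'d) set) = (\<lambda>k. axis k 1) ` UNIV" by (auto simp: Basis_vec_def)
  have inj: "inj (\<lambda>k. axis k (1::real) :: real^'d)" by (auto simp: inj_on_def axis_eq_axis)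
  have one: "(\<integral>\<^sup>+ y. ennreal (normal_density 0 \<sigma> y) \<partial>lborel) = 1"
    using prob_space.emeasure_space_1[OF prob_space_normal_density[OF assms, of 0]]
    by (simp add: emeasure_density)
  have comp: "(\<integral>\<^sup>+ x. ennreal (\<Prod>k\<in>UNIV. normal_density 0 \<sigma> (x $ k)) * ennreal ((x $ j)\<^sup>2) \<partial>(lborel :: (real^'d) measure)) = ennreal (\<sigma>\<^sup>2)"
    for j :: 'd
  proof -
    \<comment> \<open>The square is attached to coordinate \<open>j\<close> only, which makes the
      integrand a product over the basis, so that Lebesgue measure factorises.\<close>
    define h where "h b y = ennreal (normal_density 0 \<sigma> y) * (if b = (axis j 1 :: real^'d) then ennreal (y\<^sup>2) else 1)" for b y
    have "ennreal (\<Prod>k\<in>UNIV. normal_density 0 \<sigma> (x $ k)) * ennreal ((x $ j)\<^sup>2) = (\<Prod>b\<in>Basis. h b (x \<bullet> b))" for x :: "real^'d"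
    proof -
      have "(\<Prod>b\<in>Basis. h b (x \<bullet> b)) = (\<Prod>k\<in>UNIV. ennreal (normal_density 0 \<sigma> (x $ k)) * (if k = j then ennreal ((x $ k)\<^sup>2) else 1))"
        unfolding B using inj by (subst prod.reindex) (auto simp: h_def inner_axis axis_eq_axis intro!: prod.cong)
      also have "\<dots> = (\<Prod>k\<in>UNIV. ennreal (normal_density 0 \<sigma> (x $ k))) * ennreal ((x $ j)\<^sup>2)"
        by (simp add: prod.distrib)
      finally show ?thesis by (simp add: prod_ennreal)
    qed
    note * = this
    have [measurable]: "h b \<in> borel_measurable borel" for b
      by (cases "b = axis j 1") (simp_all add: h_def[abs_def])
    have "(\<integral>\<^sup>+ x. ennreal (\<Prod>k\<in>UNIV. normal_density 0 \<sigma> (x $ k)) * ennreal ((x $ j)\<^sup>2) \<partial>(lborel :: (real^'d) measure))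
      = (\<Prod>b\<in>Basis. (\<integral>\<^sup>+ y. h b y \<partial>lborel))"
      unfolding * by (rule nn_integral_lborel_prod) auto
    also have "\<dots> = (\<Prod>k\<in>(UNIV::'d set). if k = j then ennreal (\<sigma>\<^sup>2) else 1)"
    proof -
      have "(\<integral>\<^sup>+ y. h (axis k 1) y \<partial>lborel) = (if k = j then ennreal (\<sigma>\<^sup>2) else 1)" for k
        using normal_density_second_moment[OF assms] one by (simp add: h_def axis_eq_axis)
      then show ?thesis unfolding B by (subst prod.reindex[OF inj]) simp
    qed
    finally show ?thesis by simp
  qed
  have "(norm x)\<^sup>2 = (\<Sum>j\<in>UNIV. (x $ j)\<^sup>2)" for x :: "real^'d"
    unfolding power2_norm_eq_inner by (simp add: inner_vec_def power2_eq_square)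
  then have "ennreal ((norm x)\<^sup>2) = (\<Sum>j\<in>UNIV. ennreal ((x $ j)\<^sup>2))" for x :: "real^'d"
    by (simp add: sum_ennreal)
  then have "(\<integral>\<^sup>+ x. ennreal (\<Prod>k\<in>UNIV. normal_density 0 \<sigma> (x $ k)) * ennreal ((norm x)\<^sup>2) \<partial>(lborel :: (real^'d) measure))
    = (\<Sum>j\<in>(UNIV::'d set). ennreal (\<sigma>\<^sup>2))"
    by (simp add: sum_distrib_left nn_integral_sum comp del: sum_ennreal)
  also have "\<dots> = ennreal (real CARD('d) * \<sigma>\<^sup>2)"
    by (simp add: ennreal_mult ennreal_of_nat_eq_real_of_nat)
  finally show ?thesis .
qed

lemma brownian_motion_measurable:
  assumes "brownian_motion M F T W" "filtration_upto M T F" "t \<in> {0..T}"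
  shows "(\<lambda>\<omega>. W \<omega> t) \<in> borel_measurable M"
  using assms unfolding brownian_motion_def filtration_upto_def
  by (meson measurable_from_subalg)

lemma brownian_increment_second_moment:
  fixes W :: "'a \<Rightarrow> real \<Rightarrow> real^'d"
  assumes W: "brownian_motion M F T W" and F: "filtration_upto M T F" and st: "0 \<le> s" "s \<le> t" "t \<le> T"
  shows "integrable M (\<lambda>\<omega>. (norm (W \<omega> t - W \<omega> s))\<^sup>2)"
    and "(\<integral>\<omega>. (norm (W \<omega> t - W \<omega> s))\<^sup>2 \<partial>M) = real CARD('d) * (t - s)"
proof -
  have [measurable]: "(\<lambda>\<omega>. W \<omega> t) \<in> borel_measurable M" "(\<lambda>\<omega>. W \<omega> s) \<in> borel_measurable M"
    using brownian_motion_measurable[OF W F] st by auto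
  have nn: "(\<integral>\<^sup>+\<omega>. ennreal ((norm (W \<omega> t - W \<omega> s))\<^sup>2) \<partial>M) = ennreal (real CARD('d) * (t - s))"
  \<comment> \<open>\<open>brownian_motion\<close> provides a density only for s < t; for s = t the
    increment is 0.\<close>
  proof (cases "s = t")
    case False
    then have "distributed M lborel (\<lambda>\<omega>. W \<omega> t - W \<omega> s)
          (\<lambda>x. ennreal (\<Prod>k\<in>UNIV. normal_density 0 (sqrt (t - s)) (x $ k)))"
      using W st unfolding brownian_motion_def by auto
    from distributed_nn_integral[OF this, of "\<lambda>x. ennreal ((norm x)\<^sup>2)"]
    show ?thesis using gaussian_second_moment[of "sqrt (t - s)", where 'd='d] False st by simp
  qed simp
  show i: "integrable M (\<lambda>\<omega>. (norm (W \<omega> t - W \<omega> s))\<^sup>2)"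
    by (rule integrableI_bounded) (auto simp: nn)
  show "(\<integral>\<omega>. (norm (W \<omega> t - W \<omega> s))\<^sup>2 \<partial>M) = real CARD('d) * (t - s)"
    using st by (intro integral_eq_nn_integral[THEN trans]) (auto simp: nn)
qed

lemma (in prob_space) square_expectation_le:
  fixes X :: "'a \<Rightarrow> real"
  assumes "integrable M X" "integrable M (\<lambda>\<omega>. (X \<omega>)\<^sup>2)"
  shows "(expectation X)\<^sup>2 \<le> expectation (\<lambda>\<omega>. (X \<omega>)\<^sup>2)"
  using variance_eq[OF assms] variance_positive[of X] by simp

lemma (in prob_space) integrable_of_square:
  fixes X :: "'a \<Rightarrow> real"
  assumes "X \<in> borel_measurable M" "integrable M (\<lambda>\<omega>. (X \<omega>)\<^sup>2)"
  shows "integrable M X"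
proof (rule Bochner_Integration.integrable_bound[where f="\<lambda>\<omega>. 1 + (X \<omega>)\<^sup>2"])
  have "\<bar>x\<bar> \<le> 1 + x\<^sup>2" for x :: real
    using zero_le_power2[of "\<bar>x\<bar> - 1"] zero_le_power2[of x] by (simp add: power2_diff) 
  then show "AE \<omega> in M. norm (X \<omega>) \<le> norm (1 + (X \<omega>)\<^sup>2)" by simp
qed (use assms in auto)

lemma brownian_increment_first_moment:
  fixes W :: "'a \<Rightarrow> real \<Rightarrow> real^'d"
  assumes "prob_space M" and W: "brownian_motion M F T W" and F: "filtration_upto M T F" and st: "0 \<le> s" "s \<le> t" "t \<le> T"
  shows "integrable M (\<lambda>\<omega>. norm (W \<omega> t - W \<omega> s))"
    and "(\<integral>\<omega>. norm (W \<omega> t - W \<omega> s) \<partial>M) \<le> sqrt (real CARD('d) * (t - s))"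
proof -
  interpret prob_space M by fact
  note sm = brownian_increment_second_moment[OF W F st]
  have [measurable]: "(\<lambda>\<omega>. W \<omega> t) \<in> borel_measurable M" "(\<lambda>\<omega>. W \<omega> s) \<in> borel_measurable M"
    using brownian_motion_measurable[OF W F] st by auto
  show i: "integrable M (\<lambda>\<omega>. norm (W \<omega> t - W \<omega> s))"
    using sm(1) by (rule integrable_of_square[rotated]) simp
  show "(\<integral>\<omega>. norm (W \<omega> t - W \<omega> s) \<partial>M) \<le> sqrt (real CARD('d) * (t - s))"
    using square_expectation_le[OF i sm(1)] sm(2) by (intro real_le_rsqrt) simp
qed

text \<open>Turns independence of a \<sigma>-algebra into a product law, the form needed for Fubini
  and for the induction over time steps. Rectangles determine the product measure.\<close>

lemma (in prob_space) distr_pair_of_indep_set: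
  assumes G: "subalgebra M G" and X: "X \<in> G \<rightarrow>\<^sub>M S" and D: "D \<in> M \<rightarrow>\<^sub>M N"
    and ind: "indep_set (sets G) {D -` B \<inter> space M | B. B \<in> sets N}"
  shows "distr M (S \<Otimes>\<^sub>M N) (\<lambda>\<omega>. (X \<omega>, D \<omega>)) = distr M S X \<Otimes>\<^sub>M distr M N D"
proof (rule pair_measure_eqI[symmetric])
  have [measurable]: "X \<in> M \<rightarrow>\<^sub>M S" "D \<in> M \<rightarrow>\<^sub>M N"
    using measurable_from_subalg[OF G X] D by auto
  interpret X: prob_space "distr M S X" by (rule prob_space_distr) simp
  interpret D: prob_space "distr M N D" by (rule prob_space_distr) simp
  show "sigma_finite_measure (distr M S X)" "sigma_finite_measure (distr M N D)" ..
  show "sets (distr M S X \<Otimes>\<^sub>M distr M N D) = sets (distr M (S \<Otimes>\<^sub>M N) (\<lambda>\<omega>. (X \<omega>, D \<omega>)))"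
    by (simp cong: sets_pair_measure_cong)
  fix A B assume "A \<in> sets (distr M S X)" "B \<in> sets (distr M N D)"
  then have AB: "A \<in> sets S" "B \<in> sets N" by auto
  have "X -` A \<inter> space M \<in> sets G"
    using measurable_sets[OF X AB(1)] G by (simp add: subalgebra_def)
  then have p: "prob ((X -` A \<inter> space M) \<inter> (D -` B \<inter> space M)) = prob (X -` A \<inter> space M) * prob (D -` B \<inter> space M)"
    using AB by (intro indep_setD[OF ind]) auto
  have e: "(\<lambda>\<omega>. (X \<omega>, D \<omega>)) -` (A \<times> B) \<inter> space M = (X -` A \<inter> space M) \<inter> (D -` B \<inter> space M)" by auto
  have "emeasure (distr M (S \<Otimes>\<^sub>M N) (\<lambda>\<omega>. (X \<omega>, D \<omega>))) (A \<times> B)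
      = emeasure M ((X -` A \<inter> space M) \<inter> (D -` B \<inter> space M))"
    using AB by (subst emeasure_distr) (auto simp only: e, measurable)
  also have "\<dots> = ennreal (prob (X -` A \<inter> space M) * prob (D -` B \<inter> space M))"
    by (simp only: emeasure_eq_measure p)
  also have "\<dots> = emeasure (distr M S X) A * emeasure (distr M N D) B"
    using AB by (simp add: emeasure_distr emeasure_eq_measure ennreal_mult)
  finally show "emeasure (distr M S X) A * emeasure (distr M N D) B =
      emeasure (distr M (S \<Otimes>\<^sub>M N) (\<lambda>\<omega>. (X \<omega>, D \<omega>))) (A \<times> B)" by (rule sym)
qed

text \<open>The freezing lemma: the independent component is averaged while the other one is held
  fixed. It takes the place of conditional expectations.\<close>

lemma (in prob_space) expectation_freeze:
  fixes h :: "'b \<times> 'c \<Rightarrow> real"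
  assumes eq: "distr M (S \<Otimes>\<^sub>M N) (\<lambda>\<omega>. (X \<omega>, D \<omega>)) = distr M S X \<Otimes>\<^sub>M distr M N D"
    and [measurable]: "X \<in> M \<rightarrow>\<^sub>M S" "D \<in> M \<rightarrow>\<^sub>M N"
    and h[measurable]: "h \<in> borel_measurable (S \<Otimes>\<^sub>M N)" and bd: "\<And>z. z \<in> space (S \<Otimes>\<^sub>M N) \<Longrightarrow> \<bar>h z\<bar> \<le> B"
  shows "(\<integral>\<omega>. h (X \<omega>, D \<omega>) \<partial>M) = (\<integral>\<omega>. (\<integral>\<omega>'. h (X \<omega>, D \<omega>') \<partial>M) \<partial>M)"
proof -
  interpret X: prob_space "distr M S X" by (rule prob_space_distr) simp
  interpret D: prob_space "distr M N D" by (rule prob_space_distr) simp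
  interpret XD: pair_prob_space "distr M S X" "distr M N D" ..
  have "(\<integral>\<omega>. h (X \<omega>, D \<omega>) \<partial>M) = integral\<^sup>L (distr M (S \<Otimes>\<^sub>M N) (\<lambda>x. (X x, D x))) h"
    by (subst integral_distr) auto
  also have "\<dots> = integral\<^sup>L (distr M S X \<Otimes>\<^sub>M distr M N D) h" by (simp add: eq)
  also have "\<dots> = (\<integral>x. (\<integral>y. h (x, y) \<partial>distr M N D) \<partial>distr M S X)"
    using bd by (intro XD.integral_fst'[symmetric] XD.P.integrable_const_bound[where B=B] AE_I2)
      (auto simp: space_pair_measure)
  also have "\<dots> = (\<integral>x. (\<integral>\<omega>'. h (x, D \<omega>') \<partial>M) \<partial>distr M S X)"
    by (intro Bochner_Integration.integral_cong refl integral_distr) auto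
  also have "\<dots> = (\<integral>\<omega>. (\<integral>\<omega>'. h (X \<omega>, D \<omega>') \<partial>M) \<partial>M)"
    by (subst integral_distr) auto
  finally show ?thesis .
qed

section \<open>Joint independence of two Brownian increments from the past\<close>

locale brownian_family = prob_space M for M :: "'a measure" +
  fixes F :: "real \<Rightarrow> 'a measure" and T :: real and W :: "nat \<Rightarrow> 'a \<Rightarrow> real \<Rightarrow> real^'d"
  assumes filt: "filtration_upto M T F"
    and bm: "\<And>n. n \<ge> 1 \<Longrightarrow> brownian_motion M F T (W n)"
    and indW: "indep_processes M T W"
begin

lemma subalg: "t \<in> {0..T} \<Longrightarrow> subalgebra M (F t)"
  and subalg_mono: "0 \<le> s \<Longrightarrow> s \<le> t \<Longrightarrow> t \<le> T \<Longrightarrow> subalgebra (F t) (F s)"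
  using filt by (auto simp: filtration_upto_def)

lemma measurable_F_mono: "f \<in> F s \<rightarrow>\<^sub>M N \<Longrightarrow> 0 \<le> s \<Longrightarrow> s \<le> t \<Longrightarrow> t \<le> T \<Longrightarrow> f \<in> F t \<rightarrow>\<^sub>M N"
  using measurable_from_subalg[OF subalg_mono] .

lemma W_adapted: "n \<ge> 1 \<Longrightarrow> 0 \<le> s \<Longrightarrow> s \<le> t \<Longrightarrow> t \<le> T \<Longrightarrow> (\<lambda>\<omega>. W n \<omega> s) \<in> borel_measurable (F t)"
  using bm[of n] by (rule_tac measurable_F_mono[of _ s]) (auto simp: brownian_motion_def)

lemma W_meas: "n \<ge> 1 \<Longrightarrow> t \<in> {0..T} \<Longrightarrow> (\<lambda>\<omega>. W n \<omega> t) \<in> borel_measurable M"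
  using brownian_motion_measurable[OF bm filt] .

lemma distr_past_increment:
  assumes "n \<ge> 1" "0 \<le> s" "s < t" "t \<le> T" "X \<in> F s \<rightarrow>\<^sub>M S"
  shows "distr M (S \<Otimes>\<^sub>M borel) (\<lambda>\<omega>. (X \<omega>, W n \<omega> t - W n \<omega> s)) =
    distr M S X \<Otimes>\<^sub>M distr M borel (\<lambda>\<omega>. W n \<omega> t - W n \<omega> s)"
  using assms bm[of n] W_meas[of n] unfolding brownian_motion_def
  by (intro distr_pair_of_indep_set[OF subalg]) auto

lemma integrable_bdd: "f \<in> borel_measurable M \<Longrightarrow> (\<And>\<omega>. \<bar>f \<omega>\<bar> \<le> B) \<Longrightarrow> integrable M (f :: _ \<Rightarrow> real)"
  by (rule integrable_const_bound[where B=B]) auto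

lemma abs_expectation_le:
  fixes X :: "'a \<Rightarrow> real"
  assumes "\<And>\<omega>. \<bar>X \<omega>\<bar> \<le> c"
  shows "\<bar>expectation X\<bar> \<le> c"
proof -
  have "0 \<le> c" using assms by (meson abs_ge_zero order_trans)
  show ?thesis
  proof (cases "integrable M X")
    case True
    have "\<bar>expectation X\<bar> \<le> expectation (\<lambda>\<omega>. \<bar>X \<omega>\<bar>)" by (rule integral_abs_bound)
    also have "\<dots> \<le> c" using True assms by (intro integral_le_const) auto
    finally show ?thesis .
  qed (use \<open>0 \<le> c\<close> in \<open>simp add: not_integrable_integral_eq\<close>)
qed

text \<open>The Brownian motions are independent of each other, and each has increments independent of the
  past; that the pair of increments is independent of the past is not assumed. It is usually deduced
  from Levy's characterisation; here it follows from the martingales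
  \<open>E[f(W\<^sub>t - W\<^sub>s) | F\<^sub>r]\<close>, whose discrete covariation vanishes as the mesh tends to zero.\<close>
lemma increments_expectation_lipschitz:
  fixes f :: "nat \<Rightarrow> real^'d \<Rightarrow> real"
  assumes nl: "n \<ge> 1" "l \<ge> 1" "n \<noteq> l" and st: "0 \<le> s" "s < t" "t \<le> T"
    and f1: "\<And>i x. \<bar>f i x\<bar> \<le> 1" and lip: "\<And>i x y. \<bar>f i x - f i y\<bar> \<le> B * norm (x - y)" and B: "0 \<le> B"
    and Z: "Z \<in> borel_measurable (F s)" "\<And>\<omega>. \<bar>Z \<omega>\<bar> \<le> 1"
  shows "expectation (\<lambda>\<omega>. Z \<omega> * (f n (W n \<omega> t - W n \<omega> s) * f l (W l \<omega> t - W l \<omega> s))) =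
    expectation Z * (expectation (\<lambda>\<omega>. f n (W n \<omega> t - W n \<omega> s)) * expectation (\<lambda>\<omega>. f l (W l \<omega> t - W l \<omega> s)))"
    (is "?lhs = ?rhs")
proof -
  \<comment> \<open>\<open>C / J\<close> bounds the mean square of one martingale increment over a
    mesh of width (t - s) / J.\<close>
  define C where "C = 4 * B\<^sup>2 * (real CARD('d) * (t - s))"
  have [measurable]: "f i \<in> borel_measurable borel" for i
  proof -
    have "B-lipschitz_on UNIV (f i)" using lip B by (intro lipschitz_onI) (auto simp: dist_norm)
    then show ?thesis by (intro borel_measurable_continuous_onI lipschitz_on_continuous_on)
  qed
  have ZM[measurable]: "Z \<in> borel_measurable M" using Z(1) subalg[of s] st by (auto intro: measurable_from_subalg)
  have bound: "(?lhs - ?rhs)\<^sup>2 \<le> C\<^sup>2 / real J" if J: "J \<ge> 1" for J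
  proof -
    define r where "r k = s + real k * ((t - s) / real J)" for k
    define \<delta> where "\<delta> = (t - s) / real J"
    have \<delta>0: "\<delta> > 0" using J st by (simp add: \<delta>_def)
    have rS: "r (Suc k) - r k = \<delta>" for k unfolding r_def \<delta>_def of_nat_Suc distrib_right by simp
    have r_mono: "r j \<le> r k" if "j \<le> k" for j k
      unfolding r_def using that st by (intro add_left_mono mult_right_mono) auto
    have rJ: "r J = t" and r0: "r 0 = s" using J by (simp_all add: r_def)
    have r_bds: "0 \<le> r k" "s \<le> r k" for k using r_mono[of 0 k] r0 st by auto
    have r_t: "r k \<le> t" "r k \<le> T" if "k \<le> J" for k using r_mono[of k J] that rJ st by auto
    have rlt: "r k < t" if "k < J" for k using r_mono[of "Suc k" J] that rJ rS[of k] \<delta>0 by auto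
    define V where "V i k \<omega> = W i \<omega> (r k) - W i \<omega> s" for i k \<omega>
    \<comment> \<open>\<open>m i k\<close> is the conditional expectation of f i (W_t - W_s) given
      the \<sigma>-algebra at time \<open>r k\<close>, written through the explicit function
      \<open>\<Psi> i k\<close> of the increment \<open>V i k\<close> realised so far. It starts at
      a constant, ends at f i (W_t - W_s), and has the increments \<open>D i k\<close>.\<close>
    define \<Psi> where "\<Psi> i k x = expectation (\<lambda>\<omega>. f i (x + (W i \<omega> t - W i \<omega> (r k))))" for i k x
    define m where "m i k \<omega> = \<Psi> i k (V i k \<omega>)" for i k \<omega>
    define D where "D i k \<omega> = m i (Suc k) \<omega> - m i k \<omega>" for i k \<omega>
    have Wm[measurable]: "(\<lambda>\<omega>. W i \<omega> (r k)) \<in> borel_measurable M" "(\<lambda>\<omega>. W i \<omega> t) \<in> borel_measurable M" "(\<lambda>\<omega>. W i \<omega> s) \<in> borel_measurable M"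
      if "i \<in> {n, l}" "k \<le> J" for i k
      using that nl st r_bds r_t by (auto intro!: W_meas)
    have fint: "integrable M (\<lambda>\<omega>. f i (x + (W i \<omega> t - W i \<omega> (r k))))" if "i \<in> {n, l}" "k \<le> J" for i k x
      using Wm[OF that] f1 by (intro integrable_bdd[where B=1]) auto
    have \<Psi>1: "\<bar>\<Psi> i k x\<bar> \<le> 1" for i k x
      unfolding \<Psi>_def using f1 by (intro abs_expectation_le)
    have inc1: "integrable M (\<lambda>\<omega>. norm (W i \<omega> (r (Suc k)) - W i \<omega> (r k)))"
      "expectation (\<lambda>\<omega>. norm (W i \<omega> (r (Suc k)) - W i \<omega> (r k))) \<le> sqrt (real CARD('d) * \<delta>)"
      and inc2: "integrable M (\<lambda>\<omega>. (norm (W i \<omega> (r (Suc k)) - W i \<omega> (r k)))\<^sup>2)"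
      "expectation (\<lambda>\<omega>. (norm (W i \<omega> (r (Suc k)) - W i \<omega> (r k)))\<^sup>2) = real CARD('d) * \<delta>"
      if "i \<in> {n, l}" "k < J" for i k
    proof -
      have b: "brownian_motion M F T (W i)" using bm nl that by auto
      have le: "r k \<le> r (Suc k)" "r (Suc k) \<le> T" using r_mono r_t that by auto
      show "integrable M (\<lambda>\<omega>. norm (W i \<omega> (r (Suc k)) - W i \<omega> (r k)))"
        "expectation (\<lambda>\<omega>. norm (W i \<omega> (r (Suc k)) - W i \<omega> (r k))) \<le> sqrt (real CARD('d) * \<delta>)"
        using brownian_increment_first_moment[OF prob_space_axioms b filt r_bds(1) le] by (simp_all add: rS)
      show "integrable M (\<lambda>\<omega>. (norm (W i \<omega> (r (Suc k)) - W i \<omega> (r k)))\<^sup>2)"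
        "expectation (\<lambda>\<omega>. (norm (W i \<omega> (r (Suc k)) - W i \<omega> (r k)))\<^sup>2) = real CARD('d) * \<delta>"
        using brownian_increment_second_moment[OF b filt r_bds(1) le] by (simp_all add: rS)
    qed
    \<comment> \<open>Bounds the mean norm of a Brownian increment over one mesh interval by the
      root of its second moment.\<close>
    define e where "e = sqrt (real CARD('d) * \<delta>)"
    have e0: "0 \<le> e" "e\<^sup>2 = real CARD('d) * \<delta>" using \<delta>0 by (simp_all add: e_def)
    have \<Psi>_lip: "\<bar>\<Psi> i k x - \<Psi> i k y\<bar> \<le> B * norm (x - y)" if "i \<in> {n, l}" "k \<le> J" for i k x y
    proof -
      have "\<Psi> i k x - \<Psi> i k y = expectation (\<lambda>\<omega>. f i (x + (W i \<omega> t - W i \<omega> (r k))) - f i (y + (W i \<omega> t - W i \<omega> (r k))))"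
        unfolding \<Psi>_def using fint[OF that] by simp
      also have "\<bar>\<dots>\<bar> \<le> B * norm (x - y)"
      proof (rule abs_expectation_le)
        fix \<omega>
        show "\<bar>f i (x + (W i \<omega> t - W i \<omega> (r k))) - f i (y + (W i \<omega> t - W i \<omega> (r k)))\<bar> \<le> B * norm (x - y)"
          using lip[of i "x + (W i \<omega> t - W i \<omega> (r k))" "y + (W i \<omega> t - W i \<omega> (r k))"] by simp
      qed
      finally show ?thesis .
    qed
    \<comment> \<open>The two averages differ by one mesh increment inside the Lipschitz function;
      its mean norm is at most \<open>e\<close>.\<close>
    have \<Psi>_step: "\<bar>\<Psi> i (Suc k) x - \<Psi> i k y\<bar> \<le> B * (norm (x - y) + e)" if "i \<in> {n, l}" "k < J" for i k x y
    proof -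
      have k: "k \<le> J" "Suc k \<le> J" using that by auto
      let ?\<Delta> = "\<lambda>\<omega>. W i \<omega> (r (Suc k)) - W i \<omega> (r k)"
      let ?u = "\<lambda>\<omega>. f i (x + (W i \<omega> t - W i \<omega> (r (Suc k))))" and ?v = "\<lambda>\<omega>. f i (y + (W i \<omega> t - W i \<omega> (r k)))"
      have pw: "\<bar>?u \<omega> - ?v \<omega>\<bar> \<le> B * (norm (x - y) + norm (?\<Delta> \<omega>))" for \<omega>
      proof -
        have "\<bar>?u \<omega> - ?v \<omega>\<bar> \<le> B * norm ((x - y) - ?\<Delta> \<omega>)"
          using lip[of i "x + (W i \<omega> t - W i \<omega> (r (Suc k)))" "y + (W i \<omega> t - W i \<omega> (r k))"] by (simp add: algebra_simps)
        also have "\<dots> \<le> B * (norm (x - y) + norm (?\<Delta> \<omega>))"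
          using B norm_triangle_ineq4 by (intro mult_left_mono)
        finally show ?thesis .
      qed
      have "\<Psi> i (Suc k) x - \<Psi> i k y = expectation (\<lambda>\<omega>. ?u \<omega> - ?v \<omega>)"
        unfolding \<Psi>_def using fint[OF that(1)] k by simp
      also have "\<bar>\<dots>\<bar> \<le> expectation (\<lambda>\<omega>. \<bar>?u \<omega> - ?v \<omega>\<bar>)" by (rule integral_abs_bound)
      also have "\<dots> \<le> expectation (\<lambda>\<omega>. B * (norm (x - y) + norm (?\<Delta> \<omega>)))"
        using inc1(1)[OF that] fint[OF that(1) k(1)] fint[OF that(1) k(2)] pw
        by (intro integral_mono integrable_abs Bochner_Integration.integrable_diff integrable_mult_right Bochner_Integration.integrable_add) auto
      also have "\<dots> = B * (norm (x - y) + expectation (\<lambda>\<omega>. norm (?\<Delta> \<omega>)))"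
        using inc1(1)[OF that] by (simp add: prob_space)
      also have "\<dots> \<le> B * (norm (x - y) + e)"
        using inc1(2)[OF that] B by (intro mult_left_mono) (auto simp: e_def)
      finally show ?thesis .
    qed
    have \<Psi>_meas: "\<Psi> i k \<in> borel_measurable borel" if "i \<in> {n, l}" "k \<le> J" for i k
    proof -
      have "B-lipschitz_on UNIV (\<Psi> i k)" using \<Psi>_lip[OF that] B by (intro lipschitz_onI) (auto simp: dist_norm)
      then show ?thesis by (intro borel_measurable_continuous_onI lipschitz_on_continuous_on)
    qed
    have V_adapted: "V i k \<in> borel_measurable (F (r k))" if "i \<in> {n, l}" "k \<le> J" for i k
    proof -
      have "(\<lambda>\<omega>. W i \<omega> (r k)) \<in> borel_measurable (F (r k))" "(\<lambda>\<omega>. W i \<omega> s) \<in> borel_measurable (F (r k))"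
        using that nl st r_bds[of k] r_t[of k] by (auto intro!: W_adapted)
      then show ?thesis unfolding V_def by (rule borel_measurable_diff)
    qed
    have m_adapted: "m i k \<in> borel_measurable (F (r k))" if "i \<in> {n, l}" "k \<le> J" for i k
      unfolding m_def using V_adapted[OF that] \<Psi>_meas[OF that] by (rule measurable_compose)
    have to_M: "g \<in> borel_measurable M" if "g \<in> borel_measurable (F (r k))" "k \<le> J" for g :: "'a \<Rightarrow> real" and k
      using that subalg[of "r k"] r_bds r_t by (auto intro: measurable_from_subalg)
    have m_meas: "m i k \<in> borel_measurable M" if "i \<in> {n, l}" "k \<le> J" for i k
      using to_M[OF m_adapted[OF that] that(2)] .
    have m1: "\<bar>m i k \<omega>\<bar> \<le> 1" for i k \<omega> unfolding m_def by (rule \<Psi>1)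
    have D_meas: "D i k \<in> borel_measurable M" if "i \<in> {n, l}" "k < J" for i k
      unfolding D_def using that by (intro borel_measurable_diff m_meas) auto
    have D2: "\<bar>D i k \<omega>\<bar> \<le> 2" for i k \<omega>
      unfolding D_def using m1[of i k \<omega>] m1[of i "Suc k" \<omega>] by linarith
    have mJ: "m i J \<omega> = f i (W i \<omega> t - W i \<omega> s)" for i \<omega>
      by (simp add: m_def \<Psi>_def rJ V_def prob_space)
    \<comment> \<open>The martingale property, tested against bounded variables known at time
      \<open>r k\<close>: these and the increment so far are frozen, the remaining increment is
      averaged.\<close>
    have mart: "expectation (\<lambda>\<omega>. Y \<omega> * m i k \<omega>) = expectation (\<lambda>\<omega>. Y \<omega> * f i (W i \<omega> t - W i \<omega> s))"
      if i: "i \<in> {n, l}" and k: "k \<le> J" and Y: "Y \<in> borel_measurable (F (r k))" and b: "\<And>\<omega>. \<bar>Y \<omega>\<bar> \<le> b" for i k b Y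
    proof (cases "k = J")
      case False
      then have kJ: "k < J" using k by simp
      \<comment> \<open>The first coordinate is clipped to [-b, b] because the freezing lemma asks
        for a bound on the whole space; on the values of \<open>Y\<close> the clipping is
        invisible.\<close>
      define h where "h q = max (- b) (min b (fst (fst q))) * f i (snd (fst q) + snd q)" for q :: "(real \<times> (real^'d)) \<times> (real^'d)"
      have b0: "0 \<le> b" using b by (meson abs_ge_zero order_trans)
      have X: "(\<lambda>\<omega>. (Y \<omega>, V i k \<omega>)) \<in> F (r k) \<rightarrow>\<^sub>M (borel \<Otimes>\<^sub>M borel)"
        using Y V_adapted[OF i k] by simp
      then have XM: "(\<lambda>\<omega>. (Y \<omega>, V i k \<omega>)) \<in> M \<rightarrow>\<^sub>M (borel \<Otimes>\<^sub>M borel)"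
        using subalg[of "r k"] r_bds r_t[OF k] by (auto intro: measurable_from_subalg)
      have clip: "max (- b) (min b (Y \<omega>)) = Y \<omega>" for \<omega> using b[of \<omega>] by auto
      have i1: "1 \<le> i" using i nl by auto
      have "expectation (\<lambda>\<omega>. Y \<omega> * f i (W i \<omega> t - W i \<omega> s)) = expectation (\<lambda>\<omega>. h ((Y \<omega>, V i k \<omega>), W i \<omega> t - W i \<omega> (r k)))"
        by (simp add: h_def clip V_def)
      also have "\<dots> = expectation (\<lambda>\<omega>. expectation (\<lambda>\<omega>'. h ((Y \<omega>, V i k \<omega>), W i \<omega>' t - W i \<omega>' (r k))))"
      proof (rule expectation_freeze[where B=b])
        show "distr M ((borel \<Otimes>\<^sub>M borel) \<Otimes>\<^sub>M borel) (\<lambda>\<omega>. ((Y \<omega>, V i k \<omega>), W i \<omega> t - W i \<omega> (r k))) =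
          distr M (borel \<Otimes>\<^sub>M borel) (\<lambda>\<omega>. (Y \<omega>, V i k \<omega>)) \<Otimes>\<^sub>M distr M borel (\<lambda>\<omega>. W i \<omega> t - W i \<omega> (r k))"
          by (rule distr_past_increment[OF i1 r_bds(1) rlt[OF kJ] st(3) X])
        show "h \<in> borel_measurable ((borel \<Otimes>\<^sub>M borel) \<Otimes>\<^sub>M borel)" unfolding h_def by measurable
        show "(\<lambda>\<omega>. W i \<omega> t - W i \<omega> (r k)) \<in> borel_measurable M" using Wm[OF i k] by simp
        show "\<bar>h z\<bar> \<le> b" for z
        proof -
          have "\<bar>h z\<bar> \<le> b * 1" unfolding h_def abs_mult using b0 f1 by (intro mult_mono) auto
          then show ?thesis by simp
        qed
      qed (rule XM)
      also have "\<dots> = expectation (\<lambda>\<omega>. Y \<omega> * m i k \<omega>)"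
        by (simp add: h_def clip m_def \<Psi>_def)
      finally show ?thesis by (rule sym)
    qed (simp add: mJ)
    have mart0: "expectation (\<lambda>\<omega>. Y \<omega> * D i k \<omega>) = 0"
      if i: "i \<in> {n, l}" and k: "k < J" and Y: "Y \<in> borel_measurable (F (r k))" and b: "\<And>\<omega>. \<bar>Y \<omega>\<bar> \<le> b" for i k b Y
    proof -
      have Y': "Y \<in> borel_measurable (F (r (Suc k)))"
        using measurable_F_mono[OF Y] r_bds r_mono[of k "Suc k"] r_t[of "Suc k"] k by auto
      have YM: "Y \<in> borel_measurable M" using to_M[OF Y] k by simp
      have bb: "\<bar>Y \<omega> * m i j \<omega>\<bar> \<le> b" for j \<omega>
      proof -
        have "\<bar>Y \<omega> * m i j \<omega>\<bar> \<le> b * 1" unfolding abs_mult using b[of \<omega>] m1[of i j \<omega>] by (intro mult_mono) auto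
        then show ?thesis by simp
      qed
      have int: "integrable M (\<lambda>\<omega>. Y \<omega> * m i j \<omega>)" if "j \<le> J" for j
        using YM m_meas[OF i that] bb by (intro integrable_bdd[where B=b]) auto
      have "expectation (\<lambda>\<omega>. Y \<omega> * D i k \<omega>) = expectation (\<lambda>\<omega>. Y \<omega> * m i (Suc k) \<omega>) - expectation (\<lambda>\<omega>. Y \<omega> * m i k \<omega>)"
        unfolding D_def right_diff_distrib using k by (intro Bochner_Integration.integral_diff int) auto
      also have "\<dots> = 0" using mart[OF i _ Y' b] mart[OF i _ Y b] k by simp
      finally show ?thesis .
    qed
    have D_sq: "expectation (\<lambda>\<omega>. D i k \<omega> * D i k \<omega>) \<le> 4 * B\<^sup>2 * (real CARD('d) * \<delta>)" if i: "i \<in> {n, l}" and k: "k < J" for i k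
    proof -
      let ?\<Delta> = "\<lambda>\<omega>. norm (W i \<omega> (r (Suc k)) - W i \<omega> (r k))"
      have "D i k \<omega> * D i k \<omega> \<le> 2 * B\<^sup>2 * ((?\<Delta> \<omega>)\<^sup>2 + e\<^sup>2)" for \<omega>
      proof -
        have "V i (Suc k) \<omega> - V i k \<omega> = W i \<omega> (r (Suc k)) - W i \<omega> (r k)" by (simp add: V_def)
        then have "\<bar>D i k \<omega>\<bar> \<le> B * (?\<Delta> \<omega> + e)"
          unfolding D_def m_def using \<Psi>_step[OF i k, of "V i (Suc k) \<omega>" "V i k \<omega>"] by simp
        then have "(D i k \<omega>)\<^sup>2 \<le> (B * (?\<Delta> \<omega> + e))\<^sup>2"
          using B e0 by (intro power2_le_iff_abs_le[THEN iffD2]) auto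
        also have "\<dots> = B\<^sup>2 * (?\<Delta> \<omega> + e)\<^sup>2" by (simp add: power_mult_distrib)
        also have "\<dots> \<le> B\<^sup>2 * (2 * ((?\<Delta> \<omega>)\<^sup>2 + e\<^sup>2))"
          using zero_le_power2[of "?\<Delta> \<omega> - e"] by (intro mult_left_mono) (auto simp: power2_sum power2_diff)
        finally show ?thesis by (simp add: power2_eq_square mult_ac)
      qed
      then have "expectation (\<lambda>\<omega>. D i k \<omega> * D i k \<omega>) \<le> expectation (\<lambda>\<omega>. 2 * B\<^sup>2 * ((?\<Delta> \<omega>)\<^sup>2 + e\<^sup>2))"
      proof (rule integral_mono[rotated 2])
        have "\<bar>D i k \<omega> * D i k \<omega>\<bar> \<le> 2 * 2" for \<omega> unfolding abs_mult by (intro mult_mono D2) auto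
        then show "integrable M (\<lambda>\<omega>. D i k \<omega> * D i k \<omega>)"
          using D_meas[OF i k] by (intro integrable_bdd[where B="2 * 2"]) auto
      qed (use inc2(1)[OF i k] in simp)
      also have "\<dots> = 2 * B\<^sup>2 * (real CARD('d) * \<delta> + e\<^sup>2)"
        using inc2[OF i k] by (simp add: prob_space)
      finally show ?thesis by (simp add: e0 mult_ac)
    qed
    \<comment> \<open>Increments of one martingale over different intervals are orthogonal, as the
      earlier one is known when the later interval starts.\<close>
    have orth: "expectation (\<lambda>\<omega>. D i k \<omega> * D i j \<omega>) = 0" if i: "i \<in> {n, l}" and "k < j" "j < J" for i k j
    proof (rule mart0[OF i \<open>j < J\<close> _ D2])
      have kj: "Suc k \<le> j" "k \<le> j" using that by auto
      have "m i q \<in> borel_measurable (F (r j))" if "q \<le> j" for q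
        using measurable_F_mono[OF m_adapted[OF i, of q]] r_bds r_mono[OF that] r_t[of j] that \<open>j < J\<close> by auto
      then show "D i k \<in> borel_measurable (F (r j))" unfolding D_def using kj by (intro borel_measurable_diff) auto
    qed
    \<comment> \<open>The independence of the two processes enters here:
      \<open>D n k * D n j\<close> is a function of the path of \<open>W n\<close> alone, and the
      same holds for \<open>l\<close>.\<close>
    have ind: "expectation (\<lambda>\<omega>. (D n k \<omega> * D l k \<omega>) * (D n j \<omega> * D l j \<omega>)) =
      expectation (\<lambda>\<omega>. D n k \<omega> * D n j \<omega>) * expectation (\<lambda>\<omega>. D l k \<omega> * D l j \<omega>)" if kj: "k < J" "j < J" for k j
    proof -
      define G where "G i w = (\<Psi> i (Suc k) (w (r (Suc k)) - w s) - \<Psi> i k (w (r k) - w s)) *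
         (\<Psi> i (Suc j) (w (r (Suc j)) - w s) - \<Psi> i j (w (r j) - w s))" for i and w :: "real \<Rightarrow> real^'d"
      have ev: "(\<lambda>w. w (r q) - w s :: real^'d) \<in> (\<Pi>\<^sub>M t\<in>{0..T}. borel) \<rightarrow>\<^sub>M borel" if "q \<le> J" for q
        using r_bds[of q] r_t[OF that] st by (intro borel_measurable_diff measurable_component_singleton) auto
      have Gm: "G i \<in> (\<Pi>\<^sub>M t\<in>{0..T}. borel) \<rightarrow>\<^sub>M borel" if "i \<in> {n, l}" for i
        unfolding G_def using kj by (intro borel_measurable_times borel_measurable_diff measurable_compose[OF ev \<Psi>_meas[OF that]]) auto
      have GD: "G i (restrict (W i \<omega>) {0..T}) = D i k \<omega> * D i j \<omega>" for i \<omega>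
        using r_bds r_t[of k] r_t[of j] r_t[of "Suc k"] r_t[of "Suc j"] kj st
        by (simp add: G_def D_def m_def V_def)
      have "indep_vars (\<lambda>_. \<Pi>\<^sub>M t\<in>{0..T}. borel) (\<lambda>n \<omega>. restrict (W n \<omega>) {0..T}) {n, l}"
        using indW nl unfolding indep_processes_def by (elim indep_vars_subset) auto
      then have "indep_vars (\<lambda>_. borel) (\<lambda>i \<omega>. G i (restrict (W i \<omega>) {0..T})) {n, l}"
        by (rule indep_vars_compose2) (rule Gm)
      then have iv: "indep_vars (\<lambda>_. borel) (\<lambda>i \<omega>. D i k \<omega> * D i j \<omega>) {n, l}" by (simp only: GD)
      have "expectation (\<lambda>\<omega>. \<Prod>i\<in>{n, l}. D i k \<omega> * D i j \<omega>) = (\<Prod>i\<in>{n, l}. expectation (\<lambda>\<omega>. D i k \<omega> * D i j \<omega>))"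
      proof (rule indep_vars_lebesgue_integral[OF _ iv])
        fix i assume i: "i \<in> {n, l}"
        have "\<bar>D i k \<omega> * D i j \<omega>\<bar> \<le> 2 * 2" for \<omega> unfolding abs_mult by (intro mult_mono D2) auto
        then show "integrable M (\<lambda>\<omega>. D i k \<omega> * D i j \<omega>)"
          using D_meas[OF i] kj by (intro integrable_bdd[where B="2 * 2"]) auto
      qed simp
      then show ?thesis using nl(3) by (simp add: mult_ac)
    qed
    \<comment> \<open>The discrete covariation of the two martingales; its mean against
      \<open>Z\<close> is exactly the difference of the two sides of the claim.\<close>
    define S where "S \<omega> = (\<Sum>k<J. D n k \<omega> * D l k \<omega>)" for \<omega>
    have P4: "\<bar>D n k \<omega> * D l k \<omega>\<bar> \<le> 4" for k \<omega>
    proof -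
      have "\<bar>D n k \<omega> * D l k \<omega>\<bar> \<le> 2 * 2" unfolding abs_mult by (intro mult_mono D2) auto
      then show ?thesis by simp
    qed
    have P_meas: "(\<lambda>\<omega>. D n k \<omega> * D l k \<omega>) \<in> borel_measurable M" if "k < J" for k
      using D_meas[of n k] D_meas[of l k] that by simp
    have S_meas: "S \<in> borel_measurable M" unfolding S_def using P_meas by (intro borel_measurable_sum) auto
    have S_bd: "\<bar>S \<omega>\<bar> \<le> 4 * real J" for \<omega>
    proof -
      have "\<bar>S \<omega>\<bar> \<le> (\<Sum>k<J. \<bar>D n k \<omega> * D l k \<omega>\<bar>)" unfolding S_def by (rule sum_abs)
      also have "\<dots> \<le> (\<Sum>k<J. 4)" by (intro sum_mono P4)
      finally show ?thesis by simp
    qed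
    \<comment> \<open>Off the diagonal the factorised expectation contains an orthogonal pair and
      vanishes. Only \<open>J\<close> terms of size at most (C / J)^2 survive.\<close>
    have S_sq: "expectation (\<lambda>\<omega>. (S \<omega>)\<^sup>2) \<le> C\<^sup>2 / real J"
    proof -
      have int: "integrable M (\<lambda>\<omega>. (D n k \<omega> * D l k \<omega>) * (D n j \<omega> * D l j \<omega>))" if "k < J" "j < J" for k j
      proof (rule integrable_bdd[where B="4 * 4"])
        show "\<bar>(D n k \<omega> * D l k \<omega>) * (D n j \<omega> * D l j \<omega>)\<bar> \<le> 4 * 4" for \<omega>
          unfolding abs_mult[of "D n k \<omega> * D l k \<omega>"] by (intro mult_mono P4) auto
      qed (rule borel_measurable_times[OF P_meas[OF that(1)] P_meas[OF that(2)]])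
      have "expectation (\<lambda>\<omega>. (S \<omega>)\<^sup>2) = expectation (\<lambda>\<omega>. \<Sum>k<J. \<Sum>j<J. (D n k \<omega> * D l k \<omega>) * (D n j \<omega> * D l j \<omega>))"
        by (simp add: S_def power2_eq_square sum_product)
      also have "\<dots> = (\<Sum>k<J. \<Sum>j<J. expectation (\<lambda>\<omega>. (D n k \<omega> * D l k \<omega>) * (D n j \<omega> * D l j \<omega>)))"
        using int by (subst Bochner_Integration.integral_sum, force intro!: Bochner_Integration.integrable_sum)
          (intro sum.cong refl Bochner_Integration.integral_sum, auto)
      also have "\<dots> = (\<Sum>k<J. \<Sum>j<J. if j = k then expectation (\<lambda>\<omega>. D n k \<omega> * D n k \<omega>) * expectation (\<lambda>\<omega>. D l k \<omega> * D l k \<omega>) else 0)"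
      proof (intro sum.cong refl)
        fix k j assume "k \<in> {..<J}" "j \<in> {..<J}"
        then have kj: "k < J" "j < J" by auto
        have "expectation (\<lambda>\<omega>. D n k \<omega> * D n j \<omega>) = 0" if "j \<noteq> k"
          using orth[of n k j] orth[of n j k] kj that by (cases "k < j") (auto simp: mult.commute)
        then show "expectation (\<lambda>\<omega>. (D n k \<omega> * D l k \<omega>) * (D n j \<omega> * D l j \<omega>)) =
          (if j = k then expectation (\<lambda>\<omega>. D n k \<omega> * D n k \<omega>) * expectation (\<lambda>\<omega>. D l k \<omega> * D l k \<omega>) else 0)"
          unfolding ind[OF kj] by auto
      qed
      also have "\<dots> = (\<Sum>k<J. expectation (\<lambda>\<omega>. D n k \<omega> * D n k \<omega>) * expectation (\<lambda>\<omega>. D l k \<omega> * D l k \<omega>))"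
        by simp
      also have "\<dots> \<le> (\<Sum>k<J. (4 * B\<^sup>2 * (real CARD('d) * \<delta>)) * (4 * B\<^sup>2 * (real CARD('d) * \<delta>)))"
        using \<delta>0 by (intro sum_mono mult_mono D_sq) auto
      also have "\<dots> = real J * (C / real J)\<^sup>2" by (simp add: C_def \<delta>_def power2_eq_square)
      also have "\<dots> = C\<^sup>2 / real J" using J by (simp add: power2_eq_square field_simps)
      finally show ?thesis .
    qed
    \<comment> \<open>A discrete product rule for \<open>m n * m l\<close>. The mixed terms vanish,
      because \<open>Z\<close> and the other martingale are known at the beginning of the step; the
      products of increments accumulate to the covariation.\<close>
    have tele: "expectation (\<lambda>\<omega>. Z \<omega> * (m n q \<omega> * m l q \<omega>)) =
      expectation (\<lambda>\<omega>. Z \<omega> * (m n 0 \<omega> * m l 0 \<omega>)) + expectation (\<lambda>\<omega>. Z \<omega> * (\<Sum>k<q. D n k \<omega> * D l k \<omega>))" if "q \<le> J" for q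
      using that
    proof (induction q)
      case (Suc q)
      have q: "q < J" using Suc.prems by simp
      have Zr: "Z \<in> borel_measurable (F (r q))"
        using measurable_F_mono[OF Z(1)] st r_bds[of q] r_t[of q] q by auto
      have Zm: "(\<lambda>\<omega>. Z \<omega> * m i q \<omega>) \<in> borel_measurable (F (r q))" "\<And>\<omega>. \<bar>Z \<omega> * m i q \<omega>\<bar> \<le> 1" if "i \<in> {n, l}" for i
        using Zr m_adapted[OF that, of q] q Z(2) m1 by (auto simp: abs_mult intro!: mult_le_one)
      have bi: "integrable M (\<lambda>\<omega>. Z \<omega> * (a \<omega> * b \<omega>))"
        if "a \<in> borel_measurable M" "b \<in> borel_measurable M" "\<And>\<omega>. \<bar>a \<omega>\<bar> \<le> 2" "\<And>\<omega>. \<bar>b \<omega>\<bar> \<le> 2" for a b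
      proof (rule integrable_bdd[where B="1 * (2 * 2)"])
        show "\<bar>Z \<omega> * (a \<omega> * b \<omega>)\<bar> \<le> 1 * (2 * 2)" for \<omega>
          unfolding abs_mult by (intro mult_mono Z that) auto
      qed (use that in measurable)
      have m2: "\<bar>m i k \<omega>\<bar> \<le> 2" for i k \<omega> using m1[of i k \<omega>] by linarith
      have mm: "m n q \<in> borel_measurable M" "m l q \<in> borel_measurable M" "D n q \<in> borel_measurable M" "D l q \<in> borel_measurable M"
        using m_meas[of n q] m_meas[of l q] D_meas[of n q] D_meas[of l q] q by auto
      have "Z \<omega> * (m n (Suc q) \<omega> * m l (Suc q) \<omega>) = Z \<omega> * (m n q \<omega> * m l q \<omega>) + Z \<omega> * (D n q \<omega> * m l q \<omega>)
        + Z \<omega> * (m n q \<omega> * D l q \<omega>) + Z \<omega> * (D n q \<omega> * D l q \<omega>)" for \<omega>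
        by (simp add: D_def algebra_simps)
      then have "expectation (\<lambda>\<omega>. Z \<omega> * (m n (Suc q) \<omega> * m l (Suc q) \<omega>)) =
        expectation (\<lambda>\<omega>. Z \<omega> * (m n q \<omega> * m l q \<omega>)) + expectation (\<lambda>\<omega>. Z \<omega> * (D n q \<omega> * m l q \<omega>))
        + expectation (\<lambda>\<omega>. Z \<omega> * (m n q \<omega> * D l q \<omega>)) + expectation (\<lambda>\<omega>. Z \<omega> * (D n q \<omega> * D l q \<omega>))"
        using bi[OF mm(1,2) m2 m2] bi[OF mm(3,2) D2 m2] bi[OF mm(1,4) m2 D2] bi[OF mm(3,4) D2 D2] by simp
      also have "expectation (\<lambda>\<omega>. Z \<omega> * (D n q \<omega> * m l q \<omega>)) = 0"
        using mart0[of n q "\<lambda>\<omega>. Z \<omega> * m l q \<omega>" 1] Zm[of l] q by (simp add: mult_ac)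
      also have "expectation (\<lambda>\<omega>. Z \<omega> * (m n q \<omega> * D l q \<omega>)) = 0"
        using mart0[of l q "\<lambda>\<omega>. Z \<omega> * m n q \<omega>" 1] Zm[of n] q by (simp add: mult_ac)
      also have "expectation (\<lambda>\<omega>. Z \<omega> * (m n q \<omega> * m l q \<omega>)) = expectation (\<lambda>\<omega>. Z \<omega> * (m n 0 \<omega> * m l 0 \<omega>)) + expectation (\<lambda>\<omega>. Z \<omega> * (\<Sum>k<q. D n k \<omega> * D l k \<omega>))"
        using Suc by simp
      finally have eq: "expectation (\<lambda>\<omega>. Z \<omega> * (m n (Suc q) \<omega> * m l (Suc q) \<omega>)) = expectation (\<lambda>\<omega>. Z \<omega> * (m n 0 \<omega> * m l 0 \<omega>))
        + (expectation (\<lambda>\<omega>. Z \<omega> * (\<Sum>k<q. D n k \<omega> * D l k \<omega>)) + expectation (\<lambda>\<omega>. Z \<omega> * (D n q \<omega> * D l q \<omega>)))" by simp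
      have "integrable M (\<lambda>\<omega>. Z \<omega> * (\<Sum>k<q. D n k \<omega> * D l k \<omega>))"
        unfolding sum_distrib_left using q D_meas by (intro Bochner_Integration.integrable_sum bi D2) auto
      then have "expectation (\<lambda>\<omega>. Z \<omega> * (\<Sum>k<q. D n k \<omega> * D l k \<omega>)) + expectation (\<lambda>\<omega>. Z \<omega> * (D n q \<omega> * D l q \<omega>))
        = expectation (\<lambda>\<omega>. Z \<omega> * (\<Sum>k<Suc q. D n k \<omega> * D l k \<omega>))"
        using bi[OF mm(3,4) D2 D2] by (simp add: distrib_left)
      then show ?case using eq by simp
    qed simp
    \<comment> \<open>At time \<open>s\<close> the realised increment is 0, so both martingales
      equal the constants on the right-hand side.\<close>
    have "expectation (\<lambda>\<omega>. Z \<omega> * (m n 0 \<omega> * m l 0 \<omega>)) = ?rhs"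
      by (simp add: m_def V_def r0 \<Psi>_def)
    then have "?lhs - ?rhs = expectation (\<lambda>\<omega>. Z \<omega> * S \<omega>)"
      using tele[of J] by (simp add: mJ S_def)
    moreover have "(expectation (\<lambda>\<omega>. Z \<omega> * S \<omega>))\<^sup>2 \<le> expectation (\<lambda>\<omega>. (Z \<omega> * S \<omega>)\<^sup>2)"
    proof (rule square_expectation_le)
      have b: "\<bar>Z \<omega> * S \<omega>\<bar> \<le> 1 * (4 * real J)" for \<omega>
        unfolding abs_mult by (intro mult_mono Z S_bd) auto
      then show "integrable M (\<lambda>\<omega>. Z \<omega> * S \<omega>)" using S_meas by (intro integrable_bdd[where B="1 * (4 * real J)"]) auto
      show "integrable M (\<lambda>\<omega>. (Z \<omega> * S \<omega>)\<^sup>2)"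
      proof (rule integrable_bdd)
        show "\<bar>(Z \<omega> * S \<omega>)\<^sup>2\<bar> \<le> (1 * (4 * real J))\<^sup>2" for \<omega>
          using b[of \<omega>] power2_le_iff_abs_le[of "1 * (4 * real J)" "Z \<omega> * S \<omega>"] by simp
      qed (use S_meas in measurable)
    qed
    moreover have "expectation (\<lambda>\<omega>. (Z \<omega> * S \<omega>)\<^sup>2) \<le> expectation (\<lambda>\<omega>. (S \<omega>)\<^sup>2)"
    proof (rule integral_mono)
      have sq: "(Z \<omega>)\<^sup>2 \<le> 1" for \<omega> using Z(2)[of \<omega>] by (simp add: abs_square_le_1)
      show le: "(Z \<omega> * S \<omega>)\<^sup>2 \<le> (S \<omega>)\<^sup>2" for \<omega>
        unfolding power_mult_distrib using mult_right_mono[OF sq[of \<omega>] zero_le_power2[of "S \<omega>"]] by simp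
      have b: "(S \<omega>)\<^sup>2 \<le> (4 * real J)\<^sup>2" for \<omega>
        using S_bd[of \<omega>] by (intro power2_le_iff_abs_le[THEN iffD2]) auto
      show "integrable M (\<lambda>\<omega>. (S \<omega>)\<^sup>2)"
        using S_meas b by (intro integrable_bdd[where B="(4 * real J)\<^sup>2"]) auto
      show "integrable M (\<lambda>\<omega>. (Z \<omega> * S \<omega>)\<^sup>2)"
        using S_meas order_trans[OF le b] by (intro integrable_bdd[where B="(4 * real J)\<^sup>2"]) auto
    qed
    ultimately show ?thesis using S_sq by simp
  qed
  \<comment> \<open>Neither side of the claim depends on the number \<open>J\<close> of mesh
    intervals, so the mesh may be refined indefinitely.\<close>
  have "(?lhs - ?rhs)\<^sup>2 \<le> 0"
  proof (rule tendsto_lowerbound)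
    show "(\<lambda>J. C\<^sup>2 / real J) \<longlonglongrightarrow> 0" by (rule tendsto_divide_0[OF tendsto_const filterlim_real_sequentially[THEN filterlim_at_top_imp_at_infinity]])
    show "\<forall>\<^sub>F J in sequentially. (?lhs - ?rhs)\<^sup>2 \<le> C\<^sup>2 / real J"
      using bound by (intro eventually_sequentiallyI[of 1])
  qed simp
  then show ?thesis by simp
qed

end

text \<open>Truncated multiples of the distance to the complement tend to the indicator. The whole
  space is treated apart, since the distance to the empty set is 0 by convention.\<close>

lemma lipschitz_approx_open:
  fixes U :: "'b::euclidean_space set"
  assumes "open U"
  obtains u :: "nat \<Rightarrow> 'b \<Rightarrow> real" where
    "\<And>k x. \<bar>u k x\<bar> \<le> 1" "\<And>k x y. \<bar>u k x - u k y\<bar> \<le> real k * norm (x - y)"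
    "\<And>x. (\<lambda>k. u k x) \<longlonglongrightarrow> indicator U x"
proof (cases "U = UNIV")
  case True
  show ?thesis by (rule that[of "\<lambda>k x. 1"]) (auto simp: True)
next
  case False
  define u where "u k x = min 1 (real k * infdist x (- U))" for k x
  have lip: "\<bar>infdist x (- U) - infdist y (- U)\<bar> \<le> norm (x - y)" for x y
    using infdist_triangle_abs[of x "- U" y] by (simp add: dist_norm)
  have mn: "\<bar>min 1 a - min 1 b\<bar> \<le> \<bar>a - b\<bar>" for a b :: real by auto
  show ?thesis
  proof (rule that[of u])
    show "\<bar>u k x\<bar> \<le> 1" for k x using infdist_nonneg[of x "- U"] by (simp add: u_def abs_le_iff min_le_iff_disj)
    show "\<bar>u k x - u k y\<bar> \<le> real k * norm (x - y)" for k x y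
    proof -
      have "\<bar>u k x - u k y\<bar> \<le> \<bar>real k * infdist x (- U) - real k * infdist y (- U)\<bar>"
        unfolding u_def using mn by blast
      also have "\<dots> = real k * \<bar>infdist x (- U) - infdist y (- U)\<bar>" by (simp add: abs_mult flip: right_diff_distrib)
      also have "\<dots> \<le> real k * norm (x - y)" using lip by (intro mult_left_mono) auto
      finally show ?thesis .
    qed
    show "(\<lambda>k. u k x) \<longlonglongrightarrow> indicator U x" for x
    proof (cases "x \<in> U")
      case True
      have "infdist x (- U) \<noteq> 0"
        using in_closed_iff_infdist_zero[of "- U" x] assms False True by auto
      then have pos: "infdist x (- U) > 0" using infdist_nonneg[of x "- U"] by simp
      obtain K :: nat where K: "1 / infdist x (- U) \<le> real K" using real_arch_simple by blast
      have "u k x = 1" if "k \<ge> K" for k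
      proof -
        have "1 \<le> real K * infdist x (- U)" using K pos by (simp add: field_simps)
        also have "\<dots> \<le> real k * infdist x (- U)" using that pos by (intro mult_right_mono) auto
        finally show ?thesis by (simp add: u_def)
      qed
      then show ?thesis using True
        by (intro tendsto_eventually eventually_sequentiallyI[of K]) auto
    qed (use in_closed_iff_infdist_zero[of "- U" x] assms False in \<open>auto simp: u_def\<close>)
  qed
qed

section \<open>From Lipschitz test functions to Borel sets\<close>

context brownian_family begin

lemma increments_prob_open:
  assumes nl: "n \<ge> 1" "l \<ge> 1" "n \<noteq> l" and st: "0 \<le> s" "s < t" "t \<le> T"
    and A: "A \<in> sets (F s)" and U: "open U" "open V"
  shows "prob (A \<inter> ((\<lambda>\<omega>. W n \<omega> t - W n \<omega> s) -` U \<inter> space M) \<inter> ((\<lambda>\<omega>. W l \<omega> t - W l \<omega> s) -` V \<inter> space M)) =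
    prob A * (prob ((\<lambda>\<omega>. W n \<omega> t - W n \<omega> s) -` U \<inter> space M) * prob ((\<lambda>\<omega>. W l \<omega> t - W l \<omega> s) -` V \<inter> space M))"
proof -
  obtain u where u: "\<And>k x. \<bar>u k x\<bar> \<le> 1" "\<And>k x y. \<bar>u k x - u k y\<bar> \<le> real k * norm (x - y)"
    "\<And>x. (\<lambda>k. u k x) \<longlonglongrightarrow> indicator U x" using lipschitz_approx_open[OF U(1)] by blast
  obtain v where v: "\<And>k x. \<bar>v k x\<bar> \<le> 1" "\<And>k x y. \<bar>v k x - v k y\<bar> \<le> real k * norm (x - y)"
    "\<And>x. (\<lambda>k. v k x) \<longlonglongrightarrow> indicator V x" using lipschitz_approx_open[OF U(2)] by blast
  let ?D = "\<lambda>i \<omega>. W i \<omega> t - W i \<omega> s"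
  have AM[measurable]: "A \<in> sets M" using A subalg[of s] st by (auto simp: subalgebra_def)
  have [measurable]: "?D n \<in> borel_measurable M" "?D l \<in> borel_measurable M"
    using nl st W_meas[of n] W_meas[of l] by auto
  have meas: "u k \<in> borel_measurable borel" "v k \<in> borel_measurable borel" for k
  proof -
    have "(real k)-lipschitz_on UNIV (u k)" "(real k)-lipschitz_on UNIV (v k)"
      using u v by (auto intro!: lipschitz_onI simp: dist_norm)
    then show "u k \<in> borel_measurable borel" "v k \<in> borel_measurable borel"
      by (auto intro!: borel_measurable_continuous_onI lipschitz_on_continuous_on)
  qed
  have indU: "indicat_real U \<in> borel_measurable borel" and indV: "indicat_real V \<in> borel_measurable borel"
    using U by auto
  note [measurable] = meas
  \<comment> \<open>The Lipschitz statement takes one indexed family of test functions; n \<noteq> l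
    lets that family hold a different function for each increment.\<close>
  have eq: "expectation (\<lambda>\<omega>. indicator A \<omega> * (u k (?D n \<omega>) * v k (?D l \<omega>))) =
      expectation (indicator A) * (expectation (\<lambda>\<omega>. u k (?D n \<omega>)) * expectation (\<lambda>\<omega>. v k (?D l \<omega>)))" for k
    using increments_expectation_lipschitz[OF nl st, of "\<lambda>i. if i = n then u k else v k" "real k" "indicator A"]
      u v nl(3) A by (auto simp: indicator_def[abs_def] split: if_splits)
  have l1: "(\<lambda>k. expectation (\<lambda>\<omega>. indicator A \<omega> * (u k (?D n \<omega>) * v k (?D l \<omega>)))) \<longlonglongrightarrow>
     expectation (\<lambda>\<omega>. indicator A \<omega> * (indicator U (?D n \<omega>) * indicator V (?D l \<omega>)))"
  proof (rule integral_dominated_convergence[where w="\<lambda>_. 1"])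
    show "AE \<omega> in M. (\<lambda>k. indicator A \<omega> * (u k (?D n \<omega>) * v k (?D l \<omega>))) \<longlonglongrightarrow> indicator A \<omega> * (indicator U (?D n \<omega>) * indicator V (?D l \<omega>))"
      by (intro AE_I2 tendsto_intros u v)
    show "AE \<omega> in M. norm (indicator A \<omega> * (u k (?D n \<omega>) * v k (?D l \<omega>))) \<le> 1" for k
      using u v by (intro AE_I2) (auto simp: abs_mult indicator_def intro!: mult_le_one)
  qed (auto intro!: borel_measurable_times measurable_compose[OF _ meas(1)] measurable_compose[OF _ meas(2)]
      measurable_compose[OF _ indU] measurable_compose[OF _ indV])
  have l2: "(\<lambda>k. expectation (\<lambda>\<omega>. u k (?D n \<omega>))) \<longlonglongrightarrow> expectation (\<lambda>\<omega>. indicator U (?D n \<omega>))"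
    using u U by (intro integral_dominated_convergence[where w="\<lambda>_. 1"]) (auto intro!: measurable_compose[OF _ meas(1)] measurable_compose[OF _ indU])
  have l3: "(\<lambda>k. expectation (\<lambda>\<omega>. v k (?D l \<omega>))) \<longlonglongrightarrow> expectation (\<lambda>\<omega>. indicator V (?D l \<omega>))"
    using v U by (intro integral_dominated_convergence[where w="\<lambda>_. 1"]) (auto intro!: measurable_compose[OF _ meas(2)] measurable_compose[OF _ indV])
  have "expectation (\<lambda>\<omega>. indicat_real A \<omega> * (indicat_real U (?D n \<omega>) * indicat_real V (?D l \<omega>)))
    = expectation (indicat_real A) * (expectation (\<lambda>\<omega>. indicat_real U (?D n \<omega>)) * expectation (\<lambda>\<omega>. indicat_real V (?D l \<omega>)))"
    using l1 tendsto_mult[OF tendsto_const tendsto_mult[OF l2 l3]] unfolding eq by (rule LIMSEQ_unique)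
  moreover have "expectation (\<lambda>\<omega>. indicat_real A \<omega> * (indicat_real U (?D n \<omega>) * indicat_real V (?D l \<omega>))) =
     prob (A \<inter> (?D n -` U \<inter> space M) \<inter> (?D l -` V \<inter> space M))"
  proof -
    have UV: "?D n -` U \<inter> space M \<in> sets M" "?D l -` V \<inter> space M \<in> sets M"
      using U by (auto intro!: measurable_sets[where A=borel])
    have "A \<inter> (?D n -` U \<inter> space M) \<inter> (?D l -` V \<inter> space M) \<in> sets M"
      by (rule sets.Int[OF sets.Int[OF AM UV(1)] UV(2)])
    then have "prob (A \<inter> (?D n -` U \<inter> space M) \<inter> (?D l -` V \<inter> space M)) = expectation (indicat_real (A \<inter> (?D n -` U \<inter> space M) \<inter> (?D l -` V \<inter> space M)))"
      by simp
    also have "\<dots> = expectation (\<lambda>\<omega>. indicat_real A \<omega> * (indicat_real U (?D n \<omega>) * indicat_real V (?D l \<omega>)))"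
      by (intro Bochner_Integration.integral_cong refl) (auto split: split_indicator)
    finally show ?thesis by (rule sym)
  qed
  moreover have "expectation (\<lambda>\<omega>. indicat_real B (?D i \<omega>)) = prob (?D i -` B \<inter> space M)" if "i \<in> {n, l}" "open B" for i B
  proof -
    have "?D i -` B \<inter> space M \<in> sets M" using that by (intro measurable_sets[where A=borel]) auto
    then have "prob (?D i -` B \<inter> space M) = expectation (indicat_real (?D i -` B \<inter> space M))" by simp
    also have "\<dots> = expectation (\<lambda>\<omega>. indicat_real B (?D i \<omega>))"
      by (intro Bochner_Integration.integral_cong refl) (auto split: split_indicator)
    finally show ?thesis by (rule sym)
  qed
  ultimately show ?thesis using U AM by simp
qed

text \<open>Preimages of open sets form an intersection-stable generator of the preimages of Borel
  sets, so the factorisation extends by the \<pi>-\<lambda> argument behind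
  \<open>indep_sets_sigma\<close>, applied to three families: the past and one for each
  increment.\<close>

lemma increments_prob_borel:
  assumes nl: "n \<ge> 1" "l \<ge> 1" "n \<noteq> l" and st: "0 \<le> s" "s < t" "t \<le> T"
    and A: "A \<in> sets (F s)" and B: "B1 \<in> sets borel" "B2 \<in> sets borel"
  shows "prob (A \<inter> ((\<lambda>\<omega>. W n \<omega> t - W n \<omega> s) -` B1 \<inter> space M) \<inter> ((\<lambda>\<omega>. W l \<omega> t - W l \<omega> s) -` B2 \<inter> space M)) =
    prob A * (prob ((\<lambda>\<omega>. W n \<omega> t - W n \<omega> s) -` B1 \<inter> space M) * prob ((\<lambda>\<omega>. W l \<omega> t - W l \<omega> s) -` B2 \<inter> space M))"
proof -
  let ?D = "\<lambda>i \<omega>. W i \<omega> t - W i \<omega> s"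
  have Dm: "?D n \<in> borel_measurable M" "?D l \<in> borel_measurable M"
    using nl st W_meas[of n] W_meas[of l] by auto
  have sA: "subalgebra M (F s)" using subalg st by auto
  define op where "op i = {?D i -` U \<inter> space M | U. open U}" for i
  have op_space: "space M \<in> op i" for i unfolding op_def by (auto intro!: exI[of _ UNIV])
  define E where "E = (\<lambda>i::nat. if i = 0 then sets (F s) else if i = 1 then op n else op l)"
  have spF: "space M \<in> sets (F s)" using sA by (metis sets.top subalgebra_def)
  have op_ev: "op n \<subseteq> events" "op l \<subseteq> events"
    unfolding op_def using Dm by (auto intro!: measurable_sets[where A=borel])
  have E_ev: "E i \<subseteq> events" for i using op_ev sA by (auto simp: E_def subalgebra_def)
  have "indep_sets E {0,1,2}"
  \<comment> \<open>All three families contain the whole space, so checking the product formula for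
    the full index set covers the smaller ones.\<close>
  proof (subst indep_sets_finite)
    show "\<forall>A\<in>Pi {0, 1, 2} E. prob (\<Inter> (A ` {0, 1, 2})) = (\<Prod>j\<in>{0, 1, 2}. prob (A j))"
    proof
      fix C assume C: "C \<in> Pi {0, 1, 2} E"
      then obtain U V where "C 0 \<in> sets (F s)" "open U" "C 1 = ?D n -` U \<inter> space M" "open V" "C 2 = ?D l -` V \<inter> space M"
        by (auto simp: E_def op_def Pi_iff)
      then show "prob (\<Inter> (C ` {0, 1, 2})) = (\<Prod>j\<in>{0, 1, 2}. prob (C j))"
        using increments_prob_open[OF nl st, of "C 0" U V] by (simp add: Int_assoc)
    qed
    show "space M \<in> E i" if "i \<in> {0,1,2}" for i using op_space spF by (simp add: E_def)
  qed (use E_ev in auto)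
  then have "indep_sets (\<lambda>i. sigma_sets (space M) (E i)) {0,1,2}"
  proof (rule indep_sets_sigma)
    fix i :: nat
    show "Int_stable (E i)"
      unfolding E_def op_def Int_stable_def
      by (auto intro: sets.Int) (metis open_Int vimage_Int Int_assoc Int_left_commute Int_left_absorb Int_commute)+
  qed
  then have ind: "indep_sets (\<lambda>i. sigma_sets (space M) (E i)) {0,1,2}" .
  have op_sig: "?D i -` B \<inter> space M \<in> sigma_sets (space M) (op i)" if "B \<in> sets borel" for i B
  proof -
    have "sigma_sets (space M) {?D i -` C \<inter> space M | C. C \<in> {U. open U}} = {?D i -` C \<inter> space M | C. C \<in> sigma_sets UNIV {U. open U}}"
      by (rule sigma_sets_vimage_commute[symmetric]) auto
    then show ?thesis using that by (auto simp: op_def borel_def)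
  qed
  have "A \<in> sigma_sets (space M) (E 0)" "?D n -` B1 \<inter> space M \<in> sigma_sets (space M) (E 1)" "?D l -` B2 \<inter> space M \<in> sigma_sets (space M) (E 2)"
    using A B op_sig by (auto simp: E_def)
  then show ?thesis
    using indep_setsD[OF ind subset_refl, of "\<lambda>i. if i = 0 then A else if i = 1 then ?D n -` B1 \<inter> space M else ?D l -` B2 \<inter> space M"]
    by (simp add: Int_ac)
qed

text \<open>The joint independence in the form used by the Euler scheme. Taking the whole space as
  the past event gives the law of the pair; preimages of measurable rectangles then generate all
  events of the pair.\<close>

lemma distr_past_pair_increments:
  assumes nl: "n \<ge> 1" "l \<ge> 1" "n \<noteq> l" and st: "0 \<le> s" "s < t" "t \<le> T" and X: "X \<in> F s \<rightarrow>\<^sub>M S"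
  shows "distr M (S \<Otimes>\<^sub>M (borel \<Otimes>\<^sub>M borel)) (\<lambda>\<omega>. (X \<omega>, (W n \<omega> t - W n \<omega> s, W l \<omega> t - W l \<omega> s))) =
    distr M S X \<Otimes>\<^sub>M (distr M borel (\<lambda>\<omega>. W n \<omega> t - W n \<omega> s) \<Otimes>\<^sub>M distr M borel (\<lambda>\<omega>. W l \<omega> t - W l \<omega> s))"
proof -
  let ?D = "\<lambda>i \<omega>. W i \<omega> t - W i \<omega> s"
  let ?P = "\<lambda>\<omega>. (?D n \<omega>, ?D l \<omega>)"
  have Dm[measurable]: "?D n \<in> borel_measurable M" "?D l \<in> borel_measurable M"
    using nl st W_meas[of n] W_meas[of l] by auto
  have sA: "subalgebra M (F s)" using subalg st by auto
  define R where "R = {B1 \<times> B2 | (B1 :: (real^'d) set) (B2 :: (real^'d) set). B1 \<in> sets borel \<and> B2 \<in> sets borel}"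
  have spF: "space M \<in> sets (F s)" using sA by (metis sets.top subalgebra_def)
  have e: "?P -` (B1 \<times> B2) \<inter> space M = (?D n -` B1 \<inter> space M) \<inter> (?D l -` B2 \<inter> space M)" for B1 B2 by auto
  have prR: "prob (?P -` (B1 \<times> B2) \<inter> space M) = prob (?D n -` B1 \<inter> space M) * prob (?D l -` B2 \<inter> space M)"
    if "B1 \<in> sets borel" "B2 \<in> sets borel" for B1 B2
    unfolding e using increments_prob_borel[OF nl st spF that] by (simp add: prob_space Int_absorb1 Int_assoc inf_left_commute)
  have eqD: "distr M (borel \<Otimes>\<^sub>M borel) ?P = distr M borel (?D n) \<Otimes>\<^sub>M distr M borel (?D l)"
  proof (rule pair_measure_eqI[symmetric])
    interpret n: prob_space "distr M borel (?D n)" by (rule prob_space_distr) simp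
    interpret l: prob_space "distr M borel (?D l)" by (rule prob_space_distr) simp
    show "sigma_finite_measure (distr M borel (?D n))" "sigma_finite_measure (distr M borel (?D l))" ..
    fix A B assume "A \<in> sets (distr M borel (?D n))" "B \<in> sets (distr M borel (?D l))"
    then have AB: "A \<in> sets borel" "B \<in> sets borel" by auto
    have "emeasure (distr M (borel \<Otimes>\<^sub>M borel) ?P) (A \<times> B) = emeasure M (?P -` (A \<times> B) \<inter> space M)"
      using AB by (intro emeasure_distr) auto
    also have "\<dots> = ennreal (prob (?D n -` A \<inter> space M) * prob (?D l -` B \<inter> space M))"
      by (simp only: emeasure_eq_measure prR[OF AB])
    also have "\<dots> = emeasure (distr M borel (?D n)) A * emeasure (distr M borel (?D l)) B"
      using AB by (simp add: emeasure_distr emeasure_eq_measure ennreal_mult)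
    finally show "emeasure (distr M borel (?D n)) A * emeasure (distr M borel (?D l)) B = emeasure (distr M (borel \<Otimes>\<^sub>M borel) ?P) (A \<times> B)"
      by (rule sym)
  qed (simp cong: sets_pair_measure_cong)
  have "indep_set (sigma_sets (space M) (sets (F s))) (sigma_sets (space M) {?P -` C \<inter> space M | C. C \<in> R})"
  proof (rule indep_set_sigma_sets)
    show "indep_set (sets (F s)) {?P -` C \<inter> space M | C. C \<in> R}"
    proof (rule indep_setI)
      show "sets (F s) \<subseteq> events" using sA by (simp add: subalgebra_def)
      show "{?P -` C \<inter> space M | C. C \<in> R} \<subseteq> events"
        by (auto simp: R_def intro!: measurable_sets[of ?P M "borel \<Otimes>\<^sub>M borel"])
      fix A C assume A: "A \<in> sets (F s)" and "C \<in> {?P -` C \<inter> space M | C. C \<in> R}"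
      then obtain B1 B2 where B: "C = ?P -` (B1 \<times> B2) \<inter> space M" "B1 \<in> sets borel" "B2 \<in> sets borel"
        by (auto simp: R_def)
      then show "prob (A \<inter> C) = prob A * prob C"
        using increments_prob_borel[OF nl st A B(2,3)] prR[OF B(2,3)] unfolding e by (simp only: B(1) e Int_assoc)
    qed
    show "Int_stable (sets (F s))" by (rule sets.Int_stable)
    show "Int_stable {?P -` C \<inter> space M | C. C \<in> R}"
    proof (rule Int_stableI)
      fix a b assume "a \<in> {?P -` C \<inter> space M | C. C \<in> R}" "b \<in> {?P -` C \<inter> space M | C. C \<in> R}"
      then obtain a1 a2 b1 b2 where *: "a = ?P -` (a1 \<times> a2) \<inter> space M" "b = ?P -` (b1 \<times> b2) \<inter> space M"
        "a1 \<in> sets borel" "a2 \<in> sets borel" "b1 \<in> sets borel" "b2 \<in> sets borel" unfolding R_def by auto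
      then have "a \<inter> b = ?P -` ((a1 \<inter> b1) \<times> (a2 \<inter> b2)) \<inter> space M" by auto
      moreover have "(a1 \<inter> b1) \<times> (a2 \<inter> b2) \<in> R" using * unfolding R_def by blast
      ultimately show "a \<inter> b \<in> {?P -` C \<inter> space M | C. C \<in> R}" by blast
    qed
  qed
  moreover have "sigma_sets (space M) (sets (F s)) = sets (F s)"
    using sA by (metis sets.sigma_sets_eq subalgebra_def)
  moreover have "sigma_sets (space M) {?P -` C \<inter> space M | C. C \<in> R} = {?P -` C \<inter> space M | C. C \<in> sets (borel \<Otimes>\<^sub>M borel)}"
  proof -
    have "sets (borel \<Otimes>\<^sub>M borel :: ((real^'d) \<times> (real^'d)) measure) = sigma_sets UNIV R"
      by (simp add: sets_pair_measure R_def)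
    then show ?thesis using sigma_sets_vimage_commute[of ?P "space M" UNIV R] by auto
  qed
  ultimately have "indep_set (sets (F s)) {?P -` C \<inter> space M | C. C \<in> sets (borel \<Otimes>\<^sub>M borel)}" by simp
  from distr_pair_of_indep_set[OF sA X _ this] show ?thesis by (simp add: eqD)
qed

end

section \<open>Moments of the limit system\<close>

text \<open>The fundamental theorem of calculus for the gauge integral holds for every derivative,
  so no measurability of \<open>y'\<close> has to be supplied; in the application it contains
  \<open>u\<close> along a flow of measures. Only the majorant is integrated in the sense of
  Lebesgue.\<close>

lemma ode_norm_bound:
  fixes y :: "real \<Rightarrow> 'b::euclidean_space"
  assumes der: "\<And>t. t \<in> {0..T} \<Longrightarrow> (y has_vector_derivative y' t) (at t within {0..T})"
    and le: "\<And>s. s \<in> {0..T} \<Longrightarrow> norm (y' s) \<le> b s"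
    and b: "set_integrable lborel {0..T} b" and t: "t \<in> {0..T}"
  shows "norm (y t - y 0) \<le> (LINT s:{0..t}|lborel. b s)"
proof -
  have hi: "(y' has_integral (y t - y 0)) {0..t}"
    using t by (intro fundamental_theorem_of_calculus has_vector_derivative_within_subset[OF der]) auto
  have b': "set_integrable lborel {0..t} b" by (rule set_integrable_Icc_subset[OF b]) (use t in auto)
  have "norm (integral {0..t} y') \<le> integral {0..t} b"
    using hi le t set_borel_integral_eq_integral(1)[OF b'] by (intro integral_norm_bound_integral) auto
  then show ?thesis
    using hi set_borel_integral_eq_integral(2)[OF b'] by (simp add: integral_unique)
qed

text \<open>Joint measurability together with a bound of the means uniform on the interval gives
  integrability over the product. The four conclusions are the shapes in which Fubini's theorem is
  applied to moments of paths.\<close>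

lemma (in prob_space) fubini_path:
  fixes f :: "real \<Rightarrow> 'a \<Rightarrow> real"
  assumes meas: "(\<lambda>(s, \<omega>). f s \<omega>) \<in> borel_measurable (borel \<Otimes>\<^sub>M M)"
    and nonneg: "\<And>s \<omega>. 0 \<le> f s \<omega>"
    and bnd: "\<And>s. s \<in> {a..b} \<Longrightarrow> integrable M (f s) \<and> expectation (f s) \<le> C"
  shows "integrable M (\<lambda>\<omega>. LINT s:{a..b}|lborel. f s \<omega>)"
    and "expectation (\<lambda>\<omega>. LINT s:{a..b}|lborel. f s \<omega>) = (LINT s:{a..b}|lborel. expectation (f s))"
    and "AE \<omega> in M. set_integrable lborel {a..b} (\<lambda>s. f s \<omega>)"
    and "(\<lambda>s. expectation (f s)) \<in> borel_measurable borel"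
proof -
  interpret P: pair_sigma_finite lborel M ..
  have m[measurable]: "(\<lambda>z. f (fst z) (snd z)) \<in> borel_measurable (borel \<Otimes>\<^sub>M M)"
    using meas by (simp add: case_prod_beta)
  show "(\<lambda>s. expectation (f s)) \<in> borel_measurable borel"
    using borel_measurable_lebesgue_integral[of f borel] meas by simp
  define h where "h z = indicator {a..b} (fst z) *\<^sub>R f (fst z) (snd z)" for z
  have hm: "h \<in> borel_measurable (lborel \<Otimes>\<^sub>M M)"
    unfolding h_def by (measurable; simp cong: measurable_cong_sets sets_pair_measure_cong)
  have hint: "integrable (lborel \<Otimes>\<^sub>M M) h"
  proof (rule P.Fubini_integrable[OF hm])
    have e: "expectation (\<lambda>\<omega>. norm (h (s, \<omega>))) = indicator {a..b} s *\<^sub>R expectation (f s)" for s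
      using nonneg by (simp add: h_def abs_mult)
    have "set_integrable lborel {a..b} (\<lambda>s. expectation (f s))"
      using bnd nonneg borel_measurable_lebesgue_integral[of f borel] meas
      by (intro set_integrable_bounded_Icc[where B=C]) (auto simp: abs_le_iff intro: order_trans[of _ 0] order_trans[OF _ Bochner_Integration.integral_nonneg])
    then show "integrable lborel (\<lambda>s. expectation (\<lambda>\<omega>. norm (h (s, \<omega>))))"
      unfolding e by (simp add: set_integrable_def)
    show "AE s in lborel. integrable M (\<lambda>\<omega>. h (s, \<omega>))"
    proof (intro AE_I2)
      fix s
      show "integrable M (\<lambda>\<omega>. h (s, \<omega>))"
        using bnd[of s] by (cases "s \<in> {a..b}") (auto simp: h_def)
    qed
  qed
  have hint': "integrable (lborel \<Otimes>\<^sub>M M) (\<lambda>(s, \<omega>). h (s, \<omega>))" using hint by simp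
  show "integrable M (\<lambda>\<omega>. LINT s:{a..b}|lborel. f s \<omega>)"
    using P.integrable_snd[OF hint'] by (simp add: h_def set_lebesgue_integral_def)
  show "AE \<omega> in M. set_integrable lborel {a..b} (\<lambda>s. f s \<omega>)"
    using P.AE_integrable_snd[OF hint'] by (simp add: h_def set_integrable_def)
  show "expectation (\<lambda>\<omega>. LINT s:{a..b}|lborel. f s \<omega>) = (LINT s:{a..b}|lborel. expectation (f s))"
    using P.Fubini_integral[OF hint'] by (simp add: h_def set_lebesgue_integral_def)
qed

text \<open>Cauchy-Schwarz, obtained by integrating the square of \<open>f\<close> minus its mean
  over [0,T].\<close>

lemma square_set_lint_le:
  fixes f :: "real \<Rightarrow> real"
  assumes f: "continuous_on {0..T} f" and T: "T > 0"
  shows "(LINT s:{0..T}|lborel. f s)\<^sup>2 \<le> T * (LINT s:{0..T}|lborel. (f s)\<^sup>2)"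
proof -
  let ?I = "LINT s:{0..T}|lborel. f s"
  let ?a = "?I / T"
  have i: "set_integrable lborel {0..T} f" "set_integrable lborel {0..T} (\<lambda>s. (f s)\<^sup>2)"
    "set_integrable lborel {0..T} (\<lambda>s. ?a\<^sup>2)" "set_integrable lborel {0..T} (\<lambda>s. 2 * ?a * f s)"
    using f T by (auto intro!: borel_integrable_atLeastAtMost' continuous_intros)
  have "0 \<le> (LINT s:{0..T}|lborel. (f s - ?a)\<^sup>2)"
    unfolding set_lebesgue_integral_def by (intro Bochner_Integration.integral_nonneg) auto
  also have "\<dots> = (LINT s:{0..T}|lborel. ((f s)\<^sup>2 + ?a\<^sup>2) - 2 * ?a * f s)"
    by (simp add: power2_diff mult_ac)
  also have "\<dots> = (LINT s:{0..T}|lborel. (f s)\<^sup>2) + ?a\<^sup>2 * T - 2 * ?a * ?I"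
    using i set_lint_const_Icc[of 0 T "?a\<^sup>2"] T by (subst set_integral_diff; (subst set_integral_add)?) (auto intro!: set_integral_add)
  finally have "0 \<le> (LINT s:{0..T}|lborel. (f s)\<^sup>2) + ?a\<^sup>2 * T - 2 * ?a * ?I" .
  moreover have "?a\<^sup>2 * T = ?I\<^sup>2 / T" "2 * ?a * ?I = 2 * (?I\<^sup>2 / T)"
    using T by (simp_all add: power2_eq_square)
  ultimately have "?I\<^sup>2 / T \<le> (LINT s:{0..T}|lborel. (f s)\<^sup>2)" by linarith
  then show ?thesis using T by (simp add: pos_divide_le_eq mult.commute)
qed

context brownian_family begin

text \<open>\<open>w\<close> is a version of the time integral of |W|. Since paths are continuous
  only almost surely, they are replaced by 0 on a null set before joint measurability is claimed.
  The bound of the second moment is \<open>T\<close> from Cauchy-Schwarz, times \<open>T\<close> for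
  the length of the interval, times the bound d T for the second moment at one time.\<close>

lemma brownian_path_integral:
  assumes n: "n \<ge> 1" and T: "T > 0"
  obtains w where "integrable M w" "integrable M (\<lambda>\<omega>. (w \<omega>)\<^sup>2)"
    "expectation w \<le> T * sqrt (real CARD('d) * T)" "expectation (\<lambda>\<omega>. (w \<omega>)\<^sup>2) \<le> real CARD('d) * T ^ 3"
    "AE \<omega> in M. continuous_on {0..T} (W n \<omega>) \<and> w \<omega> = (LINT s:{0..T}|lborel. norm (W n \<omega> s))"
    "\<And>\<omega>. 0 \<le> w \<omega>"
proof -
  have b: "brownian_motion M F T (W n)" by (rule bm[OF n])
  have W0: "AE \<omega> in M. W n \<omega> 0 = 0" and Wc: "AE \<omega> in M. continuous_on {0..T} (W n \<omega>)"
    using b by (auto simp: brownian_motion_def)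
  from AE_conjI[OF this] obtain N where N: "{\<omega> \<in> space M. \<not> (W n \<omega> 0 = 0 \<and> continuous_on {0..T} (W n \<omega>))} \<subseteq> N" "emeasure M N = 0" "N \<in> sets M"
    by (rule AE_E)
  define W' where "W' s \<omega> = (if \<omega> \<in> N then 0 else W n \<omega> (clamp0 T s))" for s \<omega>
  have good: "AE \<omega> in M. \<omega> \<notin> N" using N by (intro AE_not_in) (auto simp: null_sets_def)
  have W'_eq: "W' s \<omega> = W n \<omega> s" if "\<omega> \<notin> N" "s \<in> {0..T}" for s \<omega> using that by (simp add: W'_def)
  have W'_cont: "continuous_on UNIV (\<lambda>s. W' s \<omega>)" if "\<omega> \<in> space M" for \<omega>
    using N(1) that T by (cases "\<omega> \<in> N") (auto simp: W'_def intro!: continuous_on_clamp0)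
  have [measurable]: "W' s \<in> borel_measurable M" for s
    unfolding W'_def using N(3) W_meas[OF n, of "clamp0 T s"] T by (intro measurable_If_set) auto
  have pair: "(\<lambda>(s, \<omega>). W' s \<omega>) \<in> borel_measurable (borel \<Otimes>\<^sub>M M)"
    by (rule borel_measurable_pair_continuous) (use W'_cont in auto)
  have sq_ae: "AE \<omega> in M. norm (W' s \<omega>) = norm (W n \<omega> s - W n \<omega> 0)" if "s \<in> {0..T}" for s
    using good W0 by eventually_elim (simp add: W'_eq[OF _ that])
  have m1: "integrable M (\<lambda>\<omega>. norm (W' s \<omega>)) \<and> expectation (\<lambda>\<omega>. norm (W' s \<omega>)) \<le> sqrt (real CARD('d) * T)" if s: "s \<in> {0..T}" for s
  proof -
    note f = brownian_increment_first_moment[OF prob_space_axioms b filt, of 0 s]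
    have "integrable M (\<lambda>\<omega>. norm (W' s \<omega>))"
      using f(1) s sq_ae[OF s] W_meas[OF n] by (subst integrable_cong_AE[where g="\<lambda>\<omega>. norm (W n \<omega> s - W n \<omega> 0)"]) auto
    moreover have "expectation (\<lambda>\<omega>. norm (W' s \<omega>)) = expectation (\<lambda>\<omega>. norm (W n \<omega> s - W n \<omega> 0))"
      using s sq_ae[OF s] W_meas[OF n] T by (intro integral_cong_AE) auto
    moreover have "expectation (\<lambda>\<omega>. norm (W n \<omega> s - W n \<omega> 0)) \<le> sqrt (real CARD('d) * T)"
      using s by (intro order_trans[OF f(2)] real_sqrt_le_mono mult_left_mono) auto
    ultimately show ?thesis by simp
  qed
  have m2: "integrable M (\<lambda>\<omega>. (norm (W' s \<omega>))\<^sup>2) \<and> expectation (\<lambda>\<omega>. (norm (W' s \<omega>))\<^sup>2) \<le> real CARD('d) * T" if s: "s \<in> {0..T}" for s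
  proof -
    note f = brownian_increment_second_moment[OF b filt, of 0 s]
    have ae: "AE \<omega> in M. (norm (W' s \<omega>))\<^sup>2 = (norm (W n \<omega> s - W n \<omega> 0))\<^sup>2" using sq_ae[OF s] by eventually_elim simp
    have "integrable M (\<lambda>\<omega>. (norm (W' s \<omega>))\<^sup>2)"
      using f(1) s ae W_meas[OF n] by (subst integrable_cong_AE[where g="\<lambda>\<omega>. (norm (W n \<omega> s - W n \<omega> 0))\<^sup>2"]) auto
    moreover have "expectation (\<lambda>\<omega>. (norm (W' s \<omega>))\<^sup>2) = expectation (\<lambda>\<omega>. (norm (W n \<omega> s - W n \<omega> 0))\<^sup>2)"
      using s ae W_meas[OF n] T by (intro integral_cong_AE) auto
    ultimately show ?thesis using f(2) s by (simp add: mult_left_mono)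
  qed
  have p1: "(\<lambda>(s, \<omega>). norm (W' s \<omega>)) \<in> borel_measurable (borel \<Otimes>\<^sub>M M)"
    and p2: "(\<lambda>(s, \<omega>). (norm (W' s \<omega>))\<^sup>2) \<in> borel_measurable (borel \<Otimes>\<^sub>M M)"
    using pair by (simp_all add: case_prod_beta)
  note f1 = fubini_path[OF p1 norm_ge_zero m1] and f2 = fubini_path[OF p2 zero_le_power2 m2]
  define w where "w \<omega> = (LINT s:{0..T}|lborel. norm (W' s \<omega>))" for \<omega>
  have w0: "0 \<le> w \<omega>" for \<omega> unfolding w_def set_lebesgue_integral_def by (intro Bochner_Integration.integral_nonneg) auto
  have w_int: "integrable M w" unfolding w_def using f1(1) by simp
  have w_sq: "(w \<omega>)\<^sup>2 \<le> T * (LINT s:{0..T}|lborel. (norm (W' s \<omega>))\<^sup>2)" if "\<omega> \<in> space M" for \<omega>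
    unfolding w_def using T continuous_on_subset[OF W'_cont[OF that]]
    by (intro square_set_lint_le continuous_intros) auto
  have w2_int: "integrable M (\<lambda>\<omega>. (w \<omega>)\<^sup>2)"
  proof (rule Bochner_Integration.integrable_bound)
    show "integrable M (\<lambda>\<omega>. T * (LINT s:{0..T}|lborel. (norm (W' s \<omega>))\<^sup>2))" using f2(1) by (intro integrable_mult_right) simp
    show "AE \<omega> in M. norm ((w \<omega>)\<^sup>2) \<le> norm (T * (LINT s:{0..T}|lborel. (norm (W' s \<omega>))\<^sup>2))"
      using order_trans[OF w_sq abs_ge_self] by (intro AE_I2) simp
  qed (use w_int in measurable)
  have le: "(LINT s:{0..T}|lborel. g s) \<le> c * T" if "g \<in> borel_measurable borel" "\<And>s. s \<in> {0..T} \<Longrightarrow> 0 \<le> g s \<and> g s \<le> c" for g :: "real \<Rightarrow> real" and c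
  proof -
    have "(LINT s:{0..T}|lborel. g s) \<le> (LINT s:{0..T}|lborel. c)"
    proof (rule set_integral_mono)
      show "set_integrable lborel {0..T} g"
        by (rule set_integrable_bounded_Icc[OF that(1), of _ _ c]) (use that(2) in fastforce)
      show "set_integrable lborel {0..T} (\<lambda>s. c)" by (rule set_integrable_bounded_Icc[of _ _ _ "\<bar>c\<bar>"]) auto
    qed (use that in auto)
    then show ?thesis using T set_lint_const_Icc[of 0 T c] by simp
  qed
  show ?thesis
  proof (rule that[OF w_int w2_int])
    have "expectation w = (LINT s:{0..T}|lborel. expectation (\<lambda>\<omega>. norm (W' s \<omega>)))" unfolding w_def using f1(2) by simp
    also have "\<dots> \<le> sqrt (real CARD('d) * T) * T" using f1(4)[of 0 0] m1 T by (intro le) auto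
    finally show "expectation w \<le> T * sqrt (real CARD('d) * T)" by (simp add: mult.commute)
    have "expectation (\<lambda>\<omega>. (w \<omega>)\<^sup>2) \<le> expectation (\<lambda>\<omega>. T * (LINT s:{0..T}|lborel. (norm (W' s \<omega>))\<^sup>2))"
      using w_sq w2_int f2(1) by (intro integral_mono) auto
    also have "\<dots> = T * (LINT s:{0..T}|lborel. expectation (\<lambda>\<omega>. (norm (W' s \<omega>))\<^sup>2))" using f2(2) by simp
    also have "\<dots> \<le> T * (real CARD('d) * T * T)" using f2(4)[of 0 0] m2 T by (intro mult_left_mono le) auto
    finally show "expectation (\<lambda>\<omega>. (w \<omega>)\<^sup>2) \<le> real CARD('d) * T ^ 3" by (simp add: power3_eq_cube mult_ac)
    show "AE \<omega> in M. continuous_on {0..T} (W n \<omega>) \<and> w \<omega> = (LINT s:{0..T}|lborel. norm (W n \<omega> s))"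
      using good AE_space
    proof eventually_elim
      case (elim \<omega>)
      then show ?case using N(1) W'_eq[of \<omega>] unfolding w_def
        by (auto intro!: set_lebesgue_integral_cong)
    qed
  qed (rule w0)
qed

end

text \<open>Collects the data that do not refer to a probability space. Constants defined in this
  locale may be chosen before the space and the processes, as the order of quantifiers in the
  theorem demands.\<close>

locale interaction =
  fixes T \<sigma> L :: real and m :: nat
    and H1 H2 K1 K2 :: "real^'d \<Rightarrow> real^'d"
    and u :: "(real^'d) measure \<Rightarrow> real^'d"
    and Y0 :: "nat \<Rightarrow> real^'d"
    and \<nu> :: "(real^'d) measure"
  assumes T: "T > 0" and \<sigma>: "\<sigma> > 0" and m: "m \<ge> 1" and L: "L > 0"
    and H1: "\<And>x y. norm (H1 x - H1 y) \<le> L * norm (x - y)"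
    and H2: "\<And>x y. norm (H2 x - H2 y) \<le> L * norm (x - y)"
    and K1: "\<And>x y. norm (K1 x - K1 y) \<le> L * norm (x - y)"
    and K2: "\<And>x y. norm (K2 x - K2 y) \<le> L * norm (x - y)"
    and u: "\<And>\<mu> \<mu>'. \<mu> \<in> W1_space \<Longrightarrow> \<mu>' \<in> W1_space \<Longrightarrow> norm (u \<mu> - u \<mu>') \<le> L * wasserstein1 \<mu> \<mu>'"
    and \<nu>: "\<nu> \<in> W1_space"
begin

lemma T0 [simp]: "0 \<le> T" and L0 [simp]: "0 \<le> L"
  using T L by simp_all

definition avg :: "(nat \<Rightarrow> 'b::real_vector) \<Rightarrow> 'b" where
  "avg f = (1 / real m) *\<^sub>R (\<Sum>j=1..m. f j)"

lemma avg_diff: "avg f - avg g = avg (\<lambda>j. f j - g j)"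
  by (simp add: avg_def sum_subtractf scaleR_diff_right)

lemma norm_avg_le:
  fixes f :: "nat \<Rightarrow> 'b::real_normed_vector"
  assumes "\<And>j. j \<in> {1..m} \<Longrightarrow> norm (f j) \<le> g j"
  shows "norm (avg f) \<le> avg g"
proof -
  have "norm (\<Sum>j=1..m. f j) \<le> (\<Sum>j=1..m. g j)" using assms by (intro sum_norm_le) auto
  then show ?thesis unfolding avg_def norm_scaleR real_scaleR_def by (intro mult_mono) auto
qed

lemma avg_mono: "(\<And>j. j \<in> {1..m} \<Longrightarrow> f j \<le> g j) \<Longrightarrow> avg f \<le> (avg g :: real)"
  unfolding avg_def real_scaleR_def by (intro mult_left_mono sum_mono) auto

lemma avg_const: "avg (\<lambda>j. c) = (c :: real)"
  using m by (simp add: avg_def)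

lemma avg_le_sum:
  assumes "\<And>j. j \<in> {1..m} \<Longrightarrow> 0 \<le> f j"
  shows "avg f \<le> (\<Sum>j=1..m. f j :: real)"
proof -
  have "(1 / real m) * (\<Sum>j=1..m. f j) \<le> 1 * (\<Sum>j=1..m. f j)"
    using m assms by (intro mult_right_mono sum_nonneg) auto
  then show ?thesis by (simp add: avg_def)
qed

text \<open>The constant of Gronwall's inequality with a variable right-hand side.\<close>
definition cG :: real where "cG = 1 + 4 * L * exp (4 * L * T) * (T + 1)"

end

text \<open>Each copy solves the limit system with its own law in the mean-field term; only
  \<open>Yb\<close> is shared. That all copies have the same marginals is established later, through
  the Euler scheme.\<close>

locale limit_family =
  interaction T \<sigma> L m H1 H2 K1 K2 u Y0 \<nu> + brownian_family M F T W
  for T \<sigma> L :: real and m :: nat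
    and H1 H2 K1 K2 :: "real^'d \<Rightarrow> real^'d"
    and u :: "(real^'d) measure \<Rightarrow> real^'d"
    and Y0 :: "nat \<Rightarrow> real^'d"
    and \<nu> :: "(real^'d) measure"
    and M :: "'a measure" and F and W :: "nat \<Rightarrow> 'a \<Rightarrow> real \<Rightarrow> real^'d" +
  fixes X0 :: "nat \<Rightarrow> 'a \<Rightarrow> real^'d" and Xb :: "nat \<Rightarrow> 'a \<Rightarrow> real \<Rightarrow> real^'d" and Yb :: "nat \<Rightarrow> real \<Rightarrow> real^'d"
  assumes X0_meas: "\<And>n. n \<ge> 1 \<Longrightarrow> X0 n \<in> borel_measurable (F 0)"
    and X0_indep: "indep_vars (\<lambda>_. borel) X0 {1..}"
    and X0_law: "\<And>n. n \<ge> 1 \<Longrightarrow> distr M borel (X0 n) = \<nu>"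
    and lim: "\<And>n. n \<ge> 1 \<Longrightarrow> limit_solution M T \<sigma> m H1 H2 K1 K2 u (X0 n) Y0 (W n) (Xb n) Yb"
begin

definition k :: "nat \<Rightarrow> real \<Rightarrow> real" where
  "k n s = expectation (\<lambda>\<omega>. norm (Xb n \<omega> (clamp0 T s)))"

definition cH :: "nat \<Rightarrow> real \<Rightarrow> real^'d \<Rightarrow> real^'d" where
  "cH n t = conv H1 (marginal M T (Xb n) t)"

definition drift :: "nat \<Rightarrow> 'a \<Rightarrow> real \<Rightarrow> real^'d" where
  "drift n \<omega> s = cH n s (Xb n \<omega> s) + avg (\<lambda>j. K1 (Yb j s - Xb n \<omega> s))"

lemma X0M: "n \<ge> 1 \<Longrightarrow> X0 n \<in> borel_measurable M"
  using X0_meas subalg[of 0] by (auto intro: measurable_from_subalg)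

lemma Xb_path: "n \<ge> 1 \<Longrightarrow> Xb n \<in> M \<rightarrow>\<^sub>M path_space T"
  using lim by (simp add: limit_solution_def)

lemma Xb_meas: "n \<ge> 1 \<Longrightarrow> t \<in> {0..T} \<Longrightarrow> (\<lambda>\<omega>. Xb n \<omega> t) \<in> borel_measurable M"
  using measurable_path_eval[OF Xb_path] .

lemma Xb_cont: "n \<ge> 1 \<Longrightarrow> \<omega> \<in> space M \<Longrightarrow> continuous_on {0..T} (Xb n \<omega>)"
  using continuous_on_path[OF Xb_path] .

lemma Xb_pair: "n \<ge> 1 \<Longrightarrow> (\<lambda>(s, \<omega>). Xb n \<omega> (clamp0 T s)) \<in> borel_measurable (borel \<Otimes>\<^sub>M M)"
  using measurable_path_pair[OF Xb_path T0] .

lemma Yb_cont: "i \<in> {1..m} \<Longrightarrow> continuous_on {0..T} (Yb i)"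
  using lim[of 1] by (auto simp: limit_solution_def space_path_space)

lemma marg: "n \<ge> 1 \<Longrightarrow> t \<in> {0..T} \<Longrightarrow> marginal M T (Xb n) t = distr M borel (\<lambda>\<omega>. Xb n \<omega> t)"
  using marginal_eq_distr[OF Xb_path] .

lemma marg_W1: "n \<ge> 1 \<Longrightarrow> t \<in> {0..T} \<Longrightarrow> marginal M T (Xb n) t \<in> W1_space"
  using lim by (auto simp: limit_solution_def)

lemma Xb_int: "n \<ge> 1 \<Longrightarrow> t \<in> {0..T} \<Longrightarrow> integrable M (\<lambda>\<omega>. norm (Xb n \<omega> t))"
  using marg_W1[of n t] Xb_meas[of n t] by (simp add: marg W1_space_def integrable_distr_eq)

lemma marg_norm: "n \<ge> 1 \<Longrightarrow> t \<in> {0..T} \<Longrightarrow> integral\<^sup>L (marginal M T (Xb n) t) norm = k n t"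
  using Xb_meas[of n t] by (simp add: marg k_def integral_distr)

lemma X0_int: "n \<ge> 1 \<Longrightarrow> integrable M (\<lambda>\<omega>. norm (X0 n \<omega>))"
  and X0_expect: "n \<ge> 1 \<Longrightarrow> expectation (\<lambda>\<omega>. norm (X0 n \<omega>)) = integral\<^sup>L \<nu> norm"
proof -
  assume n: "n \<ge> 1"
  show "integrable M (\<lambda>\<omega>. norm (X0 n \<omega>))"
    using \<nu> X0M[OF n] unfolding X0_law[OF n, symmetric] W1_space_def by (simp add: integrable_distr_eq)
  show "expectation (\<lambda>\<omega>. norm (X0 n \<omega>)) = integral\<^sup>L \<nu> norm"
    unfolding X0_law[OF n, symmetric] using X0M[OF n] by (simp add: integral_distr)
qed

lemma conv_marg:
  assumes "n \<ge> 1" "t \<in> {0..T}" and lip: "\<And>x y. norm (h x - h y) \<le> L * norm (x - y)"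
  shows "integrable M (\<lambda>\<omega>. h (x - Xb n \<omega> t))"
    and "conv h (marginal M T (Xb n) t) x = expectation (\<lambda>\<omega>. h (x - Xb n \<omega> t))"
proof -
  note [measurable] = Xb_meas[OF assms(1,2)] borel_measurable_lipschitz(2)[OF lip]
  show "conv h (marginal M T (Xb n) t) x = expectation (\<lambda>\<omega>. h (x - Xb n \<omega> t))"
    unfolding conv_def marg[OF assms(1,2)] by (subst integral_distr) auto
  have "integrable M (\<lambda>\<omega>. norm (x - Xb n \<omega> t))"
    using Xb_int[OF assms(1,2)] by (intro integrable_norm Bochner_Integration.integrable_diff) (auto simp: integrable_norm_iff)
  then show "integrable M (\<lambda>\<omega>. h (x - Xb n \<omega> t))"
    by (intro integrable_lipschitz[OF _ _ _ lip]) (auto intro: finite_measure_axioms)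
qed

lemma conv_lipschitz:
  assumes "n \<ge> 1" "t \<in> {0..T}" and lip: "\<And>x y. norm (h x - h y) \<le> L * norm (x - y)"
  shows "norm (conv h (marginal M T (Xb n) t) x - conv h (marginal M T (Xb n) t) y) \<le> L * norm (x - y)"
proof -
  note c = conv_marg[OF assms(1,2) lip]
  have "norm (conv h (marginal M T (Xb n) t) x - conv h (marginal M T (Xb n) t) y)
    = norm (expectation (\<lambda>\<omega>. h (x - Xb n \<omega> t) - h (y - Xb n \<omega> t)))"
    unfolding c(2) using c(1) by simp
  also have "\<dots> \<le> expectation (\<lambda>\<omega>. norm (h (x - Xb n \<omega> t) - h (y - Xb n \<omega> t)))" by (rule integral_norm_bound)
  also have "\<dots> \<le> L * norm (x - y)"
  proof (rule integral_le_const)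
    show "integrable M (\<lambda>\<omega>. norm (h (x - Xb n \<omega> t) - h (y - Xb n \<omega> t)))" using c(1) by simp
    show "AE \<omega> in M. norm (h (x - Xb n \<omega> t) - h (y - Xb n \<omega> t)) \<le> L * norm (x - y)"
    proof (intro AE_I2)
      fix \<omega> show "norm (h (x - Xb n \<omega> t) - h (y - Xb n \<omega> t)) \<le> L * norm (x - y)"
        using lip[of "x - Xb n \<omega> t" "y - Xb n \<omega> t"] by simp
    qed
  qed
  finally show ?thesis .
qed

lemma conv_growth:
  assumes "n \<ge> 1" "t \<in> {0..T}" and lip: "\<And>x y. norm (h x - h y) \<le> L * norm (x - y)"
  shows "norm (conv h (marginal M T (Xb n) t) x) \<le> norm (h 0) + L * norm x + L * k n t"
proof -
  note c = conv_marg[OF assms(1,2) lip]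
  have "norm (conv h (marginal M T (Xb n) t) x) \<le> expectation (\<lambda>\<omega>. norm (h (x - Xb n \<omega> t)))"
    unfolding c(2) by (rule integral_norm_bound)
  also have "\<dots> \<le> expectation (\<lambda>\<omega>. (norm (h 0) + L * norm x) + L * norm (Xb n \<omega> t))"
  proof (rule integral_mono)
    fix \<omega>
    have "norm (h (x - Xb n \<omega> t)) \<le> norm (h 0) + L * norm (x - Xb n \<omega> t)" by (rule norm_lipschitz_growth[OF lip])
    also have "\<dots> \<le> norm (h 0) + L * (norm x + norm (Xb n \<omega> t))"
      using norm_triangle_ineq4 by (intro add_left_mono mult_left_mono) auto
    finally show "norm (h (x - Xb n \<omega> t)) \<le> (norm (h 0) + L * norm x) + L * norm (Xb n \<omega> t)" by (simp add: distrib_left)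
  qed (use c(1) Xb_int[OF assms(1,2)] in auto)
  also have "\<dots> = norm (h 0) + L * norm x + L * k n t"
    using Xb_int[OF assms(1,2)] assms(2) by (simp add: prob_space k_def)
  finally show ?thesis .
qed

lemma limit_equation:
  assumes "n \<ge> 1"
  shows "AE \<omega> in M. set_integrable lborel {0..T} (drift n \<omega>) \<and>
    (\<forall>t\<in>{0..T}. Xb n \<omega> t = X0 n \<omega> + set_lebesgue_integral lborel {0..t} (drift n \<omega>) + sqrt (2 * \<sigma>) *\<^sub>R W n \<omega> t)"
  using lim[OF assms] unfolding limit_solution_def solves_integral_eq_def drift_def[abs_def] cH_def avg_def by auto

definition ysum :: "real \<Rightarrow> real" where "ysum s = (\<Sum>j=1..m. norm (Yb j (clamp0 T s)))"

lemma norm_avg_K1_diff: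
  "norm (avg (\<lambda>j. K1 (y j - x)) - avg (\<lambda>j. K1 (y' j - x'))) \<le> L * avg (\<lambda>j. norm (y j - y' j)) + L * norm (x - x')"
proof -
  have "norm (avg (\<lambda>j. K1 (y j - x)) - avg (\<lambda>j. K1 (y' j - x'))) \<le> avg (\<lambda>j. L * norm (y j - y' j) + L * norm (x - x'))"
    unfolding avg_diff
  proof (rule norm_avg_le)
    fix j
    have "norm (K1 (y j - x) - K1 (y' j - x')) \<le> L * norm ((y j - y' j) - (x - x'))"
      using K1[of "y j - x" "y' j - x'"] by (simp add: algebra_simps)
    also have "\<dots> \<le> L * (norm (y j - y' j) + norm (x - x'))" by (intro mult_left_mono norm_triangle_ineq4) auto
    finally show "norm (K1 (y j - x) - K1 (y' j - x')) \<le> L * norm (y j - y' j) + L * norm (x - x')" by (simp add: distrib_left)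
  qed
  also have "\<dots> = L * avg (\<lambda>j. norm (y j - y' j)) + avg (\<lambda>j. L * norm (x - x'))"
    by (simp add: avg_def sum.distrib sum_distrib_left distrib_left mult_ac)
  finally show ?thesis by (simp add: avg_const)
qed

text \<open>Of the factor 2 L in front of |X|, one part comes from the convolution with
  \<open>H1\<close>, the other from \<open>K1\<close>.\<close>

lemma drift_growth:
  assumes n: "n \<ge> 1" and s: "s \<in> {0..T}"
  shows "norm (drift n \<omega> s) \<le> norm (H1 0) + norm (K1 0) + L * k n s + L * ysum s + 2 * L * norm (Xb n \<omega> s)"
proof -
  have "norm (avg (\<lambda>j. K1 (Yb j s - Xb n \<omega> s)) - avg (\<lambda>j. K1 (0 - 0))) \<le> L * avg (\<lambda>j. norm (Yb j s - 0)) + L * norm (Xb n \<omega> s - 0)"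
    by (rule norm_avg_K1_diff)
  moreover have "norm (avg (\<lambda>j. K1 (0 - 0))) \<le> norm (K1 0)" using norm_avg_le[of "\<lambda>j. K1 (0 - 0)" "\<lambda>j. norm (K1 0)"] by (simp add: avg_const)
  moreover have "avg (\<lambda>j. norm (Yb j s)) \<le> ysum s" unfolding ysum_def using s avg_le_sum[of "\<lambda>j. norm (Yb j s)"] by simp
  then have "L * avg (\<lambda>j. norm (Yb j s)) \<le> L * ysum s" by (intro mult_left_mono) auto
  moreover have "norm (avg (\<lambda>j. K1 (Yb j s - Xb n \<omega> s))) \<le> norm (avg (\<lambda>j. K1 (Yb j s - Xb n \<omega> s)) - avg (\<lambda>j. K1 (0 - 0))) + norm (avg (\<lambda>j. K1 (0 - 0)))"
    using norm_triangle_sub[of "avg (\<lambda>j. K1 (Yb j s - Xb n \<omega> s))" "avg (\<lambda>j. K1 (0 - 0))"] by linarith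
  ultimately have 1: "norm (avg (\<lambda>j. K1 (Yb j s - Xb n \<omega> s))) \<le> norm (K1 0) + L * ysum s + L * norm (Xb n \<omega> s)" by simp
  have "norm (drift n \<omega> s) \<le> norm (cH n s (Xb n \<omega> s)) + norm (avg (\<lambda>j. K1 (Yb j s - Xb n \<omega> s)))"
    unfolding drift_def by (rule norm_triangle_ineq)
  with 1 conv_growth[OF n s H1, of "Xb n \<omega> s"] show ?thesis unfolding cH_def by simp
qed

lemma drift_lipschitz:
  assumes n: "n \<ge> 1" and s: "s \<in> {0..T}"
  shows "norm (drift n \<omega> s - drift n \<omega>' s) \<le> 2 * L * norm (Xb n \<omega> s - Xb n \<omega>' s)"
proof -
  have "norm (drift n \<omega> s - drift n \<omega>' s) \<le> norm (cH n s (Xb n \<omega> s) - cH n s (Xb n \<omega>' s))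
     + norm (avg (\<lambda>j. K1 (Yb j s - Xb n \<omega> s)) - avg (\<lambda>j. K1 (Yb j s - Xb n \<omega>' s)))"
    unfolding drift_def by (rule norm_diff_triangle_ineq)
  also have "\<dots> \<le> L * norm (Xb n \<omega> s - Xb n \<omega>' s) + (L * avg (\<lambda>j. norm (Yb j s - Yb j s)) + L * norm (Xb n \<omega> s - Xb n \<omega>' s))"
    unfolding cH_def by (intro add_mono conv_lipschitz[OF n s H1] norm_avg_K1_diff)
  finally show ?thesis by (simp add: avg_const)
qed

text \<open>Gronwall's inequality with the initial datum and the noise as inhomogeneity;
  \<open>w\<close> is the time integral of |W| produced by its variable version. The function
  \<open>q\<close> is left open, as the drift is dominated first with the help of a reference path
  and later by a constant.\<close>

lemma path_bound:
  assumes n: "n \<ge> 1" and q: "set_integrable lborel {0..T} q" "\<And>s. s \<in> {0..T} \<Longrightarrow> 0 \<le> q s"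
    and le: "\<And>\<omega> s. \<omega> \<in> space M \<Longrightarrow> s \<in> {0..T} \<Longrightarrow> norm (drift n \<omega> s) \<le> q s + 2 * L * norm (Xb n \<omega> s)"
    and w: "AE \<omega> in M. continuous_on {0..T} (W n \<omega>) \<and> w \<omega> = (LINT s:{0..T}|lborel. norm (W n \<omega> s))"
  shows "AE \<omega> in M. \<forall>t\<in>{0..T}. norm (Xb n \<omega> t) \<le>
    cG * (norm (X0 n \<omega>) + (LINT s:{0..T}|lborel. q s) + sqrt (2 * \<sigma>) * (norm (W n \<omega> t) + w \<omega>))"
  using limit_equation[OF n] w AE_space
proof eventually_elim
  case (elim \<omega>)
  define Q where "Q = (LINT s:{0..T}|lborel. q s)"
  define \<sigma>' where "\<sigma>' = sqrt (2 * \<sigma>)"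
  define g where "g t = norm (X0 n \<omega>) + Q + \<sigma>' * norm (W n \<omega> t)" for t
  have \<sigma>'0: "0 \<le> \<sigma>'" using \<sigma> by (simp add: \<sigma>'_def)
  have Q0: "0 \<le> Q" unfolding Q_def set_lebesgue_integral_def
    using q by (intro Bochner_Integration.integral_nonneg) (auto split: split_indicator)
  have Wc: "continuous_on {0..T} (W n \<omega>)" and weq: "w \<omega> = (LINT s:{0..T}|lborel. norm (W n \<omega> s))" using elim by auto
  have Xc: "continuous_on {0..T} (Xb n \<omega>)" using Xb_cont[OF n] elim by auto
  have w0: "0 \<le> w \<omega>" unfolding weq set_lebesgue_integral_def by (intro Bochner_Integration.integral_nonneg) auto
  have gi: "(LINT s:{0..T}|lborel. g s) = (norm (X0 n \<omega>) + Q) * T + \<sigma>' * w \<omega>" and gint: "set_integrable lborel {0..T} g"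
  proof -
    have i: "set_integrable lborel {0..T} (\<lambda>s. norm (X0 n \<omega>) + Q)" "set_integrable lborel {0..T} (\<lambda>s. \<sigma>' * norm (W n \<omega> s))"
      using Wc by (auto intro!: borel_integrable_atLeastAtMost' continuous_intros)
    show "(LINT s:{0..T}|lborel. g s) = (norm (X0 n \<omega>) + Q) * T + \<sigma>' * w \<omega>"
      unfolding g_def using set_integral_add(2)[OF i] set_lint_const_Icc[of 0 T] by (simp add: weq)
    show "set_integrable lborel {0..T} g" unfolding g_def using set_integral_add(1)[OF i] by simp
  qed
  show ?case
  proof
    fix t assume t: "t \<in> {0..T}"
    have "norm (Xb n \<omega> t) \<le> g t + 2 * (2 * L) * exp (2 * (2 * L) * T) * (LINT s:{0..T}|lborel. g s)"
    proof (rule gronwall_variable[OF _ _ _ gint _ _ t])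
      show "continuous_on {0..T} (\<lambda>t. norm (Xb n \<omega> t))" using Xc by (intro continuous_intros)
      show "0 \<le> g s" for s unfolding g_def using Q0 \<sigma>'0 by simp
      fix t assume t: "t \<in> {0..T}"
      have "norm (set_lebesgue_integral lborel {0..t} (drift n \<omega>)) \<le> (LINT s:{0..t}|lborel. q s + 2 * L * norm (Xb n \<omega> s))"
      proof (rule set_lint_mono_Icc_norm)
        show "set_integrable lborel {0..t} (drift n \<omega>)" using elim t by (auto intro: set_integrable_Icc_subset)
        show "set_integrable lborel {0..t} (\<lambda>s. q s + 2 * L * norm (Xb n \<omega> s))"
          using q(1) Xc t by (intro set_integral_add(1) set_integrable_Icc_subset[OF q(1)] borel_integrable_atLeastAtMost' continuous_intros)
            (auto intro: continuous_on_subset)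
        show "norm (drift n \<omega> s) \<le> q s + 2 * L * norm (Xb n \<omega> s)" if "s \<in> {0..t}" for s
          using that t elim(3) by (intro le) auto
      qed
      also have "\<dots> = (LINT s:{0..t}|lborel. q s) + 2 * L * (LINT s:{0..t}|lborel. norm (Xb n \<omega> s))"
      proof -
        have i: "set_integrable lborel {0..t} q" "set_integrable lborel {0..t} (\<lambda>s. 2 * L * norm (Xb n \<omega> s))"
        proof -
          show "set_integrable lborel {0..t} q" by (rule set_integrable_Icc_subset[OF q(1)]) (use t in auto)
          show "set_integrable lborel {0..t} (\<lambda>s. 2 * L * norm (Xb n \<omega> s))"
            using t by (intro borel_integrable_atLeastAtMost' continuous_intros continuous_on_subset[OF Xc]) auto
        qed
        show ?thesis using set_integral_add(2)[OF i] by simp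
      qed
      also have "(LINT s:{0..t}|lborel. q s) \<le> Q"
        unfolding Q_def set_lebesgue_integral_def using set_integrable_Icc_subset[OF q(1), of 0 t] q t
        by (intro integral_mono) (auto simp: set_integrable_def split: split_indicator)
      finally have 1: "norm (set_lebesgue_integral lborel {0..t} (drift n \<omega>)) \<le> Q + 2 * L * (LINT s:{0..t}|lborel. norm (Xb n \<omega> s))" by simp
      have "norm (Xb n \<omega> t) = norm (X0 n \<omega> + set_lebesgue_integral lborel {0..t} (drift n \<omega>) + \<sigma>' *\<^sub>R W n \<omega> t)"
        using elim t by (simp add: \<sigma>'_def)
      also have "\<dots> \<le> norm (X0 n \<omega>) + norm (set_lebesgue_integral lborel {0..t} (drift n \<omega>)) + norm (\<sigma>' *\<^sub>R W n \<omega> t)"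
        by (intro order_trans[OF norm_triangle_ineq] add_right_mono norm_triangle_ineq)
      also have "norm (\<sigma>' *\<^sub>R W n \<omega> t) = \<sigma>' * norm (W n \<omega> t)" using \<sigma>'0 by simp
      finally show "norm (Xb n \<omega> t) \<le> g t + 2 * L * (LINT s:{0..t}|lborel. norm (Xb n \<omega> s))"
        using 1 by (simp add: g_def)
    qed (use L in auto)
    also have "\<dots> \<le> cG * (norm (X0 n \<omega>) + Q + \<sigma>' * (norm (W n \<omega> t) + w \<omega>))"
    proof -
      \<comment> \<open>The factor of \<open>gronwall_variable\<close> for the rate 2 L.
        \<open>cG\<close> dominates 1 + c T, 1 and c, which multiply the constant part, the noise at
        time \<open>t\<close> and the integrated noise.\<close>
      define c where "c = 4 * L * exp (4 * L * T)"
      have c0: "0 \<le> c" by (simp add: c_def)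
      have "g t + 2 * (2 * L) * exp (2 * (2 * L) * T) * (LINT s:{0..T}|lborel. g s) = (norm (X0 n \<omega>) + Q) * (1 + c * T) + \<sigma>' * norm (W n \<omega> t) * 1 + \<sigma>' * w \<omega> * c"
        unfolding gi by (simp add: g_def c_def algebra_simps)
      also have "\<dots> \<le> (norm (X0 n \<omega>) + Q) * cG + \<sigma>' * norm (W n \<omega> t) * cG + \<sigma>' * w \<omega> * cG"
      proof (intro add_mono mult_left_mono)
        have cG: "cG = 1 + c * T + c" by (simp add: cG_def c_def algebra_simps)
        show "1 + c * T \<le> cG" "1 \<le> cG" "c \<le> cG" unfolding cG using c0 by (auto intro: add_increasing)
      qed (use Q0 \<sigma>'0 w0 in auto)
      finally show ?thesis by (simp add: algebra_simps)
    qed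
    finally show "norm (Xb n \<omega> t) \<le> cG * (norm (X0 n \<omega>) + (LINT s:{0..T}|lborel. q s) + sqrt (2 * \<sigma>) * (norm (W n \<omega> t) + w \<omega>))"
      by (simp add: Q_def \<sigma>'_def)
  qed
qed

end

lemma set_lint_diff_Icc:
  fixes f :: "real \<Rightarrow> 'b::euclidean_space"
  assumes "set_integrable lborel {0..T} f" "0 \<le> s" "s \<le> t" "t \<le> T"
  shows "set_lebesgue_integral lborel {0..t} f - set_lebesgue_integral lborel {0..s} f = set_lebesgue_integral lborel {s..t} f"
proof -
  have i: "set_integrable lborel {0..t} f" "set_integrable lborel {0..s} f" "set_integrable lborel {s..t} f"
    using assms by (auto intro: set_integrable_Icc_subset[OF assms(1)])
  show ?thesis
    using set_borel_integral_eq_integral[OF i(1)] set_borel_integral_eq_integral(2)[OF i(2)] set_borel_integral_eq_integral(2)[OF i(3)]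
      Henstock_Kurzweil_Integration.integral_combine[of 0 s t f] assms by (simp add: algebra_simps)
qed

section \<open>A first, qualitative bound of the moments in time\<close>

context limit_family begin

lemma W_zero: "n \<ge> 1 \<Longrightarrow> AE \<omega> in M. W n \<omega> 0 = 0"
  using bm[of n] by (simp add: brownian_motion_def)

lemma W_moments:
  assumes n: "n \<ge> 1" and t: "t \<in> {0..T}"
  shows "integrable M (\<lambda>\<omega>. norm (W n \<omega> t))" "expectation (\<lambda>\<omega>. norm (W n \<omega> t)) \<le> sqrt (real CARD('d) * T)"
    and "integrable M (\<lambda>\<omega>. (norm (W n \<omega> t))\<^sup>2)" "expectation (\<lambda>\<omega>. (norm (W n \<omega> t))\<^sup>2) \<le> real CARD('d) * T"
proof -
  have [measurable]: "(\<lambda>\<omega>. W n \<omega> t) \<in> borel_measurable M" "(\<lambda>\<omega>. W n \<omega> 0) \<in> borel_measurable M"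
    using W_meas[OF n] t by auto
  note a = brownian_increment_first_moment[OF prob_space_axioms bm[OF n] filt, of 0 t]
  note b = brownian_increment_second_moment[OF bm[OF n] filt, of 0 t]
  have e1: "AE \<omega> in M. norm (W n \<omega> t) = norm (W n \<omega> t - W n \<omega> 0)" using W_zero[OF n] by eventually_elim simp
  have e2: "AE \<omega> in M. (norm (W n \<omega> t))\<^sup>2 = (norm (W n \<omega> t - W n \<omega> 0))\<^sup>2" using W_zero[OF n] by eventually_elim simp
  show "integrable M (\<lambda>\<omega>. norm (W n \<omega> t))"
    using a(1) t by (subst integrable_cong_AE[OF _ _ e1]) auto
  show "integrable M (\<lambda>\<omega>. (norm (W n \<omega> t))\<^sup>2)"
    using b(1) t by (subst integrable_cong_AE[OF _ _ e2]) auto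
  have "expectation (\<lambda>\<omega>. norm (W n \<omega> t)) \<le> sqrt (real CARD('d) * (t - 0))"
    using a(2) t by (subst integral_cong_AE[OF _ _ e1]) auto
  also have "\<dots> \<le> sqrt (real CARD('d) * T)" using t by (intro real_sqrt_le_mono mult_left_mono) auto
  finally show "expectation (\<lambda>\<omega>. norm (W n \<omega> t)) \<le> sqrt (real CARD('d) * T)" .
  have "expectation (\<lambda>\<omega>. (norm (W n \<omega> t))\<^sup>2) = real CARD('d) * (t - 0)"
    using b(2) t by (subst integral_cong_AE[OF _ _ e2]) auto
  also have "\<dots> \<le> real CARD('d) * T" using t by (intro mult_left_mono) auto
  finally show "expectation (\<lambda>\<omega>. (norm (W n \<omega> t))\<^sup>2) \<le> real CARD('d) * T" .
qed

lemma k_nonneg: "0 \<le> k n s"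
  by (simp add: k_def)

lemma k_meas: "n \<ge> 1 \<Longrightarrow> k n \<in> borel_measurable borel"
  using borel_measurable_lebesgue_integral[of "\<lambda>s \<omega>. norm (Xb n \<omega> (clamp0 T s))" borel] Xb_pair[of n]
  by (simp add: k_def[abs_def] case_prod_beta)

lemma ysum_cont: "continuous_on UNIV ysum"
  unfolding ysum_def[abs_def] by (intro continuous_intros continuous_on_clamp0 Yb_cont) auto

lemma ysum_meas: "ysum \<in> borel_measurable borel"
  using ysum_cont by (rule borel_measurable_continuous_onI)

lemma ysum_nonneg: "0 \<le> ysum s"
  by (simp add: ysum_def sum_nonneg)

text \<open>The first moment is finite at each time, but nothing yet bounds it in time, so an
  estimate of the drift by \<open>k n\<close> could not be integrated. Instead, a sample path is
  fixed along which the drift is integrable. The drift is Lipschitz in space, so along any other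
  path it is dominated by a deterministic integrable function plus 2 L |X|.\<close>

lemma k_bounded:
  assumes n: "n \<ge> 1"
  obtains C where "\<And>s. s \<in> {0..T} \<Longrightarrow> k n s \<le> C"
proof -
  \<comment> \<open>An event of full measure in a probability space is not empty.\<close>
  obtain \<omega>0 where \<omega>0: "\<omega>0 \<in> space M" "set_integrable lborel {0..T} (drift n \<omega>0)"
  proof (rule ccontr)
    assume "\<not> thesis"
    then have "\<forall>\<omega>\<in>space M. \<not> set_integrable lborel {0..T} (drift n \<omega>)" using that by blast
    moreover have "AE \<omega> in M. \<omega> \<in> space M \<and> set_integrable lborel {0..T} (drift n \<omega>)"
      using limit_equation[OF n] AE_space by eventually_elim auto
    ultimately have "AE \<omega> in M. \<omega> \<notin> space M" by (auto elim: AE_mp intro!: AE_I2)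
    then show False by (simp add: AE_False)
  qed
  define q where "q s = norm (drift n \<omega>0 s) + 2 * L * norm (Xb n \<omega>0 s)" for s
  have q: "set_integrable lborel {0..T} q"
    unfolding q_def
  proof (rule set_integral_add(1))
    show "set_integrable lborel {0..T} (\<lambda>s. norm (drift n \<omega>0 s))" by (rule set_integrable_norm[OF \<omega>0(2)])
    show "set_integrable lborel {0..T} (\<lambda>s. 2 * L * norm (Xb n \<omega>0 s))"
      by (intro borel_integrable_atLeastAtMost' continuous_intros Xb_cont[OF n \<omega>0(1)])
  qed
  have le: "norm (drift n \<omega> s) \<le> q s + 2 * L * norm (Xb n \<omega> s)" if "s \<in> {0..T}" for \<omega> s
  proof -
    have "norm (drift n \<omega> s) \<le> norm (drift n \<omega>0 s) + norm (drift n \<omega> s - drift n \<omega>0 s)" by (rule norm_triangle_sub)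
    also have "\<dots> \<le> norm (drift n \<omega>0 s) + 2 * L * norm (Xb n \<omega> s - Xb n \<omega>0 s)"
      using drift_lipschitz[OF n that] by (intro add_left_mono)
    also have "\<dots> \<le> norm (drift n \<omega>0 s) + 2 * L * (norm (Xb n \<omega> s) + norm (Xb n \<omega>0 s))"
      by (intro add_left_mono mult_left_mono norm_triangle_ineq4) auto
    finally show ?thesis by (simp add: q_def algebra_simps)
  qed
  obtain w where w: "integrable M w" "AE \<omega> in M. continuous_on {0..T} (W n \<omega>) \<and> w \<omega> = (LINT s:{0..T}|lborel. norm (W n \<omega> s))"
    by (rule brownian_path_integral[OF n T], erule that)
  have "AE \<omega> in M. \<forall>t\<in>{0..T}. norm (Xb n \<omega> t) \<le> cG * (norm (X0 n \<omega>) + (LINT s:{0..T}|lborel. q s) + sqrt (2 * \<sigma>) * (norm (W n \<omega> t) + w \<omega>))"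
    using L by (intro path_bound[OF n q _ le w(2)]) (auto simp: q_def)
  then have "k n t \<le> cG * (expectation (\<lambda>\<omega>. norm (X0 n \<omega>)) + (LINT s:{0..T}|lborel. q s) + sqrt (2 * \<sigma>) * (sqrt (real CARD('d) * T) + expectation w))"
    if t: "t \<in> {0..T}" for t
  proof -
    assume ae: "AE \<omega> in M. \<forall>t\<in>{0..T}. norm (Xb n \<omega> t) \<le> cG * (norm (X0 n \<omega>) + (LINT s:{0..T}|lborel. q s) + sqrt (2 * \<sigma>) * (norm (W n \<omega> t) + w \<omega>))"
    have "k n t \<le> expectation (\<lambda>\<omega>. cG * (norm (X0 n \<omega>) + (LINT s:{0..T}|lborel. q s) + sqrt (2 * \<sigma>) * (norm (W n \<omega> t) + w \<omega>)))"
      unfolding k_def clamp0_id[OF t] using ae t W_moments(1)[OF n t] X0_int[OF n] w Xb_int[OF n t]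
      by (intro integral_mono_AE) auto
    also have "\<dots> = cG * (expectation (\<lambda>\<omega>. norm (X0 n \<omega>)) + (LINT s:{0..T}|lborel. q s) + sqrt (2 * \<sigma>) * (expectation (\<lambda>\<omega>. norm (W n \<omega> t)) + expectation w))"
      using W_moments(1)[OF n t] X0_int[OF n] w by (simp add: prob_space)
    also have "\<dots> \<le> cG * (expectation (\<lambda>\<omega>. norm (X0 n \<omega>)) + (LINT s:{0..T}|lborel. q s) + sqrt (2 * \<sigma>) * (sqrt (real CARD('d) * T) + expectation w))"
      using W_moments(2)[OF n t] \<sigma> L T by (intro mult_left_mono add_left_mono add_right_mono) (auto simp: cG_def)
    finally show ?thesis .
  qed
  then show ?thesis by (rule that)
qed

end

section \<open>A moment bound by the data alone\<close>

context interaction begin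

text \<open>The constant part of the growth of the drifts: the coefficients at 0 and
  \<open>u\<close> at the Dirac measure, with the equations for the \<open>Y\<close> counted
  \<open>m\<close> times.\<close>

definition \<kappa>1 :: real where
  "\<kappa>1 = norm (H1 0) + norm (K1 0) + real m * (norm (K2 0) + norm (H2 0) + norm (u (return borel 0)))"

text \<open>The bound 2 c exp (2 L' T) of \<open>gronwall\<close>, where L' = (3 + 3 m) L is the
  rate of the joint inequality for the first moment and the sum of the norms of the
  \<open>Y\<close>.\<close>

definition \<kappa> :: real where
  "\<kappa> = 2 * ((integral\<^sup>L \<nu> norm + sqrt (2 * \<sigma>) * sqrt (real CARD('d) * T) + (\<Sum>i=1..m. norm (Y0 i))) + \<kappa>1 * T)
     * exp (2 * ((3 + 3 * real m) * L) * T)"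

lemma \<kappa>1_nonneg: "0 \<le> \<kappa>1"
  by (simp add: \<kappa>1_def)

end

context limit_family begin

lemma fubini_Xb:
  assumes n: "n \<ge> 1" and ab: "0 \<le> a" "b \<le> T"
  shows "integrable M (\<lambda>\<omega>. LINT s:{a..b}|lborel. norm (Xb n \<omega> (clamp0 T s)))"
    and "expectation (\<lambda>\<omega>. LINT s:{a..b}|lborel. norm (Xb n \<omega> (clamp0 T s))) = (LINT s:{a..b}|lborel. k n s)"
proof -
  obtain C where C: "\<And>s. s \<in> {0..T} \<Longrightarrow> k n s \<le> C" using k_bounded[OF n] by blast
  have p: "(\<lambda>(s, \<omega>). norm (Xb n \<omega> (clamp0 T s))) \<in> borel_measurable (borel \<Otimes>\<^sub>M M)"
    using Xb_pair[OF n] by (simp add: case_prod_beta)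
  have b: "integrable M (\<lambda>\<omega>. norm (Xb n \<omega> (clamp0 T s))) \<and> expectation (\<lambda>\<omega>. norm (Xb n \<omega> (clamp0 T s))) \<le> C" if "s \<in> {a..b}" for s
    using C[of s] Xb_int[OF n, of s] that ab by (simp add: k_def)
  show "integrable M (\<lambda>\<omega>. LINT s:{a..b}|lborel. norm (Xb n \<omega> (clamp0 T s)))"
    "expectation (\<lambda>\<omega>. LINT s:{a..b}|lborel. norm (Xb n \<omega> (clamp0 T s))) = (LINT s:{a..b}|lborel. k n s)"
    using fubini_path(1,2)[OF p norm_ge_zero b] by (simp_all add: k_def)
qed

lemma k_ysum_integrable:
  assumes n: "n \<ge> 1" and ab: "0 \<le> a" "b \<le> T"
  shows "set_integrable lborel {a..b} (k n)" "set_integrable lborel {a..b} ysum"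
proof -
  obtain C where C: "\<And>s. s \<in> {0..T} \<Longrightarrow> k n s \<le> C" using k_bounded[OF n] by blast
  show "set_integrable lborel {a..b} (k n)"
    using C k_nonneg ab by (intro set_integrable_bounded_Icc[OF k_meas[OF n], of _ _ C]) (auto simp: abs_of_nonneg)
  show "set_integrable lborel {a..b} ysum"
    by (rule borel_integrable_atLeastAtMost'[OF continuous_on_subset[OF ysum_cont]]) simp
qed

text \<open>The expectation is taken before Gronwall's inequality is used, so that this estimate can
  be added to the deterministic one for \<open>ysum\<close>.\<close>

lemma k_ineq:
  assumes n: "n \<ge> 1" and t: "t \<in> {0..T}"
  shows "k n t \<le> integral\<^sup>L \<nu> norm + sqrt (2 * \<sigma>) * sqrt (real CARD('d) * T)
    + (LINT s:{0..t}|lborel. norm (H1 0) + norm (K1 0) + (L * k n s + L * ysum s + 2 * L * k n s))"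
proof -
  define c where "c = norm (H1 0) + norm (K1 0)"
  define I where "I = (LINT s:{0..t}|lborel. c + (L * k n s + L * ysum s))"
  have ki: "set_integrable lborel {0..t} (k n)" "set_integrable lborel {0..t} ysum" using k_ysum_integrable[OF n] t by auto
  have ci: "set_integrable lborel {0..t} (\<lambda>s. c)" by (rule set_integrable_bounded_Icc[of _ _ _ "\<bar>c\<bar>"]) auto
  have gi: "set_integrable lborel {0..t} (\<lambda>s. c + (L * k n s + L * ysum s))"
    using ki ci by (intro set_integral_add(1) set_integrable_mult_right) auto
  have "AE \<omega> in M. norm (Xb n \<omega> t) \<le> norm (X0 n \<omega>) + (I + 2 * L * (LINT s:{0..t}|lborel. norm (Xb n \<omega> (clamp0 T s)))) + sqrt (2 * \<sigma>) * norm (W n \<omega> t)"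
    using limit_equation[OF n] AE_space
  proof eventually_elim
    case (elim \<omega>)
    have Xc: "continuous_on UNIV (\<lambda>s. Xb n \<omega> (clamp0 T s))"
      by (rule continuous_on_clamp0[OF Xb_cont[OF n elim(2)] T0])
    have Xi: "set_integrable lborel {0..t} (\<lambda>s. 2 * L * norm (Xb n \<omega> (clamp0 T s)))"
      by (intro borel_integrable_atLeastAtMost' continuous_intros continuous_on_subset[OF Xc]) simp
    have "norm (set_lebesgue_integral lborel {0..t} (drift n \<omega>)) \<le> (LINT s:{0..t}|lborel. (c + (L * k n s + L * ysum s)) + 2 * L * norm (Xb n \<omega> (clamp0 T s)))"
    proof (rule set_lint_mono_Icc_norm)
      show "set_integrable lborel {0..t} (drift n \<omega>)" using elim t by (auto intro: set_integrable_Icc_subset)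
      show "set_integrable lborel {0..t} (\<lambda>s. (c + (L * k n s + L * ysum s)) + 2 * L * norm (Xb n \<omega> (clamp0 T s)))"
        by (rule set_integral_add(1)[OF gi Xi])
      show "norm (drift n \<omega> s) \<le> (c + (L * k n s + L * ysum s)) + 2 * L * norm (Xb n \<omega> (clamp0 T s))" if "s \<in> {0..t}" for s
        using drift_growth[OF n, of s \<omega>] that t by (simp add: c_def)
    qed
    also have "\<dots> = I + 2 * L * (LINT s:{0..t}|lborel. norm (Xb n \<omega> (clamp0 T s)))"
      using set_integral_add(2)[OF gi Xi] by (simp add: I_def)
    finally have 1: "norm (set_lebesgue_integral lborel {0..t} (drift n \<omega>)) \<le> \<dots>" .
    have "norm (Xb n \<omega> t) = norm (X0 n \<omega> + set_lebesgue_integral lborel {0..t} (drift n \<omega>) + sqrt (2 * \<sigma>) *\<^sub>R W n \<omega> t)"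
      by (rule arg_cong[where f=norm]) (use elim(1) t in blast)
    also have "\<dots> \<le> norm (X0 n \<omega>) + norm (set_lebesgue_integral lborel {0..t} (drift n \<omega>)) + norm (sqrt (2 * \<sigma>) *\<^sub>R W n \<omega> t)"
      by (intro order_trans[OF norm_triangle_ineq] add_right_mono norm_triangle_ineq)
    also have "norm (sqrt (2 * \<sigma>) *\<^sub>R W n \<omega> t) = sqrt (2 * \<sigma>) * norm (W n \<omega> t)" using \<sigma> by simp
    finally show ?case using 1 by simp
  qed
  then have "k n t \<le> expectation (\<lambda>\<omega>. norm (X0 n \<omega>) + (I + 2 * L * (LINT s:{0..t}|lborel. norm (Xb n \<omega> (clamp0 T s)))) + sqrt (2 * \<sigma>) * norm (W n \<omega> t))"
    unfolding k_def clamp0_id[OF t] using t W_moments(1)[OF n t] X0_int[OF n] Xb_int[OF n t] fubini_Xb(1)[OF n, of 0 t]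
    by (intro integral_mono_AE) auto
  also have "\<dots> = integral\<^sup>L \<nu> norm + (I + 2 * L * (LINT s:{0..t}|lborel. k n s)) + sqrt (2 * \<sigma>) * expectation (\<lambda>\<omega>. norm (W n \<omega> t))"
    using t W_moments(1)[OF n t] X0_int[OF n] fubini_Xb[OF n, of 0 t] X0_expect[OF n] by (simp add: prob_space)
  also have "\<dots> \<le> integral\<^sup>L \<nu> norm + (I + 2 * L * (LINT s:{0..t}|lborel. k n s)) + sqrt (2 * \<sigma>) * sqrt (real CARD('d) * T)"
    using W_moments(2)[OF n t] \<sigma> by (intro add_left_mono mult_left_mono) auto
  also have "I + 2 * L * (LINT s:{0..t}|lborel. k n s) = (LINT s:{0..t}|lborel. c + (L * k n s + L * ysum s + 2 * L * k n s))"
  proof -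
    have "set_integrable lborel {0..t} (\<lambda>s. 2 * L * k n s)" using ki(1) by (intro set_integrable_mult_right) auto
    from set_integral_add(2)[OF gi this] show ?thesis by (simp add: I_def add.assoc)
  qed
  finally show ?thesis by (simp add: c_def algebra_simps)
qed

lemma Yb_derivative:
  assumes "i \<in> {1..m}" "t \<in> {0..T}" "n \<ge> 1"
  shows "(Yb i has_vector_derivative conv K2 (marginal M T (Xb n) t) (Yb i t)
          + avg (\<lambda>j. H2 (Yb j t - Yb i t)) + u (marginal M T (Xb n) t)) (at t within {0..T})"
  using lim[OF assms(3)] assms(1,2) unfolding limit_solution_def avg_def by blast

lemma Yb_init: "i \<in> {1..m} \<Longrightarrow> Yb i 0 = Y0 i"
  using lim[of 1] by (simp add: limit_solution_def)

lemma avg_norm_le_ysum: "s \<in> {0..T} \<Longrightarrow> avg (\<lambda>j. norm (Yb j s)) \<le> ysum s"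
  unfolding ysum_def using avg_le_sum[of "\<lambda>j. norm (Yb j s)"] by simp

text \<open>The factor 3 L of \<open>ysum\<close> collects one part from \<open>K2\<close> and two
  from \<open>H2\<close>; the factor 2 L of \<open>k\<close> has one part from \<open>K2\<close> and
  one from \<open>u\<close>.\<close>

lemma Yb_derivative_bound:
  assumes n: "n \<ge> 1" and i: "i \<in> {1..m}" and s: "s \<in> {0..T}"
  shows "norm (conv K2 (marginal M T (Xb n) s) (Yb i s) + avg (\<lambda>j. H2 (Yb j s - Yb i s)) + u (marginal M T (Xb n) s))
    \<le> (norm (K2 0) + norm (H2 0) + norm (u (return borel 0))) + (3 * L * ysum s + 2 * L * k n s)"
proof -
  have yi: "norm (Yb i s) \<le> ysum s"
    using i s member_le_sum[of i "{1..m}" "\<lambda>j. norm (Yb j (clamp0 T s))"] by (simp add: ysum_def)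
  then have Lyi: "L * norm (Yb i s) \<le> L * ysum s" by (intro mult_left_mono) auto
  have 1: "norm (conv K2 (marginal M T (Xb n) s) (Yb i s)) \<le> norm (K2 0) + L * norm (Yb i s) + L * k n s"
    by (rule conv_growth[OF n s K2])
  have "norm (avg (\<lambda>j. H2 (Yb j s - Yb i s))) \<le> avg (\<lambda>j. norm (H2 0) + (L * norm (Yb j s) + L * norm (Yb i s)))"
  proof (rule norm_avg_le)
    fix j
    have "norm (H2 (Yb j s - Yb i s)) \<le> norm (H2 0) + L * norm (Yb j s - Yb i s)" by (rule norm_lipschitz_growth[OF H2])
    also have "\<dots> \<le> norm (H2 0) + L * (norm (Yb j s) + norm (Yb i s))"
      by (intro add_left_mono mult_left_mono norm_triangle_ineq4) auto
    finally show "norm (H2 (Yb j s - Yb i s)) \<le> norm (H2 0) + (L * norm (Yb j s) + L * norm (Yb i s))" by (simp add: distrib_left)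
  qed
  also have "\<dots> = norm (H2 0) + (L * avg (\<lambda>j. norm (Yb j s)) + L * norm (Yb i s))"
    using m by (simp add: avg_def sum.distrib sum_distrib_left field_simps)
  also have "\<dots> \<le> norm (H2 0) + (L * ysum s + L * ysum s)"
    using avg_norm_le_ysum[OF s] yi by (intro add_left_mono add_mono mult_left_mono) auto
  finally have 2: "norm (avg (\<lambda>j. H2 (Yb j s - Yb i s))) \<le> norm (H2 0) + (L * ysum s + L * ysum s)" .
  \<comment> \<open>The growth of \<open>u\<close> is obtained by comparison with the Dirac measure
    at 0, whose distance from the law is at most the first moment.\<close>
  have "norm (u (marginal M T (Xb n) s) - u (return borel 0)) \<le> L * wasserstein1 (marginal M T (Xb n) s) (return borel 0)"
    by (intro u marg_W1[OF n s] return_in_W1)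
  also have "\<dots> \<le> L * k n s"
    using wasserstein1_return_le[OF marg_W1[OF n s]] by (intro mult_left_mono) (auto simp: marg_norm[OF n s])
  finally have 3: "norm (u (marginal M T (Xb n) s)) \<le> norm (u (return borel 0)) + L * k n s"
    using norm_triangle_sub[of "u (marginal M T (Xb n) s)" "u (return borel 0)"] by linarith
  have "norm (conv K2 (marginal M T (Xb n) s) (Yb i s) + avg (\<lambda>j. H2 (Yb j s - Yb i s)) + u (marginal M T (Xb n) s))
    \<le> norm (conv K2 (marginal M T (Xb n) s) (Yb i s)) + norm (avg (\<lambda>j. H2 (Yb j s - Yb i s))) + norm (u (marginal M T (Xb n) s))"
    by (intro order_trans[OF norm_triangle_ineq] add_right_mono norm_triangle_ineq)
  then show ?thesis using 1 2 3 Lyi by linarith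
qed

text \<open>The first moment and the \<open>Y\<close> feed each other, so Gronwall's inequality is
  applied to their sum. \<open>k_bounded\<close> only supplies the finiteness it asks for; the
  resulting \<kappa> depends neither on the copy nor on the probability space.\<close>

lemma moment_bound:
  assumes n: "n \<ge> 1" and t: "t \<in> {0..T}"
  shows "k n t + ysum t \<le> \<kappa>"
proof -
  define c where "c = norm (K2 0) + norm (H2 0) + norm (u (return borel 0))"
  define c' where "c' = norm (H1 0) + norm (K1 0)"
  define \<kappa>2 where "\<kappa>2 = (3 + 3 * real m) * L"
  define \<kappa>0 where "\<kappa>0 = integral\<^sup>L \<nu> norm + sqrt (2 * \<sigma>) * sqrt (real CARD('d) * T) + (\<Sum>i=1..m. norm (Y0 i))"
  have \<kappa>2: "\<kappa>2 > 0" using L by (simp add: \<kappa>2_def add_pos_nonneg)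
  have \<kappa>0: "\<kappa>0 \<ge> 0" using \<sigma> T by (simp add: \<kappa>0_def sum_nonneg)
  obtain C where C: "\<And>s. s \<in> {0..T} \<Longrightarrow> k n s \<le> C" using k_bounded[OF n] by blast
  have "bounded (ysum ` {0..T})"
    by (intro compact_imp_bounded compact_continuous_image continuous_on_subset[OF ysum_cont]) auto
  then obtain C' where "\<forall>x\<in>ysum ` {0..T}. norm x \<le> C'"
    unfolding bounded_iff by blast
  then have C': "ysum s \<le> C'" if "s \<in> {0..T}" for s using that by force
  have "k n t + ysum t \<le> 2 * (\<kappa>0 + \<kappa>1 * T) * exp (2 * \<kappa>2 * T)"
  proof (rule gronwall[OF \<kappa>2 _ _ _ _ t, where B="C + C'"])
    show "0 \<le> \<kappa>0 + \<kappa>1 * T" using \<kappa>0 \<kappa>1_nonneg by simp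
    show "(\<lambda>s. k n s + ysum s) \<in> borel_measurable borel" using k_meas[OF n] ysum_meas by measurable
    show "0 \<le> k n s + ysum s \<and> k n s + ysum s \<le> C + C'" if "s \<in> {0..T}" for s
      using C[OF that] C'[OF that] k_nonneg ysum_nonneg by (auto intro: add_mono)
  next
    fix r assume r: "r \<in> {0..T}"
    have ki: "set_integrable lborel {0..r} (k n)" "set_integrable lborel {0..r} ysum" using k_ysum_integrable[OF n] r by auto
    have ci: "set_integrable lborel {0..r} (\<lambda>s. d)" for d :: real by (rule set_integrable_bounded_Icc[of _ _ _ "\<bar>d\<bar>"]) auto
    have "norm (Yb i r) \<le> norm (Y0 i) + (LINT s:{0..r}|lborel. c + (3 * L * ysum s + 2 * L * k n s))" if i: "i \<in> {1..m}" for i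
    proof -
      have bi: "set_integrable lborel {0..T} (\<lambda>s. c + (3 * L * ysum s + 2 * L * k n s))"
        using k_ysum_integrable[OF n, of 0 T] borel_integrable_atLeastAtMost'[of 0 T "\<lambda>s. c"]
        by (intro set_integral_add(1) set_integrable_mult_right) auto
      have "norm (Yb i r - Yb i 0) \<le> (LINT s:{0..r}|lborel. c + (3 * L * ysum s + 2 * L * k n s))"
        by (rule ode_norm_bound[OF Yb_derivative[OF i _ n] _ bi r])
           (use Yb_derivative_bound[OF n i] in \<open>auto simp: c_def\<close>)
      then show ?thesis using norm_triangle_sub[of "Yb i r" "Yb i 0"] by (simp add: Yb_init[OF i])
    qed
    then have "ysum r \<le> (\<Sum>i=1..m. norm (Y0 i) + (LINT s:{0..r}|lborel. c + (3 * L * ysum s + 2 * L * k n s)))"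
      unfolding ysum_def[of r] clamp0_id[OF r] by (intro sum_mono)
    also have "\<dots> = (\<Sum>i=1..m. norm (Y0 i)) + (LINT s:{0..r}|lborel. real m * (c + (3 * L * ysum s + 2 * L * k n s)))"
      by (simp add: sum.distrib)
    finally have y: "ysum r \<le> \<dots>" .
    have i1: "set_integrable lborel {0..r} (\<lambda>s. c' + (L * k n s + L * ysum s + 2 * L * k n s))"
      and i2: "set_integrable lborel {0..r} (\<lambda>s. real m * (c + (3 * L * ysum s + 2 * L * k n s)))"
      and i3: "set_integrable lborel {0..r} (\<lambda>s. \<kappa>2 * (k n s + ysum s))"
      using ki ci by (auto intro!: set_integral_add(1) set_integrable_mult_right)
    have "k n r + ysum r \<le> \<kappa>0 + ((LINT s:{0..r}|lborel. c' + (L * k n s + L * ysum s + 2 * L * k n s)) + (LINT s:{0..r}|lborel. real m * (c + (3 * L * ysum s + 2 * L * k n s))))"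
      using y k_ineq[OF n r] by (simp add: \<kappa>0_def c'_def)
    also have "\<dots> = \<kappa>0 + (LINT s:{0..r}|lborel. (c' + (L * k n s + L * ysum s + 2 * L * k n s)) + real m * (c + (3 * L * ysum s + 2 * L * k n s)))"
      using set_integral_add(2)[OF i1 i2] by simp
    also have "\<dots> \<le> \<kappa>0 + (LINT s:{0..r}|lborel. \<kappa>1 + \<kappa>2 * (k n s + ysum s))"
    proof (rule add_left_mono, rule set_integral_mono[OF set_integral_add(1)[OF i1 i2] set_integral_add(1)[OF ci i3]])
      fix s
      have "0 \<le> L * k n s * real m" "0 \<le> L * ysum s" using k_nonneg ysum_nonneg by auto
      then show "(c' + (L * k n s + L * ysum s + 2 * L * k n s)) + real m * (c + (3 * L * ysum s + 2 * L * k n s)) \<le> \<kappa>1 + \<kappa>2 * (k n s + ysum s)"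
        unfolding \<kappa>1_def \<kappa>2_def c_def c'_def by (simp add: algebra_simps)
    qed
    also have "(LINT s:{0..r}|lborel. \<kappa>1 + \<kappa>2 * (k n s + ysum s)) = \<kappa>1 * r + \<kappa>2 * (LINT s:{0..r}|lborel. k n s + ysum s)"
      using set_integral_add(2)[OF ci[of \<kappa>1] i3] set_lint_const_Icc[of 0 r \<kappa>1] r by simp
    also have "\<kappa>1 * r \<le> \<kappa>1 * T" using r \<kappa>1_nonneg by (intro mult_left_mono) auto
    finally show "k n r + ysum r \<le> \<kappa>0 + \<kappa>1 * T + \<kappa>2 * (LINT s:{0..r}|lborel. k n s + ysum s)" by simp
  qed
  then show ?thesis by (simp add: \<kappa>_def \<kappa>0_def \<kappa>2_def)
qed

end

context interaction begin

lemma \<kappa>_nonneg [simp]: "0 \<le> \<kappa>"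
  unfolding \<kappa>_def using \<kappa>1_nonneg \<sigma> by (intro mult_nonneg_nonneg add_nonneg_nonneg sum_nonneg) auto

end

section \<open>Time regularity of the limit processes\<close>

context limit_family begin

text \<open>The drift contributes the order t - s and the noise the order sqrt (t - s). Of the term
  3 L \<kappa>, one part comes from the moments inside the drift bound and two from the mean of 2 L
  |X|.\<close>

lemma Xb_increment:
  assumes n: "n \<ge> 1" and st: "0 \<le> s" "s \<le> t" "t \<le> T"
  shows "integrable M (\<lambda>\<omega>. norm (Xb n \<omega> t - Xb n \<omega> s))"
    and "expectation (\<lambda>\<omega>. norm (Xb n \<omega> t - Xb n \<omega> s)) \<le>
      (norm (H1 0) + norm (K1 0) + 3 * L * \<kappa>) * (t - s) + sqrt (2 * \<sigma>) * sqrt (real CARD('d) * (t - s))"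
proof -
  have tT: "s \<in> {0..T}" "t \<in> {0..T}" using st by auto
  define c where "c = norm (H1 0) + norm (K1 0) + L * \<kappa>"
  have [measurable]: "(\<lambda>\<omega>. Xb n \<omega> t) \<in> borel_measurable M" "(\<lambda>\<omega>. Xb n \<omega> s) \<in> borel_measurable M"
    using Xb_meas[OF n] tT by auto
  show int: "integrable M (\<lambda>\<omega>. norm (Xb n \<omega> t - Xb n \<omega> s))"
  proof (rule Bochner_Integration.integrable_bound)
    show "integrable M (\<lambda>\<omega>. norm (Xb n \<omega> t) + norm (Xb n \<omega> s))" using Xb_int[OF n] tT by auto
    show "AE \<omega> in M. norm (norm (Xb n \<omega> t - Xb n \<omega> s)) \<le> norm (norm (Xb n \<omega> t) + norm (Xb n \<omega> s))"
      by (intro AE_I2) (simp add: norm_triangle_ineq4)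
  qed measurable
  note bi = brownian_increment_first_moment[OF prob_space_axioms bm[OF n] filt st]
  have ci: "set_integrable lborel {s..t} (\<lambda>s. c)" by (rule set_integrable_bounded_Icc[of _ _ _ "\<bar>c\<bar>"]) auto
  have "AE \<omega> in M. norm (Xb n \<omega> t - Xb n \<omega> s) \<le> (c * (t - s) + 2 * L * (LINT r:{s..t}|lborel. norm (Xb n \<omega> (clamp0 T r)))) + sqrt (2 * \<sigma>) * norm (W n \<omega> t - W n \<omega> s)"
    using limit_equation[OF n] AE_space
  proof eventually_elim
    case (elim \<omega>)
    have Xc: "continuous_on UNIV (\<lambda>s. Xb n \<omega> (clamp0 T s))"
      by (rule continuous_on_clamp0[OF Xb_cont[OF n elim(2)] T0])
    have Xi: "set_integrable lborel {s..t} (\<lambda>s. 2 * L * norm (Xb n \<omega> (clamp0 T s)))"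
      by (intro borel_integrable_atLeastAtMost' continuous_intros continuous_on_subset[OF Xc]) simp
    have di: "set_integrable lborel {0..T} (drift n \<omega>)" using elim by auto
    have "norm (set_lebesgue_integral lborel {s..t} (drift n \<omega>)) \<le> (LINT r:{s..t}|lborel. c + 2 * L * norm (Xb n \<omega> (clamp0 T r)))"
    proof (rule set_lint_mono_Icc_norm)
      show "set_integrable lborel {s..t} (drift n \<omega>)" using st by (intro set_integrable_Icc_subset[OF di]) auto
      show "set_integrable lborel {s..t} (\<lambda>r. c + 2 * L * norm (Xb n \<omega> (clamp0 T r)))"
        by (rule set_integral_add(1)[OF ci Xi])
      show "norm (drift n \<omega> r) \<le> c + 2 * L * norm (Xb n \<omega> (clamp0 T r))" if "r \<in> {s..t}" for r
      proof -
        have r: "r \<in> {0..T}" using that st by auto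
        have "L * (k n r + ysum r) \<le> L * \<kappa>" using moment_bound[OF n r] by (intro mult_left_mono) auto
        then show ?thesis using drift_growth[OF n r, of \<omega>] r by (simp add: c_def distrib_left)
      qed
    qed
    also have "\<dots> = c * (t - s) + 2 * L * (LINT r:{s..t}|lborel. norm (Xb n \<omega> (clamp0 T r)))"
      using set_integral_add(2)[OF ci Xi] set_lint_const_Icc[OF st(2)] by simp
    finally have 1: "norm (set_lebesgue_integral lborel {s..t} (drift n \<omega>)) \<le> \<dots>" .
    have eqt: "Xb n \<omega> t = X0 n \<omega> + set_lebesgue_integral lborel {0..t} (drift n \<omega>) + sqrt (2 * \<sigma>) *\<^sub>R W n \<omega> t"
      and eqs: "Xb n \<omega> s = X0 n \<omega> + set_lebesgue_integral lborel {0..s} (drift n \<omega>) + sqrt (2 * \<sigma>) *\<^sub>R W n \<omega> s"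
      using elim(1) tT by blast+
    have "Xb n \<omega> t - Xb n \<omega> s = set_lebesgue_integral lborel {s..t} (drift n \<omega>) + sqrt (2 * \<sigma>) *\<^sub>R (W n \<omega> t - W n \<omega> s)"
      unfolding eqt eqs set_lint_diff_Icc[OF di st, symmetric] by (simp add: scaleR_diff_right)
    then have "norm (Xb n \<omega> t - Xb n \<omega> s) \<le> norm (set_lebesgue_integral lborel {s..t} (drift n \<omega>)) + norm (sqrt (2 * \<sigma>) *\<^sub>R (W n \<omega> t - W n \<omega> s))"
      by (simp only: norm_triangle_ineq)
    also have "norm (sqrt (2 * \<sigma>) *\<^sub>R (W n \<omega> t - W n \<omega> s)) = sqrt (2 * \<sigma>) * norm (W n \<omega> t - W n \<omega> s)" using \<sigma> by simp
    finally show ?case using 1 by linarith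
  qed
  then have "expectation (\<lambda>\<omega>. norm (Xb n \<omega> t - Xb n \<omega> s)) \<le> expectation (\<lambda>\<omega>. (c * (t - s) + 2 * L * (LINT r:{s..t}|lborel. norm (Xb n \<omega> (clamp0 T r)))) + sqrt (2 * \<sigma>) * norm (W n \<omega> t - W n \<omega> s))"
    using int bi fubini_Xb(1)[OF n st(1,3)] by (intro integral_mono_AE) auto
  also have "\<dots> = (c * (t - s) + 2 * L * (LINT r:{s..t}|lborel. k n r)) + sqrt (2 * \<sigma>) * expectation (\<lambda>\<omega>. norm (W n \<omega> t - W n \<omega> s))"
    using bi fubini_Xb[OF n st(1,3)] by (simp add: prob_space)
  also have "\<dots> \<le> (c * (t - s) + 2 * L * (\<kappa> * (t - s))) + sqrt (2 * \<sigma>) * sqrt (real CARD('d) * (t - s))"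
  proof (intro add_mono mult_left_mono order_refl)
    have "(LINT r:{s..t}|lborel. k n r) \<le> (LINT r:{s..t}|lborel. \<kappa>)"
    proof (rule set_integral_mono)
      show "set_integrable lborel {s..t} (k n)" using k_ysum_integrable[OF n] st by auto
      show "set_integrable lborel {s..t} (\<lambda>r. \<kappa>)" by (rule set_integrable_bounded_Icc[of _ _ _ "\<bar>\<kappa>\<bar>"]) auto
      show "k n r \<le> \<kappa>" if "r \<in> {s..t}" for r
        using moment_bound[OF n, of r] ysum_nonneg[of r] that st by simp
    qed
    then show "(LINT r:{s..t}|lborel. k n r) \<le> \<kappa> * (t - s)" using set_lint_const_Icc[OF st(2)] by simp
  qed (use bi \<sigma> in \<open>auto simp: c_def\<close>)
  finally show "expectation (\<lambda>\<omega>. norm (Xb n \<omega> t - Xb n \<omega> s)) \<le>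
      (norm (H1 0) + norm (K1 0) + 3 * L * \<kappa>) * (t - s) + sqrt (2 * \<sigma>) * sqrt (real CARD('d) * (t - s))"
    by (simp add: c_def algebra_simps)
qed

text \<open>One step size serves the random and the deterministic components, because the Euler
  scheme freezes both during a step.\<close>

lemma uniform_modulus:
  assumes "n \<ge> 1" "e > 0"
  obtains \<delta> where "\<delta> > 0"
    "\<And>s t. 0 \<le> s \<Longrightarrow> s \<le> t \<Longrightarrow> t \<le> T \<Longrightarrow> t - s \<le> \<delta> \<Longrightarrow> expectation (\<lambda>\<omega>. norm (Xb n \<omega> t - Xb n \<omega> s)) \<le> e"
    "\<And>s t j. 0 \<le> s \<Longrightarrow> s \<le> t \<Longrightarrow> t \<le> T \<Longrightarrow> t - s \<le> \<delta> \<Longrightarrow> j \<in> {1..m} \<Longrightarrow> norm (Yb j t - Yb j s) \<le> e"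
proof -
  define g where "g h = (norm (H1 0) + norm (K1 0) + 3 * L * \<kappa>) * h + sqrt (2 * \<sigma>) * sqrt (real CARD('d) * h)" for h
  have g0: "g 0 = 0" by (simp add: g_def)
  have "isCont g 0" unfolding g_def by (intro continuous_intros)
  then have "(g \<longlongrightarrow> 0) (at 0)" by (simp add: isCont_def g0)
  then have "\<forall>\<^sub>F h in at 0. dist (g h) 0 < e" by (rule tendstoD) fact
  then obtain d0 where d0: "d0 > 0" "\<And>h. h \<noteq> 0 \<Longrightarrow> \<bar>h\<bar> < d0 \<Longrightarrow> \<bar>g h\<bar> < e"
    by (auto simp: eventually_at dist_real_def)
  have g_le: "g h \<le> e" if "\<bar>h\<bar> < d0" for h
    using d0(2)[OF _ that] assms(2) by (cases "h = 0") (auto simp: g0)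
  have "\<exists>d>0. \<forall>s\<in>{0..T}. \<forall>t\<in>{0..T}. dist t s < d \<longrightarrow> dist (Yb j t) (Yb j s) < e" if "j \<in> {1..m}" for j
    using compact_uniformly_continuous[OF Yb_cont[OF that]] assms(2) unfolding uniformly_continuous_on_def by auto
  then obtain d where d: "\<And>j. j \<in> {1..m} \<Longrightarrow> d j > 0 \<and> (\<forall>s\<in>{0..T}. \<forall>t\<in>{0..T}. dist t s < d j \<longrightarrow> dist (Yb j t) (Yb j s) < e)"
    by metis
  \<comment> \<open>Half the minimum turns the strict inequalities in the definitions of continuity
    into the closed condition t - s \<le> \<delta>.\<close>
  define \<delta> where "\<delta> = Min (insert d0 (d ` {1..m})) / 2"
  have M: "Min (insert d0 (d ` {1..m})) > 0" using d0(1) d by (subst Min_gr_iff) auto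
  have \<delta>: "\<delta> > 0" "\<delta> < d0" "\<And>j. j \<in> {1..m} \<Longrightarrow> \<delta> < d j"
  proof -
    show "\<delta> > 0" using M by (simp add: \<delta>_def)
    have le: "\<delta> < x" if "x \<in> insert d0 (d ` {1..m})" for x
    proof -
      have "Min (insert d0 (d ` {1..m})) \<le> x" using that by (intro Min_le) auto
      then show ?thesis using M unfolding \<delta>_def by linarith
    qed
    show "\<delta> < d0" "\<And>j. j \<in> {1..m} \<Longrightarrow> \<delta> < d j" by (auto intro!: le)
  qed
  show ?thesis
  proof (rule that[OF \<delta>(1)])
    fix s t assume st: "0 \<le> s" "s \<le> t" "t \<le> T" "t - s \<le> \<delta>"
    show "expectation (\<lambda>\<omega>. norm (Xb n \<omega> t - Xb n \<omega> s)) \<le> e"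
      using Xb_increment(2)[OF assms(1) st(1-3)] g_le[of "t - s"] st \<delta>(2) by (simp add: g_def)
    show "norm (Yb j t - Yb j s) \<le> e" if j: "j \<in> {1..m}" for j
    proof -
      have "dist t s < d j" using st \<delta>(3)[OF j] by (simp add: dist_real_def)
      then have "dist (Yb j t) (Yb j s) < e" using d[OF j] st by auto
      then show ?thesis by (simp add: dist_norm)
    qed
  qed
qed

end

section \<open>Uniform tails of the limit processes\<close>

context interaction begin

text \<open>The part of the bound in \<open>path_bound\<close> without noise, for the constant
  majorant of the drift that \<kappa> provides.\<close>

definition initial_bound :: "real^'d \<Rightarrow> real" where
  "initial_bound x = cG * (norm x + (norm (H1 0) + norm (K1 0) + L * \<kappa>) * T)"

text \<open>Bounds \<open>E[|X(t)|; |X(t)| > R]\<close>, after splitting the pathwise Gronwall bound for \<open>|X(t)|\<close> into the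
  contribution of the initial datum and that of the noise.\<close>
definition tail :: "real \<Rightarrow> real" where
  "tail R = 2 * (\<integral>x. initial_bound x * indicator {x. initial_bound x > R / 2} x \<partial>\<nu>)
     + 16 * cG\<^sup>2 * \<sigma> * (real CARD('d) * T + real CARD('d) * T ^ 3) / R"

lemma cG_ge1: "1 \<le> cG"
  using L T by (simp add: cG_def)

lemma cG_nonneg [simp]: "0 \<le> cG"
  using cG_ge1 by simp

lemma initial_bound_nonneg: "0 \<le> initial_bound x"
  by (simp add: initial_bound_def)

lemma initial_bound_integrable: "integrable \<nu> initial_bound"
  and initial_bound_meas [measurable]: "initial_bound \<in> borel_measurable borel"
proof -
  interpret prob_space \<nu> using \<nu> by (simp add: W1_space_def)
  show "integrable \<nu> initial_bound"
    using \<nu> by (auto simp: initial_bound_def[abs_def] W1_space_def)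
  show "initial_bound \<in> borel_measurable borel" unfolding initial_bound_def[abs_def] by measurable
qed

text \<open>The initial datum has a first moment, so its part tends to 0 by dominated convergence,
  without a rate. The noise has a second moment, and its part is of order 1 / R.\<close>

lemma tail_tendsto: "(\<lambda>i. tail (real i)) \<longlonglongrightarrow> 0"
proof -
  have s[measurable_cong]: "sets \<nu> = sets borel" using \<nu> by (simp add: W1_space_def)
  have "(\<lambda>i. \<integral>x. initial_bound x * indicator {x. initial_bound x > real i / 2} x \<partial>\<nu>) \<longlonglongrightarrow> (\<integral>x. 0 \<partial>\<nu>)"
  proof (rule integral_dominated_convergence[where w=initial_bound])
    show "AE x in \<nu>. (\<lambda>i. initial_bound x * indicator {x. initial_bound x > real i / 2} x) \<longlonglongrightarrow> 0"
    proof (intro AE_I2 tendsto_eventually)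
      fix x
      obtain K :: nat where K: "2 * initial_bound x \<le> real K" using real_arch_simple by blast
      show "\<forall>\<^sub>F i in sequentially. initial_bound x * indicator {x. initial_bound x > real i / 2} x = 0"
        using eventually_ge_at_top[of K] by eventually_elim (use K in auto)
    qed
    show "AE x in \<nu>. norm (initial_bound x * indicator {x. initial_bound x > real i / 2} x) \<le> initial_bound x" for i
      using initial_bound_nonneg by (intro AE_I2) (auto split: split_indicator simp: abs_of_nonneg)
  qed (use initial_bound_integrable in \<open>auto simp: s\<close>)
  moreover have "(\<lambda>i. 16 * cG\<^sup>2 * \<sigma> * (real CARD('d) * T + real CARD('d) * T ^ 3) / real i) \<longlonglongrightarrow> 0"
    by (rule tendsto_divide_0[OF tendsto_const filterlim_real_sequentially[THEN filterlim_at_top_imp_at_infinity]])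
  ultimately show ?thesis
    unfolding tail_def using tendsto_add[OF tendsto_mult[OF tendsto_const[of 2]]] by fastforce
qed

end

context limit_family begin

text \<open>Let |X| > R and |X| \<le> U + V, with U from the initial datum and V from the noise. If
  U \<ge> V, then |X| \<le> 2 U and U > R / 2; otherwise |X| \<le> 2 V \<le> 4 V^2 / R. The cutoff
  \<open>\<phi>\<close> will be the far cell of a partition of unity.\<close>

lemma Xb_tail:
  assumes n: "n \<ge> 1" and t: "t \<in> {0..T}" and R: "R > 0"
    and \<phi>: "\<phi> \<in> borel_measurable borel" "\<And>x. 0 \<le> \<phi> x" "\<And>x. \<phi> x \<le> 1" "\<And>x. \<phi> x > 0 \<Longrightarrow> norm x > R"
  shows "integrable M (\<lambda>\<omega>. norm (Xb n \<omega> t) * \<phi> (Xb n \<omega> t))"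
    and "expectation (\<lambda>\<omega>. norm (Xb n \<omega> t) * \<phi> (Xb n \<omega> t)) \<le> tail R"
proof -
  note [measurable] = Xb_meas[OF n t] \<phi>(1) X0M[OF n]
  show int: "integrable M (\<lambda>\<omega>. norm (Xb n \<omega> t) * \<phi> (Xb n \<omega> t))"
  proof (rule Bochner_Integration.integrable_bound[OF Xb_int[OF n t]])
    show "AE \<omega> in M. norm (norm (Xb n \<omega> t) * \<phi> (Xb n \<omega> t)) \<le> norm (norm (Xb n \<omega> t))"
      using \<phi>(2,3) by (intro AE_I2) (simp add: abs_mult mult_left_le)
  qed measurable
  define c where "c = norm (H1 0) + norm (K1 0) + L * \<kappa>"
  have c0: "0 \<le> c" by (simp add: c_def)
  obtain w where w: "integrable M w" "integrable M (\<lambda>\<omega>. (w \<omega>)\<^sup>2)" "expectation (\<lambda>\<omega>. (w \<omega>)\<^sup>2) \<le> real CARD('d) * T ^ 3"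
    "AE \<omega> in M. continuous_on {0..T} (W n \<omega>) \<and> w \<omega> = (LINT s:{0..T}|lborel. norm (W n \<omega> s))" "\<And>\<omega>. 0 \<le> w \<omega>"
    by (rule brownian_path_integral[OF n T], erule that)
  define V where "V \<omega> = cG * (sqrt (2 * \<sigma>) * (norm (W n \<omega> t) + w \<omega>))" for \<omega>
  define ib where "ib x = initial_bound x * indicator {x. initial_bound x > R / 2} x" for x
  have V0: "0 \<le> V \<omega>" for \<omega> unfolding V_def using w(5) \<sigma> by (intro mult_nonneg_nonneg add_nonneg_nonneg) auto
  have [measurable]: "ib \<in> borel_measurable borel" unfolding ib_def by measurable
  have ib0: "0 \<le> ib x" for x using initial_bound_nonneg[of x] by (simp add: ib_def)
  have ib_int: "integrable \<nu> ib"
    unfolding ib_def using \<nu> by (intro integrable_real_mult_indicator initial_bound_integrable) (auto simp: W1_space_def)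
  have ib_X0: "integrable M (\<lambda>\<omega>. ib (X0 n \<omega>))" "expectation (\<lambda>\<omega>. ib (X0 n \<omega>)) = integral\<^sup>L \<nu> ib"
    using ib_int unfolding X0_law[OF n, symmetric] by (simp_all add: integrable_distr_eq integral_distr)
  have V2: "(V \<omega>)\<^sup>2 \<le> cG\<^sup>2 * (2 * \<sigma>) * (2 * ((norm (W n \<omega> t))\<^sup>2 + (w \<omega>)\<^sup>2))" for \<omega>
  proof -
    have "(V \<omega>)\<^sup>2 = cG\<^sup>2 * (2 * \<sigma>) * (norm (W n \<omega> t) + w \<omega>)\<^sup>2" using \<sigma> by (simp add: V_def power_mult_distrib)
    also have "\<dots> \<le> cG\<^sup>2 * (2 * \<sigma>) * (2 * ((norm (W n \<omega> t))\<^sup>2 + (w \<omega>)\<^sup>2))"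
      using zero_le_power2[of "norm (W n \<omega> t) - w \<omega>"] \<sigma> by (intro mult_left_mono) (auto simp: power2_sum power2_diff)
    finally show ?thesis .
  qed
  have "AE \<omega> in M. \<forall>t\<in>{0..T}. norm (Xb n \<omega> t) \<le>
    cG * (norm (X0 n \<omega>) + (LINT s:{0..T}|lborel. c) + sqrt (2 * \<sigma>) * (norm (W n \<omega> t) + w \<omega>))"
  proof (rule path_bound[OF n _ _ _ w(4)])
    show "set_integrable lborel {0..T} (\<lambda>s. c)" by (rule set_integrable_bounded_Icc[of _ _ _ "\<bar>c\<bar>"]) auto
    show "norm (drift n \<omega> s) \<le> c + 2 * L * norm (Xb n \<omega> s)" if s: "s \<in> {0..T}" for \<omega> s
    proof -
      have "L * (k n s + ysum s) \<le> L * \<kappa>" using moment_bound[OF n s] by (intro mult_left_mono) auto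
      then show ?thesis using drift_growth[OF n s, of \<omega>] by (simp add: c_def distrib_left)
    qed
  qed (use c0 in auto)
  then have "AE \<omega> in M. norm (Xb n \<omega> t) * \<phi> (Xb n \<omega> t) \<le> 2 * ib (X0 n \<omega>) + 4 / R * (cG\<^sup>2 * (2 * \<sigma>) * (2 * ((norm (W n \<omega> t))\<^sup>2 + (w \<omega>)\<^sup>2)))"
  proof eventually_elim
    case (elim \<omega>)
    define X where "X = norm (Xb n \<omega> t)"
    define U where "U = initial_bound (X0 n \<omega>)"
    have "X \<le> cG * (norm (X0 n \<omega>) + c * T + sqrt (2 * \<sigma>) * (norm (W n \<omega> t) + w \<omega>))"
      using elim t set_lint_const_Icc[OF T0, of c] by (simp add: X_def)
    also have "\<dots> = U + V \<omega>" by (simp add: U_def V_def initial_bound_def c_def algebra_simps)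
    finally have le: "X \<le> U + V \<omega>" .
    have "X * \<phi> (Xb n \<omega> t) \<le> 2 * ib (X0 n \<omega>) + 4 / R * (V \<omega>)\<^sup>2"
    proof (cases "\<phi> (Xb n \<omega> t) > 0")
      case True
      then have XR: "X > R" using \<phi>(4) by (simp add: X_def)
      have X1: "X * \<phi> (Xb n \<omega> t) \<le> X" using \<phi>(2,3) by (simp add: X_def mult_left_le)
      show ?thesis
      proof (cases "U \<ge> V \<omega>")
        case True
        then have "U > R / 2" using XR le by simp
        then have "ib (X0 n \<omega>) = U" by (simp add: ib_def U_def)
        moreover have "0 \<le> 4 / R * (V \<omega>)\<^sup>2" using R by simp
        ultimately show ?thesis using X1 le True by linarith
      next
        case False
        then have "2 * V \<omega> > R" using XR le by simp
        then have "R * (2 * V \<omega>) \<le> (2 * V \<omega>) * (2 * V \<omega>)" using V0[of \<omega>] by (intro mult_right_mono) auto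
        then have "2 * V \<omega> \<le> 4 / R * (V \<omega>)\<^sup>2" using R by (simp add: field_simps power2_eq_square)
        then show ?thesis using X1 le False ib0[of "X0 n \<omega>"] by linarith
      qed
    next
      case False
      then have "\<phi> (Xb n \<omega> t) = 0" using \<phi>(2)[of "Xb n \<omega> t"] by simp
      then show ?thesis using ib0 R by simp
    qed
    also have "4 / R * (V \<omega>)\<^sup>2 \<le> 4 / R * (cG\<^sup>2 * (2 * \<sigma>) * (2 * ((norm (W n \<omega> t))\<^sup>2 + (w \<omega>)\<^sup>2)))"
      using R by (intro mult_left_mono V2) auto
    finally show ?case by (simp add: X_def)
  qed
  then have "expectation (\<lambda>\<omega>. norm (Xb n \<omega> t) * \<phi> (Xb n \<omega> t)) \<le>
    expectation (\<lambda>\<omega>. 2 * ib (X0 n \<omega>) + 4 / R * (cG\<^sup>2 * (2 * \<sigma>) * (2 * ((norm (W n \<omega> t))\<^sup>2 + (w \<omega>)\<^sup>2))))"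
    using int ib_X0(1) W_moments(3)[OF n t] w(2) by (intro integral_mono_AE) auto
  also have "\<dots> = 2 * integral\<^sup>L \<nu> ib + 4 / R * (cG\<^sup>2 * (2 * \<sigma>) * (2 * (expectation (\<lambda>\<omega>. (norm (W n \<omega> t))\<^sup>2) + expectation (\<lambda>\<omega>. (w \<omega>)\<^sup>2))))"
    using ib_X0 W_moments(3)[OF n t] w(2) by simp
  also have "\<dots> \<le> 2 * integral\<^sup>L \<nu> ib + 4 / R * (cG\<^sup>2 * (2 * \<sigma>) * (2 * (real CARD('d) * T + real CARD('d) * T ^ 3)))"
    using W_moments(4)[OF n t] w(3) R \<sigma> by (intro add_left_mono mult_left_mono add_mono) auto
  also have "4 / R * (cG\<^sup>2 * (2 * \<sigma>) * (2 * (real CARD('d) * T + real CARD('d) * T ^ 3))) = 16 * cG\<^sup>2 * \<sigma> * (real CARD('d) * T + real CARD('d) * T ^ 3) / R"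
    by simp
  also have "2 * integral\<^sup>L \<nu> ib + \<dots> = tail R"
    by (simp only: tail_def ib_def[abs_def])
  finally show "expectation (\<lambda>\<omega>. norm (Xb n \<omega> t) * \<phi> (Xb n \<omega> t)) \<le> tail R" .
qed

end

section \<open>Euler scheme for the limit system\<close>

lemma nn_integral_pair_times:
  assumes "prob_space \<mu>" "prob_space \<nu>" and [measurable]: "f \<in> borel_measurable \<mu>" "g \<in> borel_measurable \<nu>"
  shows "(\<integral>\<^sup>+z. f (fst z) * g (snd z) \<partial>(\<mu> \<Otimes>\<^sub>M \<nu>)) = (\<integral>\<^sup>+x. f x \<partial>\<mu>) * (\<integral>\<^sup>+y. g y \<partial>\<nu>)"
proof -
  interpret m: prob_space \<mu> by fact
  interpret n: prob_space \<nu> by fact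
  have "(\<integral>\<^sup>+z. f (fst z) * g (snd z) \<partial>(\<mu> \<Otimes>\<^sub>M \<nu>)) = (\<integral>\<^sup>+x. (\<integral>\<^sup>+y. f x * g y \<partial>\<nu>) \<partial>\<mu>)"
    by (subst n.nn_integral_fst[symmetric]) auto
  also have "\<dots> = (\<integral>\<^sup>+x. f x \<partial>\<mu>) * (\<integral>\<^sup>+y. g y \<partial>\<nu>)"
    by (simp add: nn_integral_cmult nn_integral_multc)
  finally show ?thesis .
qed

text \<open>A map applied to each of two independent states with independent increments produces
  independent states again. The four factors are regrouped by integrating the indicator of a
  rectangle factor by factor.\<close>

lemma distr_pair_map:
  fixes \<eta> \<gamma> :: "'b::second_countable_topology measure"
  assumes "prob_space \<eta>" "prob_space \<gamma>" and s[measurable_cong]: "sets \<eta> = sets borel" "sets \<gamma> = sets borel"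
    and \<Phi>[measurable]: "\<Phi> \<in> borel \<Otimes>\<^sub>M borel \<rightarrow>\<^sub>M (borel :: 'b measure)"
  shows "distr ((\<eta> \<Otimes>\<^sub>M \<eta>) \<Otimes>\<^sub>M (\<gamma> \<Otimes>\<^sub>M \<gamma>)) (borel \<Otimes>\<^sub>M borel) (\<lambda>z. (\<Phi> (fst (fst z), fst (snd z)), \<Phi> (snd (fst z), snd (snd z))))
    = distr (\<eta> \<Otimes>\<^sub>M \<gamma>) borel \<Phi> \<Otimes>\<^sub>M distr (\<eta> \<Otimes>\<^sub>M \<gamma>) borel \<Phi>"
proof (rule pair_measure_eqI[symmetric])
  interpret l: prob_space \<eta> by fact
  interpret g: prob_space \<gamma> by fact
  interpret lg: pair_prob_space \<eta> \<gamma> ..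
  interpret ll: pair_prob_space \<eta> \<eta> ..
  interpret gg: pair_prob_space \<gamma> \<gamma> ..
  have \<Phi>m[measurable]: "\<Phi> \<in> \<eta> \<Otimes>\<^sub>M \<gamma> \<rightarrow>\<^sub>M borel" by simp
  interpret d: prob_space "distr (\<eta> \<Otimes>\<^sub>M \<gamma>) borel \<Phi>" by (rule lg.P.prob_space_distr) simp
  show "sigma_finite_measure (distr (\<eta> \<Otimes>\<^sub>M \<gamma>) borel \<Phi>)" "sigma_finite_measure (distr (\<eta> \<Otimes>\<^sub>M \<gamma>) borel \<Phi>)" ..
  fix A B assume "A \<in> sets (distr (\<eta> \<Otimes>\<^sub>M \<gamma>) borel \<Phi>)" "B \<in> sets (distr (\<eta> \<Otimes>\<^sub>M \<gamma>) borel \<Phi>)"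
  then have [measurable]: "A \<in> sets borel" "B \<in> sets borel" by auto
  let ?P = "(\<eta> \<Otimes>\<^sub>M \<eta>) \<Otimes>\<^sub>M (\<gamma> \<Otimes>\<^sub>M \<gamma>)"
  let ?\<Psi> = "\<lambda>z. (\<Phi> (fst (fst z), fst (snd z)), \<Phi> (snd (fst z), snd (snd z)))"
  define a where "a C x = (\<integral>\<^sup>+v. indicator C (\<Phi> (x, v)) \<partial>\<gamma>)" for C x
  have a_meas: "a C \<in> borel_measurable \<eta>" if [measurable]: "C \<in> sets borel" for C
    unfolding a_def by measurable
  have a_int: "(\<integral>\<^sup>+x. a C x \<partial>\<eta>) = emeasure (distr (\<eta> \<Otimes>\<^sub>M \<gamma>) borel \<Phi>) C" if [measurable]: "C \<in> sets borel" for C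
  proof -
    have "(\<integral>\<^sup>+x. a C x \<partial>\<eta>) = (\<integral>\<^sup>+z. indicator C (\<Phi> z) \<partial>(\<eta> \<Otimes>\<^sub>M \<gamma>))"
      unfolding a_def by (subst g.nn_integral_fst) auto
    also have "\<dots> = (\<integral>\<^sup>+y. indicator C y \<partial>distr (\<eta> \<Otimes>\<^sub>M \<gamma>) borel \<Phi>)" by (subst nn_integral_distr) auto
    finally show ?thesis by simp
  qed
  have "emeasure (distr ?P (borel \<Otimes>\<^sub>M borel) ?\<Psi>) (A \<times> B) = (\<integral>\<^sup>+q. indicator (A \<times> B) q \<partial>distr ?P (borel \<Otimes>\<^sub>M borel) ?\<Psi>)"
    by simp
  also have "\<dots> = (\<integral>\<^sup>+z. indicator (A \<times> B) (?\<Psi> z) \<partial>?P)"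
    by (subst nn_integral_distr) auto
  also have "\<dots> = (\<integral>\<^sup>+p. (\<integral>\<^sup>+q. indicator A (\<Phi> (fst p, fst q)) * indicator B (\<Phi> (snd p, snd q)) \<partial>(\<gamma> \<Otimes>\<^sub>M \<gamma>)) \<partial>(\<eta> \<Otimes>\<^sub>M \<eta>))"
    by (subst gg.P.nn_integral_fst[symmetric]) (auto simp: indicator_times)
  also have "\<dots> = (\<integral>\<^sup>+p. a A (fst p) * a B (snd p) \<partial>(\<eta> \<Otimes>\<^sub>M \<eta>))"
  proof (rule nn_integral_cong)
    fix p :: "'b \<times> 'b"
    show "(\<integral>\<^sup>+q. indicator A (\<Phi> (fst p, fst q)) * indicator B (\<Phi> (snd p, snd q)) \<partial>(\<gamma> \<Otimes>\<^sub>M \<gamma>)) = a A (fst p) * a B (snd p)"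
      unfolding a_def by (rule nn_integral_pair_times) (auto intro: assms)
  qed
  also have "\<dots> = (\<integral>\<^sup>+x. a A x \<partial>\<eta>) * (\<integral>\<^sup>+x. a B x \<partial>\<eta>)"
    by (rule nn_integral_pair_times) (auto intro: assms a_meas)
  finally show "emeasure (distr (\<eta> \<Otimes>\<^sub>M \<gamma>) borel \<Phi>) A * emeasure (distr (\<eta> \<Otimes>\<^sub>M \<gamma>) borel \<Phi>) B = emeasure (distr ?P (borel \<Otimes>\<^sub>M borel) ?\<Psi>) (A \<times> B)"
    by (simp add: a_int)
qed (simp cong: sets_pair_measure_cong)

context limit_family begin

text \<open>Euler scheme for the limit system with time step \<open>h\<close>. The mean-field term uses the law of the
  first copy; it is a consequence (and not part of the definition) that all copies have the same law.\<close>
primrec eul :: "nat \<Rightarrow> real \<Rightarrow> nat \<Rightarrow> 'a \<Rightarrow> real^'d" where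
  "eul 0 h = X0"
| "eul (Suc j) h = (\<lambda>n \<omega>. eul j h n \<omega>
      + h *\<^sub>R (expectation (\<lambda>\<omega>'. H1 (eul j h n \<omega> - eul j h 1 \<omega>')) + avg (\<lambda>i. K1 (Yb i (real j * h) - eul j h n \<omega>)))
      + sqrt (2 * \<sigma>) *\<^sub>R (W n \<omega> (real (Suc j) * h) - W n \<omega> (real j * h)))"

text \<open>One step as a deterministic map of state and increment. It is the same map for every
  copy, so equality of laws and independence propagate through it.\<close>

definition eul_step :: "nat \<Rightarrow> real \<Rightarrow> (real^'d) \<times> (real^'d) \<Rightarrow> real^'d" where
  "eul_step j h z = fst z
      + h *\<^sub>R (expectation (\<lambda>\<omega>'. H1 (fst z - eul j h 1 \<omega>')) + avg (\<lambda>i. K1 (Yb i (real j * h) - fst z)))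
      + sqrt (2 * \<sigma>) *\<^sub>R snd z"

lemma eul_Suc: "eul (Suc j) h n \<omega> = eul_step j h (eul j h n \<omega>, W n \<omega> (real (Suc j) * h) - W n \<omega> (real j * h))"
  by (simp add: eul_step_def)

lemma expectation_H1_lipschitz:
  assumes X: "X \<in> borel_measurable M" "integrable M (\<lambda>\<omega>. norm (X \<omega>))" and Y: "Y \<in> borel_measurable M" "integrable M (\<lambda>\<omega>. norm (Y \<omega>))"
  shows "integrable M (\<lambda>\<omega>. H1 (x - X \<omega>))"
    and "norm (expectation (\<lambda>\<omega>. H1 (x - X \<omega>)) - expectation (\<lambda>\<omega>. H1 (y - Y \<omega>))) \<le> L * norm (x - y) + L * expectation (\<lambda>\<omega>. norm (X \<omega> - Y \<omega>))"
proof -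
  have i: "integrable M (\<lambda>\<omega>. H1 (z - Z \<omega>))" if "Z \<in> borel_measurable M" "integrable M (\<lambda>\<omega>. norm (Z \<omega>))" for z and Z :: "'a \<Rightarrow> real^'d"
  proof (rule integrable_lipschitz[OF _ _ _ H1])
    have "integrable M Z" using that by (simp add: integrable_norm_iff)
    then show "integrable M (\<lambda>\<omega>. norm (z - Z \<omega>))" by (intro integrable_norm Bochner_Integration.integrable_diff) auto
  qed (use that finite_measure_axioms in auto)
  show "integrable M (\<lambda>\<omega>. H1 (x - X \<omega>))" by (rule i[OF X])
  have XY: "integrable M (\<lambda>\<omega>. norm (X \<omega> - Y \<omega>))"
    using X Y by (intro integrable_norm Bochner_Integration.integrable_diff) (auto simp: integrable_norm_iff)
  have "norm (expectation (\<lambda>\<omega>. H1 (x - X \<omega>)) - expectation (\<lambda>\<omega>. H1 (y - Y \<omega>))) = norm (expectation (\<lambda>\<omega>. H1 (x - X \<omega>) - H1 (y - Y \<omega>)))"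
    using i[OF X] i[OF Y] by simp
  also have "\<dots> \<le> expectation (\<lambda>\<omega>. norm (H1 (x - X \<omega>) - H1 (y - Y \<omega>)))" by (rule integral_norm_bound)
  also have "\<dots> \<le> expectation (\<lambda>\<omega>. L * norm (x - y) + L * norm (X \<omega> - Y \<omega>))"
  proof (rule integral_mono)
    show "integrable M (\<lambda>\<omega>. norm (H1 (x - X \<omega>) - H1 (y - Y \<omega>)))" using i[OF X] i[OF Y] by simp
    show "integrable M (\<lambda>\<omega>. L * norm (x - y) + L * norm (X \<omega> - Y \<omega>))" using XY by simp
    fix \<omega>
    have "norm (H1 (x - X \<omega>) - H1 (y - Y \<omega>)) \<le> L * norm ((x - y) - (X \<omega> - Y \<omega>))"
      using H1[of "x - X \<omega>" "y - Y \<omega>"] by (simp add: algebra_simps)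
    also have "\<dots> \<le> L * (norm (x - y) + norm (X \<omega> - Y \<omega>))" by (intro mult_left_mono norm_triangle_ineq4) auto
    finally show "norm (H1 (x - X \<omega>) - H1 (y - Y \<omega>)) \<le> L * norm (x - y) + L * norm (X \<omega> - Y \<omega>)" by (simp add: distrib_left)
  qed
  also have "\<dots> = L * norm (x - y) + L * expectation (\<lambda>\<omega>. norm (X \<omega> - Y \<omega>))" using XY by (simp add: prob_space)
  finally show "norm (expectation (\<lambda>\<omega>. H1 (x - X \<omega>)) - expectation (\<lambda>\<omega>. H1 (y - Y \<omega>))) \<le> L * norm (x - y) + L * expectation (\<lambda>\<omega>. norm (X \<omega> - Y \<omega>))" .
qed

lemma eul_step_meas:
  assumes "eul j h 1 \<in> borel_measurable M" "integrable M (\<lambda>\<omega>. norm (eul j h 1 \<omega>))"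
  shows "eul_step j h \<in> borel \<Otimes>\<^sub>M borel \<rightarrow>\<^sub>M borel"
    and "norm (eul_step j h (x, w)) \<le> norm (eul_step j h (0, 0)) + (1 + \<bar>h\<bar> * (2 * L)) * norm x + sqrt (2 * \<sigma>) * norm w"
proof -
  define g where "g x = expectation (\<lambda>\<omega>'. H1 (x - eul j h 1 \<omega>')) + avg (\<lambda>i. K1 (Yb i (real j * h) - x))" for x
  have g: "norm (g x - g y) \<le> 2 * L * norm (x - y)" for x y
  proof -
    have "norm (g x - g y) \<le> norm (expectation (\<lambda>\<omega>'. H1 (x - eul j h 1 \<omega>')) - expectation (\<lambda>\<omega>'. H1 (y - eul j h 1 \<omega>')))
       + norm (avg (\<lambda>i. K1 (Yb i (real j * h) - x)) - avg (\<lambda>i. K1 (Yb i (real j * h) - y)))"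
      unfolding g_def by (rule norm_diff_triangle_ineq)
    also have "\<dots> \<le> (L * norm (x - y) + L * expectation (\<lambda>\<omega>. norm (eul j h 1 \<omega> - eul j h 1 \<omega>))) + (L * avg (\<lambda>i. norm (Yb i (real j * h) - Yb i (real j * h))) + L * norm (x - y))"
      by (intro add_mono expectation_H1_lipschitz(2) norm_avg_K1_diff assms)
    finally show ?thesis by (simp add: avg_const)
  qed
  have [measurable]: "g \<in> borel_measurable borel" by (rule borel_measurable_lipschitz(2)[OF g])
  have e: "eul_step j h z = fst z + h *\<^sub>R g (fst z) + sqrt (2 * \<sigma>) *\<^sub>R snd z" for z
    by (simp add: eul_step_def g_def)
  show "eul_step j h \<in> borel \<Otimes>\<^sub>M borel \<rightarrow>\<^sub>M borel"
    unfolding e[abs_def] by measurable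
  have "eul_step j h (x, w) = eul_step j h (0, 0) + (x + h *\<^sub>R (g x - g 0) + sqrt (2 * \<sigma>) *\<^sub>R w)"
    by (simp add: e algebra_simps)
  then have "norm (eul_step j h (x, w)) \<le> norm (eul_step j h (0, 0)) + norm (x + h *\<^sub>R (g x - g 0) + sqrt (2 * \<sigma>) *\<^sub>R w)"
    by (simp only: norm_triangle_ineq)
  also have "norm (x + h *\<^sub>R (g x - g 0) + sqrt (2 * \<sigma>) *\<^sub>R w) \<le> norm x + norm (h *\<^sub>R (g x - g 0)) + norm (sqrt (2 * \<sigma>) *\<^sub>R w)"
    by (intro order_trans[OF norm_triangle_ineq] add_right_mono norm_triangle_ineq)
  also have "norm (h *\<^sub>R (g x - g 0)) \<le> \<bar>h\<bar> * (2 * L * norm x)" using g[of x 0] by (simp add: mult_left_mono)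
  also have "norm (sqrt (2 * \<sigma>) *\<^sub>R w) = sqrt (2 * \<sigma>) * norm w" using \<sigma> by simp
  finally show "norm (eul_step j h (x, w)) \<le> norm (eul_step j h (0, 0)) + (1 + \<bar>h\<bar> * (2 * L)) * norm x + sqrt (2 * \<sigma>) * norm w"
    by (simp add: algebra_simps)
qed

lemma grid_bounds:
  assumes "h > 0" "real (Suc j) * h \<le> T"
  shows "0 \<le> real j * h" "real j * h < real (Suc j) * h" "real j * h \<le> T" "real j * h \<in> {0..T}" "real (Suc j) * h \<in> {0..T}"
    "real (Suc j) * h - real j * h = h"
proof -
  show e: "real (Suc j) * h - real j * h = h" by (simp add: algebra_simps)
  show 0: "0 \<le> real j * h" using assms by simp
  show "real j * h < real (Suc j) * h" using assms e by linarith
  show 1: "real j * h \<le> T" using assms e by linarith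
  show "real j * h \<in> {0..T}" "real (Suc j) * h \<in> {0..T}" using assms 0 1 by (auto intro: mult_nonneg_nonneg)
qed

text \<open>Adaptedness makes the state at time \<open>j * h\<close> independent of the increments
  of the next step.\<close>

lemma eul_adapted:
  assumes "h > 0" "real j * h \<le> T" "n \<ge> 1"
  shows "eul j h n \<in> borel_measurable (F (real j * h)) \<and> integrable M (\<lambda>\<omega>. norm (eul j h n \<omega>))"
  using assms
proof (induction j arbitrary: n)
  case 0
  then show ?case using X0_meas X0_int by simp
next
  case (Suc j)
  note gb = grid_bounds[OF Suc.prems(1,2)]
  have IH: "eul j h i \<in> borel_measurable (F (real j * h))" "integrable M (\<lambda>\<omega>. norm (eul j h i \<omega>))" if "i \<ge> 1" for i
    using Suc.IH[OF Suc.prems(1) gb(3) that] by auto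
  have M1: "eul j h i \<in> borel_measurable M" if "i \<ge> 1" for i
    using IH(1)[OF that] subalg[OF gb(4)] by (auto intro: measurable_from_subalg)
  note st = eul_step_meas[OF M1[OF order_refl] IH(2)[OF order_refl]]
  let ?D = "\<lambda>\<omega>. W n \<omega> (real (Suc j) * h) - W n \<omega> (real j * h)"
  have a: "eul j h n \<in> borel_measurable (F (real (Suc j) * h))"
    by (rule measurable_F_mono[OF IH(1)[OF Suc.prems(3)]]) (use gb Suc.prems in auto)
  have b: "?D \<in> borel_measurable (F (real (Suc j) * h))"
    using Suc.prems gb by (intro borel_measurable_diff W_adapted) auto
  have c: "eul (Suc j) h n = (\<lambda>\<omega>. eul_step j h (eul j h n \<omega>, ?D \<omega>))" by (rule ext) (rule eul_Suc)
  have m: "eul (Suc j) h n \<in> borel_measurable (F (real (Suc j) * h))"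
    unfolding c by (rule measurable_compose[OF measurable_Pair[OF a b] st(1)])
  have "integrable M (\<lambda>\<omega>. norm (eul (Suc j) h n \<omega>))"
  proof (rule Bochner_Integration.integrable_bound)
    show "integrable M (\<lambda>\<omega>. norm (eul_step j h (0, 0)) + (1 + \<bar>h\<bar> * (2 * L)) * norm (eul j h n \<omega>) + sqrt (2 * \<sigma>) * norm (?D \<omega>))"
      using IH(2)[OF Suc.prems(3)] brownian_increment_first_moment(1)[OF prob_space_axioms bm[OF Suc.prems(3)] filt gb(1) less_imp_le[OF gb(2)] Suc.prems(2)] by simp
    show "(\<lambda>\<omega>. norm (eul (Suc j) h n \<omega>)) \<in> borel_measurable M"
      by (rule measurable_compose[OF measurable_from_subalg[OF subalg[OF gb(5)] m] borel_measurable_norm])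
    show "AE \<omega> in M. norm (norm (eul (Suc j) h n \<omega>)) \<le> norm (norm (eul_step j h (0, 0)) + (1 + \<bar>h\<bar> * (2 * L)) * norm (eul j h n \<omega>) + sqrt (2 * \<sigma>) * norm (?D \<omega>))"
      unfolding c using order_trans[OF st(2) abs_ge_self] by (intro AE_I2) simp
  qed
  with m show ?case by blast
qed

lemma eul_meas: "h > 0 \<Longrightarrow> real j * h \<le> T \<Longrightarrow> n \<ge> 1 \<Longrightarrow> eul j h n \<in> borel_measurable M"
  using eul_adapted[of h j n] subalg[of "real j * h"] by (auto intro: measurable_from_subalg)

lemma eul_int: "h > 0 \<Longrightarrow> real j * h \<le> T \<Longrightarrow> n \<ge> 1 \<Longrightarrow> integrable M (\<lambda>\<omega>. norm (eul j h n \<omega>))"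
  using eul_adapted by blast

lemma increment_law:
  assumes "n \<ge> 1" "0 \<le> s" "s < t" "t \<le> T"
  shows "distr M borel (\<lambda>\<omega>. W n \<omega> t - W n \<omega> s) = distr M borel (\<lambda>\<omega>. W 1 \<omega> t - W 1 \<omega> s)"
proof -
  have "distr M lborel (\<lambda>\<omega>. W i \<omega> t - W i \<omega> s) = density lborel (\<lambda>x. ennreal (\<Prod>k\<in>UNIV. normal_density 0 (sqrt (t - s)) (x $ k)))" if "i \<ge> 1" for i
    using bm[OF that] assms unfolding brownian_motion_def by (intro distributed_distr_eq_density) blast
  moreover have "distr M lborel (\<lambda>\<omega>. W i \<omega> t - W i \<omega> s) = distr M borel (\<lambda>\<omega>. W i \<omega> t - W i \<omega> s)" for i
    by (rule distr_cong) auto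
  ultimately show ?thesis using assms(1) by simp
qed

text \<open>Both assertions are carried through one induction over all copies: two independent
  states followed by a step stay independent only if the pair of new increments is independent of
  the pair of old states, which \<open>distr_past_pair_increments\<close> supplies.\<close>

lemma eul_law:
  assumes "h > 0" "real j * h \<le> T" "n \<ge> 1"
  shows "distr M borel (eul j h n) = distr M borel (eul j h 1)"
    and "l \<ge> 1 \<Longrightarrow> l \<noteq> n \<Longrightarrow> distr M (borel \<Otimes>\<^sub>M borel) (\<lambda>\<omega>. (eul j h n \<omega>, eul j h l \<omega>)) = distr M borel (eul j h 1) \<Otimes>\<^sub>M distr M borel (eul j h 1)"
proof -
  have "\<forall>n\<ge>1. distr M borel (eul j h n) = distr M borel (eul j h 1) \<and>
    (\<forall>l\<ge>1. l \<noteq> n \<longrightarrow> distr M (borel \<Otimes>\<^sub>M borel) (\<lambda>\<omega>. (eul j h n \<omega>, eul j h l \<omega>)) = distr M borel (eul j h 1) \<Otimes>\<^sub>M distr M borel (eul j h 1))"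
    using assms(1,2)
  proof (induction j)
    case 0
    show ?case
    proof (intro allI impI conjI)
      fix n :: nat assume n: "1 \<le> n"
      show "distr M borel (eul 0 h n) = distr M borel (eul 0 h 1)" using X0_law[OF n] X0_law[of 1] by simp
      fix l :: nat assume l: "1 \<le> l" "l \<noteq> n"
      have [measurable]: "X0 n \<in> borel_measurable M" "X0 l \<in> borel_measurable M" using X0M n l by auto
      interpret \<nu>: prob_space \<nu> using \<nu> by (simp add: W1_space_def)
      have s: "sets \<nu> = sets borel" using \<nu> by (simp add: W1_space_def)
      have "distr M (borel \<Otimes>\<^sub>M borel) (\<lambda>\<omega>. (X0 n \<omega>, X0 l \<omega>)) = \<nu> \<Otimes>\<^sub>M \<nu>"
      proof (rule pair_measure_eqI[symmetric])
        show "sigma_finite_measure \<nu>" "sigma_finite_measure \<nu>" ..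
        show "sets (\<nu> \<Otimes>\<^sub>M \<nu>) = sets (distr M (borel \<Otimes>\<^sub>M borel) (\<lambda>\<omega>. (X0 n \<omega>, X0 l \<omega>)))"
          by (simp add: s cong: sets_pair_measure_cong)
        fix A B assume "A \<in> sets \<nu>" "B \<in> sets \<nu>"
        then have AB: "A \<in> sets borel" "B \<in> sets borel" by (auto simp: s)
        have e: "(\<lambda>\<omega>. (X0 n \<omega>, X0 l \<omega>)) -` (A \<times> B) \<inter> space M = (X0 n -` A \<inter> space M) \<inter> (X0 l -` B \<inter> space M)" by auto
        have "prob (\<Inter>j\<in>{n, l}. X0 j -` (if j = n then A else B) \<inter> space M) = (\<Prod>j\<in>{n, l}. prob (X0 j -` (if j = n then A else B) \<inter> space M))"
          using AB n l by (intro indep_varsD[OF X0_indep]) auto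
        then have p: "prob ((X0 n -` A \<inter> space M) \<inter> (X0 l -` B \<inter> space M)) = prob (X0 n -` A \<inter> space M) * prob (X0 l -` B \<inter> space M)"
          using l by simp
        have "emeasure (distr M (borel \<Otimes>\<^sub>M borel) (\<lambda>\<omega>. (X0 n \<omega>, X0 l \<omega>))) (A \<times> B) = emeasure M ((X0 n -` A \<inter> space M) \<inter> (X0 l -` B \<inter> space M))"
          using AB by (subst emeasure_distr) (auto simp only: e, measurable)
        also have "\<dots> = ennreal (prob (X0 n -` A \<inter> space M) * prob (X0 l -` B \<inter> space M))"
          by (simp only: emeasure_eq_measure p)
        also have "\<dots> = emeasure (distr M borel (X0 n)) A * emeasure (distr M borel (X0 l)) B"
          using AB by (simp add: emeasure_distr emeasure_eq_measure ennreal_mult)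
        finally show "emeasure \<nu> A * emeasure \<nu> B = emeasure (distr M (borel \<Otimes>\<^sub>M borel) (\<lambda>\<omega>. (X0 n \<omega>, X0 l \<omega>))) (A \<times> B)"
          using X0_law[OF n] X0_law[OF l(1)] by simp
      qed
      then show "distr M (borel \<Otimes>\<^sub>M borel) (\<lambda>\<omega>. (eul 0 h n \<omega>, eul 0 h l \<omega>)) = distr M borel (eul 0 h 1) \<Otimes>\<^sub>M distr M borel (eul 0 h 1)"
        using X0_law[of 1] by simp
    qed
  next
    case (Suc j)
    note gb = grid_bounds[OF Suc.prems(1,2)]
    have em: "eul j h n \<in> borel_measurable M" if "n \<ge> 1" for n using eul_meas[OF Suc.prems(1) gb(3) that] .
    have ea: "eul j h n \<in> borel_measurable (F (real j * h))" if "n \<ge> 1" for n using eul_adapted[OF Suc.prems(1) gb(3) that] by blast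
    have st: "eul_step j h \<in> borel \<Otimes>\<^sub>M borel \<rightarrow>\<^sub>M borel"
      using eul_int[OF Suc.prems(1) gb(3), of 1] by (intro eul_step_meas em) auto
    let ?D = "\<lambda>n \<omega>. W n \<omega> (real (Suc j) * h) - W n \<omega> (real j * h)"
    have Dm: "?D n \<in> borel_measurable M" if "n \<ge> 1" for n using W_meas[OF that] gb by auto
    define \<eta> where "\<eta> = distr M borel (eul j h 1)"
    define \<gamma> where "\<gamma> = distr M borel (?D 1)"
    have pl: "prob_space \<eta>" unfolding \<eta>_def by (intro prob_space_distr em) simp
    have pg: "prob_space \<gamma>" unfolding \<gamma>_def by (intro prob_space_distr Dm) simp
    have sl: "sets \<eta> = sets borel" "sets \<gamma> = sets borel" by (simp_all add: \<eta>_def \<gamma>_def)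
    have IH: "distr M borel (eul j h n) = \<eta>" "l \<ge> 1 \<Longrightarrow> l \<noteq> n \<Longrightarrow> distr M (borel \<Otimes>\<^sub>M borel) (\<lambda>\<omega>. (eul j h n \<omega>, eul j h l \<omega>)) = \<eta> \<Otimes>\<^sub>M \<eta>"
      if "n \<ge> 1" for n l using Suc.IH[OF Suc.prems(1) gb(3)] that unfolding \<eta>_def by blast+
    have G: "distr M borel (?D n) = \<gamma>" if "n \<ge> 1" for n
      unfolding \<gamma>_def by (rule increment_law[OF that gb(1,2) Suc.prems(2)])
    have single: "distr M borel (eul (Suc j) h n) = distr (\<eta> \<Otimes>\<^sub>M \<gamma>) borel (eul_step j h)" if n: "n \<ge> 1" for n
    proof -
      have "distr M borel (eul (Suc j) h n) = distr (distr M (borel \<Otimes>\<^sub>M borel) (\<lambda>\<omega>. (eul j h n \<omega>, ?D n \<omega>))) borel (eul_step j h)"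
        using em[OF n] Dm[OF n] st by (subst distr_distr) (auto simp: comp_def eul_Suc[abs_def] simp del: eul.simps intro!: distr_cong eul_Suc)
      also have "distr M (borel \<Otimes>\<^sub>M borel) (\<lambda>\<omega>. (eul j h n \<omega>, ?D n \<omega>)) = \<eta> \<Otimes>\<^sub>M \<gamma>"
        unfolding distr_past_increment[OF n gb(1,2) Suc.prems(2) ea[OF n]] IH(1)[OF n] G[OF n] ..
      finally show ?thesis .
    qed
    have pair: "distr M (borel \<Otimes>\<^sub>M borel) (\<lambda>\<omega>. (eul (Suc j) h n \<omega>, eul (Suc j) h l \<omega>)) = distr (\<eta> \<Otimes>\<^sub>M \<gamma>) borel (eul_step j h) \<Otimes>\<^sub>M distr (\<eta> \<Otimes>\<^sub>M \<gamma>) borel (eul_step j h)"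
      if n: "n \<ge> 1" and l: "l \<ge> 1" and ln: "l \<noteq> n" for n l
    proof -
      let ?Q = "\<lambda>\<omega>. ((eul j h n \<omega>, eul j h l \<omega>), (?D n \<omega>, ?D l \<omega>))"
      let ?\<Psi> = "\<lambda>z. (eul_step j h (fst (fst z), fst (snd z)), eul_step j h (snd (fst z), snd (snd z)))"
      have Qm: "?Q \<in> M \<rightarrow>\<^sub>M ((borel \<Otimes>\<^sub>M borel) \<Otimes>\<^sub>M (borel \<Otimes>\<^sub>M borel))"
        using em[OF n] em[OF l] Dm[OF n] Dm[OF l] by (intro measurable_Pair) auto
      note [measurable] = st
      have \<Psi>m: "?\<Psi> \<in> (borel \<Otimes>\<^sub>M borel) \<Otimes>\<^sub>M (borel \<Otimes>\<^sub>M borel) \<rightarrow>\<^sub>M borel \<Otimes>\<^sub>M borel" by measurable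
      have "distr M (borel \<Otimes>\<^sub>M borel) (\<lambda>\<omega>. (eul (Suc j) h n \<omega>, eul (Suc j) h l \<omega>)) = distr M (borel \<Otimes>\<^sub>M borel) (\<lambda>\<omega>. ?\<Psi> (?Q \<omega>))"
        by (intro distr_cong refl) (simp add: eul_Suc del: eul.simps)
      also have "\<dots> = distr (distr M ((borel \<Otimes>\<^sub>M borel) \<Otimes>\<^sub>M (borel \<Otimes>\<^sub>M borel)) ?Q) (borel \<Otimes>\<^sub>M borel) ?\<Psi>"
        by (subst distr_distr[OF \<Psi>m Qm]) (simp add: comp_def)
      \<comment> \<open>The pair of states is independent of the pair of increments, and each pair
        is itself a product of equal laws; the regrouping is left to
        \<open>distr_pair_map\<close>.\<close>
      also have "distr M ((borel \<Otimes>\<^sub>M borel) \<Otimes>\<^sub>M (borel \<Otimes>\<^sub>M borel)) ?Q = (\<eta> \<Otimes>\<^sub>M \<eta>) \<Otimes>\<^sub>M (\<gamma> \<Otimes>\<^sub>M \<gamma>)"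
        unfolding distr_past_pair_increments[OF n l ln[symmetric] gb(1,2) Suc.prems(2) measurable_Pair[OF ea[OF n] ea[OF l]]]
          IH(2)[OF n l ln] G[OF n] G[OF l] ..
      finally show ?thesis unfolding distr_pair_map[OF pl pg sl st] .
    qed
    show ?case using single[of 1] single pair by simp
  qed
  then show "distr M borel (eul j h n) = distr M borel (eul j h 1)"
    "l \<ge> 1 \<Longrightarrow> l \<noteq> n \<Longrightarrow> distr M (borel \<Otimes>\<^sub>M borel) (\<lambda>\<omega>. (eul j h n \<omega>, eul j h l \<omega>)) = distr M borel (eul j h 1) \<Otimes>\<^sub>M distr M borel (eul j h 1)"
    using assms(3) by blast+
qed

end

lemma set_lint_const_vec: 
  fixes c :: "'b::euclidean_space"
  shows "x \<le> y \<Longrightarrow> set_integrable lborel {x..y} (\<lambda>s. c)" "x \<le> y \<Longrightarrow> (LINT s:{x..y}|lborel. c) = (y - x) *\<^sub>R c"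
  by (auto simp: set_lebesgue_integral_def set_integrable_def)

section \<open>Convergence of the Euler scheme in the mean\<close>

context limit_family begin

definition eul_err :: "real \<Rightarrow> nat \<Rightarrow> nat \<Rightarrow> real" where
  "eul_err h n j = expectation (\<lambda>\<omega>. norm (Xb n \<omega> (real j * h) - eul j h n \<omega>))"

lemma eul_diff_int:
  assumes "h > 0" "real j * h \<le> T" "n \<ge> 1"
  shows "integrable M (\<lambda>\<omega>. norm (Xb n \<omega> (real j * h) - eul j h n \<omega>))"
proof -
  have t: "real j * h \<in> {0..T}" using assms by simp
  show ?thesis
    using Xb_int[OF assms(3) t] Xb_meas[OF assms(3) t] eul_meas[OF assms] eul_int[OF assms]
    by (intro integrable_norm Bochner_Integration.integrable_diff) (auto simp: integrable_norm_iff)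
qed

text \<open>During a step the drift is compared with its frozen value. The rate 3 L has two parts
  from the error of the particle in \<open>H1\<close> and \<open>K1\<close> and one from the error
  of the law. The defect 4 L e has two parts from the motion of the particle, one from the motion of
  its law and one from that of the \<open>Y\<close>.\<close>

lemma eul_err_step:
  assumes n: "n \<ge> 1" and h: "h > 0" "real (Suc j) * h \<le> T" and e: "0 \<le> e"
    and modX: "\<And>s. s \<in> {real j * h..real (Suc j) * h} \<Longrightarrow> expectation (\<lambda>\<omega>. norm (Xb n \<omega> s - Xb n \<omega> (real j * h))) \<le> e"
    and modY: "\<And>s i. s \<in> {real j * h..real (Suc j) * h} \<Longrightarrow> i \<in> {1..m} \<Longrightarrow> norm (Yb i s - Yb i (real j * h)) \<le> e"
  shows "eul_err h n (Suc j) \<le> (1 + 3 * L * h) * eul_err h n j + 4 * L * e * h"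
proof -
  note gb = grid_bounds[OF h]
  define a where "a = real j * h"
  define b where "b = real (Suc j) * h"
  have ab: "0 \<le> a" "a \<le> b" "b \<le> T" "b - a = h" "a \<in> {0..T}" "b \<in> {0..T}" using gb h by (auto simp: a_def b_def)
  note eint = eul_int[OF h(1) gb(3)] and emeas = eul_meas[OF h(1) gb(3)]
  define x where "x = eul_err h n j"
  define G where "G \<omega> = expectation (\<lambda>\<omega>'. H1 (eul j h n \<omega> - eul j h 1 \<omega>')) + avg (\<lambda>i. K1 (Yb i a - eul j h n \<omega>))" for \<omega>
  \<comment> \<open>The scheme averages over the first copy, while the limit drift of copy
    \<open>n\<close> contains the law of copy \<open>n\<close>. Equality of the laws of the scheme
    reconciles the two.\<close>
  have Gexp: "expectation (\<lambda>\<omega>'. H1 (y - eul j h 1 \<omega>')) = expectation (\<lambda>\<omega>'. H1 (y - eul j h n \<omega>'))" for y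
  proof -
    have [measurable]: "(\<lambda>z. H1 (y - z)) \<in> borel_measurable borel"
      using measurable_compose[OF _ borel_measurable_lipschitz(2)[OF H1], of "\<lambda>z. y - z" borel] by simp
    have "expectation (\<lambda>\<omega>'. H1 (y - eul j h i \<omega>')) = (\<integral>z. H1 (y - z) \<partial>distr M borel (eul j h i))" if "i \<ge> 1" for i
      using emeas[OF that] by (subst integral_distr) auto
    then show ?thesis using n eul_law(1)[OF h(1) gb(3) n] by simp
  qed
  have pw: "norm (drift n \<omega> s - G \<omega>) \<le> 2 * L * norm (Xb n \<omega> s - Xb n \<omega> a) + (2 * L * norm (Xb n \<omega> a - eul j h n \<omega>) + (2 * L * e + L * x))"
    if s: "s \<in> {a..b}" and "\<omega> \<in> space M" for s \<omega>
  proof -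
    have sT: "s \<in> {0..T}" using s ab by auto
    let ?z = "Xb n \<omega> s - eul j h n \<omega>"
    have d1: "expectation (\<lambda>\<omega>'. norm (Xb n \<omega>' s - eul j h n \<omega>')) \<le> e + x"
    proof -
      have i1: "integrable M (\<lambda>\<omega>'. norm (Xb n \<omega>' s - Xb n \<omega>' a))" using Xb_increment(1)[OF n ab(1), of s] s ab by auto
      have i2: "integrable M (\<lambda>\<omega>'. norm (Xb n \<omega>' a - eul j h n \<omega>'))" using eul_diff_int[OF h(1) gb(3) n] by (simp add: a_def)
      have "expectation (\<lambda>\<omega>'. norm (Xb n \<omega>' s - eul j h n \<omega>')) \<le> expectation (\<lambda>\<omega>'. norm (Xb n \<omega>' s - Xb n \<omega>' a) + norm (Xb n \<omega>' a - eul j h n \<omega>'))"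
      proof (rule integral_mono)
        show "integrable M (\<lambda>\<omega>'. norm (Xb n \<omega>' s - eul j h n \<omega>'))"
          using Xb_int[OF n sT] Xb_meas[OF n sT] emeas[OF n] eint[OF n]
          by (intro integrable_norm Bochner_Integration.integrable_diff) (auto simp: integrable_norm_iff)
        show "norm (Xb n \<omega>' s - eul j h n \<omega>') \<le> norm (Xb n \<omega>' s - Xb n \<omega>' a) + norm (Xb n \<omega>' a - eul j h n \<omega>')" for \<omega>'
          using norm_triangle_ineq[of "Xb n \<omega>' s - Xb n \<omega>' a" "Xb n \<omega>' a - eul j h n \<omega>'"] by simp
      qed (use i1 i2 in auto)
      also have "\<dots> = expectation (\<lambda>\<omega>'. norm (Xb n \<omega>' s - Xb n \<omega>' a)) + x" using i1 i2 by (simp add: x_def eul_err_def a_def)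
      also have "\<dots> \<le> e + x" using modX[of s] s by (simp add: a_def b_def)
      finally show ?thesis .
    qed
    have "norm (cH n s (Xb n \<omega> s) - expectation (\<lambda>\<omega>'. H1 (eul j h n \<omega> - eul j h n \<omega>'))) \<le> L * norm ?z + L * expectation (\<lambda>\<omega>'. norm (Xb n \<omega>' s - eul j h n \<omega>'))"
      unfolding cH_def conv_marg(2)[OF n sT H1]
      by (rule expectation_H1_lipschitz(2)[OF Xb_meas[OF n sT] Xb_int[OF n sT] emeas[OF n] eint[OF n]])
    also have "\<dots> \<le> L * norm ?z + L * (e + x)" using d1 by (intro add_left_mono mult_left_mono) auto
    finally have 1: "norm (cH n s (Xb n \<omega> s) - expectation (\<lambda>\<omega>'. H1 (eul j h n \<omega> - eul j h 1 \<omega>'))) \<le> L * norm ?z + L * (e + x)"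
      unfolding Gexp .
    have "avg (\<lambda>i. norm (Yb i s - Yb i a)) \<le> avg (\<lambda>i. e)"
      using modY[of s] s by (intro avg_mono) (simp add: a_def b_def)
    then have "L * avg (\<lambda>i. norm (Yb i s - Yb i a)) \<le> L * e" by (intro mult_left_mono) (auto simp: avg_const)
    then have 2: "norm (avg (\<lambda>i. K1 (Yb i s - Xb n \<omega> s)) - avg (\<lambda>i. K1 (Yb i a - eul j h n \<omega>))) \<le> L * e + L * norm ?z"
      using norm_avg_K1_diff[of "\<lambda>i. Yb i s" "Xb n \<omega> s" "\<lambda>i. Yb i a" "eul j h n \<omega>"] by linarith
    have "norm (drift n \<omega> s - G \<omega>) \<le> norm (cH n s (Xb n \<omega> s) - expectation (\<lambda>\<omega>'. H1 (eul j h n \<omega> - eul j h 1 \<omega>')))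
       + norm (avg (\<lambda>i. K1 (Yb i s - Xb n \<omega> s)) - avg (\<lambda>i. K1 (Yb i a - eul j h n \<omega>)))"
      unfolding drift_def G_def by (rule norm_diff_triangle_ineq)
    also have "\<dots> \<le> 2 * (L * norm ?z) + (2 * L * e + L * x)" using 1 2 by (simp add: distrib_left)
    also have "L * norm ?z \<le> L * (norm (Xb n \<omega> s - Xb n \<omega> a) + norm (Xb n \<omega> a - eul j h n \<omega>))"
      using norm_triangle_ineq[of "Xb n \<omega> s - Xb n \<omega> a" "Xb n \<omega> a - eul j h n \<omega>"] by (intro mult_left_mono) auto
    finally show ?thesis by (simp add: algebra_simps)
  qed
  let ?I = "\<lambda>\<omega>. LINT s:{a..b}|lborel. norm (Xb n \<omega> (clamp0 T s) - Xb n \<omega> a)"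
  have I: "integrable M ?I" "expectation ?I \<le> e * h"
  proof -
    have p: "(\<lambda>(s, \<omega>). norm (Xb n \<omega> (clamp0 T s) - Xb n \<omega> a)) \<in> borel_measurable (borel \<Otimes>\<^sub>M M)"
    proof -
      have [measurable]: "(\<lambda>z. Xb n (snd z) (clamp0 T (fst z))) \<in> borel_measurable (borel \<Otimes>\<^sub>M M)"
        using Xb_pair[OF n] by (simp add: case_prod_beta)
      have [measurable]: "(\<lambda>z. Xb n (snd z) a) \<in> borel_measurable (borel \<Otimes>\<^sub>M M)"
        using measurable_compose[OF measurable_snd Xb_meas[OF n ab(5)]] .
      show ?thesis unfolding case_prod_beta by measurable
    qed
    have bd: "integrable M (\<lambda>\<omega>. norm (Xb n \<omega> (clamp0 T s) - Xb n \<omega> a)) \<and> expectation (\<lambda>\<omega>. norm (Xb n \<omega> (clamp0 T s) - Xb n \<omega> a)) \<le> e"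
      if s: "s \<in> {a..b}" for s
    proof -
      have "clamp0 T s = s" using s ab by (intro clamp0_id) auto
      then show ?thesis using Xb_increment(1)[OF n ab(1), of s] modX[of s] s ab by (auto simp: a_def b_def)
    qed
    note f = fubini_path[OF p norm_ge_zero bd]
    show "integrable M ?I" by (rule f(1))
    have "expectation ?I = (LINT s:{a..b}|lborel. expectation (\<lambda>\<omega>. norm (Xb n \<omega> (clamp0 T s) - Xb n \<omega> a)))" by (rule f(2))
    also have "\<dots> \<le> (LINT s:{a..b}|lborel. e)"
    proof (rule set_integral_mono)
      show "set_integrable lborel {a..b} (\<lambda>s. expectation (\<lambda>\<omega>. norm (Xb n \<omega> (clamp0 T s) - Xb n \<omega> a)))"
        using f(4) bd by (intro set_integrable_bounded_Icc[where B=e]) auto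
    qed (use bd set_lint_const_vec(1)[OF ab(2)] in auto)
    finally show "expectation ?I \<le> e * h" using set_lint_const_Icc[OF ab(2)] ab(4) by simp
  qed
  have "AE \<omega> in M. norm (Xb n \<omega> b - eul (Suc j) h n \<omega>) \<le> norm (Xb n \<omega> a - eul j h n \<omega>) + (2 * L * ?I \<omega> + h * (2 * L * norm (Xb n \<omega> a - eul j h n \<omega>) + (2 * L * e + L * x)))"
    using limit_equation[OF n] AE_space
  proof eventually_elim
    case (elim \<omega>)
    define c where "c = 2 * L * norm (Xb n \<omega> a - eul j h n \<omega>) + (2 * L * e + L * x)"
    have di: "set_integrable lborel {0..T} (drift n \<omega>)" using elim by auto
    have dab: "set_integrable lborel {a..b} (drift n \<omega>)" using ab by (intro set_integrable_Icc_subset[OF di]) auto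
    have eqb: "Xb n \<omega> b = X0 n \<omega> + set_lebesgue_integral lborel {0..b} (drift n \<omega>) + sqrt (2 * \<sigma>) *\<^sub>R W n \<omega> b"
      and eqa: "Xb n \<omega> a = X0 n \<omega> + set_lebesgue_integral lborel {0..a} (drift n \<omega>) + sqrt (2 * \<sigma>) *\<^sub>R W n \<omega> a"
      using elim(1) ab by blast+
    have X: "Xb n \<omega> b - Xb n \<omega> a = set_lebesgue_integral lborel {a..b} (drift n \<omega>) + sqrt (2 * \<sigma>) *\<^sub>R (W n \<omega> b - W n \<omega> a)"
      unfolding eqb eqa set_lint_diff_Icc[OF di ab(1-3), symmetric] by (simp add: scaleR_diff_right)
    have E: "eul (Suc j) h n \<omega> - eul j h n \<omega> = h *\<^sub>R G \<omega> + sqrt (2 * \<sigma>) *\<^sub>R (W n \<omega> b - W n \<omega> a)"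
      by (simp add: G_def a_def b_def)
    have "set_lebesgue_integral lborel {a..b} (drift n \<omega>) - h *\<^sub>R G \<omega> = (LINT s:{a..b}|lborel. drift n \<omega> s - G \<omega>)"
      using set_integral_diff(2)[OF dab set_lint_const_vec(1)[OF ab(2), of "G \<omega>"]] set_lint_const_vec(2)[OF ab(2), of "G \<omega>"] ab(4) by simp
    \<comment> \<open>The noise increments of the process and of the scheme coincide and cancel,
      leaving an integral of drifts.\<close>
    then have eq: "Xb n \<omega> b - eul (Suc j) h n \<omega> = (Xb n \<omega> a - eul j h n \<omega>) + (LINT s:{a..b}|lborel. drift n \<omega> s - G \<omega>)"
    proof -
      have "p - p' = (q - q') + c" if "p - q = i + w" "p' - q' = g + w" "i - g = c" for p p' q q' i w g c :: "real^'d"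
      proof -
        have "p - p' = (p - q) - (p' - q') + (q - q')" by simp
        then show ?thesis using that(3) unfolding that(1,2) by simp
      qed
      from this[OF X E] show "set_lebesgue_integral lborel {a..b} (drift n \<omega>) - h *\<^sub>R G \<omega> = (LINT s:{a..b}|lborel. drift n \<omega> s - G \<omega>) \<Longrightarrow> ?thesis" .
    qed
    have Xc: "continuous_on UNIV (\<lambda>s. Xb n \<omega> (clamp0 T s))"
      by (rule continuous_on_clamp0[OF Xb_cont[OF n elim(2)] T0])
    have i1: "set_integrable lborel {a..b} (\<lambda>s. 2 * L * norm (Xb n \<omega> (clamp0 T s) - Xb n \<omega> a))"
      by (intro borel_integrable_atLeastAtMost' continuous_intros continuous_on_subset[OF Xc]) simp
    have i2: "set_integrable lborel {a..b} (\<lambda>s. c)" by (rule set_lint_const_vec(1)[OF ab(2)])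
    have "norm (LINT s:{a..b}|lborel. drift n \<omega> s - G \<omega>) \<le> (LINT s:{a..b}|lborel. 2 * L * norm (Xb n \<omega> (clamp0 T s) - Xb n \<omega> a) + c)"
    proof (rule set_lint_mono_Icc_norm)
      show "set_integrable lborel {a..b} (\<lambda>s. drift n \<omega> s - G \<omega>)" by (rule set_integral_diff(1)[OF dab set_lint_const_vec(1)[OF ab(2)]])
      show "set_integrable lborel {a..b} (\<lambda>s. 2 * L * norm (Xb n \<omega> (clamp0 T s) - Xb n \<omega> a) + c)" by (rule set_integral_add(1)[OF i1 i2])
      show "norm (drift n \<omega> s - G \<omega>) \<le> 2 * L * norm (Xb n \<omega> (clamp0 T s) - Xb n \<omega> a) + c" if s: "s \<in> {a..b}" for s
      proof -
        have "clamp0 T s = s" using s ab by (intro clamp0_id) auto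
        then show ?thesis using pw[OF s elim(2)] by (simp add: c_def)
      qed
    qed
    also have "\<dots> = 2 * L * ?I \<omega> + h * c"
      using set_integral_add(2)[OF i1 i2] set_lint_const_Icc[OF ab(2), of c] ab(4) by (simp add: mult.commute)
    finally have "norm (LINT s:{a..b}|lborel. drift n \<omega> s - G \<omega>) \<le> \<dots>" .
    then show ?case unfolding eq c_def[symmetric] by (intro order_trans[OF norm_triangle_ineq] add_left_mono)
  qed
  then have "eul_err h n (Suc j) \<le> expectation (\<lambda>\<omega>. norm (Xb n \<omega> a - eul j h n \<omega>) + (2 * L * ?I \<omega> + h * (2 * L * norm (Xb n \<omega> a - eul j h n \<omega>) + (2 * L * e + L * x))))"
    unfolding eul_err_def b_def[symmetric] using eul_diff_int[OF h(1) gb(3) n] eul_diff_int[OF h(1) h(2) n] I(1)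
    by (intro integral_mono_AE) (auto simp: a_def b_def simp del: eul.simps)
  also have "\<dots> = x + (2 * L * expectation ?I + h * (2 * L * x + (2 * L * e + L * x)))"
    using eul_diff_int[OF h(1) gb(3) n] I(1) by (simp add: prob_space x_def eul_err_def a_def)
  also have "\<dots> \<le> x + (2 * L * (e * h) + h * (2 * L * x + (2 * L * e + L * x)))"
    using I(2) by (intro add_left_mono add_right_mono mult_left_mono) auto
  finally show ?thesis by (simp add: x_def algebra_simps)
qed

text \<open>The process meets the initial datum only almost surely, since both the integral equation
  and \<open>W n \<omega> 0 = 0\<close> hold only almost surely.\<close>

lemma eul_err_zero: "n \<ge> 1 \<Longrightarrow> eul_err h n 0 = 0"
proof -
  assume n: "n \<ge> 1"
  have "AE \<omega> in M. norm (Xb n \<omega> 0 - X0 n \<omega>) = 0"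
    using limit_equation[OF n] W_zero[OF n]
  proof eventually_elim
    case (elim \<omega>)
    have "set_lebesgue_integral lborel {0..0} (drift n \<omega>) = 0"
      using set_lint_diff_Icc[of T "drift n \<omega>" 0 0] elim(1) by simp
    moreover have "Xb n \<omega> 0 = X0 n \<omega> + set_lebesgue_integral lborel {0..0} (drift n \<omega>) + sqrt (2 * \<sigma>) *\<^sub>R W n \<omega> 0"
      using elim(1) by (auto dest!: bspec[of _ _ 0])
    ultimately show ?case by (simp add: elim(2))
  qed
  then show ?thesis unfolding eul_err_def by (simp add: integral_eq_zero_AE)
qed

text \<open>As j h \<le> T, the accumulated defect is at most 4 L T e' with amplification exp (3 L
  T); \<open>e'\<close> is chosen so that the product stays below \<open>e\<close>.\<close>

lemma eul_converges:
  assumes n: "n \<ge> 1" and e: "e > 0"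
  obtains \<delta> where "\<delta> > 0" "\<And>h j. 0 < h \<Longrightarrow> h \<le> \<delta> \<Longrightarrow> real j * h \<le> T \<Longrightarrow> eul_err h n j \<le> e"
proof -
  define e' where "e' = e / (4 * L * T * exp (3 * L * T) + 1)"
  have p: "4 * L * T * exp (3 * L * T) \<ge> 0" using L T by simp
  have e': "e' > 0" "e' * (4 * L * T * exp (3 * L * T)) \<le> e"
  proof -
    have q: "4 * L * T * exp (3 * L * T) + 1 > 0" using p by linarith
    then show "e' > 0" unfolding e'_def using e by (intro divide_pos_pos)
    have "e' * (4 * L * T * exp (3 * L * T)) \<le> e' * (4 * L * T * exp (3 * L * T) + 1)" using \<open>e' > 0\<close> by (intro mult_left_mono) auto
    also have "\<dots> = e" unfolding e'_def using q by (metis less_numeral_extra(3) nonzero_eq_divide_eq)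
    finally show "e' * (4 * L * T * exp (3 * L * T)) \<le> e" .
  qed
  obtain \<delta> where \<delta>: "\<delta> > 0"
    "\<And>s t. 0 \<le> s \<Longrightarrow> s \<le> t \<Longrightarrow> t \<le> T \<Longrightarrow> t - s \<le> \<delta> \<Longrightarrow> expectation (\<lambda>\<omega>. norm (Xb n \<omega> t - Xb n \<omega> s)) \<le> e'"
    "\<And>s t j. 0 \<le> s \<Longrightarrow> s \<le> t \<Longrightarrow> t \<le> T \<Longrightarrow> t - s \<le> \<delta> \<Longrightarrow> j \<in> {1..m} \<Longrightarrow> norm (Yb j t - Yb j s) \<le> e'"
    by (rule uniform_modulus[OF n e'(1)]) blast
  show ?thesis
  proof (rule that[OF \<delta>(1)])
    fix h j assume h: "0 < h" "h \<le> \<delta>" and jT: "real j * h \<le> T"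
    have "eul_err h n j \<le> real j * (4 * L * e' * h) * exp (3 * L * h * real j)"
    proof (rule gronwall_discrete[where J=j])
      fix i assume i: "i < j"
      have "real (Suc i) * h \<le> real j * h" using i h by (intro mult_right_mono) auto
      then have iT: "real (Suc i) * h \<le> T" using jT by simp
      note gb = grid_bounds[OF h(1) iT]
      have *: "0 \<le> real i * h" "real i * h \<le> s" "s \<le> T" "s - real i * h \<le> \<delta>" if "s \<in> {real i * h..real (Suc i) * h}" for s
        using that gb iT h by auto
      show "eul_err h n (Suc i) \<le> (1 + 3 * L * h) * eul_err h n i + 4 * L * e' * h"
      proof (rule eul_err_step[OF n h(1) iT])
        show "0 \<le> e'" using e' by simp
        fix s assume "s \<in> {real i * h..real (Suc i) * h}"
        from *[OF this] show "expectation (\<lambda>\<omega>. norm (Xb n \<omega> s - Xb n \<omega> (real i * h))) \<le> e'"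
          "\<And>k. k \<in> {1..m} \<Longrightarrow> norm (Yb k s - Yb k (real i * h)) \<le> e'"
          by (auto intro: \<delta>)
      qed
    qed (use h L e' eul_err_zero[OF n] in auto)
    also have "\<dots> = (e' * (4 * L)) * ((real j * h) * exp (3 * L * (real j * h)))" by (simp add: mult_ac)
    also have "\<dots> \<le> (e' * (4 * L)) * (T * exp (3 * L * T))"
      using jT h L e' T by (intro mult_left_mono mult_mono) auto
    also have "\<dots> \<le> e" using e'(2) by (simp add: mult_ac)
    finally show "eul_err h n j \<le> e" .
  qed
qed

section \<open>Transfer of laws from the scheme to the limit processes\<close>

lemma grid_exists:
  assumes "t \<in> {0..T}" "\<delta> > 0"
  obtains h j where "0 < h" "h \<le> \<delta>" "real j * h = t"
proof (cases "t = 0")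
  case True
  show ?thesis by (rule that[of \<delta> 0]) (use assms True in auto)
next
  case False
  then have t: "t > 0" using assms by simp
  obtain J :: nat where J: "t / \<delta> \<le> real J" using real_arch_simple by blast
  have "real J > 0" using J t assms by (smt (verit) divide_pos_pos)
  then show ?thesis using J t assms by (intro that[of "t / real J" J]) (auto simp: field_simps)
qed

text \<open>The step size is chosen so that \<open>t\<close> is itself a grid point, common to both
  copies; the scheme is never interpolated.\<close>

lemma eul_close:
  assumes n: "n \<ge> 1" "l \<ge> 1" and t: "t \<in> {0..T}" and e: "e > 0"
  obtains h j where "0 < h" "real j * h = t" "eul_err h n j \<le> e" "eul_err h l j \<le> e"
proof -
  obtain d1 where d1: "d1 > 0" "\<And>h j. 0 < h \<Longrightarrow> h \<le> d1 \<Longrightarrow> real j * h \<le> T \<Longrightarrow> eul_err h n j \<le> e"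
    by (rule eul_converges[OF n(1) e], rule that)
  obtain d2 where d2: "d2 > 0" "\<And>h j. 0 < h \<Longrightarrow> h \<le> d2 \<Longrightarrow> real j * h \<le> T \<Longrightarrow> eul_err h l j \<le> e"
    by (rule eul_converges[OF n(2) e], rule that)
  obtain h j where hj: "0 < h" "h \<le> min d1 d2" "real j * h = t" using grid_exists[OF t, of "min d1 d2"] d1 d2 by auto
  show ?thesis by (rule that[OF hj(1,3)]) (use hj t d1 d2 in auto)
qed

text \<open>Each side differs from its counterpart for the scheme by at most \<open>B\<close> times
  an arbitrarily small error in the mean, and these counterparts coincide. Uniqueness in law of the
  limit system is not invoked.\<close>

lemma expectation_lipschitz_eq:
  fixes f :: "real^'d \<Rightarrow> 'c::euclidean_space"
  assumes n: "n \<ge> 1" and t: "t \<in> {0..T}" and lip: "\<And>x y. norm (f x - f y) \<le> B * norm (x - y)" and B: "0 \<le> B"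
  shows "expectation (\<lambda>\<omega>. f (Xb n \<omega> t)) = expectation (\<lambda>\<omega>. f (Xb 1 \<omega> t))"
proof -
  let ?d = "norm (expectation (\<lambda>\<omega>. f (Xb n \<omega> t)) - expectation (\<lambda>\<omega>. f (Xb 1 \<omega> t)))"
  have fm[measurable]: "f \<in> borel_measurable borel" by (rule borel_measurable_lipschitz(2)[OF lip])
  have "?d \<le> 0 + e" if e: "e > 0" for e
  proof -
    define e' where "e' = e / (2 * B + 1)"
    have e': "e' > 0" "2 * B * e' \<le> e" using B e by (auto simp: e'_def field_simps add_pos_nonneg)
    obtain h j where hj: "0 < h" "real j * h = t" "eul_err h n j \<le> e'" "eul_err h 1 j \<le> e'"
      using eul_close[OF n order_refl t e'(1)] .
    have jT: "real j * h \<le> T" using t hj by simp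
    have d: "norm (expectation (\<lambda>\<omega>. f (Xb i \<omega> t)) - expectation (\<lambda>\<omega>. f (eul j h i \<omega>))) \<le> B * eul_err h i j" if i: "i \<ge> 1" for i
    proof -
      have i1: "integrable M (\<lambda>\<omega>. f (Xb i \<omega> t))"
        by (rule integrable_lipschitz[OF finite_measure_axioms Xb_meas[OF i t] Xb_int[OF i t] lip B])
      have i2: "integrable M (\<lambda>\<omega>. f (eul j h i \<omega>))"
        by (rule integrable_lipschitz[OF finite_measure_axioms eul_meas[OF hj(1) jT i] eul_int[OF hj(1) jT i] lip B])
      have "norm (expectation (\<lambda>\<omega>. f (Xb i \<omega> t)) - expectation (\<lambda>\<omega>. f (eul j h i \<omega>))) = norm (expectation (\<lambda>\<omega>. f (Xb i \<omega> t) - f (eul j h i \<omega>)))"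
        using i1 i2 by simp
      also have "\<dots> \<le> expectation (\<lambda>\<omega>. norm (f (Xb i \<omega> t) - f (eul j h i \<omega>)))" by (rule integral_norm_bound)
      also have "\<dots> \<le> expectation (\<lambda>\<omega>. B * norm (Xb i \<omega> t - eul j h i \<omega>))"
        using i1 i2 lip eul_diff_int[OF hj(1) jT i] by (intro integral_mono) (auto simp: hj(2))
      finally show ?thesis by (simp add: eul_err_def hj(2))
    qed
    have "expectation (\<lambda>\<omega>. f (eul j h i \<omega>)) = (\<integral>z. f z \<partial>distr M borel (eul j h i))" if "i \<ge> 1" for i
      using eul_meas[OF hj(1) jT that] by (subst integral_distr) auto
    then have eq: "expectation (\<lambda>\<omega>. f (eul j h n \<omega>)) = expectation (\<lambda>\<omega>. f (eul j h 1 \<omega>))"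
      using n eul_law(1)[OF hj(1) jT n] by simp
    have "?d \<le> norm (expectation (\<lambda>\<omega>. f (Xb n \<omega> t)) - expectation (\<lambda>\<omega>. f (eul j h n \<omega>))) + norm (expectation (\<lambda>\<omega>. f (Xb 1 \<omega> t)) - expectation (\<lambda>\<omega>. f (eul j h 1 \<omega>)))"
    proof -
      have "norm (a - b) \<le> norm (a - z) + norm (b - z)" for a b z :: 'c
        using norm_triangle_ineq4[of "a - z" "b - z"] by simp
      then show ?thesis unfolding eq[symmetric] .
    qed
    also have "\<dots> \<le> B * e' + B * e'"
      using order_trans[OF d[OF n] mult_left_mono[OF hj(3) B]] order_trans[OF d[OF order_refl] mult_left_mono[OF hj(4) B]] by (rule add_mono)
    finally show ?thesis using e' by simp
  qed
  then have "?d \<le> 0" by (rule field_le_epsilon)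
  then show ?thesis by simp
qed

text \<open>All mean-field terms may now be referred to the law of the first copy, with which the
  empirical measure is compared.\<close>

lemma cH_eq: 
  assumes "n \<ge> 1" "t \<in> {0..T}"
  shows "cH n t x = conv H1 (marginal M T (Xb 1) t) x"
  unfolding cH_def conv_marg(2)[OF assms H1] conv_marg(2)[OF order_refl assms(2) H1]
proof (rule expectation_lipschitz_eq[OF assms, where B=L])
  show "norm (H1 (x - a) - H1 (x - b)) \<le> L * norm (a - b)" for a b
    using H1[of "x - a" "x - b"] by (simp add: norm_minus_commute)
qed simp

text \<open>The expectation of the product factorises for the scheme. For bounded Lipschitz
  functions the product is controlled by the sum of the two errors, so convergence in the mean
  carries the factorisation over.\<close>

lemma uncorrelated:
  fixes f :: "real^'d \<Rightarrow> real"
  assumes nl: "n \<ge> 1" "l \<ge> 1" "l \<noteq> n" and t: "t \<in> {0..T}"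
    and lip: "\<And>x y. \<bar>f x - f y\<bar> \<le> B * norm (x - y)" and B: "0 \<le> B" and f1: "\<And>x. \<bar>f x\<bar> \<le> 1"
  shows "expectation (\<lambda>\<omega>. f (Xb n \<omega> t) * f (Xb l \<omega> t)) = expectation (\<lambda>\<omega>. f (Xb 1 \<omega> t)) * expectation (\<lambda>\<omega>. f (Xb 1 \<omega> t))"
    (is "?l = ?r * ?r")
proof -
  have lip': "norm (f x - f y) \<le> B * norm (x - y)" for x y using lip by simp
  have fm[measurable]: "f \<in> borel_measurable borel" by (rule borel_measurable_lipschitz(2)[OF lip'])
  have r1: "\<bar>?r\<bar> \<le> 1" using f1 by (intro abs_expectation_le)
  have pm: "\<bar>a * b - c * d\<bar> \<le> \<bar>a - c\<bar> + \<bar>b - d\<bar>" if "\<bar>b\<bar> \<le> 1" "\<bar>c\<bar> \<le> 1" for a b c d :: real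
  proof -
    have "\<bar>a * b - c * d\<bar> = \<bar>(a - c) * b + c * (b - d)\<bar>" by (simp add: algebra_simps)
    also have "\<dots> \<le> \<bar>(a - c) * b\<bar> + \<bar>c * (b - d)\<bar>" by (rule abs_triangle_ineq)
    also have "\<dots> \<le> \<bar>a - c\<bar> + \<bar>b - d\<bar>" unfolding abs_mult using that by (intro add_mono mult_left_le mult_left_le_one_le) auto
    finally show ?thesis .
  qed
  have "\<bar>?l - ?r * ?r\<bar> \<le> 0 + e" if e: "e > 0" for e
  proof -
    define e' where "e' = e / (4 * B + 1)"
    have e': "e' > 0" "4 * B * e' \<le> e" using B e by (auto simp: e'_def field_simps add_pos_nonneg)
    obtain h j where hj: "0 < h" "real j * h = t" "eul_err h n j \<le> e'" "eul_err h l j \<le> e'"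
      using eul_close[OF nl(1,2) t e'(1)] .
    have jT: "real j * h \<le> T" using t hj by simp
    note [measurable] = Xb_meas[OF nl(1) t] Xb_meas[OF nl(2) t] eul_meas[OF hj(1) jT nl(1)] eul_meas[OF hj(1) jT nl(2)]
    note di = eul_diff_int[OF hj(1) jT nl(1), unfolded hj(2)] eul_diff_int[OF hj(1) jT nl(2), unfolded hj(2)]
    define E1 where "E1 = eul j h 1"
    have [measurable]: "E1 \<in> borel_measurable M" unfolding E1_def by (rule eul_meas[OF hj(1) jT order_refl])
    define \<eta> where "\<eta> = distr M borel E1"
    have p\<eta>: "prob_space \<eta>" unfolding \<eta>_def by (rule prob_space_distr) simp
    define r where "r = integral\<^sup>L \<eta> f"
    have f\<eta>: "integrable \<eta> f"
      unfolding \<eta>_def using f1 by (subst integrable_distr_eq) (auto intro!: integrable_bdd[where B=1])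
    have b1: "\<bar>a * b\<bar> \<le> 1" if "\<bar>a\<bar> \<le> 1" "\<bar>b\<bar> \<le> 1" for a b :: real using that by (simp add: abs_mult mult_le_one)
    have "expectation (\<lambda>\<omega>. f (eul j h n \<omega>) * f (eul j h l \<omega>)) = (\<integral>z. f (fst z) * f (snd z) \<partial>distr M (borel \<Otimes>\<^sub>M borel) (\<lambda>\<omega>. (eul j h n \<omega>, eul j h l \<omega>)))"
      by (subst integral_distr) auto
    also have "\<dots> = (\<integral>z. f (fst z) * f (snd z) \<partial>(\<eta> \<Otimes>\<^sub>M \<eta>))" unfolding eul_law(2)[OF hj(1) jT nl] \<eta>_def E1_def ..
    also have "\<dots> = r * r" unfolding r_def
      by (rule has_bochner_integral_integral_eq[OF has_bochner_integral_pair_times[OF p\<eta> p\<eta> f\<eta> f\<eta>]])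
    finally have prod: "expectation (\<lambda>\<omega>. f (eul j h n \<omega>) * f (eul j h l \<omega>)) = r * r" .
    have er: "expectation (\<lambda>\<omega>. f (eul j h n \<omega>)) = r"
    proof -
      have "expectation (\<lambda>\<omega>. f (eul j h n \<omega>)) = integral\<^sup>L (distr M borel (eul j h n)) f" by (subst integral_distr) auto
      then show ?thesis by (simp add: r_def \<eta>_def E1_def eul_law(1)[OF hj(1) jT nl(1)])
    qed
    have i: "integrable M (\<lambda>\<omega>. f (Xb n \<omega> t) * f (Xb l \<omega> t))" "integrable M (\<lambda>\<omega>. f (eul j h n \<omega>) * f (eul j h l \<omega>))"
      "integrable M (\<lambda>\<omega>. f (Xb n \<omega> t))" "integrable M (\<lambda>\<omega>. f (eul j h n \<omega>))"
      using b1 f1 by (auto intro!: integrable_bdd[where B=1])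
    have d1: "?l - r * r = expectation (\<lambda>\<omega>. f (Xb n \<omega> t) * f (Xb l \<omega> t) - f (eul j h n \<omega>) * f (eul j h l \<omega>))"
      using i by (simp add: prod)
    have "\<bar>?l - r * r\<bar> \<le> expectation (\<lambda>\<omega>. \<bar>f (Xb n \<omega> t) * f (Xb l \<omega> t) - f (eul j h n \<omega>) * f (eul j h l \<omega>)\<bar>)" unfolding d1 by (rule integral_abs_bound)
    also have "\<dots> \<le> expectation (\<lambda>\<omega>. B * norm (Xb n \<omega> t - eul j h n \<omega>) + B * norm (Xb l \<omega> t - eul j h l \<omega>))"
    proof (rule integral_mono)
      show "\<bar>f (Xb n \<omega> t) * f (Xb l \<omega> t) - f (eul j h n \<omega>) * f (eul j h l \<omega>)\<bar> \<le> B * norm (Xb n \<omega> t - eul j h n \<omega>) + B * norm (Xb l \<omega> t - eul j h l \<omega>)" for \<omega>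
        by (rule order_trans[OF pm[OF f1 f1] add_mono[OF lip lip]])
    qed (use i di in auto)
    also have "\<dots> = B * eul_err h n j + B * eul_err h l j" using di by (simp add: eul_err_def hj(2))
    also have "\<dots> \<le> B * e' + B * e'" using hj B by (intro add_mono mult_left_mono) auto
    finally have 1: "\<bar>?l - r * r\<bar> \<le> B * e' + B * e'" .
    have req: "?r = expectation (\<lambda>\<omega>. f (Xb n \<omega> t))" by (rule expectation_lipschitz_eq[OF nl(1) t lip' B, symmetric])
    have d2: "?r - r = expectation (\<lambda>\<omega>. f (Xb n \<omega> t) - f (eul j h n \<omega>))" unfolding req using i er by simp
    have "\<bar>?r - r\<bar> \<le> expectation (\<lambda>\<omega>. \<bar>f (Xb n \<omega> t) - f (eul j h n \<omega>)\<bar>)" unfolding d2 by (rule integral_abs_bound)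
    also have "\<dots> \<le> expectation (\<lambda>\<omega>. B * norm (Xb n \<omega> t - eul j h n \<omega>))"
      using i di lip by (intro integral_mono) auto
    also have "\<dots> \<le> B * e'" using hj(3) B by (simp add: eul_err_def hj(2) mult_left_mono)
    finally have 2: "\<bar>?r - r\<bar> \<le> B * e'" .
    have rr: "\<bar>r\<bar> \<le> 1" unfolding er[symmetric] using f1 by (intro abs_expectation_le)
    have "\<bar>?l - ?r * ?r\<bar> \<le> \<bar>?l - r * r\<bar> + \<bar>r * r - ?r * ?r\<bar>" by linarith
    also have "\<dots> \<le> (B * e' + B * e') + (B * e' + B * e')"
      using 1 order_trans[OF pm[OF rr r1, of r ?r] add_mono[OF 2 2, folded abs_minus_commute[of r ?r]]]
      by (intro add_mono) (auto simp: abs_minus_commute)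
    finally show ?thesis using e' by simp
  qed
  then have "\<bar>?l - ?r * ?r\<bar> \<le> 0" by (rule field_le_epsilon)
  then show ?thesis by simp
qed

end

section \<open>Empirical measures of the limit processes\<close>

text \<open>A law of large numbers in the mean: for orthogonal terms bounded by 1 the second moment
  of the average is at most 1 / N, and its root bounds the first moment.\<close>

lemma (in prob_space) orthogonal_average_le:
  fixes Z :: "nat \<Rightarrow> 'a \<Rightarrow> real"
  assumes N: "N \<ge> 1" and meas: "\<And>l. l \<in> {1..N} \<Longrightarrow> Z l \<in> borel_measurable M" and Z1: "\<And>l \<omega>. l \<in> {1..N} \<Longrightarrow> \<bar>Z l \<omega>\<bar> \<le> 1"
    and orth: "\<And>l j. l \<in> {1..N} \<Longrightarrow> j \<in> {1..N} \<Longrightarrow> l \<noteq> j \<Longrightarrow> expectation (\<lambda>\<omega>. Z l \<omega> * Z j \<omega>) = 0"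
  shows "expectation (\<lambda>\<omega>. \<bar>(1 / real N) * (\<Sum>l=1..N. Z l \<omega>)\<bar>) \<le> 1 / sqrt (real N)"
proof -
  let ?S = "\<lambda>\<omega>. (1 / real N) * (\<Sum>l=1..N. Z l \<omega>)"
  have ZZ: "\<bar>Z l \<omega> * Z j \<omega>\<bar> \<le> 1" if "l \<in> {1..N}" "j \<in> {1..N}" for l j \<omega>
    using Z1[OF that(1)] Z1[OF that(2)] by (simp add: abs_mult mult_le_one)
  have iZZ: "integrable M (\<lambda>\<omega>. Z l \<omega> * Z j \<omega>)" if "l \<in> {1..N}" "j \<in> {1..N}" for l j
    using ZZ[OF that] meas that by (intro integrable_const_bound[where B=1]) auto
  have eq: "(?S \<omega>)\<^sup>2 = (1 / (real N)\<^sup>2) * (\<Sum>l=1..N. \<Sum>j=1..N. Z l \<omega> * Z j \<omega>)" for \<omega>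
    by (simp add: power_mult_distrib power2_eq_square sum_product divide_simps)
  have iS2: "integrable M (\<lambda>\<omega>. (?S \<omega>)\<^sup>2)" unfolding eq using iZZ by (intro integrable_mult_right Bochner_Integration.integrable_sum)
  have Sm: "?S \<in> borel_measurable M" using meas by (intro borel_measurable_times borel_measurable_sum) auto
  have iS: "integrable M ?S" by (rule integrable_of_square[OF Sm iS2])
  have eqE: "expectation (\<lambda>\<omega>. (?S \<omega>)\<^sup>2) = (1 / (real N)\<^sup>2) * (\<Sum>l=1..N. \<Sum>j=1..N. expectation (\<lambda>\<omega>. Z l \<omega> * Z j \<omega>))"
  proof -
    have "expectation (\<lambda>\<omega>. \<Sum>l=1..N. \<Sum>j=1..N. Z l \<omega> * Z j \<omega>) = (\<Sum>l=1..N. \<Sum>j=1..N. expectation (\<lambda>\<omega>. Z l \<omega> * Z j \<omega>))"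
    proof (rule trans[OF Bochner_Integration.integral_sum])
      show "integrable M (\<lambda>\<omega>. \<Sum>j=1..N. Z l \<omega> * Z j \<omega>)" if "l \<in> {1..N}" for l
        by (intro Bochner_Integration.integrable_sum iZZ that)
      show "(\<Sum>l=1..N. expectation (\<lambda>\<omega>. \<Sum>j=1..N. Z l \<omega> * Z j \<omega>)) = (\<Sum>l=1..N. \<Sum>j=1..N. expectation (\<lambda>\<omega>. Z l \<omega> * Z j \<omega>))"
        by (intro sum.cong refl Bochner_Integration.integral_sum iZZ)
    qed
    then show ?thesis unfolding eq by simp
  qed
  have "(\<Sum>l=1..N. \<Sum>j=1..N. expectation (\<lambda>\<omega>. Z l \<omega> * Z j \<omega>)) \<le> (\<Sum>l=1..N. \<Sum>j=1..N. if j = l then 1 else 0)"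
  proof (intro sum_mono)
    fix l j assume lj: "l \<in> {1..N}" "j \<in> {1..N}"
    have "expectation (\<lambda>\<omega>. Z l \<omega> * Z j \<omega>) \<le> 1" using ZZ[OF lj] iZZ[OF lj] by (intro integral_le_const) (auto simp: abs_le_iff)
    then show "expectation (\<lambda>\<omega>. Z l \<omega> * Z j \<omega>) \<le> (if j = l then 1 else 0)" using orth[OF lj] by auto
  qed
  also have "(\<Sum>l=1..N. \<Sum>j=1..N. if j = l then 1 else (0::real)) = real N" by simp
  finally have "expectation (\<lambda>\<omega>. (?S \<omega>)\<^sup>2) \<le> 1 / (real N)\<^sup>2 * real N"
    unfolding eqE by (intro mult_left_mono) auto
  also have "\<dots> = 1 / real N" using N by (simp add: power2_eq_square)
  finally have 1: "expectation (\<lambda>\<omega>. (?S \<omega>)\<^sup>2) \<le> 1 / real N" .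
  have "(expectation (\<lambda>\<omega>. \<bar>?S \<omega>\<bar>))\<^sup>2 \<le> expectation (\<lambda>\<omega>. \<bar>?S \<omega>\<bar>\<^sup>2)"
  proof (rule square_expectation_le)
    show "integrable M (\<lambda>\<omega>. \<bar>?S \<omega>\<bar>)" by (rule integrable_abs[OF iS])
    show "integrable M (\<lambda>\<omega>. \<bar>?S \<omega>\<bar>\<^sup>2)" unfolding power2_abs by (rule iS2)
  qed
  also have "\<dots> \<le> 1 / real N" unfolding power2_abs by (rule 1)
  finally have "expectation (\<lambda>\<omega>. \<bar>?S \<omega>\<bar>) \<le> sqrt (1 / real N)" by (intro real_le_rsqrt)
  then show ?thesis by (simp add: real_sqrt_divide)
qed

locale limit_partition = limit_family T \<sigma> L m H1 H2 K1 K2 u Y0 \<nu> M F W X0 Xb Yb + partition_of_unity R \<epsilon> K \<phi> B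
  for T \<sigma> L :: real and m :: nat
    and H1 H2 K1 K2 :: "real^'d \<Rightarrow> real^'d"
    and u :: "(real^'d) measure \<Rightarrow> real^'d"
    and Y0 :: "nat \<Rightarrow> real^'d"
    and \<nu> :: "(real^'d) measure"
    and M :: "'a measure" and F and W :: "nat \<Rightarrow> 'a \<Rightarrow> real \<Rightarrow> real^'d"
    and X0 :: "nat \<Rightarrow> 'a \<Rightarrow> real^'d" and Xb :: "nat \<Rightarrow> 'a \<Rightarrow> real \<Rightarrow> real^'d" and Yb :: "nat \<Rightarrow> real \<Rightarrow> real^'d"
    and R \<epsilon> :: real and K :: nat and \<phi> :: "nat \<Rightarrow> real^'d \<Rightarrow> real" and B :: real
begin

text \<open>Transport cost between the empirical measure of the limit processes and their common law: masses
  are matched within the cells \<open>1, \<dots>, K\<close> of diameter at most \<open>\<epsilon>\<close>, and cell \<open>0\<close>, far from the origin, is charged to the tails.\<close>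
definition Q :: "nat \<Rightarrow> real \<Rightarrow> 'a \<Rightarrow> real" where
  "Q N s \<omega> = \<epsilon> + (R + \<epsilon>) * (\<Sum>c\<in>{..K} - {0}. \<bar>(1 / real N) * (\<Sum>l=1..N. \<phi> c (Xb l \<omega> s) - expectation (\<lambda>\<omega>'. \<phi> c (Xb 1 \<omega>' s)))\<bar>)
     + (1 / real N) * (\<Sum>l=1..N. norm (Xb l \<omega> s) * \<phi> 0 (Xb l \<omega> s)) + expectation (\<lambda>\<omega>'. norm (Xb 1 \<omega>' s) * \<phi> 0 (Xb 1 \<omega>' s))"

abbreviation \<mu> :: "real \<Rightarrow> (real^'d) measure" where "\<mu> s \<equiv> marginal M T (Xb 1) s"

lemma Q_nonneg: "0 \<le> Q N s \<omega>"
  unfolding Q_def using R \<epsilon> \<phi>_nonneg by (intro add_nonneg_nonneg mult_nonneg_nonneg sum_nonneg Bochner_Integration.integral_nonneg) auto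

text \<open>\<open>coupling_of_partition\<close> with cell 0 as the far one and \<rho> = R +
  \<epsilon>, the radius of a ball containing all small cells.\<close>

lemma exists_coupling_Q:
  assumes N: "N \<ge> 1" and s: "s \<in> {0..T}"
  shows "\<exists>\<pi>\<in>couplings (empirical_measure N (\<lambda>l. Xb l \<omega> s)) (\<mu> s). (\<integral>\<^sup>+ z. ennreal (dist (fst z) (snd z)) \<partial>\<pi>) \<le> ennreal (Q N s \<omega>)"
proof -
  let ?e = "empirical_measure N (\<lambda>l. Xb l \<omega> s)"
  have Xm[measurable]: "(\<lambda>\<omega>. Xb 1 \<omega> s) \<in> borel_measurable M" using Xb_meas[OF order_refl s] .
  have e: "integral\<^sup>L ?e f = (1 / real N) * (\<Sum>l=1..N. f (Xb l \<omega> s))" if "f \<in> borel_measurable borel" for f :: "real^'d \<Rightarrow> real"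
    using empirical_measure_integral[OF N that] by simp
  have mu: "integral\<^sup>L (\<mu> s) f = expectation (\<lambda>\<omega>'. f (Xb 1 \<omega>' s))" if "f \<in> borel_measurable borel" for f :: "real^'d \<Rightarrow> real"
    unfolding marg[OF order_refl s] by (rule integral_distr[OF Xm that])
  have "\<exists>\<pi>\<in>couplings ?e (\<mu> s). (\<integral>\<^sup>+ z. ennreal (dist (fst z) (snd z)) \<partial>\<pi>) \<le>
    ennreal (\<epsilon> + (R + \<epsilon>) * (\<Sum>c\<in>{..K} - {0}. \<bar>integral\<^sup>L ?e (\<phi> c) - integral\<^sup>L (\<mu> s) (\<phi> c)\<bar>)
      + (\<integral>x. norm x * \<phi> 0 x \<partial>?e) + (\<integral>x. norm x * \<phi> 0 x \<partial>\<mu> s))"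
  proof (rule coupling_of_partition)
    show "?e \<in> W1_space" by (rule empirical_measure_in_W1[OF N])
    show "\<mu> s \<in> W1_space" by (rule marg_W1[OF order_refl s])
  qed (use R \<epsilon> \<phi>_nonneg \<phi>_sum \<phi>_diam \<phi>_supp in auto)
  moreover have "(1 / real N) * (\<Sum>l=1..N. \<phi> c (Xb l \<omega> s) - b) = (1 / real N) * (\<Sum>l=1..N. \<phi> c (Xb l \<omega> s)) - b" for c b
    using N by (simp add: sum_subtractf right_diff_distrib)
  moreover have n0: "(\<lambda>x. norm x * \<phi> 0 x) \<in> borel_measurable borel" by measurable
  ultimately show ?thesis unfolding Q_def
    by (simp only: e[OF \<phi>_meas] mu[OF \<phi>_meas] e[OF n0] mu[OF n0])
qed

lemma wasserstein_Q: "N \<ge> 1 \<Longrightarrow> s \<in> {0..T} \<Longrightarrow> wasserstein1 (empirical_measure N (\<lambda>l. Xb l \<omega> s)) (\<mu> s) \<le> Q N s \<omega>"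
  using exists_coupling_Q[of N s \<omega>] Q_nonneg[of N s \<omega>] by (auto intro: wasserstein1_le)

text \<open>The bound is the same for all points \<open>x\<close>, which matters because
  \<open>x\<close> will be the position of a limit process and hence depends on the same
  \<omega>.\<close>

lemma conv_Q:
  assumes N: "N \<ge> 1" and s: "s \<in> {0..T}" and lip: "\<And>x y. norm (h x - h y) \<le> L * norm (x - y)"
  shows "norm ((1 / real N) *\<^sub>R (\<Sum>l=1..N. h (x - Xb l \<omega> s)) - conv h (\<mu> s) x) \<le> L * Q N s \<omega>"
proof -
  obtain \<pi> where \<pi>: "\<pi> \<in> couplings (empirical_measure N (\<lambda>l. Xb l \<omega> s)) (\<mu> s)" "(\<integral>\<^sup>+ z. ennreal (dist (fst z) (snd z)) \<partial>\<pi>) \<le> ennreal (Q N s \<omega>)"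
    using exists_coupling_Q[OF N s] by blast
  have lip': "norm (h (x - a) - h (x - b)) \<le> L * norm (a - b)" for a b
    using lip[of "x - a" "x - b"] by (simp add: norm_minus_commute)
  have "(1 / real N) *\<^sub>R (\<Sum>l=1..N. h (x - Xb l \<omega> s)) = integral\<^sup>L (empirical_measure N (\<lambda>l. Xb l \<omega> s)) (\<lambda>y. h (x - y))"
    by (rule empirical_measure_integral[symmetric, OF N borel_measurable_lipschitz(2)[OF lip']])
  then show ?thesis unfolding conv_def
    using lipschitz_integral_diff_le[OF \<pi>(1) empirical_measure_in_W1[OF N] marg_W1[OF order_refl s] \<pi>(2) Q_nonneg lip'] by simp
qed

text \<open>In each cell the centred values of different copies are orthogonal by
  \<open>uncorrelated\<close>, the means being equal by \<open>expectation_lipschitz_eq\<close>. The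
  \<open>K\<close> small cells thus contribute K / sqrt N each time weighted by the radius, and the
  far cell costs one \<open>tail R\<close> for each of the two measures.\<close>

lemma Q_moment:
  assumes N: "N \<ge> 1" and s: "s \<in> {0..T}"
  shows "integrable M (Q N s)" and "expectation (Q N s) \<le> \<epsilon> + (R + \<epsilon>) * (real K / sqrt (real N)) + 2 * tail R"
proof -
  note Xm[measurable] = Xb_meas[OF _ s]
  let ?Z = "\<lambda>c l \<omega>. \<phi> c (Xb l \<omega> s) - expectation (\<lambda>\<omega>'. \<phi> c (Xb 1 \<omega>' s))"
  have \<phi>c1: "\<bar>\<phi> c x\<bar> \<le> 1" if "c \<in> {..K}" for c x using \<phi>_nonneg[of c x] \<phi>_le_1[OF that, of x] by simp
  have \<phi>lip': "norm (\<phi> c x - \<phi> c y) \<le> B * norm (x - y)" for c x y using \<phi>_lip by simp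
  have Zm: "?Z c l \<in> borel_measurable M" if "l \<in> {1..N}" for c l
    using that by (intro borel_measurable_diff measurable_compose[OF Xm \<phi>_meas]) auto
  have E01: "0 \<le> expectation (\<lambda>\<omega>'. \<phi> c (Xb 1 \<omega>' s))" "expectation (\<lambda>\<omega>'. \<phi> c (Xb 1 \<omega>' s)) \<le> 1" if "c \<in> {..K}" for c
    using \<phi>_nonneg abs_expectation_le[of "\<lambda>\<omega>'. \<phi> c (Xb 1 \<omega>' s)" 1] \<phi>c1[OF that] by (auto simp: abs_le_iff)
  have Z1: "\<bar>?Z c l \<omega>\<bar> \<le> 1" if "c \<in> {..K}" for c l \<omega>
    using E01[OF that] \<phi>_nonneg[of c "Xb l \<omega> s"] \<phi>_le_1[OF that, of "Xb l \<omega> s"] by (simp add: abs_le_iff)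
  have orth: "expectation (\<lambda>\<omega>. ?Z c l \<omega> * ?Z c j \<omega>) = 0" if lj: "l \<in> {1..N}" "j \<in> {1..N}" "l \<noteq> j" and c: "c \<in> {..K}" for c l j
  proof -
    define b where "b = expectation (\<lambda>\<omega>'. \<phi> c (Xb 1 \<omega>' s))"
    have l1: "l \<ge> 1" "j \<ge> 1" using lj by auto
    have i: "integrable M (\<lambda>\<omega>. \<phi> c (Xb i \<omega> s))" if "i \<ge> 1" for i
      using Xm[OF that] \<phi>c1[OF c] by (intro integrable_bdd[where B=1]) auto
    have ii: "integrable M (\<lambda>\<omega>. \<phi> c (Xb l \<omega> s) * \<phi> c (Xb j \<omega> s))"
      using Xm[OF l1(1)] Xm[OF l1(2)] \<phi>c1[OF c] by (intro integrable_bdd[where B=1]) (auto simp: abs_mult intro!: mult_le_one)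
    have e: "expectation (\<lambda>\<omega>. \<phi> c (Xb i \<omega> s)) = b" if "i \<ge> 1" for i
      unfolding b_def by (rule expectation_lipschitz_eq[OF that s \<phi>lip' B])
    have p: "expectation (\<lambda>\<omega>. \<phi> c (Xb l \<omega> s) * \<phi> c (Xb j \<omega> s)) = b * b"
      unfolding b_def using lj(3) by (intro uncorrelated[OF l1 _ s \<phi>_lip B \<phi>c1[OF c]]) simp
    have "expectation (\<lambda>\<omega>. ?Z c l \<omega> * ?Z c j \<omega>) = expectation (\<lambda>\<omega>. \<phi> c (Xb l \<omega> s) * \<phi> c (Xb j \<omega> s) - b * \<phi> c (Xb l \<omega> s) - b * \<phi> c (Xb j \<omega> s) + b * b)"
      unfolding b_def[symmetric] by (simp add: algebra_simps)
    also have "\<dots> = b * b - b * b - b * b + b * b"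
      using i[OF l1(1)] i[OF l1(2)] ii by (simp add: p e[OF l1(1)] e[OF l1(2)] prob_space)
    finally show ?thesis by simp
  qed
  have avgZ: "expectation (\<lambda>\<omega>. \<bar>(1 / real N) * (\<Sum>l=1..N. ?Z c l \<omega>)\<bar>) \<le> 1 / sqrt (real N)" if "c \<in> {..K}" for c
    using Zm Z1[OF that] orth[OF _ _ _ that] by (intro orthogonal_average_le[OF N]) auto
  have intZ: "integrable M (\<lambda>\<omega>. \<bar>(1 / real N) * (\<Sum>l=1..N. ?Z c l \<omega>)\<bar>)" if "c \<in> {..K}" for c
    using Zm Z1[OF that] by (intro integrable_abs integrable_mult_right Bochner_Integration.integrable_sum integrable_bdd[where B=1]) auto
  have tl: "integrable M (\<lambda>\<omega>. norm (Xb l \<omega> s) * \<phi> 0 (Xb l \<omega> s))" "expectation (\<lambda>\<omega>. norm (Xb l \<omega> s) * \<phi> 0 (Xb l \<omega> s)) \<le> tail R" if "l \<ge> 1" for l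
    using Xb_tail[OF that s R \<phi>_meas \<phi>_nonneg _ \<phi>_far] \<phi>_le_1[of 0] by auto
  have S1: "integrable M (\<lambda>\<omega>. (R + \<epsilon>) * (\<Sum>c\<in>{..K} - {0}. \<bar>(1 / real N) * (\<Sum>l=1..N. ?Z c l \<omega>)\<bar>))"
    using intZ by (intro integrable_mult_right Bochner_Integration.integrable_sum) auto
  have S2: "integrable M (\<lambda>\<omega>. (1 / real N) * (\<Sum>l=1..N. norm (Xb l \<omega> s) * \<phi> 0 (Xb l \<omega> s)))"
    using tl(1) by (intro integrable_mult_right Bochner_Integration.integrable_sum) auto
  show "integrable M (Q N s)" unfolding Q_def[abs_def] using S1 S2 by (intro Bochner_Integration.integrable_add) auto
  have "expectation (Q N s) = \<epsilon> + expectation (\<lambda>\<omega>. (R + \<epsilon>) * (\<Sum>c\<in>{..K} - {0}. \<bar>(1 / real N) * (\<Sum>l=1..N. ?Z c l \<omega>)\<bar>))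
    + expectation (\<lambda>\<omega>. (1 / real N) * (\<Sum>l=1..N. norm (Xb l \<omega> s) * \<phi> 0 (Xb l \<omega> s))) + expectation (\<lambda>\<omega>'. norm (Xb 1 \<omega>' s) * \<phi> 0 (Xb 1 \<omega>' s))"
    unfolding Q_def[abs_def] using S1 S2
    by (simp add: prob_space Bochner_Integration.integral_add Bochner_Integration.integrable_add del: integral_mult_right_zero Bochner_Integration.integral_mult_right)
  also have "expectation (\<lambda>\<omega>. (R + \<epsilon>) * (\<Sum>c\<in>{..K} - {0}. \<bar>(1 / real N) * (\<Sum>l=1..N. ?Z c l \<omega>)\<bar>)) \<le> (R + \<epsilon>) * (real K / sqrt (real N))"
  proof -
    have "expectation (\<lambda>\<omega>. \<Sum>c\<in>{..K} - {0}. \<bar>(1 / real N) * (\<Sum>l=1..N. ?Z c l \<omega>)\<bar>) = (\<Sum>c\<in>{..K} - {0}. expectation (\<lambda>\<omega>. \<bar>(1 / real N) * (\<Sum>l=1..N. ?Z c l \<omega>)\<bar>))"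
      using intZ by (intro Bochner_Integration.integral_sum) auto
    also have "\<dots> \<le> (\<Sum>c\<in>{..K} - {0}. 1 / sqrt (real N))" using avgZ by (intro sum_mono) auto
    also have "\<dots> = real K / sqrt (real N)" by simp
    finally have "(R + \<epsilon>) * expectation (\<lambda>\<omega>. \<Sum>c\<in>{..K} - {0}. \<bar>(1 / real N) * (\<Sum>l=1..N. ?Z c l \<omega>)\<bar>) \<le> (R + \<epsilon>) * (real K / sqrt (real N))"
      using R \<epsilon> by (intro mult_left_mono) auto
    then show ?thesis by simp
  qed
  also have "expectation (\<lambda>\<omega>. (1 / real N) * (\<Sum>l=1..N. norm (Xb l \<omega> s) * \<phi> 0 (Xb l \<omega> s))) \<le> tail R"
  proof -
    have "expectation (\<lambda>\<omega>. (1 / real N) * (\<Sum>l=1..N. norm (Xb l \<omega> s) * \<phi> 0 (Xb l \<omega> s))) = (1 / real N) * (\<Sum>l=1..N. expectation (\<lambda>\<omega>. norm (Xb l \<omega> s) * \<phi> 0 (Xb l \<omega> s)))"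
      using tl(1) by (subst integral_mult_right_zero, subst Bochner_Integration.integral_sum) auto
    also have "\<dots> \<le> (1 / real N) * (\<Sum>l=1..N. tail R)" using tl(2) by (intro mult_left_mono sum_mono) auto
    also have "\<dots> = tail R" using N by simp
    finally show ?thesis .
  qed
  also have "expectation (\<lambda>\<omega>'. norm (Xb 1 \<omega>' s) * \<phi> 0 (Xb 1 \<omega>' s)) \<le> tail R" by (rule tl(2)) simp
  finally show "expectation (Q N s) \<le> \<epsilon> + (R + \<epsilon>) * (real K / sqrt (real N)) + 2 * tail R" by simp
qed

definition Qc :: "nat \<Rightarrow> real \<Rightarrow> 'a \<Rightarrow> real" where "Qc N s = Q N (clamp0 T s)"

definition bound :: "nat \<Rightarrow> real" where "bound N = \<epsilon> + (R + \<epsilon>) * (real K / sqrt (real N)) + 2 * tail R"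

text \<open>\<open>Q\<close> is an explicit finite expression in the paths, so its joint
  measurability is direct. This is the reason for integrating \<open>Q\<close> over time instead of
  the Wasserstein distance it dominates.\<close>

lemma Q_pair:
  "(\<lambda>(s, \<omega>). Qc N s \<omega>) \<in> borel_measurable (borel \<Otimes>\<^sub>M M)"
proof -
  have [measurable]: "(\<lambda>z. Xb l (snd z) (clamp0 T (fst z))) \<in> borel_measurable (borel \<Otimes>\<^sub>M M)" if "l \<in> {1..N} \<union> {1}" for l
    using Xb_pair[of l] that by (auto simp: case_prod_beta)
  have e: "(\<lambda>s. expectation (\<lambda>\<omega>'. f (Xb 1 \<omega>' (clamp0 T s)))) \<in> borel_measurable borel" if "f \<in> borel_measurable borel" for f :: "real^'d \<Rightarrow> real"
    using borel_measurable_lebesgue_integral[of "\<lambda>s \<omega>'. f (Xb 1 \<omega>' (clamp0 T s))" borel] measurable_compose[OF Xb_pair[OF order_refl] that]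
    by (simp add: case_prod_beta)
  have e1: "(\<lambda>z. expectation (\<lambda>\<omega>'. f (Xb 1 \<omega>' (clamp0 T (fst z))))) \<in> borel_measurable (borel \<Otimes>\<^sub>M M)" if "f \<in> borel_measurable borel" for f :: "real^'d \<Rightarrow> real"
    using measurable_compose[OF measurable_fst e[OF that]] .
  have e2: "(\<lambda>z. f (Xb l (snd z) (clamp0 T (fst z)))) \<in> borel_measurable (borel \<Otimes>\<^sub>M M)" if "f \<in> borel_measurable borel" "l \<in> {1..N}" for f :: "real^'d \<Rightarrow> real" and l
    using that by (intro measurable_compose[OF _ that(1)]) auto
  have n0: "(\<lambda>x. norm x * \<phi> 0 x) \<in> borel_measurable borel" by measurable
  show ?thesis unfolding Qc_def Q_def case_prod_beta
    by (intro borel_measurable_add borel_measurable_times borel_measurable_sum borel_measurable_abs borel_measurable_diff borel_measurable_const e1[OF \<phi>_meas] e2[OF \<phi>_meas] e1[OF n0] e2[OF n0])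
qed

lemma Q_integral:
  assumes N: "N \<ge> 1"
  shows "integrable M (\<lambda>\<omega>. LINT s:{0..T}|lborel. Qc N s \<omega>)" "expectation (\<lambda>\<omega>. LINT s:{0..T}|lborel. Qc N s \<omega>) \<le> bound N * T"
    "AE \<omega> in M. set_integrable lborel {0..T} (\<lambda>s. Qc N s \<omega>)"
proof -
  have b: "integrable M (Qc N s) \<and> expectation (Qc N s) \<le> bound N" if "s \<in> {0..T}" for s
    unfolding Qc_def bound_def clamp0_id[OF that] using Q_moment[OF N that] by simp
  have n: "0 \<le> Qc N s \<omega>" for s \<omega> by (simp add: Qc_def Q_nonneg)
  note f = fubini_path[OF Q_pair n b]
  show "integrable M (\<lambda>\<omega>. LINT s:{0..T}|lborel. Qc N s \<omega>)" "AE \<omega> in M. set_integrable lborel {0..T} (\<lambda>s. Qc N s \<omega>)"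
    using f(1,3) by blast+
  have "expectation (\<lambda>\<omega>. LINT s:{0..T}|lborel. Qc N s \<omega>) = (LINT s:{0..T}|lborel. expectation (Qc N s))" by (rule f(2))
  also have "\<dots> \<le> (LINT s:{0..T}|lborel. bound N)"
  proof (rule set_integral_mono)
    show "set_integrable lborel {0..T} (\<lambda>s. expectation (Qc N s))"
      using f(4) b n by (intro set_integrable_bounded_Icc[where B="bound N"]) (auto simp: abs_of_nonneg)
  qed (use b set_lint_const_vec(1)[OF T0] in auto)
  finally show "expectation (\<lambda>\<omega>. LINT s:{0..T}|lborel. Qc N s \<omega>) \<le> bound N * T" using set_lint_const_Icc[OF T0] by simp
qed

end

section \<open>Propagation of chaos\<close>

lemma norm_mean_le:
  fixes f :: "nat \<Rightarrow> 'b::real_normed_vector"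
  assumes N: "N \<ge> 1" and le: "\<And>l. l \<in> {1..N} \<Longrightarrow> norm (f l) \<le> c"
  shows "norm ((1 / real N) *\<^sub>R (\<Sum>l=1..N. f l)) \<le> c"
proof -
  have "norm (\<Sum>l=1..N. f l) \<le> (\<Sum>l=1..N. c)" using le by (intro sum_norm_le) auto
  then have "norm (\<Sum>l=1..N. f l) \<le> real N * c" by simp
  then have "(1 / real N) * norm (\<Sum>l=1..N. f l) \<le> (1 / real N) * (real N * c)" by (intro mult_left_mono) auto
  then show ?thesis using N by simp
qed

section \<open>Comparison of the particle and the limit system along a path\<close>

context limit_partition begin

context
  fixes N :: nat and X :: "nat \<Rightarrow> 'a \<Rightarrow> real \<Rightarrow> real^'d" and Y :: "nat \<Rightarrow> 'a \<Rightarrow> real \<Rightarrow> real^'d"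
  assumes N: "N \<ge> 1" and sol: "particle_solution M T \<sigma> m H1 H2 K1 K2 u N X0 Y0 W X Y"
begin

lemma X_path: "n \<in> {1..N} \<Longrightarrow> X n \<in> M \<rightarrow>\<^sub>M path_space T"
  and Y_path: "i \<in> {1..m} \<Longrightarrow> Y i \<in> M \<rightarrow>\<^sub>M path_space T"
  using sol by (auto simp: particle_solution_def)

definition xerr :: "'a \<Rightarrow> real \<Rightarrow> real" where
  "xerr \<omega> s = (MAX n\<in>{1..N}. norm (X n \<omega> (clamp0 T s) - Xb n \<omega> (clamp0 T s)))"

definition yerr :: "'a \<Rightarrow> real \<Rightarrow> real" where
  "yerr \<omega> s = (MAX i\<in>{1..m}. norm (Y i \<omega> (clamp0 T s) - Yb i (clamp0 T s)))"

lemma xerr_ge: "s \<in> {0..T} \<Longrightarrow> n \<in> {1..N} \<Longrightarrow> norm (X n \<omega> s - Xb n \<omega> s) \<le> xerr \<omega> s"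
  unfolding xerr_def by (intro Max_ge) auto

lemma yerr_ge: "s \<in> {0..T} \<Longrightarrow> i \<in> {1..m} \<Longrightarrow> norm (Y i \<omega> s - Yb i s) \<le> yerr \<omega> s"
  unfolding yerr_def by (intro Max_ge) auto

lemma xerr_nonneg: "0 \<le> xerr \<omega> s"
proof -
  have "0 \<le> norm (X 1 \<omega> (clamp0 T s) - Xb 1 \<omega> (clamp0 T s))" by simp
  also have "\<dots> \<le> xerr \<omega> s" unfolding xerr_def using N by (intro Max_ge) auto
  finally show ?thesis .
qed

lemma yerr_nonneg: "0 \<le> yerr \<omega> s"
proof -
  have "0 \<le> norm (Y 1 \<omega> (clamp0 T s) - Yb 1 (clamp0 T s))" by simp
  also have "\<dots> \<le> yerr \<omega> s" unfolding yerr_def using m by (intro Max_ge) auto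
  finally show ?thesis .
qed

lemma xerr_cont: "n \<in> {1..N} \<Longrightarrow> \<omega> \<in> space M \<Longrightarrow> continuous_on {0..T} (\<lambda>s. norm (X n \<omega> s - Xb n \<omega> s))"
  by (intro continuous_intros continuous_on_path[OF X_path] Xb_cont) auto

lemma yerr_cont: "i \<in> {1..m} \<Longrightarrow> \<omega> \<in> space M \<Longrightarrow> continuous_on {0..T} (\<lambda>s. norm (Y i \<omega> s - Yb i s))"
  by (intro continuous_intros continuous_on_path[OF Y_path] Yb_cont) auto

lemma err_meas:
  assumes "\<omega> \<in> space M"
  shows "xerr \<omega> \<in> borel_measurable borel" "yerr \<omega> \<in> borel_measurable borel"
proof -
  show "xerr \<omega> \<in> borel_measurable borel" unfolding xerr_def[abs_def]
    by (rule borel_measurable_Max) (auto intro!: borel_measurable_continuous_onI continuous_on_clamp0[OF xerr_cont[OF _ assms] T0])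
  show "yerr \<omega> \<in> borel_measurable borel" unfolding yerr_def[abs_def]
    by (rule borel_measurable_Max) (auto intro!: borel_measurable_continuous_onI continuous_on_clamp0[OF yerr_cont[OF _ assms] T0])
qed

lemma err_bounded:
  assumes "\<omega> \<in> space M"
  obtains C where "\<And>s. s \<in> {0..T} \<Longrightarrow> xerr \<omega> s + yerr \<omega> s \<le> C"
proof -
  let ?g = "\<lambda>s. (\<Sum>n=1..N. norm (X n \<omega> s - Xb n \<omega> s)) + (\<Sum>i=1..m. norm (Y i \<omega> s - Yb i s))"
  have "continuous_on {0..T} ?g"
    using xerr_cont[OF _ assms] yerr_cont[OF _ assms] by (intro continuous_on_add continuous_on_sum) auto
  then have "bounded (?g ` {0..T})" by (intro compact_imp_bounded compact_continuous_image) auto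
  then obtain C where C: "\<forall>x\<in>?g ` {0..T}. norm x \<le> C" unfolding bounded_iff by blast
  show ?thesis
  proof (rule that)
    fix s assume s: "s \<in> {0..T}"
    have "xerr \<omega> s \<le> (\<Sum>n=1..N. norm (X n \<omega> s - Xb n \<omega> s))"
      unfolding xerr_def clamp0_id[OF s] using N by (subst Max_le_iff) (auto intro!: member_le_sum)
    moreover have "yerr \<omega> s \<le> (\<Sum>i=1..m. norm (Y i \<omega> s - Yb i s))"
      unfolding yerr_def clamp0_id[OF s] using m by (subst Max_le_iff) (auto intro!: member_le_sum)
    moreover have "?g s \<le> C" using C s by (force simp: abs_le_iff)
    ultimately show "xerr \<omega> s + yerr \<omega> s \<le> C" by linarith
  qed
qed

text \<open>The interacting particles are first replaced by the limit processes at the cost of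
  \<open>xerr\<close>, and their empirical average is then replaced by the convolution at the cost
  of \<open>Q\<close>.\<close>

lemma mean_interaction_diff:
  assumes lip: "\<And>x y. norm (h x - h y) \<le> L * norm (x - y)" and s: "s \<in> {0..T}" and z: "norm (z - z') \<le> c"
  shows "norm ((1 / real N) *\<^sub>R (\<Sum>l=1..N. h (z - X l \<omega> s)) - conv h (\<mu> s) z') \<le> L * (c + xerr \<omega> s) + L * Q N s \<omega>"
proof -
  have "norm ((1 / real N) *\<^sub>R (\<Sum>l=1..N. h (z - X l \<omega> s) - h (z' - Xb l \<omega> s))) \<le> L * (c + xerr \<omega> s)"
  proof (rule norm_mean_le[OF N])
    fix l assume l: "l \<in> {1..N}"
    have "norm (h (z - X l \<omega> s) - h (z' - Xb l \<omega> s)) \<le> L * norm ((z - z') - (X l \<omega> s - Xb l \<omega> s))"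
      using lip[of "z - X l \<omega> s" "z' - Xb l \<omega> s"] by (simp add: algebra_simps)
    also have "\<dots> \<le> L * (c + xerr \<omega> s)"
      using norm_triangle_ineq4[of "z - z'" "X l \<omega> s - Xb l \<omega> s"] xerr_ge[OF s l, of \<omega>] z by (intro mult_left_mono) auto
    finally show "norm (h (z - X l \<omega> s) - h (z' - Xb l \<omega> s)) \<le> L * (c + xerr \<omega> s)" .
  qed
  moreover note conv_Q[OF N s lip, of z' \<omega>]
  moreover have "(1 / real N) *\<^sub>R (\<Sum>l=1..N. h (z - X l \<omega> s)) - conv h (\<mu> s) z'
    = (1 / real N) *\<^sub>R (\<Sum>l=1..N. h (z - X l \<omega> s) - h (z' - Xb l \<omega> s)) + ((1 / real N) *\<^sub>R (\<Sum>l=1..N. h (z' - Xb l \<omega> s)) - conv h (\<mu> s) z')"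
    by (simp add: sum_subtractf scaleR_diff_right)
  ultimately show ?thesis by (metis (no_types, lifting) norm_triangle_mono)
qed

text \<open>The factor 3 L of \<open>xerr\<close> arises since \<open>H1\<close> sees the error in
  both positions and \<open>K1\<close> in one; \<open>K1\<close> also sees the error of the
  \<open>Y\<close>.\<close>

lemma x_drift_diff:
  assumes n: "n \<in> {1..N}" and s: "s \<in> {0..T}"
  shows "norm (((1 / real N) *\<^sub>R (\<Sum>l=1..N. H1 (X n \<omega> s - X l \<omega> s)) + (1 / real m) *\<^sub>R (\<Sum>j=1..m. K1 (Y j \<omega> s - X n \<omega> s))) - drift n \<omega> s)
    \<le> 3 * L * xerr \<omega> s + L * yerr \<omega> s + L * Q N s \<omega>"
proof -
  have n1: "n \<ge> 1" using n by simp
  have "norm (avg (\<lambda>j. K1 (Y j \<omega> s - X n \<omega> s)) - avg (\<lambda>j. K1 (Yb j s - Xb n \<omega> s))) \<le> L * avg (\<lambda>j. norm (Y j \<omega> s - Yb j s)) + L * norm (X n \<omega> s - Xb n \<omega> s)"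
    by (rule norm_avg_K1_diff)
  also have "\<dots> \<le> L * avg (\<lambda>j. yerr \<omega> s) + L * xerr \<omega> s"
    using yerr_ge[OF s] xerr_ge[OF s n] by (intro add_mono mult_left_mono avg_mono) auto
  finally have 1: "norm (avg (\<lambda>j. K1 (Y j \<omega> s - X n \<omega> s)) - avg (\<lambda>j. K1 (Yb j s - Xb n \<omega> s))) \<le> L * yerr \<omega> s + L * xerr \<omega> s" by (simp add: avg_const)
  have 2: "norm ((1 / real N) *\<^sub>R (\<Sum>l=1..N. H1 (X n \<omega> s - X l \<omega> s)) - cH n s (Xb n \<omega> s)) \<le> L * (xerr \<omega> s + xerr \<omega> s) + L * Q N s \<omega>"
    unfolding cH_eq[OF n1 s] by (rule mean_interaction_diff[OF H1 s xerr_ge[OF s n]])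
  have "norm (((1 / real N) *\<^sub>R (\<Sum>l=1..N. H1 (X n \<omega> s - X l \<omega> s)) + avg (\<lambda>j. K1 (Y j \<omega> s - X n \<omega> s))) - drift n \<omega> s)
     \<le> norm ((1 / real N) *\<^sub>R (\<Sum>l=1..N. H1 (X n \<omega> s - X l \<omega> s)) - cH n s (Xb n \<omega> s)) + norm (avg (\<lambda>j. K1 (Y j \<omega> s - X n \<omega> s)) - avg (\<lambda>j. K1 (Yb j s - Xb n \<omega> s)))"
    unfolding drift_def by (rule norm_diff_triangle_ineq)
  with 1 2 show ?thesis unfolding avg_def by (simp add: algebra_simps)
qed

text \<open>\<open>K2\<close> contributes one part each to \<open>xerr\<close>, \<open>yerr\<close>
  and \<open>Q\<close>, and \<open>H2\<close> two parts to \<open>yerr\<close>. The difference of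
  the values of \<open>u\<close> is split at the empirical measure of the limit processes and
  contributes one part to \<open>xerr\<close> and one to \<open>Q\<close>.\<close>

lemma y_drift_diff:
  assumes i: "i \<in> {1..m}" and s: "s \<in> {0..T}"
  shows "norm (((1 / real N) *\<^sub>R (\<Sum>l=1..N. K2 (Y i \<omega> s - X l \<omega> s)) + (1 / real m) *\<^sub>R (\<Sum>j=1..m. H2 (Y j \<omega> s - Y i \<omega> s)) + u (empirical_measure N (\<lambda>l. X l \<omega> s)))
     - (conv K2 (\<mu> s) (Yb i s) + avg (\<lambda>j. H2 (Yb j s - Yb i s)) + u (\<mu> s)))
    \<le> 2 * L * xerr \<omega> s + 3 * L * yerr \<omega> s + 2 * L * Q N s \<omega>"
proof -
  have 1: "norm ((1 / real N) *\<^sub>R (\<Sum>l=1..N. K2 (Y i \<omega> s - X l \<omega> s)) - conv K2 (\<mu> s) (Yb i s)) \<le> L * (yerr \<omega> s + xerr \<omega> s) + L * Q N s \<omega>"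
    by (rule mean_interaction_diff[OF K2 s yerr_ge[OF s i]])
  have "norm (avg (\<lambda>j. H2 (Y j \<omega> s - Y i \<omega> s)) - avg (\<lambda>j. H2 (Yb j s - Yb i s))) \<le> avg (\<lambda>j. L * (2 * yerr \<omega> s))"
    unfolding avg_diff
  proof (rule norm_avg_le)
    fix j assume j: "j \<in> {1..m}"
    have "norm (H2 (Y j \<omega> s - Y i \<omega> s) - H2 (Yb j s - Yb i s)) \<le> L * norm ((Y j \<omega> s - Yb j s) - (Y i \<omega> s - Yb i s))"
      using H2[of "Y j \<omega> s - Y i \<omega> s" "Yb j s - Yb i s"] by (simp add: algebra_simps)
    also have "\<dots> \<le> L * (2 * yerr \<omega> s)"
      using norm_triangle_ineq4[of "Y j \<omega> s - Yb j s" "Y i \<omega> s - Yb i s"] yerr_ge[OF s i, of \<omega>] yerr_ge[OF s j, of \<omega>] by (intro mult_left_mono) auto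
    finally show "norm (H2 (Y j \<omega> s - Y i \<omega> s) - H2 (Yb j s - Yb i s)) \<le> L * (2 * yerr \<omega> s)" .
  qed
  then have 2: "norm (avg (\<lambda>j. H2 (Y j \<omega> s - Y i \<omega> s)) - avg (\<lambda>j. H2 (Yb j s - Yb i s))) \<le> L * (2 * yerr \<omega> s)" by (simp add: avg_const)
  let ?eX = "empirical_measure N (\<lambda>l. X l \<omega> s)" and ?eb = "empirical_measure N (\<lambda>l. Xb l \<omega> s)"
  have "wasserstein1 ?eX ?eb \<le> (1 / real N) * (\<Sum>l=1..N. norm (X l \<omega> s - Xb l \<omega> s))"
    by (rule wasserstein1_empirical_le[OF N])
  also have "\<dots> \<le> xerr \<omega> s"
  proof -
    have "norm ((1 / real N) *\<^sub>R (\<Sum>l=1..N. norm (X l \<omega> s - Xb l \<omega> s))) \<le> xerr \<omega> s"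
      by (rule norm_mean_le[OF N]) (use xerr_ge[OF s] in simp)
    then show ?thesis unfolding real_norm_def real_scaleR_def by linarith
  qed
  finally have "L * wasserstein1 ?eX ?eb \<le> L * xerr \<omega> s" by (intro mult_left_mono) auto
  then have 3: "norm (u ?eX - u ?eb) \<le> L * xerr \<omega> s"
    using u[OF empirical_measure_in_W1[OF N] empirical_measure_in_W1[OF N], of "\<lambda>l. X l \<omega> s" "\<lambda>l. Xb l \<omega> s"] by linarith
  have "L * wasserstein1 ?eb (\<mu> s) \<le> L * Q N s \<omega>" using wasserstein_Q[OF N s] by (intro mult_left_mono) auto
  then have 4: "norm (u ?eb - u (\<mu> s)) \<le> L * Q N s \<omega>"
    using u[OF empirical_measure_in_W1[OF N] marg_W1[OF order_refl s], of "\<lambda>l. Xb l \<omega> s"] by linarith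
  have "norm ((a1 + a2 + a3) - (b1 + b2 + b3)) \<le> norm (a1 - b1) + norm (a2 - b2) + (norm (a3 - c) + norm (c - b3))" for a1 a2 a3 b1 b2 b3 c :: "real^'d"
  proof -
    have "(a1 + a2 + a3) - (b1 + b2 + b3) = (a1 - b1) + (a2 - b2) + ((a3 - c) + (c - b3))" by simp
    then show ?thesis by (metis (no_types, lifting) norm_triangle_mono order_refl)
  qed
  from order_trans[OF this add_mono[OF add_mono[OF 1 2] add_mono[OF 3 4]]] show ?thesis
    unfolding avg_def by (simp add: algebra_simps)
qed

text \<open>Particle and limit process share initial datum and noise, so the comparison is
  deterministic for almost every \<omega>. Adding the two inequalities gives the rate 5 L and the
  inhomogeneity 3 L times the integral of \<open>Qc\<close>; \<open>gronwall\<close> doubles the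
  latter to 6 L and produces exp (10 L T).\<close>

lemma pathwise_error:
  "AE \<omega> in M. \<forall>t\<in>{0..T}. xerr \<omega> t + yerr \<omega> t \<le> 6 * L * exp (10 * L * T) * (LINT s:{0..T}|lborel. Qc N s \<omega>)"
proof -
  have aX: "AE \<omega> in M. \<forall>n\<in>{1..N}. solves_integral_eq T (X0 n \<omega>)
        (\<lambda>t. (1 / real N) *\<^sub>R (\<Sum>l=1..N. H1 (X n \<omega> t - X l \<omega> t)) + (1 / real m) *\<^sub>R (\<Sum>j=1..m. K1 (Y j \<omega> t - X n \<omega> t)))
        (\<lambda>t. sqrt (2 * \<sigma>) *\<^sub>R W n \<omega> t) (X n \<omega>)"
    using sol unfolding particle_solution_def by (intro AE_finite_allI) auto
  have aY: "AE \<omega> in M. \<forall>i\<in>{1..m}. Y i \<omega> 0 = Y0 i \<and>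
        (\<forall>t\<in>{0..T}. (Y i \<omega> has_vector_derivative
            (1 / real N) *\<^sub>R (\<Sum>l=1..N. K2 (Y i \<omega> t - X l \<omega> t))
          + (1 / real m) *\<^sub>R (\<Sum>j=1..m. H2 (Y j \<omega> t - Y i \<omega> t))
          + u (empirical_measure N (\<lambda>l. X l \<omega> t))) (at t within {0..T}))"
    using sol unfolding particle_solution_def by (intro AE_finite_allI) auto
  have aB: "AE \<omega> in M. \<forall>n\<in>{1..N}. set_integrable lborel {0..T} (drift n \<omega>) \<and>
    (\<forall>t\<in>{0..T}. Xb n \<omega> t = X0 n \<omega> + set_lebesgue_integral lborel {0..t} (drift n \<omega>) + sqrt (2 * \<sigma>) *\<^sub>R W n \<omega> t)"
    using limit_equation by (intro AE_finite_allI) auto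
  show ?thesis
    using aX aY aB Q_integral(3)[OF N] AE_space
  proof eventually_elim
    case (elim \<omega>)
    note \<omega> = elim(5)
    define I where "I = (LINT s:{0..T}|lborel. Qc N s \<omega>)"
    have Q0: "0 \<le> Qc N s \<omega>" for s by (simp add: Qc_def Q_nonneg)
    have Qc: "Qc N s \<omega> = Q N s \<omega>" if "s \<in> {0..T}" for s by (simp add: Qc_def clamp0_id[OF that])
    have Ile: "(LINT s:{0..t}|lborel. Qc N s \<omega>) \<le> I" and Qi: "set_integrable lborel {0..t} (\<lambda>s. Qc N s \<omega>)" if t: "t \<in> {0..T}" for t
    proof -
      show Qi: "set_integrable lborel {0..t} (\<lambda>s. Qc N s \<omega>)" using t by (intro set_integrable_Icc_subset[OF elim(4)]) auto
      show "(LINT s:{0..t}|lborel. Qc N s \<omega>) \<le> I"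
        unfolding I_def set_lebesgue_integral_def using Qi elim(4) t Q0
        by (intro integral_mono) (auto simp: set_integrable_def split: split_indicator)
    qed
    have I0: "0 \<le> I" unfolding I_def set_lebesgue_integral_def
      using Q0 by (intro Bochner_Integration.integral_nonneg) (auto split: split_indicator)
    obtain C where C: "\<And>s. s \<in> {0..T} \<Longrightarrow> xerr \<omega> s + yerr \<omega> s \<le> C" using err_bounded[OF \<omega>] by blast
    have ei: "set_integrable lborel {0..t} (xerr \<omega>)" "set_integrable lborel {0..t} (yerr \<omega>)" if t: "t \<in> {0..T}" for t
    proof -
      have "\<bar>xerr \<omega> s\<bar> \<le> C" "\<bar>yerr \<omega> s\<bar> \<le> C" if "s \<in> {0..t}" for s
        using C[of s] xerr_nonneg[of \<omega> s] yerr_nonneg[of \<omega> s] that t by auto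
      then show "set_integrable lborel {0..t} (xerr \<omega>)" "set_integrable lborel {0..t} (yerr \<omega>)"
        using err_meas[OF \<omega>] by (auto intro!: set_integrable_bounded_Icc[where B=C])
    qed
    have lin: "set_integrable lborel {0..t} (\<lambda>s. a * xerr \<omega> s + b * yerr \<omega> s + c * Qc N s \<omega>)"
      "(LINT s:{0..t}|lborel. a * xerr \<omega> s + b * yerr \<omega> s + c * Qc N s \<omega>) =
         a * (LINT s:{0..t}|lborel. xerr \<omega> s) + b * (LINT s:{0..t}|lborel. yerr \<omega> s) + c * (LINT s:{0..t}|lborel. Qc N s \<omega>)"
      if t: "t \<in> {0..T}" for t a b c
    proof -
      have 1: "set_integrable lborel {0..t} (\<lambda>s. a * xerr \<omega> s)" "set_integrable lborel {0..t} (\<lambda>s. b * yerr \<omega> s)" "set_integrable lborel {0..t} (\<lambda>s. c * Qc N s \<omega>)"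
        using ei[OF t] Qi[OF t] by (auto intro: set_integrable_mult_right)
      note 2 = set_integral_add[OF 1(1,2)]
      note 3 = set_integral_add[OF 2(1) 1(3)]
      show "set_integrable lborel {0..t} (\<lambda>s. a * xerr \<omega> s + b * yerr \<omega> s + c * Qc N s \<omega>)" by (rule 3(1))
      show "(LINT s:{0..t}|lborel. a * xerr \<omega> s + b * yerr \<omega> s + c * Qc N s \<omega>) =
         a * (LINT s:{0..t}|lborel. xerr \<omega> s) + b * (LINT s:{0..t}|lborel. yerr \<omega> s) + c * (LINT s:{0..t}|lborel. Qc N s \<omega>)"
        using 2(2) 3(2) by simp
    qed
    have xb: "xerr \<omega> t \<le> (LINT s:{0..t}|lborel. 3 * L * xerr \<omega> s + L * yerr \<omega> s + L * Qc N s \<omega>)" if t: "t \<in> {0..T}" for t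
      unfolding xerr_def[of \<omega> t] clamp0_id[OF t]
    proof (subst Max_le_iff)
      show "\<forall>a\<in>(\<lambda>n. norm (X n \<omega> t - Xb n \<omega> t)) ` {1..N}. a \<le> (LINT s:{0..t}|lborel. 3 * L * xerr \<omega> s + L * yerr \<omega> s + L * Qc N s \<omega>)"
      proof clarify
        fix n assume n: "n \<in> {1..N}"
        define b where "b s = (1 / real N) *\<^sub>R (\<Sum>l=1..N. H1 (X n \<omega> s - X l \<omega> s)) + (1 / real m) *\<^sub>R (\<Sum>j=1..m. K1 (Y j \<omega> s - X n \<omega> s))" for s
        have bi: "set_integrable lborel {0..T} b" and bx: "X n \<omega> t = X0 n \<omega> + set_lebesgue_integral lborel {0..t} b + sqrt (2 * \<sigma>) *\<^sub>R W n \<omega> t"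
          using elim(1) n t unfolding solves_integral_eq_def b_def by blast+
        have di: "set_integrable lborel {0..T} (drift n \<omega>)" and dx: "Xb n \<omega> t = X0 n \<omega> + set_lebesgue_integral lborel {0..t} (drift n \<omega>) + sqrt (2 * \<sigma>) *\<^sub>R W n \<omega> t"
          using elim(3) n t by blast+
        have i: "set_integrable lborel {0..t} b" "set_integrable lborel {0..t} (drift n \<omega>)"
          using t by (auto intro: set_integrable_Icc_subset[OF bi] set_integrable_Icc_subset[OF di])
        \<comment> \<open>The common initial datum and the common Brownian path cancel.\<close>
        have eq: "X n \<omega> t - Xb n \<omega> t = (LINT s:{0..t}|lborel. b s - drift n \<omega> s)"
          unfolding bx dx set_integral_diff(2)[OF i] by simp
        show "norm (X n \<omega> t - Xb n \<omega> t) \<le> (LINT s:{0..t}|lborel. 3 * L * xerr \<omega> s + L * yerr \<omega> s + L * Qc N s \<omega>)"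
          unfolding eq
        proof (rule set_lint_mono_Icc_norm[OF set_integral_diff(1)[OF i] lin(1)[OF t]])
          fix s assume "s \<in> {0..t}"
          then have s: "s \<in> {0..T}" using t by auto
          show "norm (b s - drift n \<omega> s) \<le> 3 * L * xerr \<omega> s + L * yerr \<omega> s + L * Qc N s \<omega>"
            unfolding b_def Qc[OF s] by (rule x_drift_diff[OF n s])
        qed
      qed
    qed (use N in auto)
    have yb: "yerr \<omega> t \<le> (LINT s:{0..t}|lborel. 2 * L * xerr \<omega> s + 3 * L * yerr \<omega> s + 2 * L * Qc N s \<omega>)" if t: "t \<in> {0..T}" for t
      unfolding yerr_def[of \<omega> t] clamp0_id[OF t]
    proof (subst Max_le_iff)
      show "\<forall>a\<in>(\<lambda>i. norm (Y i \<omega> t - Yb i t)) ` {1..m}. a \<le> (LINT s:{0..t}|lborel. 2 * L * xerr \<omega> s + 3 * L * yerr \<omega> s + 2 * L * Qc N s \<omega>)"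
      proof clarify
        fix i assume i: "i \<in> {1..m}"
        let ?D = "\<lambda>s. ((1 / real N) *\<^sub>R (\<Sum>l=1..N. K2 (Y i \<omega> s - X l \<omega> s)) + (1 / real m) *\<^sub>R (\<Sum>j=1..m. H2 (Y j \<omega> s - Y i \<omega> s)) + u (empirical_measure N (\<lambda>l. X l \<omega> s)))
           - (conv K2 (\<mu> s) (Yb i s) + avg (\<lambda>j. H2 (Yb j s - Yb i s)) + u (\<mu> s))"
        have T': "T \<in> {0..T}" by simp
        have "norm ((Y i \<omega> t - Yb i t) - (Y i \<omega> 0 - Yb i 0)) \<le> (LINT s:{0..t}|lborel. 2 * L * xerr \<omega> s + 3 * L * yerr \<omega> s + 2 * L * Qc N s \<omega>)"
        proof (rule ode_norm_bound[OF _ _ lin(1)[OF T'] t])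
          show "((\<lambda>s. Y i \<omega> s - Yb i s) has_vector_derivative ?D s) (at s within {0..T})" if s: "s \<in> {0..T}" for s
            using elim(2) i s by (intro has_vector_derivative_diff Yb_derivative[OF i s order_refl]) blast
          show "norm (?D s) \<le> 2 * L * xerr \<omega> s + 3 * L * yerr \<omega> s + 2 * L * Qc N s \<omega>" if s: "s \<in> {0..T}" for s
            unfolding Qc[OF s] by (rule y_drift_diff[OF i s])
        qed
        moreover have "Y i \<omega> 0 = Yb i 0" using elim(2) i Yb_init[OF i] by simp
        ultimately show "norm (Y i \<omega> t - Yb i t) \<le> (LINT s:{0..t}|lborel. 2 * L * xerr \<omega> s + 3 * L * yerr \<omega> s + 2 * L * Qc N s \<omega>)" by simp
      qed
    qed (use m in auto)
    show "\<forall>t\<in>{0..T}. xerr \<omega> t + yerr \<omega> t \<le> 6 * L * exp (10 * L * T) * (LINT s:{0..T}|lborel. Qc N s \<omega>)"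
    proof
      fix t assume t: "t \<in> {0..T}"
      have "xerr \<omega> t + yerr \<omega> t \<le> 2 * (3 * L * I) * exp (2 * (5 * L) * T)"
      proof (rule gronwall[OF _ _ _ _ _ t, where B=C])
        show "(\<lambda>s. xerr \<omega> s + yerr \<omega> s) \<in> borel_measurable borel" using err_meas[OF \<omega>] by measurable
        show "0 \<le> xerr \<omega> s + yerr \<omega> s \<and> xerr \<omega> s + yerr \<omega> s \<le> C" if "s \<in> {0..T}" for s
          using C[OF that] xerr_nonneg yerr_nonneg by simp
        fix r assume r: "r \<in> {0..T}"
        \<comment> \<open>Allows the factor 4 L of the integral of \<open>yerr\<close> to be raised
          to 5 L, so that the sum of both errors appears.\<close>
        have nn: "0 \<le> (LINT s:{0..r}|lborel. yerr \<omega> s)" unfolding set_lebesgue_integral_def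
          using yerr_nonneg by (intro Bochner_Integration.integral_nonneg) auto
        have "xerr \<omega> r + yerr \<omega> r \<le> 5 * L * (LINT s:{0..r}|lborel. xerr \<omega> s) + 4 * L * (LINT s:{0..r}|lborel. yerr \<omega> s) + 3 * L * (LINT s:{0..r}|lborel. Qc N s \<omega>)"
          using xb[OF r] yb[OF r] unfolding lin(2)[OF r] by simp
        also have "\<dots> \<le> 5 * L * (LINT s:{0..r}|lborel. xerr \<omega> s) + 5 * L * (LINT s:{0..r}|lborel. yerr \<omega> s) + 3 * L * I"
          using nn Ile[OF r] L by (intro add_mono mult_left_mono mult_right_mono) auto
        also have "\<dots> = 3 * L * I + 5 * L * (LINT s:{0..r}|lborel. xerr \<omega> s + yerr \<omega> s)"
          using set_integral_add(2)[OF ei[OF r]] by (simp add: algebra_simps)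
        finally show "xerr \<omega> r + yerr \<omega> r \<le> 3 * L * I + 5 * L * (LINT s:{0..r}|lborel. xerr \<omega> s + yerr \<omega> s)" .
      qed (use L I0 in auto)
      then show "xerr \<omega> t + yerr \<omega> t \<le> 6 * L * exp (10 * L * T) * (LINT s:{0..T}|lborel. Qc N s \<omega>)"
        by (simp add: I_def mult_ac)
    qed
  qed
qed

text \<open>The two maxima in \<open>max_error\<close> may be attained at different times, so each
  is bounded by \<open>b\<close> separately; hence the factor 2.\<close>

lemma max_error_bounds:
  assumes \<omega>: "\<omega> \<in> space M" and b: "\<And>t. t \<in> {0..T} \<Longrightarrow> xerr \<omega> t + yerr \<omega> t \<le> b"
  shows "0 \<le> max_error T m N X Xb Y Yb \<omega>" "max_error T m N X Xb Y Yb \<omega> \<le> 2 * b"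
proof -
  have zT: "0 \<in> {0..T}" by simp
  have sx: "norm (X n \<omega> t - Xb n \<omega> t) \<le> b" if "n \<in> {1..N}" "t \<in> {0..T}" for n t
    using xerr_ge[OF that(2,1), of \<omega>] b[OF that(2)] yerr_nonneg[of \<omega> t] by linarith
  have sy: "norm (Y i \<omega> t - Yb i t) \<le> b" if "i \<in> {1..m}" "t \<in> {0..T}" for i t
    using yerr_ge[OF that(2,1), of \<omega>] b[OF that(2)] xerr_nonneg[of \<omega> t] by linarith
  have x1: "(SUP t\<in>{0..T}. norm (X n \<omega> t - Xb n \<omega> t)) \<le> b" "0 \<le> (SUP t\<in>{0..T}. norm (X n \<omega> t - Xb n \<omega> t))" if n: "n \<in> {1..N}" for n
  proof -
    show "(SUP t\<in>{0..T}. norm (X n \<omega> t - Xb n \<omega> t)) \<le> b"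
      by (rule cSUP_least) (use sx[OF n] zT in auto)
    show "0 \<le> (SUP t\<in>{0..T}. norm (X n \<omega> t - Xb n \<omega> t))"
      by (rule cSUP_upper2[OF bdd_aboveI2 zT]) (use sx[OF n] in auto)
  qed
  have y1: "(SUP t\<in>{0..T}. norm (Y i \<omega> t - Yb i t)) \<le> b" "0 \<le> (SUP t\<in>{0..T}. norm (Y i \<omega> t - Yb i t))" if i: "i \<in> {1..m}" for i
  proof -
    show "(SUP t\<in>{0..T}. norm (Y i \<omega> t - Yb i t)) \<le> b"
      by (rule cSUP_least) (use sy[OF i] zT in auto)
    show "0 \<le> (SUP t\<in>{0..T}. norm (Y i \<omega> t - Yb i t))"
      by (rule cSUP_upper2[OF bdd_aboveI2 zT]) (use sy[OF i] in auto)
  qed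
  have "(MAX n\<in>{1..N}. SUP t\<in>{0..T}. norm (X n \<omega> t - Xb n \<omega> t)) \<le> b"
    using x1(1) N by (subst Max_le_iff) auto
  moreover have "(MAX i\<in>{1..m}. SUP t\<in>{0..T}. norm (Y i \<omega> t - Yb i t)) \<le> b"
    using y1(1) m by (subst Max_le_iff) auto
  ultimately show "max_error T m N X Xb Y Yb \<omega> \<le> 2 * b" by (simp add: max_error_def)
  have "0 \<le> (MAX n\<in>{1..N}. SUP t\<in>{0..T}. norm (X n \<omega> t - Xb n \<omega> t))"
    using x1(2) N by (subst Max_ge_iff) auto
  moreover have "0 \<le> (MAX i\<in>{1..m}. SUP t\<in>{0..T}. norm (Y i \<omega> t - Yb i t))"
    using y1(2) m by (subst Max_ge_iff) auto
  ultimately show "0 \<le> max_error T m N X Xb Y Yb \<omega>" by (simp add: max_error_def)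
qed

lemma max_error_meas: "max_error T m N X Xb Y Yb \<in> borel_measurable M"
proof -
  have "(\<lambda>\<omega>. SUP t\<in>{0..T}. norm (X n \<omega> t - Xb n \<omega> t)) \<in> borel_measurable M" if n: "n \<in> {1..N}" for n
  proof (rule borel_measurable_SUP_Icc[OF _ xerr_cont[OF n] T0])
    fix t assume t: "t \<in> {0..T}"
    have "(\<lambda>\<omega>. X n \<omega> t - Xb n \<omega> t) \<in> borel_measurable M"
      using n by (intro borel_measurable_diff measurable_path_eval[OF X_path t] Xb_meas[OF _ t]) auto
    then show "(\<lambda>\<omega>. norm (X n \<omega> t - Xb n \<omega> t)) \<in> borel_measurable M" by measurable
  qed
  moreover have "(\<lambda>\<omega>. SUP t\<in>{0..T}. norm (Y i \<omega> t - Yb i t)) \<in> borel_measurable M" if i: "i \<in> {1..m}" for i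
  proof (rule borel_measurable_SUP_Icc[OF _ yerr_cont[OF i] T0])
    fix t assume t: "t \<in> {0..T}"
    have "(\<lambda>\<omega>. Y i \<omega> t - Yb i t) \<in> borel_measurable M"
      using i by (intro borel_measurable_diff measurable_path_eval[OF Y_path t] borel_measurable_const) auto
    then show "(\<lambda>\<omega>. norm (Y i \<omega> t - Yb i t)) \<in> borel_measurable M" by measurable
  qed
  ultimately show ?thesis
    unfolding max_error_def[abs_def] by (intro borel_measurable_add borel_measurable_Max) auto
qed

text \<open>12 L exp (10 L T) is twice the pathwise constant. Apart from N, the right-hand side
  contains only constants of \<open>interaction\<close> and of the partition, none of the
  probability space.\<close>

lemma max_error_expectation:
  "integrable M (max_error T m N X Xb Y Yb)"
  "expectation (max_error T m N X Xb Y Yb) \<le> 12 * L * exp (10 * L * T) * T * (\<epsilon> + (R + \<epsilon>) * (real K / sqrt (real N)) + 2 * tail R)"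
proof -
  define c where "c = 12 * L * exp (10 * L * T)"
  have c0: "0 \<le> c" by (simp add: c_def)
  have ae: "AE \<omega> in M. 0 \<le> max_error T m N X Xb Y Yb \<omega> \<and> max_error T m N X Xb Y Yb \<omega> \<le> c * (LINT s:{0..T}|lborel. Qc N s \<omega>)"
    using pathwise_error AE_space
  proof eventually_elim
    case (elim \<omega>)
    then show ?case
      using max_error_bounds[OF elim(2), of "6 * L * exp (10 * L * T) * (LINT s:{0..T}|lborel. Qc N s \<omega>)"] by (simp add: c_def)
  qed
  have Qi: "integrable M (\<lambda>\<omega>. c * (LINT s:{0..T}|lborel. Qc N s \<omega>))" using Q_integral(1)[OF N] by simp
  show int: "integrable M (max_error T m N X Xb Y Yb)"
  proof (rule Bochner_Integration.integrable_bound[OF Qi max_error_meas])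
    show "AE \<omega> in M. norm (max_error T m N X Xb Y Yb \<omega>) \<le> norm (c * (LINT s:{0..T}|lborel. Qc N s \<omega>))"
      using ae by eventually_elim auto
  qed
  have "expectation (max_error T m N X Xb Y Yb) \<le> expectation (\<lambda>\<omega>. c * (LINT s:{0..T}|lborel. Qc N s \<omega>))"
    by (rule integral_mono_AE[OF int Qi]) (use ae in \<open>eventually_elim, auto\<close>)
  also have "\<dots> = c * expectation (\<lambda>\<omega>. LINT s:{0..T}|lborel. Qc N s \<omega>)" by simp
  also have "\<dots> \<le> c * (bound N * T)" using Q_integral(2)[OF N] c0 by (intro mult_left_mono)
  finally show "expectation (max_error T m N X Xb Y Yb) \<le> 12 * L * exp (10 * L * T) * T * (\<epsilon> + (R + \<epsilon>) * (real K / sqrt (real N)) + 2 * tail R)"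
    by (simp add: c_def bound_def mult_ac)
qed

end

end

text \<open>A diagonal argument: a large k makes the limit \<open>c k\<close> small, and then a
  large N makes \<open>b k N\<close> small; the infimum chooses k in terms of N. The summand 1 / (N
  + 1) will make the sequence strictly positive.\<close>

lemma Inf_null_sequence:
  fixes b :: "nat \<Rightarrow> nat \<Rightarrow> real"
  assumes nonneg: "\<And>k N. 0 \<le> b k N" and lim: "\<And>k. b k \<longlonglongrightarrow> c k" and c: "c \<longlonglongrightarrow> 0"
  shows "(\<lambda>N. (INF k. b k N) + 1 / real (Suc N)) \<longlonglongrightarrow> 0"
proof -
  have bdd: "bdd_below (range (\<lambda>k. b k N))" for N by (rule bdd_belowI2[of _ 0]) (rule nonneg)
  have "(\<lambda>N. INF k. b k N) \<longlonglongrightarrow> 0"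
  proof (rule LIMSEQ_I)
    fix r :: real assume r: "r > 0"
    have "\<forall>\<^sub>F k in sequentially. c k < r" by (rule order_tendstoD(2)[OF c r])
    then obtain k where "c k < r" by (auto simp: eventually_sequentially)
    then have "\<forall>\<^sub>F N in sequentially. b k N < r" by (rule order_tendstoD(2)[OF lim])
    then obtain N0 where N0: "\<And>N. N \<ge> N0 \<Longrightarrow> b k N < r" by (auto simp: eventually_sequentially)
    have "norm ((INF k. b k N) - 0) < r" if "N \<ge> N0" for N
    proof -
      have "(INF k. b k N) \<le> b k N" by (rule cINF_lower[OF bdd]) simp
      moreover have "0 \<le> (INF k. b k N)" by (rule cINF_greatest) (auto simp: nonneg)
      ultimately show ?thesis using N0[OF that] by simp
    qed
    then show "\<exists>N0. \<forall>N\<ge>N0. norm ((INF k. b k N) - 0) < r" by blast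
  qed
  from tendsto_add[OF this LIMSEQ_inverse_real_of_nat] show ?thesis by (simp add: divide_inverse)
qed

text \<open>The initial law \<nu> is a parameter and \<open>C\<close> is quantified before the
  probability space and all processes, so it depends only on the fixed data. Integrability of the
  error is part of the conclusion, since the Bochner integral of a function that is not integrable
  is 0 and the bare inequality would be vacuous.\<close>

theorem theorem3p9:
  fixes p T \<sigma> :: real and m :: nat
    and H1 H2 K1 K2 :: "real^'d \<Rightarrow> real^'d"
    and u :: "(real^'d) measure \<Rightarrow> real^'d"
    and Y0 :: "nat \<Rightarrow> real^'d"
    and \<nu> :: "(real^'d) measure"
  assumes "p > 1" and "T > 0" and "\<sigma> > 0" and "m \<ge> 1"
    and "\<exists>L. L-lipschitz_on UNIV H1" and "\<exists>L. L-lipschitz_on UNIV H2"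
    and "\<exists>L. L-lipschitz_on UNIV K1" and "\<exists>L. L-lipschitz_on UNIV K2"
    and "lipschitz_on_W1 u"
  shows "\<exists>C :: nat \<Rightarrow> real. (\<forall>N. C N > 0) \<and> C \<longlonglongrightarrow> 0 \<and>
    (\<forall>(M :: 'a measure) F X0 W Xbar Ybar.
       prob_space M \<and> filtration_upto M T F \<and>
       (\<forall>n\<ge>1. X0 n \<in> borel_measurable (F 0)) \<and>
       prob_space.indep_vars M (\<lambda>_. borel) X0 {1..} \<and>
       (\<forall>n\<ge>1. distr M borel (X0 n) = \<nu>) \<and>
       (\<forall>n\<ge>1. integrable M (\<lambda>\<omega>. norm (X0 n \<omega>) powr p)) \<and>
       (\<forall>n\<ge>1. brownian_motion M F T (W n)) \<and> indep_processes M T W \<and>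
       (\<forall>n\<ge>1. limit_solution M T \<sigma> m H1 H2 K1 K2 u (X0 n) Y0 (W n) (Xbar n) Ybar)
       \<longrightarrow>
       (\<forall>N\<ge>1. \<forall>X Y. particle_solution M T \<sigma> m H1 H2 K1 K2 u N X0 Y0 W X Y \<longrightarrow>
          integrable M (max_error T m N X Xbar Y Ybar) \<and>
          (\<integral>\<omega>. max_error T m N X Xbar Y Ybar \<omega> \<partial>M) \<le> C N))"
\<comment> \<open>Outside \<open>W1_space\<close> the hypotheses on the initial data are
  contradictory, because a finite moment of order p > 1 forces a finite first moment. Any positive
  null sequence then serves.\<close>
proof (cases "\<nu> \<in> W1_space")
  case False
  have W1: "distr M borel X \<in> W1_space"
    if M: "prob_space M" and F: "filtration_upto M T F" and X: "X \<in> borel_measurable (F 0)" and i: "integrable M (\<lambda>\<omega>. norm (X \<omega>) powr p)"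
    for M :: "'a measure" and F and X :: "'a \<Rightarrow> real^'d"
  proof -
    interpret prob_space M by fact
    have "subalgebra M (F 0)" using F \<open>T > 0\<close> by (auto simp: filtration_upto_def)
    from measurable_from_subalg[OF this X] have Xm[measurable]: "X \<in> borel_measurable M" .
    have "integrable M (\<lambda>\<omega>. norm (X \<omega>))"
    proof (rule Bochner_Integration.integrable_bound)
      show "integrable M (\<lambda>\<omega>. 1 + norm (X \<omega>) powr p)" using i by simp
      have "a \<le> 1 + a powr p" if "0 \<le> a" for a :: real
      proof (cases "a \<le> 1")
        case True
        then show ?thesis using powr_ge_zero[of a p] by linarith
      next
        case False
        then have "a powr 1 \<le> a powr p" using \<open>p > 1\<close> by (intro powr_mono) auto
        then show ?thesis using False by simp
      qed
      then show "AE \<omega> in M. norm (norm (X \<omega>)) \<le> norm (1 + norm (X \<omega>) powr p)"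
        by (intro AE_I2) (simp add: add_nonneg_nonneg)
    qed measurable
    then show ?thesis using prob_space_distr[OF Xm] by (simp add: W1_space_def integrable_distr_eq)
  qed
  show ?thesis
  proof (intro exI[of _ "\<lambda>N. inverse (real (Suc N))"] conjI allI impI LIMSEQ_inverse_real_of_nat, goal_cases)
    case (2 M F X0 W Xbar Ybar N X Y)
    then have "distr M borel (X0 1) \<in> W1_space" "distr M borel (X0 1) = \<nu>" by (auto intro!: W1)
    then show ?case using False by simp
  next
    case (3 M F X0 W Xbar Ybar N X Y)
    then have "distr M borel (X0 1) \<in> W1_space" "distr M borel (X0 1) = \<nu>" by (auto intro!: W1)
    then show ?case using False by simp
  qed simp
next
  case True
  obtain L1 L2 L3 L4 L5 where lip: "L1-lipschitz_on UNIV H1" "L2-lipschitz_on UNIV H2" "L3-lipschitz_on UNIV K1" "L4-lipschitz_on UNIV K2"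
    and L5: "\<And>\<mu> \<mu>'. \<mu> \<in> W1_space \<Longrightarrow> \<mu>' \<in> W1_space \<Longrightarrow> dist (u \<mu>) (u \<mu>') \<le> L5 * wasserstein1 \<mu> \<mu>'"
    using assms(5-9) unfolding lipschitz_on_W1_def by blast
  \<comment> \<open>\<open>lipschitz_on_W1\<close> puts no sign on its constant, hence the absolute
    values; the summand 1 makes \<open>L\<close> positive, as Gronwall's inequality asks.\<close>
  define L where "L = 1 + \<bar>L1\<bar> + \<bar>L2\<bar> + \<bar>L3\<bar> + \<bar>L4\<bar> + \<bar>L5\<bar>"
  have L: "L1 \<le> L" "L2 \<le> L" "L3 \<le> L" "L4 \<le> L" "L5 \<le> L" "L > 0" by (auto simp: L_def)
  have lipL: "norm (h x - h y) \<le> L * norm (x - y)" if "c-lipschitz_on UNIV h" "c \<le> L" for c and h :: "real^'d \<Rightarrow> real^'d" and x y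
    using lipschitz_onD[OF that(1), of x y] mult_right_mono[OF that(2) norm_ge_zero[of "x - y"]] by (simp add: dist_norm)
  interpret interaction T \<sigma> L m H1 H2 K1 K2 u Y0 \<nu>
  proof
    show "norm (u \<mu> - u \<mu>') \<le> L * wasserstein1 \<mu> \<mu>'" if "\<mu> \<in> W1_space" "\<mu>' \<in> W1_space" for \<mu> \<mu>'
      using L5[OF that] mult_right_mono[OF L(5) wasserstein1_nonneg[of \<mu> \<mu>']] by (simp add: dist_norm)
  qed (use assms L True lipL[OF lip(1)] lipL[OF lip(2)] lipL[OF lip(3)] lipL[OF lip(4)] in auto)
  \<comment> \<open>Radius k + 1 and cell diameter 1 / (k + 1) make both the cell error and the tail
    vanish as k grows.\<close>
  let ?R = "\<lambda>k::nat. real (Suc k)" and ?\<epsilon> = "\<lambda>k::nat. inverse (real (Suc k))"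
  have "\<exists>K \<phi> B. partition_of_unity (?R k) (?\<epsilon> k) K (\<phi> :: nat \<Rightarrow> real^'d \<Rightarrow> real) B" for k
    by (rule exists_partition_of_unity) auto
  then obtain K :: "nat \<Rightarrow> nat" and \<phi> :: "nat \<Rightarrow> nat \<Rightarrow> real^'d \<Rightarrow> real" and B :: "nat \<Rightarrow> real" where
    pou: "\<And>k. partition_of_unity (?R k) (?\<epsilon> k) (K k) (\<phi> k) (B k)" by metis
  define c0 where "c0 = 12 * L * exp (10 * L * T) * T"
  define b where "b k N = c0 * (?\<epsilon> k + (?R k + ?\<epsilon> k) * (real (K k) / sqrt (real N)) + 2 * tail (?R k))" for k N
  have c0: "0 \<le> c0" by (simp add: c0_def)
  have tail0: "0 \<le> tail (?R k)" for k
    unfolding tail_def using initial_bound_nonneg \<sigma> T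
    by (intro add_nonneg_nonneg mult_nonneg_nonneg divide_nonneg_nonneg Bochner_Integration.integral_nonneg) auto
  have b0: "0 \<le> b k N" for k N
    unfolding b_def using c0 tail0 by (intro mult_nonneg_nonneg add_nonneg_nonneg) auto
  \<comment> \<open>With k fixed, the number \<open>K k\<close> of cells is fixed too, and the
    statistical error disappears as N grows.\<close>
  have b_lim: "b k \<longlonglongrightarrow> c0 * (?\<epsilon> k + (?R k + ?\<epsilon> k) * 0 + 2 * tail (?R k))" for k
    unfolding b_def
    by (intro tendsto_intros tendsto_divide_0[OF tendsto_const] filterlim_at_top_imp_at_infinity filterlim_compose[OF sqrt_at_top filterlim_real_sequentially])
  have "(\<lambda>k. c0 * (?\<epsilon> k + (?R k + ?\<epsilon> k) * 0 + 2 * tail (?R k))) \<longlonglongrightarrow> c0 * (0 + 0 + 2 * 0)"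
    using LIMSEQ_inverse_real_of_nat LIMSEQ_Suc[OF tail_tendsto] by (intro tendsto_intros) auto
  then have lim0: "(\<lambda>k. c0 * (?\<epsilon> k + (?R k + ?\<epsilon> k) * 0 + 2 * tail (?R k))) \<longlonglongrightarrow> 0" by simp
  define C where "C N = (INF k. b k N) + 1 / real (Suc N)" for N
  have C_pos: "C N > 0" for N
  proof -
    have "0 \<le> (INF k. b k N)" by (rule cINF_greatest) (auto simp: b0)
    then show ?thesis by (simp add: C_def add_nonneg_pos)
  qed
  have "C \<longlonglongrightarrow> 0" unfolding C_def[abs_def] by (rule Inf_null_sequence[OF b0 b_lim lim0])
  moreover have "integrable M (max_error T m N X Xbar Y Ybar) \<and> (\<integral>\<omega>. max_error T m N X Xbar Y Ybar \<omega> \<partial>M) \<le> C N"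
    if A: "prob_space M \<and> filtration_upto M T F \<and>
       (\<forall>n\<ge>1. X0 n \<in> borel_measurable (F 0)) \<and>
       prob_space.indep_vars M (\<lambda>_. borel) X0 {1..} \<and>
       (\<forall>n\<ge>1. distr M borel (X0 n) = \<nu>) \<and>
       (\<forall>n\<ge>1. integrable M (\<lambda>\<omega>. norm (X0 n \<omega>) powr p)) \<and>
       (\<forall>n\<ge>1. brownian_motion M F T (W n)) \<and> indep_processes M T W \<and>
       (\<forall>n\<ge>1. limit_solution M T \<sigma> m H1 H2 K1 K2 u (X0 n) Y0 (W n) (Xbar n) Ybar)"
      and N: "N \<ge> 1" and sol: "particle_solution M T \<sigma> m H1 H2 K1 K2 u N X0 Y0 W X Y"
    for M :: "'a measure" and F X0 W Xbar Ybar N X Y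
  proof -
    interpret prob_space M using A by blast
    have lp: "limit_partition T \<sigma> L m H1 H2 K1 K2 u Y0 \<nu> M F W X0 Xbar Ybar (?R k) (?\<epsilon> k) (K k) (\<phi> k) (B k)" for k
      using A pou[of k] interaction_axioms
      by (intro limit_partition.intro limit_family.intro brownian_family.intro brownian_family_axioms.intro limit_family_axioms.intro) auto
    note me = limit_partition.max_error_expectation[OF lp N sol]
    have "expectation (max_error T m N X Xbar Y Ybar) \<le> b k N" for k
      using me(2)[of k] by (simp only: b_def c0_def)
    \<comment> \<open>The solutions do not involve the partition, so all the bounds hold for the
      same expectation at once.\<close>
    then have "expectation (max_error T m N X Xbar Y Ybar) \<le> (INF k. b k N)" by (intro cINF_greatest) auto
    also have "\<dots> \<le> C N" by (simp add: C_def)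
    finally show ?thesis using me(1) by blast
  qed
  ultimately show ?thesis using C_pos by (intro exI[of _ C]) blast
qed

end
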